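(* Let $\Omega=(a,b)\subset\mathbb R$, $f:[0,+\infty)\to\mathbb R$ with $f\in C^k([0,+\infty))$, $k\ge 3$, and $m_0\ge 2$. For $\varepsilon\in(0,1]$ let $\psi=\psi(x,t)$ be the solution of $$i\partial_t\psi-\varepsilon^2\partial_{tt}\psi+\partial_{xx}\psi+f(|\psi|^2)\psi=0\ (x\in\Omega,\ t>0),\quad \psi(x,0)=\psi_0(x),\ \ \partial_t\psi(x,0)=\psi_1^\varepsilon(x),\quad \psi|_{\partial\Omega}=0,$$ where $\psi_1^\varepsilon=i(\partial_{xx}\psi_0+f(|\psi_0|^2)\psi_0)+\varepsilon^\alpha\omega^\varepsilon$ with $\alpha\ge 2$ (well-prepared initial data), and let $\psi^s$ be the solution of $$i\partial_t\psi^s+\partial_{xx}\psi^s+f(|\psi^s|^2)\psi^s=0\ (x\in\Omega,\ t>0),\quad \psi^s(x,0)=\psi_0(x),\quad \psi^s|_{\partial\Omega}=0.$$ Put $\alpha^\ast=\min\{\alpha,2\}$ and let $0<T<T_{\max}$, where $T_{\max}$ is the maximal common existence time. Assume: (A) $1\lesssim\|\omega^\varepsilon\|_{H^{m_0}_s}\lesssim 1$ and $\psi_0\in H^{m_0+2}_s$; (B) $\|\psi\|_{L^\infty([0,T];L^\infty\cap H^{m_0}\cap H^1_0)}+\|\partial_t\psi\|_{L^\infty([0,T];H^1)}+\|\psi^s\|_{L^\infty([0,T];L^\infty\cap H^{m_0}\cap H_0^1)}\lesssim 1$, $\ \|\partial_{tt}\psi\|_{L^\infty([0,T];H^1)}\lesssim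 \varepsilon^{-(2-\alpha^\ast)}$, $\ \|\partial_t^{j}\psi^s\|_{L^\infty([0,T];H^1)}\lesssim 1$ for $j=1,2$, and $\|\psi-\psi^s\|_{L^\infty([0,T];H^1)}\lesssim\varepsilon^2$. Let $M_1=\max\{\sup_{\varepsilon\in(0,1]}\|\psi\|_{L^\infty([0,T]\times\Omega)},\ \|\psi^s\|_{L^\infty([0,T]\times\Omega)}\}$ and $m=\min\{m_0,k\}$. Let $\psi^n\in Y_M$ ($n\ge0$) be produced by the EWI-SP scheme (defined in the context) with mesh size $h=(b-a)/M$ and time step $\tau$, let $t_n=n\tau$, and let $\psi^n_I(x)=I_M(\psi^n)(x)$. Then there exist constants $0<\tau_0\le 1$ and $0<h_0\le\pi$, independent of $\varepsilon$, such that if $0<h\le h_0$ and $0<\tau\le\tau_0$, then for all $0\le n\le T/\tau$: $$\|\psi(\cdot,t_n)-\psi^n_I\|_{L^2}\lesssim h^m+\tau^2,\qquad \|\nabla(\psi(\cdot,t_n)-\psi_I^n)\|_{L^2}\lesssim h^{m-1}+\tau^2,\qquad \|\psi^n\|_{l^\infty}\le M_1+1 .$$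
   Context: Notation. $A\lesssim B$ means $|A|\le C\,B$ with a constant $C$ independent of $\varepsilon\in(0,1]$, the time step $\tau$ and the mesh size $h$ (and of $n$). $\nabla=\partial_x$. The function $\omega^\varepsilon$ is bounded in $H_0^1\cap H^2$ uniformly in $\varepsilon$, with $\liminf_{\varepsilon\to0^+}\|\omega^\varepsilon\|_{H^2}>0$. Spaces. $H^m_s(\Omega)=\{\phi\in H^m(\Omega):\partial_x^{2k}\phi(a)=\partial_x^{2k}\phi(b)=0,\ 0\le 2k<m\}$ (traces), with norm $\|\phi\|_{H^m_s}=(\sum_{l\ge1}\mu_l^{2m}|\widehat\phi_l|^2)^{1/2}$, $\mu_l=\pi l/(b-a)$, $\widehat\phi_l=\frac{2}{b-a}\int_a^b\phi(x)\sin(\mu_l(x-a))\,dx$. Grid and interpolation. $M$ is a positive integer, $h=(b-a)/M$, $x_j=a+jh$ ($0\le j\le M$), $t_n=n\tau$. $Y_M=\{v=(v_0,\dots,v_M)^T\in\mathbb C^{M+1}: v_0=v_M=0\}$, $\|v\|_{l^\infty}=\max_{1\le j\le M-1}|v_j|$. For $\phi\in Y_M$ (or $\phi\in C_0(\overline\Omega)$, with $\phi_j=\phi(x_j)$), $\widetilde\phi_l=\frac2M\sum_{j=1}^{M-1}\phi_j\sin(jl\pi/M)$ for $1\le l\le M-1$, and $I_M(\phi)(x)=\sum_{l=1}^{M-1}\widetilde\phi_l\sin(\mu_l(x-a))$. EWI-SP scheme. Let $\mathcal F(z)=f(|z|^2)z$, $G(z)=f(|z|^2)+f'(|z|^2)|z|^2$,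 $H(z)=f'(|z|^2)z^2$ for $z\in\mathbb C$; $\mathrm{sinc}(s)=\sin(s)/s$ for $s\neq0$, $\mathrm{sinc}(0)=1$. For $1\le l\le M-1$ let $$\beta_l^{\pm}=\frac{1\pm\sqrt{1+4\varepsilon^2\mu_l^2}}{2\varepsilon^2},\quad \beta_l=\beta_l^+-\beta_l^-=\frac{\sqrt{1+4\varepsilon^2\mu_l^2}}{\varepsilon^2},\quad \sigma_l^\pm(\tau)=e^{i\tau\beta_l^\pm/2}\,\mathrm{sinc}(\tau\beta_l^\pm/2),$$ $$c_l^0=\frac{\beta_l^+e^{i\tau\beta_l^-}-\beta_l^-e^{i\tau\beta_l^+}}{\beta_l},\quad d_l^0=\tau e^{i\tau/(2\varepsilon^2)}\mathrm{sinc}(\tau\beta_l/2),\quad c_l=-e^{i\tau/\varepsilon^2},\quad d_l=2e^{i\tau/(2\varepsilon^2)}\cos(\tau\beta_l/2),$$ $$p_l=\frac{-i\tau}{\varepsilon^2\beta_l}(\sigma_l^+(\tau)-\sigma_l^-(\tau)),\quad q_l=\frac{\tau}{\varepsilon^2\beta_l}\Big(\frac{1-\sigma_l^+(\tau)}{\beta_l^+}-\frac{1-\sigma_l^-(\tau)}{\beta_l^-}\Big),$$ $$p_l^\ast=\frac{-i\tau e^{i\tau/\varepsilon^2}}{\varepsilon^2\beta_l}\big(\overline{\sigma_l^+(\tau)}-\overline{\sigma_l^-(\tau)}\big),\quad q_l^\ast=\frac{\tau e^{i\tau/\varepsilon^2}}{\varepsilon^2\beta_l}\Big(\frac{1-\sigma_l^+(\tau)}{e^{i\tau\beta_l^+}\beta_l^+}-\frac{1-\sigma_l^-(\tau)}{e^{i\tau\beta_l^-}\beta_l^-}\Big).$$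 Set $\psi^0_j=\psi_0(x_j)$, $\psi_0^n=\psi_M^n=0$, and $\psi_j^{n+1}=\sum_{l=1}^{M-1}(\widetilde{\psi^{n+1}})_l\sin(jl\pi/M)$ for $1\le j\le M-1$, $n\ge0$, where $$(\widetilde{\psi^1})_l=c_l^0(\widetilde{\psi_0})_l+d_l^0(\widetilde{\psi_1^\varepsilon})_l+p_l(\widetilde{\mathcal F(\psi_0)})_l+q_l(\widetilde{\mathcal D(\psi_0)})_l,$$ and for $n\ge1$ $$(\widetilde{\psi^{n+1}})_l=c_l(\widetilde{\psi^{n-1}})_l+d_l(\widetilde{\psi^n})_l+p_l(\widetilde{\mathcal F(\psi^n)})_l+q_l(\widetilde{\mathcal D(\psi^n)})_l-p_l^\ast(\widetilde{\mathcal F(\psi^{n-1})})_l-q_l^\ast(\widetilde{\mathcal D(\psi^{n-1})})_l,$$ with $\mathcal D(\psi^0)=\mathcal D(\psi_0)=G(\psi_0)\psi_1^\varepsilon+H(\psi_0)\overline{\psi_1^\varepsilon}$ and $\mathcal D(\psi^n)=\frac1\tau(\mathcal F(\psi^n)-\mathcal F(\psi^{n-1}))$ for $n\ge1$ ($\mathcal F,G,H$ applied componentwise on the grid). *)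

theory Defs
  imports "HOL-Probability.Probability"
begin

subsection \<open>Sobolev spaces on a bounded interval\<close>

text \<open>Elements of the function spaces on \<open>(a, b)\<close> are represented by functions \<open>real \<Rightarrow> complex\<close>
  whose values outside \<open>(a, b)\<close> and on null sets are irrelevant: every notion below
  is invariant under changes on a null set.\<close>

abbreviation Om :: "real \<Rightarrow> real \<Rightarrow> real measure" where
  "Om a b \<equiv> lebesgue_on {a<..<b}"

definition L2space :: "real \<Rightarrow> real \<Rightarrow> (real \<Rightarrow> complex) set" where
  "L2space a b = {u \<in> borel_measurable (Om a b). integrable (Om a b) (\<lambda>x. (cmod (u x))\<^sup>2)}"

definition L2norm :: "real \<Rightarrow> real \<Rightarrow> (real \<Rightarrow> complex) \<Rightarrow> real" where
  "L2norm a b u = sqrt (LINT x|Om a b. (cmod (u x))\<^sup>2)"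

definition test_function :: "real \<Rightarrow> real \<Rightarrow> (real \<Rightarrow> real) \<Rightarrow> bool" where
  "test_function a b \<phi> \<longleftrightarrow>
     (\<forall>n x. ((deriv ^^ n) \<phi>) differentiable (at x)) \<and>
     (\<exists>c d. a < c \<and> d < b \<and> (\<forall>x. x \<notin> {c..d} \<longrightarrow> \<phi> x = 0))"

definition loc_integrable :: "real \<Rightarrow> real \<Rightarrow> (real \<Rightarrow> complex) \<Rightarrow> bool" where
  "loc_integrable a b u \<longleftrightarrow>
     (\<forall>c d. a < c \<longrightarrow> c \<le> d \<longrightarrow> d < b \<longrightarrow> integrable (lebesgue_on {c..d}) u)"

definition weak_deriv :: "real \<Rightarrow> real \<Rightarrow> nat \<Rightarrow> (real \<Rightarrow> complex) \<Rightarrow> (real \<Rightarrow> complex) \<Rightarrow> bool" where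
  "weak_deriv a b j u v \<longleftrightarrow> loc_integrable a b u \<and> loc_integrable a b v \<and>
     (\<forall>\<phi>. test_function a b \<phi> \<longrightarrow>
        (LINT x|Om a b. (deriv ^^ j) \<phi> x *\<^sub>R u x) = (- 1) ^ j * (LINT x|Om a b. \<phi> x *\<^sub>R v x))"

text \<open>The weak derivative \<open>\<partial>\<^sub>x\<^sup>j u\<close>, chosen up to null sets.\<close>

definition Dx :: "real \<Rightarrow> real \<Rightarrow> nat \<Rightarrow> (real \<Rightarrow> complex) \<Rightarrow> real \<Rightarrow> complex" where
  "Dx a b j u = (SOME v. weak_deriv a b j u v)"

definition Hspace :: "real \<Rightarrow> real \<Rightarrow> nat \<Rightarrow> (real \<Rightarrow> complex) set" where
  "Hspace a b m = {u \<in> L2space a b. \<forall>j\<le>m. \<exists>v \<in> L2space a b. weak_deriv a b j u v}"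

definition Hnorm :: "real \<Rightarrow> real \<Rightarrow> nat \<Rightarrow> (real \<Rightarrow> complex) \<Rightarrow> real" where
  "Hnorm a b m u = sqrt (\<Sum>j\<le>m. (L2norm a b (Dx a b j u))\<^sup>2)"

text \<open>The representative that is continuous on \<open>[a, b]\<close>; its values on \<open>[a, b]\<close> are uniquely
  determined. Its values at \<open>a\<close>, \<open>b\<close> are the traces, and it is also what is sampled on grids.\<close>

definition crep :: "real \<Rightarrow> real \<Rightarrow> (real \<Rightarrow> complex) \<Rightarrow> real \<Rightarrow> complex" where
  "crep a b u = (SOME g. continuous_on {a..b} g \<and> (AE x in Om a b. u x = g x))"

definition H10 :: "real \<Rightarrow> real \<Rightarrow> (real \<Rightarrow> complex) set" where
  "H10 a b = {u \<in> Hspace a b 1. crep a b u a = 0 \<and> crep a b u b = 0}"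

definition Hs :: "real \<Rightarrow> real \<Rightarrow> nat \<Rightarrow> (real \<Rightarrow> complex) set" where
  "Hs a b m = {u \<in> Hspace a b m. \<forall>k. 2 * k < m \<longrightarrow>
      crep a b (Dx a b (2 * k) u) a = 0 \<and> crep a b (Dx a b (2 * k) u) b = 0}"

definition mu :: "real \<Rightarrow> real \<Rightarrow> nat \<Rightarrow> real" where
  "mu a b l = pi * real l / (b - a)"

definition sine_coeff :: "real \<Rightarrow> real \<Rightarrow> (real \<Rightarrow> complex) \<Rightarrow> nat \<Rightarrow> complex" where
  "sine_coeff a b u l =
     (2 / (b - a)) *\<^sub>R (LINT x|Om a b. sin (mu a b l * (x - a)) *\<^sub>R u x)"

definition Hs_norm :: "real \<Rightarrow> real \<Rightarrow> nat \<Rightarrow> (real \<Rightarrow> complex) \<Rightarrow> real" where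
  "Hs_norm a b m u =
     sqrt (\<Sum>l. mu a b (Suc l) ^ (2 * m) * (cmod (sine_coeff a b u (Suc l)))\<^sup>2)"

subsection \<open>Spaces of functions of time and space\<close>

text \<open>A function of time and space is curried, time first: \<open>u t x\<close>.\<close>

definition ext_norm ::
  "(real \<Rightarrow> complex) set \<Rightarrow> ((real \<Rightarrow> complex) \<Rightarrow> real) \<Rightarrow> (real \<Rightarrow> complex) \<Rightarrow> ennreal" where
  "ext_norm X N u = (if u \<in> X then ennreal (N u) else \<infinity>)"

definition Linf :: "real \<Rightarrow> real \<Rightarrow> (real \<Rightarrow> complex) \<Rightarrow> ennreal" where
  "Linf a b u = esssup (Om a b) (\<lambda>x. ennreal (cmod (u x)))"

abbreviation H_ext :: "real \<Rightarrow> real \<Rightarrow> nat \<Rightarrow> (real \<Rightarrow> complex) \<Rightarrow> ennreal" where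
  "H_ext a b m \<equiv> ext_norm (Hspace a b m) (Hnorm a b m)"

text \<open>The norm of \<open>L\<^sup>\<infinity> \<inter> H\<^sup>m \<inter> H\<^sup>1\<^sub>0\<close>.\<close>

definition Xnorm :: "real \<Rightarrow> real \<Rightarrow> nat \<Rightarrow> (real \<Rightarrow> complex) \<Rightarrow> ennreal" where
  "Xnorm a b m u = Linf a b u + H_ext a b m u + ext_norm (H10 a b) (Hnorm a b 1) u"

text \<open>The norm of \<open>L\<^sup>\<infinity>([0, T]; X)\<close> for a space \<open>X\<close> with extended norm \<open>N\<close>.\<close>

definition LinfT ::
  "real \<Rightarrow> ((real \<Rightarrow> complex) \<Rightarrow> ennreal) \<Rightarrow> (real \<Rightarrow> real \<Rightarrow> complex) \<Rightarrow> ennreal" where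
  "LinfT T N u = esssup (lebesgue_on {0..T}) (\<lambda>t. N (u t))"

definition Linf_cyl :: "real \<Rightarrow> real \<Rightarrow> real \<Rightarrow> (real \<Rightarrow> real \<Rightarrow> complex) \<Rightarrow> ennreal" where
  "Linf_cyl a b T u =
     esssup (lebesgue_on ({0..T} \<times> {a<..<b})) (\<lambda>(t, x). ennreal (cmod (u t x)))"

text \<open>Derivatives in time of \<open>L\<^sup>2\<close>-valued functions on \<open>[0, \<infinity>)\<close> (one-sided at \<open>t = 0\<close>).\<close>

definition has_Dt :: "real \<Rightarrow> real \<Rightarrow> (real \<Rightarrow> real \<Rightarrow> complex) \<Rightarrow> real \<Rightarrow> (real \<Rightarrow> complex) \<Rightarrow> bool" where
  "has_Dt a b u t v \<longleftrightarrow> v \<in> L2space a b \<and>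
     (\<forall>\<^sub>F s in at t within {0..}. u s \<in> L2space a b) \<and> u t \<in> L2space a b \<and>
     ((\<lambda>s. L2norm a b (\<lambda>x. (u s x - u t x) /\<^sub>R (s - t) - v x)) \<longlongrightarrow> 0) (at t within {0..})"

definition Dt :: "real \<Rightarrow> real \<Rightarrow> (real \<Rightarrow> real \<Rightarrow> complex) \<Rightarrow> real \<Rightarrow> real \<Rightarrow> complex" where
  "Dt a b u t = (SOME v. has_Dt a b u t v)"

definition Dt_exists :: "real \<Rightarrow> real \<Rightarrow> real set \<Rightarrow> (real \<Rightarrow> real \<Rightarrow> complex) \<Rightarrow> bool" where
  "Dt_exists a b J u \<longleftrightarrow> (\<forall>t\<in>J. \<exists>v. has_Dt a b u t v)"

text \<open>\<open>u \<in> C(J; X)\<close> where \<open>X\<close> carries the norm \<open>N\<close>.\<close>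

definition cont_time ::
  "real set \<Rightarrow> (real \<Rightarrow> complex) set \<Rightarrow> ((real \<Rightarrow> complex) \<Rightarrow> real) \<Rightarrow> (real \<Rightarrow> real \<Rightarrow> complex) \<Rightarrow> bool"
where
  "cont_time J X N u \<longleftrightarrow> (\<forall>t\<in>J. u t \<in> X) \<and>
     (\<forall>t\<in>J. ((\<lambda>s. N (\<lambda>x. u s x - u t x)) \<longlongrightarrow> 0) (at t within J))"

subsection \<open>The two equations\<close>

text \<open>\<open>f \<in> C\<^sup>k([0, \<infinity>))\<close>, with one-sided derivatives at \<open>0\<close>.\<close>

definition Ck_halfline :: "nat \<Rightarrow> (real \<Rightarrow> real) \<Rightarrow> bool" where
  "Ck_halfline k f \<longleftrightarrow> (\<exists>D. D 0 = f \<and>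
     (\<forall>j<k. \<forall>s\<ge>0. (D j has_real_derivative D (Suc j) s) (at s within {0..})) \<and>
     (\<forall>j\<le>k. continuous_on {0..} (D j)))"

definition Fnl :: "(real \<Rightarrow> real) \<Rightarrow> complex \<Rightarrow> complex" where
  "Fnl f z = f ((cmod z)\<^sup>2) *\<^sub>R z"

definition time_dom :: "ereal \<Rightarrow> real set" where
  "time_dom S = {t. 0 \<le> t \<and> ereal t < S}"

text \<open>Strong solutions on \<open>[0, S)\<close>, i.e. in
  \<open>C([0,S); H\<^sup>2 \<inter> H\<^sup>1\<^sub>0) \<inter> C\<^sup>1([0,S); H\<^sup>1\<^sub>0) \<inter> C\<^sup>2([0,S); L\<^sup>2)\<close> for the equation with wave operator and in
  \<open>C([0,S); H\<^sup>2 \<inter> H\<^sup>1\<^sub>0) \<inter> C\<^sup>1([0,S); L\<^sup>2)\<close> for the limiting equation; the equations hold in \<open>L\<^sup>2\<close>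
  at every time. Membership in \<open>H\<^sup>1\<^sub>0\<close> is the boundary condition. Joint measurability merely
  excludes pathological choices of a representative at each time.\<close>

definition nlsw_solution ::
  "real \<Rightarrow> real \<Rightarrow> (real \<Rightarrow> real) \<Rightarrow> real \<Rightarrow> (real \<Rightarrow> complex) \<Rightarrow> (real \<Rightarrow> complex) \<Rightarrow> ereal \<Rightarrow>
   (real \<Rightarrow> real \<Rightarrow> complex) \<Rightarrow> bool" where
  "nlsw_solution a b f \<epsilon> \<psi>0 \<psi>1 S \<psi> \<longleftrightarrow>
     (\<lambda>(t, x). \<psi> t x) \<in> borel_measurable (lebesgue_on (time_dom S \<times> {a<..<b})) \<and>
     cont_time (time_dom S) (Hspace a b 2 \<inter> H10 a b) (Hnorm a b 2) \<psi> \<and>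
     Dt_exists a b (time_dom S) \<psi> \<and>
     cont_time (time_dom S) (H10 a b) (Hnorm a b 1) (Dt a b \<psi>) \<and>
     Dt_exists a b (time_dom S) (Dt a b \<psi>) \<and>
     cont_time (time_dom S) (L2space a b) (L2norm a b) (Dt a b (Dt a b \<psi>)) \<and>
     (\<forall>t \<in> time_dom S. t > 0 \<longrightarrow> (AE x in Om a b.
        \<i> * Dt a b \<psi> t x - (\<epsilon>\<^sup>2) *\<^sub>R Dt a b (Dt a b \<psi>) t x + Dx a b 2 (\<psi> t) x
          + Fnl f (\<psi> t x) = 0)) \<and>
     (AE x in Om a b. \<psi> 0 x = \<psi>0 x) \<and>
     (AE x in Om a b. Dt a b \<psi> 0 x = \<psi>1 x)"

definition nls_solution ::
  "real \<Rightarrow> real \<Rightarrow> (real \<Rightarrow> real) \<Rightarrow> (real \<Rightarrow> complex) \<Rightarrow> ereal \<Rightarrow> (real \<Rightarrow> real \<Rightarrow> complex) \<Rightarrow> bool" where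
  "nls_solution a b f \<psi>0 S \<psi> \<longleftrightarrow>
     (\<lambda>(t, x). \<psi> t x) \<in> borel_measurable (lebesgue_on (time_dom S \<times> {a<..<b})) \<and>
     cont_time (time_dom S) (Hspace a b 2 \<inter> H10 a b) (Hnorm a b 2) \<psi> \<and>
     Dt_exists a b (time_dom S) \<psi> \<and>
     cont_time (time_dom S) (L2space a b) (L2norm a b) (Dt a b \<psi>) \<and>
     (\<forall>t \<in> time_dom S. t > 0 \<longrightarrow> (AE x in Om a b.
        \<i> * Dt a b \<psi> t x + Dx a b 2 (\<psi> t) x + Fnl f (\<psi> t x) = 0)) \<and>
     (AE x in Om a b. \<psi> 0 x = \<psi>0 x)"

text \<open>The initial velocity \<open>\<psi>\<^sub>1\<^sup>\<epsilon>\<close>.\<close>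

definition psi1 ::
  "real \<Rightarrow> real \<Rightarrow> (real \<Rightarrow> real) \<Rightarrow> real \<Rightarrow> (real \<Rightarrow> complex) \<Rightarrow> (real \<Rightarrow> real \<Rightarrow> complex) \<Rightarrow>
   real \<Rightarrow> real \<Rightarrow> complex" where
  "psi1 a b f \<alpha> \<psi>0 \<omega> \<epsilon> x =
     \<i> * (Dx a b 2 \<psi>0 x + Fnl f (\<psi>0 x)) + (\<epsilon> powr \<alpha>) *\<^sub>R \<omega> \<epsilon> x"

text \<open>The maximal time of existence common to all \<open>\<epsilon> \<in> (0, 1]\<close> and the limiting equation.\<close>

definition Tmax ::
  "real \<Rightarrow> real \<Rightarrow> (real \<Rightarrow> real) \<Rightarrow> real \<Rightarrow> (real \<Rightarrow> complex) \<Rightarrow> (real \<Rightarrow> real \<Rightarrow> complex) \<Rightarrow> ereal" where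
  "Tmax a b f \<alpha> \<psi>0 \<omega> = Sup {S.
     (\<forall>\<epsilon>\<in>{0<..1}. \<exists>\<psi>. nlsw_solution a b f \<epsilon> \<psi>0 (psi1 a b f \<alpha> \<psi>0 \<omega> \<epsilon>) S \<psi>) \<and>
     (\<exists>\<psi>. nls_solution a b f \<psi>0 S \<psi>)}"

subsection \<open>Grid functions and sine interpolation\<close>

text \<open>A grid function is a map \<open>nat \<Rightarrow> complex\<close> of which only the values at \<open>0, \<dots>, M\<close> matter.\<close>

definition grid :: "real \<Rightarrow> real \<Rightarrow> nat \<Rightarrow> nat \<Rightarrow> real" where
  "grid a b M j = a + real j * ((b - a) / real M)"

definition YM :: "nat \<Rightarrow> (nat \<Rightarrow> complex) set" where
  "YM M = {v. v 0 = 0 \<and> v M = 0}"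

text \<open>The inserted \<open>0\<close> only matters for \<open>M = 1\<close>, when there are no interior nodes.\<close>

definition linf_norm :: "nat \<Rightarrow> (nat \<Rightarrow> complex) \<Rightarrow> real" where
  "linf_norm M v = Max (insert 0 ((\<lambda>j. cmod (v j)) ` {1..M - 1}))"

definition dst :: "nat \<Rightarrow> (nat \<Rightarrow> complex) \<Rightarrow> nat \<Rightarrow> complex" where
  "dst M v l = (2 / real M) *\<^sub>R (\<Sum>j = 1..M - 1. sin (real j * real l * pi / real M) *\<^sub>R v j)"

definition interp :: "real \<Rightarrow> real \<Rightarrow> nat \<Rightarrow> (nat \<Rightarrow> complex) \<Rightarrow> real \<Rightarrow> complex" where
  "interp a b M v x = (\<Sum>l = 1..M - 1. sin (mu a b l * (x - a)) *\<^sub>R dst M v l)"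

definition nodal :: "real \<Rightarrow> real \<Rightarrow> nat \<Rightarrow> (real \<Rightarrow> complex) \<Rightarrow> nat \<Rightarrow> complex" where
  "nodal a b M u j = crep a b u (grid a b M j)"

subsection \<open>The EWI-SP scheme\<close>

definition fder :: "(real \<Rightarrow> real) \<Rightarrow> real \<Rightarrow> real" where
  "fder f s = vector_derivative f (at s within {0..})"

definition Gnl :: "(real \<Rightarrow> real) \<Rightarrow> complex \<Rightarrow> real" where
  "Gnl f z = f ((cmod z)\<^sup>2) + fder f ((cmod z)\<^sup>2) * (cmod z)\<^sup>2"

definition Hnl :: "(real \<Rightarrow> real) \<Rightarrow> complex \<Rightarrow> complex" where
  "Hnl f z = fder f ((cmod z)\<^sup>2) *\<^sub>R z\<^sup>2"

definition beta_p :: "real \<Rightarrow> real \<Rightarrow> real" where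
  "beta_p \<epsilon> \<mu> = (1 + sqrt (1 + 4 * \<epsilon>\<^sup>2 * \<mu>\<^sup>2)) / (2 * \<epsilon>\<^sup>2)"

definition beta_m :: "real \<Rightarrow> real \<Rightarrow> real" where
  "beta_m \<epsilon> \<mu> = (1 - sqrt (1 + 4 * \<epsilon>\<^sup>2 * \<mu>\<^sup>2)) / (2 * \<epsilon>\<^sup>2)"

definition beta :: "real \<Rightarrow> real \<Rightarrow> real" where
  "beta \<epsilon> \<mu> = beta_p \<epsilon> \<mu> - beta_m \<epsilon> \<mu>"

definition sigma :: "real \<Rightarrow> real \<Rightarrow> complex" where
  "sigma \<tau> \<beta> = sinc (\<tau> * \<beta> / 2) *\<^sub>R cis (\<tau> * \<beta> / 2)"

context
  fixes \<epsilon> \<tau> \<mu> :: real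
begin

definition c0 :: complex where
  "c0 = (beta_p \<epsilon> \<mu> *\<^sub>R cis (\<tau> * beta_m \<epsilon> \<mu>) - beta_m \<epsilon> \<mu> *\<^sub>R cis (\<tau> * beta_p \<epsilon> \<mu>)) /\<^sub>R beta \<epsilon> \<mu>"

definition d0 :: complex where
  "d0 = (\<tau> * sinc (\<tau> * beta \<epsilon> \<mu> / 2)) *\<^sub>R cis (\<tau> / (2 * \<epsilon>\<^sup>2))"

definition cc :: complex where
  "cc = - cis (\<tau> / \<epsilon>\<^sup>2)"

definition dd :: complex where
  "dd = (2 * cos (\<tau> * beta \<epsilon> \<mu> / 2)) *\<^sub>R cis (\<tau> / (2 * \<epsilon>\<^sup>2))"

definition pp :: complex where
  "pp = - \<i> * (\<tau> / (\<epsilon>\<^sup>2 * beta \<epsilon> \<mu>)) * (sigma \<tau> (beta_p \<epsilon> \<mu>) - sigma \<tau> (beta_m \<epsilon> \<mu>))"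

definition qq :: complex where
  "qq = (\<tau> / (\<epsilon>\<^sup>2 * beta \<epsilon> \<mu>)) *
     ((1 - sigma \<tau> (beta_p \<epsilon> \<mu>)) / beta_p \<epsilon> \<mu> - (1 - sigma \<tau> (beta_m \<epsilon> \<mu>)) / beta_m \<epsilon> \<mu>)"

definition pp_star :: complex where
  "pp_star = - \<i> * (\<tau> / (\<epsilon>\<^sup>2 * beta \<epsilon> \<mu>)) * cis (\<tau> / \<epsilon>\<^sup>2) *
     (cnj (sigma \<tau> (beta_p \<epsilon> \<mu>)) - cnj (sigma \<tau> (beta_m \<epsilon> \<mu>)))"

definition qq_star :: complex where
  "qq_star = (\<tau> / (\<epsilon>\<^sup>2 * beta \<epsilon> \<mu>)) * cis (\<tau> / \<epsilon>\<^sup>2) *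
     ((1 - sigma \<tau> (beta_p \<epsilon> \<mu>)) / (cis (\<tau> * beta_p \<epsilon> \<mu>) * beta_p \<epsilon> \<mu>)
      - (1 - sigma \<tau> (beta_m \<epsilon> \<mu>)) / (cis (\<tau> * beta_m \<epsilon> \<mu>) * beta_m \<epsilon> \<mu>))"

end

text \<open>\<open>\<D>(\<psi>\<^sup>n)\<close>, where \<open>\<Psi> n\<close> is the \<open>n\<close>-th iterate and \<open>v0\<close>, \<open>v1\<close> are the initial data on the grid.\<close>

definition Dnl ::
  "(real \<Rightarrow> real) \<Rightarrow> real \<Rightarrow> (nat \<Rightarrow> complex) \<Rightarrow> (nat \<Rightarrow> complex) \<Rightarrow> (nat \<Rightarrow> nat \<Rightarrow> complex) \<Rightarrow>
   nat \<Rightarrow> nat \<Rightarrow> complex" where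
  "Dnl f \<tau> v0 v1 \<Psi> n j =
     (if n = 0 then Gnl f (v0 j) *\<^sub>R v1 j + Hnl f (v0 j) * cnj (v1 j)
      else (Fnl f (\<Psi> n j) - Fnl f (\<Psi> (n - 1) j)) /\<^sub>R \<tau>)"

definition ewi_sp ::
  "real \<Rightarrow> real \<Rightarrow> (real \<Rightarrow> real) \<Rightarrow> real \<Rightarrow> (real \<Rightarrow> complex) \<Rightarrow> (real \<Rightarrow> complex) \<Rightarrow>
   nat \<Rightarrow> real \<Rightarrow> (nat \<Rightarrow> nat \<Rightarrow> complex) \<Rightarrow> bool" where
  "ewi_sp a b f \<epsilon> \<psi>0 \<psi>1 M \<tau> \<Psi> \<longleftrightarrow>
     (let v0 = nodal a b M \<psi>0; v1 = nodal a b M \<psi>1; \<D> = Dnl f \<tau> v0 v1 \<Psi>;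
          \<F> = (\<lambda>n j. Fnl f (\<Psi> n j)); s = (\<lambda>j l. sin (real j * real l * pi / real M)) in
      (\<forall>n. \<Psi> n \<in> YM M) \<and>
      (\<forall>j\<in>{1..M - 1}. \<Psi> 0 j = v0 j) \<and>
      (\<forall>j\<in>{1..M - 1}. \<Psi> 1 j = (\<Sum>l = 1..M - 1. s j l *\<^sub>R
         (let \<mu> = mu a b l in
            c0 \<epsilon> \<tau> \<mu> * dst M v0 l + d0 \<epsilon> \<tau> \<mu> * dst M v1 l
            + pp \<epsilon> \<tau> \<mu> * dst M (\<F> 0) l + qq \<epsilon> \<tau> \<mu> * dst M (\<D> 0) l))) \<and>
      (\<forall>n\<ge>1. \<forall>j\<in>{1..M - 1}. \<Psi> (n + 1) j = (\<Sum>l = 1..M - 1. s j l *\<^sub>R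
         (let \<mu> = mu a b l in
            cc \<epsilon> \<tau> * dst M (\<Psi> (n - 1)) l + dd \<epsilon> \<tau> \<mu> * dst M (\<Psi> n) l
            + pp \<epsilon> \<tau> \<mu> * dst M (\<F> n) l + qq \<epsilon> \<tau> \<mu> * dst M (\<D> n) l
            - pp_star \<epsilon> \<tau> \<mu> * dst M (\<F> (n - 1)) l
            - qq_star \<epsilon> \<tau> \<mu> * dst M (\<D> (n - 1)) l))))"

end

theory Submission
  imports Defs
begin

text \<open>Two facts make the proof short. Well-prepared data (\<open>\<alpha> \<ge> 2\<close>) bound \<open>\<partial>\<^sub>t\<^sub>t\<psi>\<close> in \<open>H\<^sup>1\<close> uniformly
in \<open>\<epsilon>\<close>, so the error can be measured against \<open>\<psi>\<close> itself (in the code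
\<open>ep\<close>, \<open>ts\<close>, \<open>nu\<close> stand for \<open>\<epsilon>\<close>, \<open>\<tau>\<close>, \<open>\<mu>\<close>). Moreover the three-term scheme is exactly a Duhamel formula: its coefficients are
moments of the kernel \<open>Kn\<close> of \<open>\<epsilon>\<^sup>2 y'' - \<i> y' + \<mu>\<^sup>2 y = F\<close>, and the linear recurrence is the one satisfied by
every combination of the two characteristic exponentials (\<open>scheme_duhamel\<close>). The kernel is bounded by \<open>2\<close>, uniformly
in \<open>\<epsilon>\<close> and \<open>\<mu>\<close>, so stability is immediate: the error is the propagated error of the data plus \<open>2 \<tau>\<close> times
the sum of the local errors (\<open>error_accumulation\<close>).

A local error has three parts. The first is the remainder of the linear extrapolation in time of \<open>f(|\<psi>|\<^sup>2)\<psi>\<close>,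
which is \<open>O(\<tau>\<^sup>2)\<close> in \<open>H\<^sup>1\<close> (\<open>Fnl_extrapolation\<close>). It rests on Lipschitz continuity of \<open>\<partial>\<^sub>t\<psi>\<close> in
\<open>H\<^sup>1\<close>; since \<open>\<partial>\<^sub>t\<^sub>t\<psi>\<close> need not vanish at the ends, its traces have to be cancelled (\<open>trace_cancellation\<close>,
\<open>Y1_lipschitz\<close>). In the first step the extrapolation uses the initial slope and is only \<open>O(\<tau>)\<close>, but this occurs once.
The second part is the aliasing error of sampling (\<open>aliasing\<close>). It is \<open>O(h\<^sup>m)\<close> provided the odd periodic extension of
\<open>\<psi>\<close> has \<open>m\<close> derivatives, that is, provided even derivatives of order below \<open>m\<close> vanish at the ends. This is a
property of the equation: Duhamel's formula gains one power of the frequency for each fixed \<open>\<epsilon>\<close>, which forces one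
trace after the other to vanish, while the size of the derivatives is given by the hypotheses (\<open>compatibility\<close>,
\<open>spatial_regularity\<close>). The third part is the nonlinearity applied to the error (\<open>stability_one\<close>,
\<open>stability_gradient\<close>).

The discrete Gronwall inequality in the discrete \<open>L\<^sup>2\<close> and \<open>H\<^sup>1\<close> norms finishes the argument. The Lipschitz
constants need a bound of the numerical solution in the maximum norm. The discrete \<open>H\<^sup>1\<close> norm controls it, and as the
\<open>H\<^sup>1\<close> error is small for small \<open>h\<close> and \<open>\<tau>\<close>, the bound propagates by induction (\<open>sup_error\<close>).\<close>

lemmas alg = algebra_simps
lemmas mlm = mult_left_mono
lemmas mrm = mult_right_mono
lemmas pmd = power_mult_distrib
lemmas psq = power2_eq_square
lemmas sRc = scaleR_conv_of_real
lemmas mnn = mult_nonneg_nonneg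
lemmas ann = add_nonneg_nonneg
lemmas cos = continuous_on_subset
lemmas hvw = has_vector_derivative_within_subset

abbreviation cr :: "real => complex" where "cr == of_real"
abbreviation LQ (infix "LQ" 60) where "X LQ L == (X \<longlonglongrightarrow> L)"
abbreviation hvd (infix "hvd" 50) where "f hvd d == (f has_vector_derivative d)"

section \<open>Absolutely continuous functions on an interval\<close>

definition AC :: "real => real => (real => complex) => (real => complex) => bool" where
 "AC a b u v \<longleftrightarrow> v absolutely_integrable_on {a..b} &
  (\<forall>x\<in>{a..b}. u x - u a = integral {a..x} v)"

locale seg =
 fixes a b :: real
 assumes ab: "a < b"
begin
text \<open>The end points stay fixed from here on, so they are suppressed: \<open>fq\<close> are the frequencies, \<open>sc\<close> the sine
coefficients, \<open>LL\<close>, \<open>hS\<close>, \<open>hZ\<close> the function spaces, \<open>nrm\<close>, \<open>hN\<close> their norms, \<open>OM\<close> the measure, \<open>crp\<close> the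
continuous representative, \<open>gr\<close>, \<open>ndl\<close>, \<open>itp\<close> the grid with sampling and interpolation, \<open>dX\<close>, \<open>dT\<close> the
derivatives.\<close>

abbreviation cont :: "(real => 'x::topological_space) => bool" where "cont == continuous_on {a..b}"
abbreviation fq where "fq == mu a b"
abbreviation sc where "sc == sine_coeff a b"
abbreviation LL where "LL == L2space a b"
abbreviation nrm where "nrm == L2norm a b"
abbreviation OM where "OM == Om a b"
abbreviation ac where "ac == AC a b"
abbreviation hS where "hS == Hspace a b"
abbreviation hN where "hN == Hnorm a b"
abbreviation hZ where "hZ == H10 a b"
abbreviation crp where "crp == crep a b"
abbreviation gr where "gr == grid a b"
abbreviation ndl where "ndl == nodal a b"
abbreviation itp where "itp == interp a b"
abbreviation dX where "dX == Dx a b"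
abbreviation dT where "dT == Dt a b"

lemma abs_int_sub: "v absolutely_integrable_on {a..b} ==> a <= p ==> q <= b ==> v absolutely_integrable_on {p..q}"
 for v :: "real => 'x::euclidean_space"
 by (rule absolutely_integrable_on_subinterval) auto

lemma int_sub: "v absolutely_integrable_on {a..b} ==> a <= p ==> q <= b ==> v integrable_on {p..q}"
 for v :: "real => 'x::euclidean_space"
 using abs_int_sub absolutely_integrable_on_def by blast

lemma abs_int_cont_mult:
 fixes g v :: "real => complex"
 assumes "continuous_on {a..b} g" "v absolutely_integrable_on {a..b}"
 shows "(%x. g x * v x) absolutely_integrable_on {a..b}"
proof (rule absolutely_integrable_bounded_measurable_product[OF bilinear_times])
 show "g : borel_measurable (lebesgue_on {a..b})"
  using assms(1) by (intro continuous_imp_measurable_on_sets_lebesgue) auto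
 show "bounded (g ` {a..b})"
  using assms(1) compact_continuous_image compact_imp_bounded by blast
qed (use assms in auto)

lemma AC_diff:
 assumes "AC a b u v" "a <= p" "p <= q" "q <= b"
 shows "u q - u p = integral {p..q} v"
proof -
 have "v integrable_on {a..q}" using assms int_sub unfolding AC_def by auto
 then have "integral {a..p} v + integral {p..q} v = integral {a..q} v"
  using assms by (intro Henstock_Kurzweil_Integration.integral_combine) auto
 moreover have "u p - u a = integral {a..p} v" "u q - u a = integral {a..q} v"
  using assms unfolding AC_def by auto
 ultimately show ?thesis by (simp add: alg)
qed

lemma AC_continuous: "AC a b u v ==> continuous_on {a..b} u"
proof -
 assume A: "AC a b u v"
 then have "continuous_on {a..b} (%x. u a + integral {a..x} v)"
  unfolding AC_def by (intro continuous_intros indefinite_integral_continuous_1)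
  (auto dest: absolutely_integrable_on_def[THEN iffD1])
 moreover have "u x = u a + integral {a..x} v" if "x : {a..b}" for x
  using A that unfolding AC_def by (metis add_diff_cancel_left' add_diff_eq)
 ultimately show ?thesis by (metis (no_types, lifting) continuous_on_cong)
qed

text \<open>A telescoping sum over a fine partition turns a local estimate with an error that is small
 relative to the integral of a fixed weight into an exact identity. Product and chain rule for
 absolutely continuous functions need nothing else.\<close>

lemma integral_from_local:
 fixes h g :: "real => complex" and w :: "real => real"
 assumes g: "g absolutely_integrable_on {a..b}" and w: "w absolutely_integrable_on {a..b}"
  and loc: "!!e. e > 0 ==> \<exists>d>0. \<forall>p q. a <= p --> p <= q --> q <= b --> q - p < d -->
  norm (h q - h p - integral {p..q} g) <= e * integral {p..q} w"
 shows "AC a b h g"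
 unfolding AC_def
proof (intro conjI ballI g)
 fix x assume x: "x : {a..b}"
 let ?W = "integral {a..x} w"
 have key: "norm (h x - h a - integral {a..x} g) <= e * ?W" if e: "e > 0" for e
 proof -
  obtain d where d: "d > 0" and D: "!!p q. a <= p ==> p <= q ==> q <= b ==> q - p < d ==>
  norm (h q - h p - integral {p..q} g) <= e * integral {p..q} w"
  using loc[OF e] by blast
  obtain n :: nat where n: "(x - a) / d < real n" using reals_Archimedean2 by blast
  define N where "N = Suc n"
  have N: "N > 0" "(x - a) / real N < d"
  proof -
  have "(x - a) < d * real n" using n d by (simp add: field_simps)
  also have "... <= d * real N" using d unfolding N_def by simp
  finally show "(x - a) / real N < d" unfolding N_def by (simp add: field_simps)
  qed (simp add: N_def)
  define p where "p i = a + real i * ((x - a) / real N)" for i :: nat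
  have pN: "p 0 = a" "p N = x" using N by (auto simp: p_def)
  have st: "p (Suc i) - p i = (x - a) / real N" for i by (simp add: p_def alg add_divide_distrib diff_divide_distrib)
  have mono: "p i <= p j" if "i <= j" for i j
  using that x N unfolding p_def by (intro add_left_mono mrm) auto
  have ge: "a <= p i" for i using x N unfolding p_def by auto
  have le: "p i <= x" if "i <= N" for i using mono[OF that] pN by simp
  have "norm (h (p i) - h a - integral {a..p i} g) <= e * integral {a..p i} w" if "i <= N" for i
  using that
  proof (induction i)
  case 0 then show ?case by (simp add: pN)
  next
  case (Suc i)
  have pi: "p (Suc i) <= b" "p i <= p (Suc i)" "a <= p i" using le[OF Suc.prems] x mono[of i "Suc i"] ge by auto
  have 1: "integral {a..p i} g + integral {p i..p (Suc i)} g = integral {a..p (Suc i)} g"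
  using pi int_sub[OF g, of a "p (Suc i)"] by (intro Henstock_Kurzweil_Integration.integral_combine) auto
  have 2: "integral {a..p i} w + integral {p i..p (Suc i)} w = integral {a..p (Suc i)} w"
  using pi int_sub[OF w, of a "p (Suc i)"] by (intro Henstock_Kurzweil_Integration.integral_combine) auto
  have 3: "norm (h (p (Suc i)) - h (p i) - integral {p i..p (Suc i)} g) <= e * integral {p i..p (Suc i)} w"
  using D[of "p i" "p (Suc i)"] pi st[of i] N by auto
  have "h (p (Suc i)) - h a - integral {a..p (Suc i)} g =
  (h (p i) - h a - integral {a..p i} g) + (h (p (Suc i)) - h (p i) - integral {p i..p (Suc i)} g)"
  by (simp add: 1[symmetric])
  also have "norm ... <= e * integral {a..p i} w + e * integral {p i..p (Suc i)} w"
  using Suc 3 by (intro norm_triangle_mono) auto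
  also have "... = e * integral {a..p (Suc i)} w" by (simp add: 2[symmetric] alg)
  finally show ?case .
  qed
  from this[of N] show ?thesis by (simp add: pN)
 qed
 have "norm (h x - h a - integral {a..x} g) <= 0"
 proof (rule field_le_epsilon)
  fix e :: real assume e: "e > 0"
  have "norm (h x - h a - integral {a..x} g) <= e / (\<bar>?W\<bar> + 1) * ?W"
  using e by (intro key) (auto simp: add_nonneg_pos)
  also have "... <= e / (\<bar>?W\<bar> + 1) * (\<bar>?W\<bar> + 1)"
  using e by (intro mlm) auto
  also have "... = e" by (simp add: add_nonneg_eq_0_iff)
  finally show "norm (h x - h a - integral {a..x} g) <= 0 + e" by simp
 qed
 then show "h x - h a = integral {a..x} g" by simp
qed

lemma norm_integral_le:
 fixes v :: "real => complex"
 assumes "v absolutely_integrable_on {a..b}" "w absolutely_integrable_on {a..b}" "a <= p" "q <= b"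
  "!!x. x : {p..q} ==> norm (v x) <= w x"
 shows "norm (integral {p..q} v) <= integral {p..q} w"
 using assms by (intro integral_norm_bound_integral int_sub) auto

text \<open>Freezing one factor at the left end of a short interval leaves an error controlled by the oscillation of the continuous factors.\<close>

lemma AC_mult:
 assumes u: "AC a b u u'" and v: "AC a b v v'"
 shows "AC a b (%x. u x * v x) (%x. u x * v' x + v x * u' x)"
proof (rule integral_from_local)
 have cu: "continuous_on {a..b} u" and cv: "continuous_on {a..b} v" using u v AC_continuous by auto
 have iu: "u' absolutely_integrable_on {a..b}" and iv: "v' absolutely_integrable_on {a..b}"
  using u v by (auto simp: AC_def)
 have iuv: "(%x. u x * v' x) absolutely_integrable_on {a..b}" "(%x. v x * u' x) absolutely_integrable_on {a..b}"
  using abs_int_cont_mult cu cv iu iv by auto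
 show "(%x. u x * v' x + v x * u' x) absolutely_integrable_on {a..b}"
  using iuv by (rule set_integral_add)
 let ?w = "%x. norm (v' x) + norm (u' x)"
 show iw: "?w absolutely_integrable_on {a..b}"
  using iu iv by (intro set_integral_add absolutely_integrable_norm[unfolded o_def]) 
 fix e :: real assume e: "e > 0"
 have "uniformly_continuous_on {a..b} u" "uniformly_continuous_on {a..b} v"
  using cu cv compact_uniformly_continuous by auto
 then obtain d1 d2 where d: "d1 > 0" "d2 > 0"
  and d1: "!!x y. x : {a..b} ==> y : {a..b} ==> dist x y < d1 ==> dist (u x) (u y) < e"
  and d2: "!!x y. x : {a..b} ==> y : {a..b} ==> dist x y < d2 ==> dist (v x) (v y) < e"
  using e unfolding uniformly_continuous_on_def by metis
 show "\<exists>d>0. \<forall>p q. a <= p --> p <= q --> q <= b --> q - p < d -->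
  norm (u q * v q - u p * v p - integral {p..q} (%x. u x * v' x + v x * u' x)) <= e * integral {p..q} ?w"
 proof (intro exI[of _ "min d1 d2"] conjI allI impI)
  fix p q assume pq: "a <= p" "p <= q" "q <= b" "q - p < min d1 d2"
  have I: "(%x. u q * v' x) absolutely_integrable_on {a..b}" "(%x. v p * u' x) absolutely_integrable_on {a..b}"
  using abs_int_cont_mult[of "%_. u q" v'] abs_int_cont_mult[of "%_. v p" u'] iu iv by auto
  have I2: "(%x. (u q - u x) * v' x + (v p - v x) * u' x) absolutely_integrable_on {a..b}"
  by (intro set_integral_add abs_int_cont_mult continuous_intros cu cv iu iv)
  have "u q * v q - u p * v p = u q * (v q - v p) + v p * (u q - u p)" by (simp add: alg)
  also have "... = integral {p..q} (%x. u q * v' x) + integral {p..q} (%x. v p * u' x)"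
  using AC_diff[OF u pq(1-3)] AC_diff[OF v pq(1-3)] by simp
  also have "... = integral {p..q} (%x. u q * v' x + v p * u' x)"
  using I pq int_sub by (intro Henstock_Kurzweil_Integration.integral_add[symmetric]) auto
  finally have "u q * v q - u p * v p - integral {p..q} (%x. u x * v' x + v x * u' x)
  = integral {p..q} (%x. u q * v' x + v p * u' x) - integral {p..q} (%x. u x * v' x + v x * u' x)" by simp
  also have "... = integral {p..q} (%x. (u q * v' x + v p * u' x) - (u x * v' x + v x * u' x))"
  using I iuv pq int_sub by (intro Henstock_Kurzweil_Integration.integral_diff[symmetric] integrable_add) auto
  also have "... = integral {p..q} (%x. (u q - u x) * v' x + (v p - v x) * u' x)"
  by (simp add: alg)
  also have "norm ... <= integral {p..q} (%x. e * ?w x)"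
  proof (rule norm_integral_le[OF I2 _ pq(1,3)])
  show "(%x. e * ?w x) absolutely_integrable_on {a..b}" using iw by (rule set_integrable_mult_right)
  fix x assume x: "x : {p..q}"
  have "norm (u q - u x) <= e" "norm (v p - v x) <= e"
  using d1[of q x] d2[of p x] x pq by (auto simp: dist_norm less_imp_le)
  then show "norm ((u q - u x) * v' x + (v p - v x) * u' x) <= e * ?w x"
  unfolding distrib_left by (intro norm_triangle_mono) (auto simp: norm_mult mrm)
  qed
  also have "... = e * integral {p..q} ?w" by simp
  finally show "norm (u q * v q - u p * v p - integral {p..q} (%x. u x * v' x + v x * u' x)) <= e * integral {p..q} ?w" .
 qed (use d in auto)
qed

text \<open>On a short interval \<open>f\<close> is replaced by its tangent; \<open>s\<close> may touch \<open>0\<close>, so only one-sided derivatives at \<open>0\<close> are available.\<close>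

lemma AC_chain:
 fixes s :: "real => real"
 assumes s: "AC a b (%x. of_real (s x)) v" and pos: "!!x. x : {a..b} ==> s x >= 0"
  and f: "!!r. r >= 0 ==> (f has_real_derivative f' r) (at r within {0..})"
  and cf: "continuous_on {0..} f'"
 shows "AC a b (%x. of_real (f (s x))) (%x. of_real (f' (s x)) * v x)"
proof (rule integral_from_local)
 have cs: "continuous_on {a..b} s"
  using continuous_on_Re[OF AC_continuous[OF s]] by simp
 have iv: "v absolutely_integrable_on {a..b}" using s by (auto simp: AC_def)
 have cfs: "continuous_on {a..b} (%x. f' (s x))"
  by (rule continuous_on_compose2[OF cf cs]) (use pos in auto)
 show iuv: "(%x. of_real (f' (s x)) * v x) absolutely_integrable_on {a..b}"
  by (intro abs_int_cont_mult continuous_intros cfs iv)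
 show iw: "(%x. norm (v x)) absolutely_integrable_on {a..b}"
  using iv absolutely_integrable_norm[unfolded o_def] by blast
 fix e :: real assume e: "e > 0"
 have "bdd_above (s ` {a..b})"
  by (intro bounded_imp_bdd_above compact_imp_bounded compact_continuous_image[OF cs compact_Icc])
 then obtain R where R: "!!x. x : {a..b} ==> s x <= R"
  unfolding bdd_above_def by blast
 have "uniformly_continuous_on {0..R} f'"
  using cos[OF cf] by (intro compact_uniformly_continuous) auto
 then obtain d1 where d1: "d1 > 0" "!!x y. x : {0..R} ==> y : {0..R} ==> dist x y < d1 ==> dist (f' x) (f' y) < e"
  using e unfolding uniformly_continuous_on_def by metis
 have "uniformly_continuous_on {a..b} s" using cs compact_uniformly_continuous by auto
 then obtain d2 where d2: "d2 > 0" "!!x y. x : {a..b} ==> y : {a..b} ==> dist x y < d2 ==> dist (s x) (s y) < d1"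
  using d1 unfolding uniformly_continuous_on_def by metis
 show "\<exists>d>0. \<forall>p q. a <= p --> p <= q --> q <= b --> q - p < d -->
  norm (of_real (f (s q)) - of_real (f (s p)) - integral {p..q} (%x. of_real (f' (s x)) * v x)) <= e * integral {p..q} (%x. norm (v x))"
 proof (intro exI[of _ "d2"] conjI allI impI)
  fix p q assume pq: "a <= p" "p <= q" "q <= b" "q - p < d2"
  have sp: "0 <= s p" "0 <= s q" "s p <= R" "s q <= R" using pos R pq by auto
  have dsp: "\<bar>s q - s x\<bar> < d1" "\<bar>s p - s x\<bar> < d1" if "x : {p..q}" for x
  using d2(2)[of q x] d2(2)[of p x] that pq by (auto simp: dist_real_def)
  \<comment> \<open>The intermediate point of the mean value theorem, which lies between the two values of \<open>s\<close>.\<close>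
  have mvt: "\<exists>xi. min r r' <= xi & xi <= max r r' & f r' - f r = f' xi * (r' - r)" if "0 <= r" "0 <= r'" for r r'
  proof -
  have *: "\<exists>xi. r <= xi & xi <= r' & f r' - f r = f' xi * (r' - r)" if "0 <= r" "r < r'" for r r'
  proof -
  have "\<exists>x\<in>{r<..<r'}. f r' - f r = (%h. f' x * h) (r' - r)"
  proof (rule mvt[OF that(2)])
  show "continuous_on {r..r'} f"
  by (rule DERIV_continuous_on[where D=f'], rule DERIV_subset[OF f]) (use that in auto)
  fix x assume "r < x" "x < r'"
  then show "(f has_derivative (%h. f' x * h)) (at x)"
  using f[of x] that at_within_interior[of x "{0..}"]
  by (auto simp: has_field_derivative_def)
  qed (use that in auto)
  then obtain xi where "r < xi" "xi < r'" "f r' - f r = f' xi * (r' - r)" by auto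
  then show ?thesis by (intro exI[of _ xi]) auto
  qed
  consider "r < r'" | "r' < r" | "r = r'" by linarith
  then show ?thesis
  proof cases
  case 1 then show ?thesis using *[of r r'] that by (auto simp: min_def max_def)
  next
  case 2 then obtain xi where "r' <= xi" "xi <= r" "f r - f r' = f' xi * (r - r')" using *[of r' r] \<open>0 <= r'\<close> by auto
  then have "f r' - f r = f' xi * (r' - r)" by (simp add: alg)
  with \<open>r' <= xi\<close> \<open>xi <= r\<close> show ?thesis by (intro exI[of _ xi]) auto
  next
  case 3 then show ?thesis by auto
  qed
  qed
  obtain xi where xi: "min (s p) (s q) <= xi" "xi <= max (s p) (s q)" "f (s q) - f (s p) = f' xi * (s q - s p)"
  using mvt[OF sp(1,2)] by blast
  have xiR: "xi : {0..R}" using xi sp by auto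
  have I: "(%x. of_real (f' xi) * v x) absolutely_integrable_on {a..b}"
  using abs_int_cont_mult[of "%_. of_real (f' xi)" v] iv by auto
  have I2: "(%x. (of_real (f' xi) - of_real (f' (s x))) * v x) absolutely_integrable_on {a..b}"
  by (intro abs_int_cont_mult continuous_intros cfs iv)
  have "of_real (f (s q)) - of_real (f (s p)) = (of_real (f' xi) * (of_real (s q) - of_real (s p)) :: complex)"
  unfolding of_real_diff[symmetric] of_real_mult[symmetric] xi(3) by simp
  also have "... = integral {p..q} (%x. of_real (f' xi) * v x)"
  using AC_diff[OF s pq(1-3)] by simp
  finally have "of_real (f (s q)) - of_real (f (s p)) - integral {p..q} (%x. of_real (f' (s x)) * v x)
  = integral {p..q} (%x. of_real (f' xi) * v x) - integral {p..q} (%x. of_real (f' (s x)) * v x)" by simp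
  also have "... = integral {p..q} (%x. of_real (f' xi) * v x - of_real (f' (s x)) * v x)"
  using I iuv pq int_sub by (intro Henstock_Kurzweil_Integration.integral_diff[symmetric]) auto
  also have "... = integral {p..q} (%x. (of_real (f' xi) - of_real (f' (s x))) * v x)"
  by (simp add: alg)
  also have "norm ... <= integral {p..q} (%x. e * norm (v x))"
  proof (rule norm_integral_le[OF I2 _ pq(1,3)])
  show "(%x. e * norm (v x)) absolutely_integrable_on {a..b}" using iw by (rule set_integrable_mult_right)
  fix x assume x: "x : {p..q}"
  have "\<bar>xi - s x\<bar> < d1" using dsp[OF x] xi by (auto simp: min_def max_def abs_if split: if_splits)
  then have "\<bar>f' xi - f' (s x)\<bar> <= e"
  using d1(2)[of xi "s x"] xiR pos[of x] R[of x] x pq by (auto simp: dist_real_def)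
  then show "norm ((of_real (f' xi) - of_real (f' (s x))) * v x) <= e * norm (v x)"
  unfolding norm_mult of_real_diff[symmetric] norm_of_real by (rule mrm) auto
  qed
  also have "... = e * integral {p..q} (%x. norm (v x))" by simp
  finally show "norm (of_real (f (s q)) - of_real (f (s p)) - integral {p..q} (%x. of_real (f' (s x)) * v x)) <= e * integral {p..q} (%x. norm (v x))" .
 qed (use d2 in auto)
qed

lemma AC_I:
 assumes "v absolutely_integrable_on {a..b}" "!!x. a <= x ==> x <= b ==> u x - u a = integral {a..x} v"
 shows "AC a b u v"
 using assms by (auto simp: AC_def)

lemma AC_abs_int: "AC a b u v ==> v absolutely_integrable_on {a..b}"
 by (auto simp: AC_def)

lemma AC_int: "AC a b u v ==> a <= p ==> q <= b ==> v integrable_on {p..q}"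
 using int_sub AC_abs_int by blast

lemma AC_add:
 assumes u: "AC a b u u'" and v: "AC a b v v'"
 shows "AC a b (%x. u x + v x) (%x. u' x + v' x)"
proof (rule AC_I)
 show "(%x. u' x + v' x) absolutely_integrable_on {a..b}"
  using AC_abs_int[OF u] AC_abs_int[OF v] by (rule set_integral_add)
 fix x assume x: "a <= x" "x <= b"
 have "integral {a..x} (%x. u' x + v' x) = integral {a..x} u' + integral {a..x} v'"
  using AC_int[OF u, of a x] AC_int[OF v, of a x] x by (intro Henstock_Kurzweil_Integration.integral_add) auto
 also have "... = (u x - u a) + (v x - v a)"
  using AC_diff[OF u, of a x] AC_diff[OF v, of a x] x by simp
 finally show "u x + v x - (u a + v a) = integral {a..x} (%x. u' x + v' x)" by simp
qed

lemma AC_cmult: 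
 assumes u: "AC a b u u'"
 shows "AC a b (%x. c * u x) (%x. c * u' x)"
proof (rule AC_I)
 show "(%x. c * u' x) absolutely_integrable_on {a..b}"
  using AC_abs_int[OF u] by (rule set_integrable_mult_right)
 fix x assume x: "a <= x" "x <= b"
 show "c * u x - c * u a = integral {a..x} (%x. c * u' x)"
  using AC_diff[OF u, of a x] x by (simp add: right_diff_distrib[symmetric])
qed

lemma AC_diff_fun: "AC a b u u' ==> AC a b v v' ==> AC a b (%x. u x - v x) (%x. u' x - v' x)"
 using AC_add[of u u' "%x. -1 * v x" "%x. -1 * v' x"] AC_cmult[of v v' "-1"] by simp

lemma AC_cnj:
 assumes u: "AC a b u u'"
 shows "AC a b (%x. cnj (u x)) (%x. cnj (u' x))"
proof (rule AC_I)
 show "(%x. cnj (u' x)) absolutely_integrable_on {a..b}"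
  using absolutely_integrable_linear[OF AC_abs_int[OF u] bounded_linear_cnj] by (simp add: o_def)
 fix x assume x: "a <= x" "x <= b"
 show "cnj (u x) - cnj (u a) = integral {a..x} (%x. cnj (u' x))"
  using AC_diff[OF u, of a x] x integral_linear[OF AC_int[OF u, of a x] bounded_linear_cnj]
  by (simp add: o_def flip: complex_cnj_diff)
qed

lemma AC_smooth:
 assumes "!!x. x : {a..b} ==> (u hvd u' x) (at x within {a..b})" "continuous_on {a..b} u'"
 shows "AC a b u u'"
proof (rule AC_I)
 show "u' absolutely_integrable_on {a..b}" using assms(2) by (rule absolutely_integrable_continuous_real)
 fix x assume x: "a <= x" "x <= b"
 have "(u' has_integral (u x - u a)) {a..x}"
  using x by (intro fundamental_theorem_of_calculus)
  (auto intro!: hvw[OF assms(1)])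
 then show "u x - u a = integral {a..x} u'" by (simp add: integral_unique)
qed

lemma AC_cong:
 assumes u: "AC a b u u'" and e: "!!x. x : {a..b} ==> u x = v x" "!!x. x : {a..b} ==> u' x = v' x"
 shows "AC a b v v'"
proof (rule AC_I)
 show "v' absolutely_integrable_on {a..b}"
  using AC_abs_int[OF u] set_integrable_cong[of lebesgue lebesgue "{a..b}" "{a..b}" u' v'] e by auto
 fix x assume x: "a <= x" "x <= b"
 have "integral {a..x} u' = integral {a..x} v'"
  using x e by (intro Henstock_Kurzweil_Integration.integral_cong) auto
 then show "v x - v a = integral {a..x} v'"
  using AC_diff[OF u, of a x] x e ab by auto
qed

lemma AC_by_parts:
 assumes u: "AC a b u u'" and v: "AC a b v v'"
 shows "integral {a..b} (%x. u x * v' x) = u b * v b - u a * v a - integral {a..b} (%x. v x * u' x)"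
proof -
 have I: "(%x. u x * v' x) integrable_on {a..b}" "(%x. v x * u' x) integrable_on {a..b}"
  using abs_int_cont_mult[OF AC_continuous[OF u] AC_abs_int[OF v]]
  abs_int_cont_mult[OF AC_continuous[OF v] AC_abs_int[OF u]]
  unfolding absolutely_integrable_on_def by blast+
 have "u b * v b - u a * v a = integral {a..b} (%x. u x * v' x + v x * u' x)"
  using AC_diff[OF AC_mult[OF assms], of a b] ab by simp
 also have "... = integral {a..b} (%x. u x * v' x) + integral {a..b} (%x. v x * u' x)"
  using I by (rule Henstock_Kurzweil_Integration.integral_add)
 finally show ?thesis by simp
qed

end

section \<open>Square integrable functions and the trigonometric systems\<close>

lemma cauchy_schwarz_from_weights:
 fixes A B C :: real
 assumes A: "A >= 0" and B: "B >= 0" and *: "!!t. t > 0 ==> 2 * C <= t * A + B / t"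
 shows "C <= sqrt A * sqrt B"
proof (rule field_le_epsilon)
 fix e :: real assume e: "e > 0"
 define p where "p = sqrt A" define q where "q = sqrt B"
 have p: "p >= 0" "A = p^2" and q: "q >= 0" "B = q^2" using A B by (auto simp: p_def q_def)
 \<comment> \<open>The optimal weight is \<open>q / p\<close>; shifting both by \<open>d\<close> keeps it meaningful when one of them vanishes.\<close>
 define d where "d = min 1 (e / (p + q + 1))"
 have d: "d > 0" "d <= 1" "d <= e / (p + q + 1)" using e p q by (auto simp: d_def)
 then have d: "d > 0" "d <= 1" "d * (p + q + 1) <= e" using p q by (auto simp: pos_le_divide_eq add_nonneg_pos)
 have "2 * C <= (q + d) / (p + d) * p^2 + q^2 / ((q + d) / (p + d))"
  using *[of "(q + d) / (p + d)"] d p q by simp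
 also have "... <= (q + d) * (p + d) + (q + d) * (p + d)"
 proof (rule add_mono)
  have "p^2 <= (p + d)^2" using p d by (intro power_mono) auto
  then have "(q + d) / (p + d) * p^2 <= (q + d) / (p + d) * (p + d)^2"
  using p q d by (intro mlm) auto
  then show "(q + d) / (p + d) * p^2 <= (q + d) * (p + d)"
  using p d by (simp add: psq)
  have "q^2 <= (q + d)^2" using q d by (intro power_mono) auto
  then have "q^2 / ((q + d) / (p + d)) <= (q + d)^2 / ((q + d) / (p + d))"
  using p q d by (intro divide_right_mono) auto
  also have "... = (q + d) * (p + d)" using p q d by (simp add: psq)
  finally show "q^2 / ((q + d) / (p + d)) <= (q + d) * (p + d)" .
 qed
 finally have "C <= (q + d) * (p + d)" by linarith
 also have "... = p * q + d * (p + q + d)" by (simp add: alg)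
 also have "... <= p * q + d * (p + q + 1)" using d p q by (intro add_left_mono mlm) auto
 finally show "C <= sqrt A * sqrt B + e" using d unfolding p_def q_def by simp
qed

lemma half_length_cancel:
 fixes L X :: real
 assumes "L ~= 0"
 shows "(2 / L)^2 * (L / 2 * X) = 2 / L * X" "L / 2 * ((2 / L)^2 * X) = 2 / L * X"
 using assms by (simp_all add: psq)

lemma L2norm_nonneg [simp]: "L2norm a b u >= 0"
 by (simp add: L2norm_def)

definition sn :: "real => real => nat => real => real" where
 "sn a b l x = sin (mu a b l * (x - a))"

definition cn :: "real => real => nat => real => real" where
 "cn a b l x = cos (mu a b l * (x - a))"

definition ip :: "real => real => (real => real) => (real => complex) => complex" where
 "ip a b e u = (LINT x|Om a b. of_real (e x) * u x)"

context seg
begin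
abbreviation ipr where "ipr == ip a b"
abbreviation cN where "cN == cn a b"
abbreviation sN where "sN == sn a b"

lemma Om_integrable_iff: "integrable (OM) u \<longleftrightarrow> u absolutely_integrable_on {a..b}"
 for u :: "real => 'x::euclidean_space"
 by (subst absolutely_integrable_on_Icc_iff_Ioo)
  (simp add: set_integrable_def integrable_restrict_space)

lemma Om_integral_eq: "integrable (OM) u ==> (LINT x|OM. u x) = integral {a..b} u"
 for u :: "real => 'x::euclidean_space"
 by (subst lebesgue_integral_eq_integral) (auto simp: integral_open_interval_real)

lemma Om_const [simp]: "integrable (OM) (%x. c::'x::euclidean_space)"
 unfolding Om_integrable_iff by (intro absolutely_integrable_continuous_real) auto

lemma Om_finite: "finite_measure (OM)"
 by (intro finite_measure_lebesgue_on) auto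

lemma Om_measurable_cont: "cont g ==> g : borel_measurable (OM)"
 for g :: "real => 'x::euclidean_space"
 by (intro continuous_imp_measurable_on_sets_lebesgue) (auto intro: cos)

lemma Om_integrable_cont: "cont g ==> integrable (OM) g"
 for g :: "real => 'x::euclidean_space"
 unfolding Om_integrable_iff by (intro absolutely_integrable_continuous_real) auto

lemma L2_meas: "u : LL ==> u : borel_measurable (OM)" by (simp add: L2space_def)
lemma L2_sq: "u : LL ==> integrable (OM) (%x. (cmod (u x))^2)" by (simp add: L2space_def)

lemma L2norm_sq: "(nrm u)^2 = (LINT x|OM. (cmod (u x))^2)"
 unfolding L2norm_def by (rule real_sqrt_pow2) simp

lemma L2_prod_norm: "u : LL ==> v : LL ==> integrable (OM) (%x. cmod (u x) * cmod (v x))"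
proof -
 assume uv: "u : LL" "v : LL"
 have "integrable (OM) (%x. (cmod (u x))^2 + (cmod (v x))^2)"
  using L2_sq[OF uv(1)] L2_sq[OF uv(2)] by (intro Bochner_Integration.integrable_add) auto
 then show ?thesis
 proof (rule Bochner_Integration.integrable_bound)
  show "(%x. cmod (u x) * cmod (v x)) : borel_measurable (OM)"
  using L2_meas[OF uv(1)] L2_meas[OF uv(2)] by (intro borel_measurable_times borel_measurable_norm) auto
  have "y * z <= y^2 + z^2" if "0 <= y * z" for y z :: real
  using sum_squares_bound[of y z] that by (simp add: mult.assoc)
  then show "AE x in OM. norm (cmod (u x) * cmod (v x)) <= norm ((cmod (u x))^2 + (cmod (v x))^2)"
  by (intro AE_I2) (simp add: zero_le_mult_iff)
 qed
qed

lemma L2_mult_int: "u : LL ==> v : LL ==> integrable (OM) (%x. u x * v x)"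
 using L2_meas[of u] L2_meas[of v]
 by (intro Bochner_Integration.integrable_bound[OF L2_prod_norm[of u v]] borel_measurable_times) (simp_all add: norm_mult)

text \<open>The weighted arithmetic-geometric inequality holds pointwise for every weight; optimise the weight after integrating.\<close>

lemma L2_cauchy_schwarz_norm:
 assumes uv: "u : LL" "v : LL"
 shows "(LINT x|OM. cmod (u x) * cmod (v x)) <= nrm u * nrm v"
 unfolding L2norm_def
proof (rule cauchy_schwarz_from_weights)
 fix t :: real assume t: "t > 0"
 have pt: "2 * (x * y) <= t * x^2 + y^2 / t" for x y :: real
 proof -
  have "0 <= (t * x - y)^2 / t" using t by simp
  also have "... = t * x^2 + y^2 / t - 2 * (x * y)" using t by (simp add: power2_diff pmd psq field_simps)
  finally show ?thesis by simp
 qed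
 have "2 * (LINT x|OM. cmod (u x) * cmod (v x)) = (LINT x|OM. 2 * (cmod (u x) * cmod (v x)))" by simp
 also have "... <= (LINT x|OM. t * (cmod (u x))^2 + (cmod (v x))^2 / t)"
  using pt L2_prod_norm[OF uv] L2_sq[OF uv(1)] L2_sq[OF uv(2)] by (intro integral_mono) auto
 also have "... = t * (LINT x|OM. (cmod (u x))^2) + (LINT x|OM. (cmod (v x))^2) / t"
  using L2_sq[OF uv(1)] L2_sq[OF uv(2)] by (subst Bochner_Integration.integral_add) auto
 finally show "2 * (LINT x|OM. cmod (u x) * cmod (v x))
  <= t * (LINT x|OM. (cmod (u x))^2) + (LINT x|OM. (cmod (v x))^2) / t" .
qed simp_all

lemma L2_cauchy_schwarz:
 assumes uv: "u : LL" "v : LL"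
 shows "cmod (LINT x|OM. u x * v x) <= nrm u * nrm v"
proof -
 have "cmod (LINT x|OM. u x * v x) <= (LINT x|OM. cmod (u x * v x))" by (rule integral_norm_bound)
 also have "... <= nrm u * nrm v" using L2_cauchy_schwarz_norm[OF uv] by (simp add: norm_mult)
 finally show ?thesis .
qed

lemma L2_add:
 assumes uv: "u : LL" "v : LL"
 shows "(%x. u x + v x) : LL" "nrm (%x. u x + v x) <= nrm u + nrm v"
proof -
 let ?r = "%x. (cmod (u x))^2 + (cmod (v x))^2 + 2 * (cmod (u x) * cmod (v x))"
 have I: "integrable (OM) ?r"
  using L2_prod_norm[OF uv] L2_sq[OF uv(1)] L2_sq[OF uv(2)] by (intro Bochner_Integration.integrable_add) auto
 have le: "(cmod (u x + v x))^2 <= ?r x" for x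
 proof -
  have "(cmod (u x + v x))^2 <= (cmod (u x) + cmod (v x))^2" by (intro power_mono norm_triangle_ineq) auto
  then show ?thesis by (simp add: power2_sum)
 qed
 have m: "(%x. u x + v x) : borel_measurable (OM)" using L2_meas[OF uv(1)] L2_meas[OF uv(2)] by (intro borel_measurable_add) auto
 have I2: "integrable (OM) (%x. (cmod (u x + v x))^2)"
 proof (rule Bochner_Integration.integrable_bound[OF I])
  show "(%x. (cmod (u x + v x))^2) : borel_measurable (OM)"
  using m by (intro borel_measurable_power borel_measurable_norm) auto
  show "AE x in OM. norm ((cmod (u x + v x))^2) <= norm (?r x)"
  using le by (auto intro: order_trans[OF le])
 qed
 then show "(%x. u x + v x) : LL" using m by (simp add: L2space_def)
 have "(nrm (%x. u x + v x))^2 <= (LINT x|OM. ?r x)"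
  unfolding L2norm_sq using I I2 le by (intro integral_mono) auto
 also have "... = (nrm u)^2 + (nrm v)^2 + 2 * (LINT x|OM. cmod (u x) * cmod (v x))"
  unfolding L2norm_sq using L2_prod_norm[OF uv] L2_sq[OF uv(1)] L2_sq[OF uv(2)]
  by (subst Bochner_Integration.integral_add; simp)+
 also have "... <= (nrm u)^2 + (nrm v)^2 + 2 * (nrm u * nrm v)"
  using L2_cauchy_schwarz_norm[OF uv] by simp
 also have "... = (nrm u + nrm v)^2" by (simp add: power2_sum)
 finally show "nrm (%x. u x + v x) <= nrm u + nrm v"
  by (rule power2_le_imp_le) simp
qed

lemma L2_bounded_mult:
 assumes u: "u : LL" and g: "g : borel_measurable (OM)" and B: "!!x. x : {a<..<b} ==> cmod (g x) <= B"
 shows "(%x. g x * u x) : LL" "nrm (%x. g x * u x) <= B * nrm u"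
proof -
 have B0: "B >= 0" using order_trans[OF norm_ge_zero B[of "(a + b) / 2"]] ab by simp
 have le: "(cmod (g x * u x))^2 <= B^2 * (cmod (u x))^2" if "x : {a<..<b}" for x
  unfolding norm_mult pmd[symmetric] using B[OF that] by (intro power_mono mrm) auto
 have m: "(%x. g x * u x) : borel_measurable (OM)" using L2_meas[OF u] g by (intro borel_measurable_times) auto
 have I: "integrable (OM) (%x. B^2 * (cmod (u x))^2)" using L2_sq[OF u] by simp
 have I2: "integrable (OM) (%x. (cmod (g x * u x))^2)"
 proof (rule Bochner_Integration.integrable_bound[OF I])
  show "(%x. (cmod (g x * u x))^2) : borel_measurable (OM)"
  using m by (intro borel_measurable_power borel_measurable_norm) auto
  show "AE x in OM. norm ((cmod (g x * u x))^2) <= norm (B^2 * (cmod (u x))^2)"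
  using le by (auto intro!: AE_I2)
 qed
 then show "(%x. g x * u x) : LL" using m by (simp add: L2space_def)
 have "(nrm (%x. g x * u x))^2 <= (LINT x|OM. B^2 * (cmod (u x))^2)"
  unfolding L2norm_sq using I I2 le by (intro integral_mono) auto
 also have "... = (B * nrm u)^2" by (simp add: pmd L2norm_sq)
 finally show "nrm (%x. g x * u x) <= B * nrm u"
  by (rule power2_le_imp_le) (use B0 in simp)
qed

lemma L2_cmult:
 assumes u: "u : LL"
 shows "(%x. c * u x) : LL" "nrm (%x. c * u x) <= cmod c * nrm u"
 using L2_bounded_mult[OF u, of "%_. c" "cmod c"] by auto

lemma L2_diff:
 assumes uv: "u : LL" "v : LL"
 shows "(%x. u x - v x) : LL" "nrm (%x. u x - v x) <= nrm u + nrm v"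
proof -
 have v: "(%x. - 1 * v x) : LL" "nrm (%x. - 1 * v x) <= nrm v"
  using L2_cmult[OF uv(2), of "-1"] by auto
 show "(%x. u x - v x) : LL" "nrm (%x. u x - v x) <= nrm u + nrm v"
  using L2_add[OF uv(1) v(1)] v(2) by auto
qed

lemma L2_cnj: "u : LL ==> (%x. cnj (u x)) : LL" "nrm (%x. cnj (u x)) = nrm u"
 by (auto simp: L2space_def L2norm_def intro: borel_measurable_continuous_on[OF continuous_on_cnj[OF continuous_on_id]])

lemma L2_bounded:
 assumes "g : borel_measurable (OM)" and "!!x. x : {a<..<b} ==> cmod (g x) <= B"
 shows "g : LL" "nrm g <= B * sqrt (b - a)"
proof -
 have 1: "(%_. 1) : LL" by (simp add: L2space_def)
 have "(LINT x|OM. 1::real) = b - a"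
  using Om_integral_eq[OF Om_const[of "1::real"]] ab by simp
 then have "nrm (%_. 1) = sqrt (b - a)" by (simp add: L2norm_def)
 then show "g : LL" "nrm g <= B * sqrt (b - a)"
  using L2_bounded_mult[OF 1 assms] by auto
qed

lemma L2_cont: "cont g ==> g : LL"
proof -
 assume g: "cont g"
 have "bounded (g ` {a..b})" by (intro compact_imp_bounded compact_continuous_image[OF g compact_Icc])
 then obtain B where "!!x. x : {a..b} ==> cmod (g x) <= B" unfolding bounded_iff by blast
 then show ?thesis using L2_bounded[OF Om_measurable_cont[OF g], of B] by auto
qed

lemma L2_int: "u : LL ==> integrable (OM) u"
 using L2_mult_int[of u "%_. 1"] L2_cont[of "%_. 1"] by auto

lemma L2norm_cong_AE:
 assumes "AE x in OM. u x = v x" "u : borel_measurable (OM)" "v : borel_measurable (OM)"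
 shows "nrm u = nrm v"
proof -
 have "(LINT x|OM. (cmod (u x))^2) = (LINT x|OM. (cmod (v x))^2)"
  using assms by (intro integral_cong_AE) (auto intro!: borel_measurable_power borel_measurable_norm)
 then show ?thesis by (simp add: L2norm_def)
qed

lemma L2_cong_AE:
 assumes "u : LL" "AE x in OM. u x = v x" "v : borel_measurable (OM)"
 shows "v : LL" "nrm v = nrm u"
proof -
 have "integrable (OM) (%x. (cmod (v x))^2)"
  using assms L2_sq[OF assms(1)] L2_meas[OF assms(1)]
  by (subst integrable_cong_AE[of _ _ "%x. (cmod (u x))^2"]) (auto intro!: borel_measurable_power borel_measurable_norm)
 then show "v : LL" using assms by (simp add: L2space_def)
 show "nrm v = nrm u" using L2norm_cong_AE[OF assms(2) L2_meas[OF assms(1)] assms(3)] by simp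
qed

lemma ip_cong_AE:
 assumes "AE x in OM. u x = v x" "u : borel_measurable (OM)" "v : borel_measurable (OM)" "cont e"
 shows "ipr e u = ipr e v"
 unfolding ip_def using assms Om_measurable_cont[OF assms(4)]
 by (intro integral_cong_AE) (auto intro!: borel_measurable_times borel_measurable_of_real)

lemma L2_e_mult: "cont e ==> u : LL ==> integrable (OM) (%x. of_real (e x) * u x)"
 by (rule L2_mult_int[OF L2_cont[OF continuous_on_of_real]])

lemma ip_add: "cont e ==> u : LL ==> v : LL ==>
  ipr e (%x. u x + v x) = ipr e u + ipr e v"
 unfolding ip_def distrib_left by (intro Bochner_Integration.integral_add L2_e_mult)

lemma ip_diff: "cont e ==> u : LL ==> v : LL ==>
  ipr e (%x. u x - v x) = ipr e u - ipr e v"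
 unfolding ip_def right_diff_distrib by (intro Bochner_Integration.integral_diff L2_e_mult)

lemma ip_cmult: "ipr e (%x. c * u x) = c * ipr e u"
 unfolding ip_def by (simp add: mult.left_commute)

lemma ip_sum: "cont e ==> (!!i. i : A ==> u i : LL) ==>
  ipr e (%x. \<Sum>i\<in>A. u i x) = (\<Sum>i\<in>A. ipr e (u i))"
 unfolding ip_def sum_distrib_left by (intro Bochner_Integration.integral_sum L2_e_mult)

lemma cont_sn [continuous_intros]: "continuous_on S (sN l)" unfolding sn_def by (intro continuous_intros)
lemma cont_cn [continuous_intros]: "continuous_on S (cN l)" unfolding cn_def by (intro continuous_intros)

lemma mu_pos: "l >= 1 ==> fq l > 0" using ab by (simp add: mu_def)
lemma mu_nonneg: "fq l >= 0" using ab by (simp add: mu_def)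
lemma mu_mono: "l <= k ==> fq l <= fq k" using ab by (simp add: mu_def divide_right_mono mlm)

lemma sn_ends: "sN l a = 0" "sN l b = 0"
 using ab by (auto simp: sn_def mu_def)
lemma cn_ends: "cN l a = 1" "cN l b = (- 1) ^ l"
 using ab by (auto simp: cn_def mu_def)

lemma integral_cos_freq:
 assumes "k ~= (0::int)"
 shows "integral {a..b} (%x. cos (pi * of_int k / (b - a) * (x - a))) = 0"
proof -
 let ?c = "pi * of_int k / (b - a)"
 have c: "?c ~= 0" using assms ab by simp
 have "((%x. cos (?c * (x - a))) has_integral (sin (?c * (b - a)) / ?c - sin (?c * (a - a)) / ?c)) {a..b}"
 proof (rule fundamental_theorem_of_calculus)
  fix x assume "x : {a..b}"
  have "((%x. sin (?c * (x - a)) / ?c) has_real_derivative cos (?c * (x - a)) * ?c / ?c) (at x within {a..b})"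
  by (auto intro!: derivative_eq_intros)
  then show "((%x. sin (?c * (x - a)) / ?c) hvd cos (?c * (x - a))) (at x within {a..b})"
  using c by (simp add: has_real_derivative_iff_has_vector_derivative)
 qed (use ab in simp)
 moreover have "sin (?c * (b - a)) = 0" using ab sin_integer_2pi sin_npi_int[of k] by (simp add: mult.commute)
 ultimately show ?thesis by (simp add: integral_unique)
qed

definition trig_system :: "(nat => real => real) => bool" where
 "trig_system e \<longleftrightarrow> (\<forall>l. cont (e l)) &
  (\<forall>l\<ge>1. \<forall>k\<ge>1. integral {a..b} (%x. e l x * e k x) = (if l = k then (b - a) / 2 else 0))"

lemma trig_sn: "trig_system (sN)" and trig_cn: "trig_system (cN)"
proof -
 have I: "(%x. cos (pi * of_int k / (b - a) * (x - a))) integrable_on {a..b}" for k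
  by (intro integrable_continuous_real continuous_intros)
 have 0: "integral {a..b} (%x. cos (pi * of_int k / (b - a) * (x - a))) = (if k = 0 then b - a else 0)" for k
  using integral_cos_freq[of k] ab by auto
 have A: "fq l * (x - a) - fq k * (x - a) = pi * of_int (int l - int k) / (b - a) * (x - a)" 
  "fq l * (x - a) + fq k * (x - a) = pi * of_int (int l + int k) / (b - a) * (x - a)" for l k x
  using ab by (simp_all add: mu_def alg add_divide_distrib diff_divide_distrib)
 have s: "sN l x * sN k x = 1/2 * (cos (pi * of_int (int l - int k) / (b - a) * (x - a)) - cos (pi * of_int (int l + int k) / (b - a) * (x - a)))" for l k x
  unfolding sn_def sin_times_sin A by simp
 have c: "cN l x * cN k x = 1/2 * (cos (pi * of_int (int l - int k) / (b - a) * (x - a)) + cos (pi * of_int (int l + int k) / (b - a) * (x - a)))" for l k x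
  unfolding cn_def cos_times_cos A by simp
 show "trig_system (sN)"
  unfolding trig_system_def s integral_mult_right Henstock_Kurzweil_Integration.integral_diff[OF I I] 0
  by (auto intro: continuous_intros)
 show "trig_system (cN)"
  unfolding trig_system_def c integral_mult_right Henstock_Kurzweil_Integration.integral_add[OF I I] 0
  by (auto intro: continuous_intros)
qed

lemma trig_cont: "trig_system e ==> cont (e l)" by (simp add: trig_system_def)

lemma trig_orth:
 assumes "trig_system e" "l >= 1" "k >= 1"
 shows "ipr (e l) (%x. of_real (e k x)) = (if l = k then (b - a) / 2 else 0)"
proof -
 have c: "cont (%x. e l x * e k x)" using assms(1) trig_cont by (intro continuous_intros) auto
 have "ipr (e l) (%x. of_real (e k x)) = of_real (LINT x|OM. e l x * e k x)"
  unfolding ip_def of_real_mult[symmetric] by (rule integral_complex_of_real)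
 also have "(LINT x|OM. e l x * e k x) = integral {a..b} (%x. e l x * e k x)"
  using c Om_integral_eq Om_integrable_cont by blast
 finally show ?thesis using assms unfolding trig_system_def by auto
qed

lemma trig_sum_L2: "trig_system e ==> (%x. \<Sum>l\<in>A. c l * of_real (e l x)) : LL"
 using trig_cont by (intro L2_cont continuous_intros) auto

lemma ip_trig_sum:
 fixes c :: "nat => complex"
 assumes e: "trig_system e" and A: "finite A" "!!l. l : A ==> l >= 1" and l: "l >= 1"
 shows "ipr (e l) (%x. \<Sum>k\<in>A. c k * of_real (e k x)) = (if l : A then (b - a) / 2 * c l else 0)"
proof -
 have "ipr (e l) (%x. \<Sum>k\<in>A. c k * of_real (e k x)) = (\<Sum>k\<in>A. c k * ipr (e l) (%x. of_real (e k x)))"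
  using e trig_cont by (subst ip_sum) (auto simp: ip_cmult intro!: L2_cont continuous_intros)
 also have "... = (\<Sum>k\<in>A. if l = k then (b - a) / 2 * c k else 0)"
  using trig_orth[OF e l] A by (intro sum.cong) auto
 finally show ?thesis using A by (simp add: sum.delta)
qed

lemma trig_parseval_finite:
 fixes c :: "nat => complex"
 assumes e: "trig_system e" and A: "finite A" "!!l. l : A ==> l >= 1" 
 shows "(nrm (%x. \<Sum>k\<in>A. c k * of_real (e k x)))^2 = (b - a) / 2 * (\<Sum>k\<in>A. (cmod (c k))^2)"
proof -
 let ?h = "%x. \<Sum>k\<in>A. c k * of_real (e k x)"
 have "cr ((nrm ?h)^2) = (LINT x|OM. cr ((cmod (?h x))^2))"
  by (simp only: L2norm_sq integral_complex_of_real)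
 also have "... = (LINT x|OM. (\<Sum>k\<in>A. cnj (c k) * (of_real (e k x) * ?h x)))"
  by (intro Bochner_Integration.integral_cong refl, subst complex_norm_square)
  (simp add: sum_distrib_left sum_distrib_right mult_ac)
 also have "... = (\<Sum>k\<in>A. cnj (c k) * ipr (e k) ?h)"
  using e trig_cont by (subst Bochner_Integration.integral_sum)
  (auto simp: ip_def intro!: integrable_mult_right L2_e_mult trig_sum_L2)
 also have "... = (\<Sum>k\<in>A. of_real ((b - a) / 2 * (cmod (c k))^2))"
  using A by (intro sum.cong refl) (simp add: ip_trig_sum[OF e A] complex_norm_square mult_ac del: of_real_power; simp add: alg complex_norm_square)
 finally have "cr ((nrm ?h)^2) = cr ((b - a) / 2 * (\<Sum>k\<in>A. (cmod (c k))^2))"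
  by (simp add: sum_distrib_left)
 then show ?thesis using of_real_eq_iff by blast
qed

lemma L2norm_diff_sq:
 assumes g: "g : LL" and h: "h : LL"
 shows "(nrm (%x. g x - h x))^2 = (nrm g)^2 + (nrm h)^2 - 2 * Re (LINT x|OM. cnj (g x) * h x)"
proof -
 define f where "f x = cnj (g x) * h x" for x
 have I: "integrable (OM) f" unfolding f_def using L2_cnj(1)[OF g] h by (rule L2_mult_int)
 have "(cmod (g x - h x))^2 = (cmod (g x))^2 + (cmod (h x))^2 - 2 * Re (f x)" for x
  by (simp only: cmod_power2 f_def) (simp add: psq alg)
 then have "(nrm (%x. g x - h x))^2 = (LINT x|OM. (cmod (g x))^2 + (cmod (h x))^2 - 2 * Re (f x))"
  unfolding L2norm_sq by simp
 also have "... = (nrm g)^2 + (nrm h)^2 - (LINT x|OM. 2 * Re (f x))"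
  unfolding L2norm_sq using L2_sq[OF g] L2_sq[OF h] integrable_Re[OF I]
  by (subst Bochner_Integration.integral_diff Bochner_Integration.integral_add; simp)+
 also have "(LINT x|OM. 2 * Re (f x)) = 2 * Re (LINT x|OM. f x)" using I by simp
 finally show ?thesis unfolding f_def .
qed

text \<open>Expand the square of the distance to the partial sum.\<close>

lemma bessel:
 assumes e: "trig_system e" and A: "finite A" "!!l. l : A ==> l >= 1" and g: "g : LL"
 shows "(\<Sum>l\<in>A. (cmod (ipr (e l) g))^2) <= (b - a) / 2 * (nrm g)^2"
proof -
 define c where "c l = of_real (2 / (b - a)) * ipr (e l) g" for l
 let ?h = "%x. \<Sum>k\<in>A. c k * of_real (e k x)"
 let ?S = "\<Sum>l\<in>A. (cmod (ipr (e l) g))^2"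
 have h: "?h : LL" by (rule trig_sum_L2[OF e])
 have hc: "(%x. cnj (g x)) : LL" by (rule L2_cnj(1)[OF g])
 have "(LINT x|OM. cnj (g x) * ?h x) = (LINT x|OM. (\<Sum>k\<in>A. c k * (of_real (e k x) * cnj (g x))))"
  by (simp add: sum_distrib_left mult_ac)
 also have "... = (\<Sum>k\<in>A. c k * ipr (e k) (%x. cnj (g x)))"
  using e trig_cont hc by (subst Bochner_Integration.integral_sum)
  (auto simp: ip_def intro!: integrable_mult_right L2_e_mult)
 also have "... = (\<Sum>k\<in>A. of_real (2 / (b - a) * (cmod (ipr (e k) g))^2))"
 proof (intro sum.cong refl)
  fix k assume "k : A"
  have "ipr (e k) (%x. cnj (g x)) = cnj (ipr (e k) g)"
  unfolding ip_def Bochner_Integration.integral_cnj[symmetric] by simp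
  then show "c k * ipr (e k) (%x. cnj (g x)) = of_real (2 / (b - a) * (cmod (ipr (e k) g))^2)"
  by (simp add: c_def complex_norm_square[symmetric] flip: of_real_power)
 qed
 finally have gh: "Re (LINT x|OM. cnj (g x) * ?h x) = 2 / (b - a) * ?S"
  by (simp add: sum_distrib_left)
 have "(cmod (c k))^2 = (2 / (b - a))^2 * (cmod (ipr (e k) g))^2" for k
  using ab unfolding c_def norm_mult norm_of_real pmd by simp
 then have "(\<Sum>k\<in>A. (cmod (c k))^2) = (2 / (b - a))^2 * ?S" by (simp only: sum_distrib_left)
 then have hh: "(nrm ?h)^2 = 2 / (b - a) * ?S"
  using trig_parseval_finite[OF e A, of c] ab half_length_cancel(2)[of "b - a" ?S] by simp
 have "0 <= (nrm (%x. g x - ?h x))^2" by simp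
 also have "... = (nrm g)^2 + (nrm ?h)^2 - 2 * Re (LINT x|OM. cnj (g x) * ?h x)"
  by (rule L2norm_diff_sq[OF g h])
 finally have "2 / (b - a) * ?S <= (nrm g)^2" using gh hh by simp
 then show ?thesis using ab by (simp add: field_simps)
qed

lemma sine_coeff_ip: "sc u l = of_real (2 / (b - a)) * ipr (sN l) u"
 by (simp add: sine_coeff_def ip_def sn_def sRc)

lemma bessel_sine:
 assumes "finite A" "!!l. l : A ==> l >= 1" "g : LL"
 shows "(\<Sum>l\<in>A. (cmod (sc g l))^2) <= 2 / (b - a) * (nrm g)^2"
proof -
 have "(\<Sum>l\<in>A. (cmod (sc g l))^2) = (2 / (b - a))^2 * (\<Sum>l\<in>A. (cmod (ipr (sN l) g))^2)"
  using ab unfolding sine_coeff_ip norm_mult norm_of_real pmd sum_distrib_left by simp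
 also have "... <= (2 / (b - a))^2 * ((b - a) / 2 * (nrm g)^2)"
  using bessel[OF trig_sn assms] by (intro mlm) auto
 also have "... = 2 / (b - a) * (nrm g)^2"
  using ab by (intro half_length_cancel) auto
 finally show ?thesis .
qed

end

section \<open>Test functions and weak derivatives\<close>

definition Gb :: "real => nat => real => real" where
 "Gb m i x = (if x > 0 then inverse x ^ i * exp (- (1 / (m * x))) else 0)"

lemma Gb_tendsto_0:
 assumes m: "m > 0"
 shows "(Gb m i \<longlongrightarrow> 0) (at 0)"
proof (rule filterlim_split_at)
 show "(Gb m i \<longlongrightarrow> 0) (at_left 0)"
  by (intro tendsto_eventually) (simp add: eventually_at_filter Gb_def)
 have "filterlim (%x. (1 / m) * inverse x) at_top (at_right 0)"
  by (rule filterlim_tendsto_pos_mult_at_top[OF tendsto_const _ filterlim_inverse_at_top_right]) (use m in simp)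
 then have "((%x. ((1 / m) * inverse x) ^ i / exp ((1 / m) * inverse x)) \<longlongrightarrow> 0) (at_right 0)"
  by (rule filterlim_compose[OF tendsto_power_div_exp_0])
 then have "((%x. m ^ i * (((1 / m) * inverse x) ^ i / exp ((1 / m) * inverse x))) \<longlongrightarrow> m ^ i * 0) (at_right 0)"
  by (intro tendsto_mult tendsto_const)
 moreover have "\<forall>\<^sub>F x in at_right 0. m ^ i * (((1 / m) * inverse x) ^ i / exp ((1 / m) * inverse x)) = Gb m i x"
  using m by (auto simp: eventually_at_filter Gb_def pmd power_divide exp_minus field_simps intro!: always_eventually)
 ultimately show "(Gb m i \<longlongrightarrow> 0) (at_right 0)"
  by (simp add: filterlim_cong)
qed

lemma Gb_deriv:
 assumes m: "m > 0"
 shows "(Gb m i has_real_derivative (1 / m) * Gb m (i + 2) x - real i * Gb m (i + 1) x) (at x)"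
proof -
 consider "x > 0" | "x < 0" | "x = 0" by linarith
 then show ?thesis
 proof cases
  case 1
  have P: "((%x. inverse x ^ i) has_real_derivative - real i * inverse x ^ (i + 1)) (at x)"
  proof (cases i)
  case (Suc n)
  have "((%x. inverse x ^ i) has_real_derivative real i * (- (inverse x ^ Suc (Suc 0)) * inverse x ^ (i - Suc 0))) (at x)"
  using 1 by (intro DERIV_power DERIV_inverse) auto
  then show ?thesis by (rule DERIV_cong) (simp add: Suc alg)
  qed simp
  have E: "((%x. exp (- (1 / (m * x)))) has_real_derivative exp (- (1 / (m * x))) * ((1 / m) * inverse x ^ 2)) (at x)"
  using 1 m by (auto intro!: derivative_eq_intros simp: psq field_simps)
  have "((%x. inverse x ^ i * exp (- (1 / (m * x)))) has_real_derivative
  (1 / m) * Gb m (i + 2) x - real i * Gb m (i + 1) x) (at x)"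
  by (rule DERIV_cong[OF DERIV_mult[OF P E]]) (use 1 in \<open>simp add: Gb_def power_add psq alg\<close>)
  then show ?thesis
  by (rule has_field_derivative_transform_within_open[of _ _ _ "{0<..}"]) (use 1 in \<open>auto simp: Gb_def\<close>)
 next
  case 2
  have "((%x. 0) has_real_derivative (1 / m) * Gb m (i + 2) x - real i * Gb m (i + 1) x) (at x)"
  using 2 by (simp add: Gb_def)
  then show ?thesis
  by (rule has_field_derivative_transform_within_open[of _ _ _ "{..<0}"]) (use 2 in \<open>auto simp: Gb_def\<close>)
 next
  case 3
  have "((%h. (Gb m i (0 + h) - Gb m i 0) / h) \<longlongrightarrow> 0) (at 0)"
  proof (rule Lim_transform_eventually[OF Gb_tendsto_0[OF m, of "Suc i"]])
  show "\<forall>\<^sub>F h in at 0. Gb m (Suc i) h = (Gb m i (0 + h) - Gb m i 0) / h"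
  by (simp add: eventually_at_filter Gb_def divide_inverse mult_ac)
  qed
  then show ?thesis using 3 by (simp add: DERIV_def Gb_def)
 qed
qed

lemma smooth_closed:
 assumes A: "!!g. g : A ==> \<exists>g'\<in>A. \<forall>x. (g has_real_derivative g' x) (at x)" and f: "f : A"
 shows "(deriv ^^ n) f : A" "((deriv ^^ n) f) differentiable (at x)"
proof -
 have step: "deriv g : A" "g differentiable (at x)" if g: "g : A" for g x
 proof -
  obtain g' where g': "g' : A" "!!x. (g has_real_derivative g' x) (at x)" using A[OF g] by blast
  then have "deriv g = g'" by (intro ext DERIV_imp_deriv)
  then show "deriv g : A" using g' by simp
  show "g differentiable (at x)" using g' real_differentiable_def by blast
 qed
 show *: "(deriv ^^ n) f : A" by (induction n) (auto simp: f step)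
 show "((deriv ^^ n) f) differentiable (at x)" by (rule step(2)[OF *])
qed

inductive_set bumps :: "real => real => real => (real => real) set" for c d m where
 base: "(%x. Gb m i (x - c) * Gb m j (d - x)) : bumps c d m"
| add: "f : bumps c d m ==> g : bumps c d m ==> (%x. f x + g x) : bumps c d m"
| scale: "f : bumps c d m ==> (%x. r * f x) : bumps c d m"

lemma bumps_deriv:
 assumes m: "m > 0" and f: "f : bumps c d m"
 shows "\<exists>g\<in>bumps c d m. \<forall>x. (f has_real_derivative g x) (at x)"
 using f
proof induction
 case (base i j)
 let ?B = "%i j x. Gb m i (x - c) * Gb m j (d - x)"
 let ?g = "%x. ((1 / m) * ?B (i + 2) j x + (- real i) * ?B (i + 1) j x) + ((- (1 / m)) * ?B i (j + 2) x + real j * ?B i (j + 1) x)"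
 have "?g : bumps c d m" by (intro bumps.intros)
 moreover have "((%x. ?B i j x) has_real_derivative ?g x) (at x)" for x
 proof -
  have 1: "((%x. Gb m i (x - c)) has_real_derivative ((1 / m) * Gb m (i + 2) (x - c) - real i * Gb m (i + 1) (x - c)) * 1) (at x)"
  by (rule DERIV_chain2[OF Gb_deriv[OF m]]) (auto intro!: derivative_eq_intros)
  have 2: "((%x. Gb m j (d - x)) has_real_derivative ((1 / m) * Gb m (j + 2) (d - x) - real j * Gb m (j + 1) (d - x)) * (- 1)) (at x)"
  by (rule DERIV_chain2[OF Gb_deriv[OF m]]) (auto intro!: derivative_eq_intros)
  show ?thesis using DERIV_mult[OF 1 2] by (rule back_subst[where P="%D. (_ has_real_derivative D) (at x)"]) (simp add: alg)
 qed
 ultimately show ?case by (intro bexI[of _ ?g] allI)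
next
 case (add f g)
 then obtain f' g' where "f' : bumps c d m" "g' : bumps c d m"
  "!!x. (f has_real_derivative f' x) (at x)" "!!x. (g has_real_derivative g' x) (at x)" by blast
 then show ?case by (intro bexI[of _ "%x. f' x + g' x"] allI DERIV_add bumps.add)
next
 case (scale f r)
 then obtain f' where "f' : bumps c d m" "!!x. (f has_real_derivative f' x) (at x)" by blast
 then show ?case by (intro bexI[of _ "%x. r * f' x"] allI DERIV_cmult bumps.scale)
qed

lemma test_function_bump:
 assumes m: "m > 0" and c: "a < c" and d: "d < b"
 shows "test_function a b (%x. Gb m 0 (x - c) * Gb m 0 (d - x))"
 unfolding test_function_def
proof (intro conjI allI exI)
 fix n x
 show "((deriv ^^ n) (%x. Gb m 0 (x - c) * Gb m 0 (d - x))) differentiable (at x)"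
  by (rule smooth_closed(2)[OF bumps_deriv[OF m] bumps.base])
 show "x \<notin> {c..d} --> Gb m 0 (x - c) * Gb m 0 (d - x) = 0" by (auto simp: Gb_def)
qed (use c d in auto)

lemma test_family:
 "test_function a b ph \<longleftrightarrow> (\<exists>D. D 0 = ph & (\<forall>n x. (D n has_real_derivative D (Suc n) x) (at x))) &
  (\<exists>c d. a < c & d < b & (\<forall>x. x \<notin> {c..d} --> ph x = 0))"
proof -
 have "(\<forall>n x. ((deriv ^^ n) ph) differentiable (at x)) \<longleftrightarrow>
  (\<exists>D. D 0 = ph & (\<forall>n x. (D n has_real_derivative D (Suc n) x) (at x)))" (is "?l \<longleftrightarrow> ?r")
 proof
  assume ?l
  then show ?r by (intro exI[of _ "%n. (deriv ^^ n) ph"]) (simp add: DERIV_deriv_iff_real_differentiable)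
 next
  assume ?r
  then obtain D where D: "D 0 = ph" "!!n x. (D n has_real_derivative D (Suc n) x) (at x)" by blast
  have "g : range D ==> \<exists>g'\<in>range D. \<forall>x. (g has_real_derivative g' x) (at x)" for g
  using D(2) by blast
  then show ?l using smooth_closed(2)[of "range D" ph] D(1) by blast
 qed
 then show ?thesis unfolding test_function_def by simp
qed

lemma test_function_deriv: "test_function a b ph ==> test_function a b (deriv ph)"
proof -
 assume t: "test_function a b ph"
 then obtain c d where cd: "a < c" "d < b" "!!x. x \<notin> {c..d} ==> ph x = 0" unfolding test_function_def by blast
 have "((deriv ^^ n) (deriv ph)) differentiable (at x)" for n x
  using t unfolding test_function_def by (metis comp_apply funpow_Suc_right)
 moreover have "deriv ph x = 0" if "x \<notin> {c..d}" for x
 proof -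
  have "open (- {c..d})" by auto
  then have "(ph has_real_derivative 0) (at x)"
  using that cd(3) by (intro has_field_derivative_transform_within_open[of "%_. 0" 0 x "- {c..d}" ph]) auto
  then show ?thesis by (rule DERIV_imp_deriv)
 qed
 ultimately show ?thesis using cd unfolding test_function_def by blast
qed

lemma test_function_DERIV: "test_function a b ph ==> (ph has_real_derivative deriv ph x) (at x)"
 unfolding test_function_def DERIV_deriv_iff_real_differentiable by (auto dest!: spec[of _ "0::nat"])

lemma test_function_cont: "test_function a b ph ==> continuous_on S ph"
 by (rule DERIV_continuous_on[where D="deriv ph"]) (rule has_field_derivative_at_within[OF test_function_DERIV])

lemma test_function_ends:
 assumes "test_function a b ph" "a < b" shows "ph a = 0 & ph b = 0"
proof -
 obtain c d where "a < c" "d < b" "!!x. x \<notin> {c..d} ==> ph x = 0"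
  using assms unfolding test_function_def by blast
 then show ?thesis by auto
qed

lemma sets_borel_lessThan: "sets (borel :: real measure) = sigma_sets UNIV (range (%p::real. {..<p}))"
 by (subst borel_Iio) (simp add: sets_measure_of)

lemma test_function_lincomb:
 assumes "test_function a b ph" "test_function a b et"
 shows "test_function a b (%x. ph x - s * et x)"
proof -
 obtain D E where D: "D 0 = ph" "!!n x. (D n has_real_derivative D (Suc n) x) (at x)"
  and E: "E 0 = et" "!!n x. (E n has_real_derivative E (Suc n) x) (at x)"
  using assms unfolding test_family by blast
 obtain c d where cd: "a < c" "d < b" "!!x. x \<notin> {c..d} ==> ph x = 0"
  using assms(1) unfolding test_function_def by blast
 obtain c' d' where cd': "a < c'" "d' < b" "!!x. x \<notin> {c'..d'} ==> et x = 0"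
  using assms(2) unfolding test_function_def by blast
 have sup: "ph x - s * et x = 0" if "x \<notin> {min c c'..max d d'}" for x
 proof -
  have "x \<notin> {c..d}" "x \<notin> {c'..d'}" using that by auto
  then show ?thesis using cd(3)[of x] cd'(3)[of x] by simp
 qed
 have "\<exists>D. D 0 = (%x. ph x - s * et x) & (\<forall>n x. (D n has_real_derivative D (Suc n) x) (at x))"
  by (rule exI[of _ "%n x. D n x - s * E n x"]) (auto intro!: DERIV_diff DERIV_cmult D(2) E(2) simp: D(1) E(1))
 moreover have "a < min c c' & max d d' < b" using cd cd' by simp
 ultimately show ?thesis unfolding test_family using sup by blast
qed

context seg
begin

lemma Om_integrable_bounded_cont:
 fixes ph :: "real => real" and w :: "real => complex"
 assumes "cont ph" "integrable (OM) w"
 shows "integrable (OM) (%x. ph x *\<^sub>R w x)"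
 using abs_int_cont_mult[of "%x. of_real (ph x)" w] assms
 unfolding Om_integrable_iff by (auto simp: sRc intro: continuous_intros)

lemma Om_sets: "A : sets borel ==> A \<inter> {a<..<b} : sets (OM)"
 by (subst sets_restrict_space_iff) auto

text \<open>Bump functions increase to the indicator of any subinterval, so the integral of \<open>w\<close> vanishes on
 intervals and hence, by a Dynkin argument, on all measurable sets.\<close>

lemma fundamental_lemma:
 fixes w :: "real => complex"
 assumes w: "integrable (OM) w"
  and 0: "!!ph. test_function a b ph ==> (LINT x|OM. ph x *\<^sub>R w x) = 0"
 shows "AE x in OM. w x = 0"
proof -
 interpret Om: finite_measure "OM" by (rule Om_finite)
 show ?thesis
 proof (rule Om.density_zero[OF w])
 have half: "(LINT x|OM. indicator {..<p} x *\<^sub>R w x) = 0" for p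
 proof (cases "p <= a")
  case True
  then have "(LINT x|OM. indicator {..<p} x *\<^sub>R w x) = (LINT x|OM. 0)"
  by (intro Bochner_Integration.integral_cong) (auto simp: indicator_def)
  then show ?thesis by simp
 next
  case False
  define q where "q = min p b"
  have q: "a < q" "q <= b" using False ab by (auto simp: q_def)
  define bu where "bu n x = Gb (real (Suc n)) 0 (x - (a + 1 / real (Suc n))) * Gb (real (Suc n)) 0 ((q - 1 / real (Suc n)) - x)" for n x
  have t: "test_function a b (bu n)" for n
  unfolding bu_def using q by (intro test_function_bump) (auto simp: less_le_trans[of _ q])
  have G1: "\<bar>Gb (real (Suc n)) 0 y\<bar> <= 1" for n y by (simp add: Gb_def)
  have lim1: "(%n. Gb (real (Suc n)) 0 (r - 1 / real (Suc n))) LQ 1" if r: "r > 0" for r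
  proof -
  have F: "filterlim (%n. - 1 + r * real (Suc n)) at_top sequentially"
  by (rule filterlim_tendsto_add_at_top[OF tendsto_const filterlim_tendsto_pos_mult_at_top[OF tendsto_const r
  filterlim_compose[OF filterlim_real_sequentially filterlim_Suc]]])
  have "(%n. exp (- inverse (- 1 + r * real (Suc n)))) LQ exp (- 0)"
  by (intro tendsto_exp tendsto_minus tendsto_inverse_0_at_top F)
  moreover have "\<forall>\<^sub>F n in sequentially. exp (- inverse (- 1 + r * real (Suc n))) = Gb (real (Suc n)) 0 (r - 1 / real (Suc n))"
  using F[unfolded filterlim_at_top_dense, rule_format, of 0]
  proof eventually_elim
  case (elim n)
  then have "r - 1 / real (Suc n) > 0" by (simp add: field_simps)
  moreover have "real (Suc n) * (r - 1 / real (Suc n)) = - 1 + r * real (Suc n)" by (simp add: field_simps)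
  ultimately show ?case by (simp add: Gb_def inverse_eq_divide del: of_nat_Suc)
  qed
  ultimately show ?thesis using Lim_transform_eventually by fastforce
  qed
  have "(%n. LINT x|OM. bu n x *\<^sub>R w x) LQ (LINT x|OM. indicator {..<p} x *\<^sub>R w x)"
  proof (rule integral_dominated_convergence[where w="%x. norm (w x)"])
  have wm: "w : borel_measurable (OM)" using w by auto
  show "(%x. indicat_real {..<p} x *\<^sub>R w x) : borel_measurable (OM)"
  by (rule borel_measurable_scaleR[OF measurable_restrict_space1[OF borel_measurable_indicator] wm]) auto
  show "(%x. bu n x *\<^sub>R w x) : borel_measurable (OM)" for n
  using wm Om_measurable_cont[OF test_function_cont[OF t]] by (intro borel_measurable_scaleR)
  show "integrable (OM) (%x. norm (w x))" using w by simp
  show "AE x in OM. norm (bu n x *\<^sub>R w x) <= norm (w x)" for n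
  proof (rule AE_I2)
  fix x
  have "\<bar>bu n x\<bar> <= 1 * 1" unfolding bu_def abs_mult by (intro mult_mono G1) auto
  then show "norm (bu n x *\<^sub>R w x) <= norm (w x)" by (simp add: mult_left_le_one_le)
  qed
  show "AE x in OM. (%n. bu n x *\<^sub>R w x) LQ indicat_real {..<p} x *\<^sub>R w x"
  proof (rule AE_I2)
  fix x assume "x : space (OM)"
  then have x: "a < x" "x < b" by auto
  have "(%n. bu n x) LQ indicat_real {..<p} x"
  proof (cases "x < p")
  case True
  then have xq: "x < q" using x by (simp add: q_def)
  have e: "x - (a + y) = (x - a) - y" "(q - y) - x = (q - x) - y" for y by auto
  have "(%n. bu n x) LQ 1 * 1"
  unfolding bu_def e by (intro tendsto_mult lim1) (use x xq in auto)
  then show ?thesis using True by simp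
  next
  case False
  then have "bu n x = 0" for n 
  proof -
  have "q - 1 / real (Suc n) - x <= 0" 
  using False min.cobounded1[of p b] zero_le_divide_1_iff[of "real (Suc n)"] unfolding q_def by linarith
  then show ?thesis by (simp add: bu_def Gb_def del: of_nat_Suc)
  qed
  then show ?thesis using False by simp
  qed
  then show "(%n. bu n x *\<^sub>R w x) LQ indicat_real {..<p} x *\<^sub>R w x"
  by (intro tendsto_scaleR tendsto_const)
  qed
  qed
  then show ?thesis unfolding 0[OF t] by (simp add: LIMSEQ_const_iff)
 qed
 have all: "(LINT x|OM. w x) = 0"
 proof -
  have "(LINT x|OM. w x) = (LINT x|OM. indicator {..<b} x *\<^sub>R w x)"
  by (intro Bochner_Integration.integral_cong) auto
  then show ?thesis using half by simp
 qed
 have si: "set_integrable (OM) (A \<inter> {a<..<b}) w" if "A : sets borel" for A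
  using integrable_mult_indicator[OF Om_sets[OF that] w]
  unfolding set_integrable_def by simp
 have bor: "(LINT x:(A \<inter> {a<..<b})|OM. w x) = 0" if A: "A : sets borel" for A
 proof -
  have Am: "A : sigma_sets UNIV (range (%p::real. {..<p}))"
  using A by (simp add: sets_borel_lessThan)
  have st: "Int_stable (range (%p::real. {..<p}))"
  proof -
  have "{..<p} \<inter> {..<q} = {..<min p q}" for p q :: real by auto
  then show ?thesis by (auto simp: Int_stable_def)
  qed
  have cl: "range (%p::real. {..<p}) \<subseteq> Pow UNIV" by simp
  from st cl Am show ?thesis
  proof (induction rule: sigma_sets_induct_disjoint)
  case (basic A)
  then obtain p where "A = {..<p}" by auto
  moreover have "(LINT x:({..<p} \<inter> {a<..<b})|OM. w x) = (LINT x|OM. indicator {..<p} x *\<^sub>R w x)"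
  unfolding set_lebesgue_integral_def by (intro Bochner_Integration.integral_cong) (auto simp: indicator_def)
  ultimately show ?case using half by simp
  next
  case empty then show ?case by (simp add: set_lebesgue_integral_def)
  next
  case (compl A)
  then have Ab: "A : sets borel" by (simp add: sets_borel_lessThan)
  have "(LINT x:((UNIV - A) \<inter> {a<..<b})|OM. w x) = (LINT x|OM. w x - indicator (A \<inter> {a<..<b}) x *\<^sub>R w x)"
  unfolding set_lebesgue_integral_def by (intro Bochner_Integration.integral_cong) (auto simp: indicator_def)
  also have "... = (LINT x|OM. w x) - (LINT x:(A \<inter> {a<..<b})|OM. w x)"
  using si[OF Ab] w unfolding set_lebesgue_integral_def set_integrable_def by (intro Bochner_Integration.integral_diff)
  finally show ?case using all compl by simp
  next
  case (union A)
  have Ab: "A i : sets borel" for i using union(2) by (auto simp: sets_borel_lessThan)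
  have "(LINT x:(\<Union>i. A i \<inter> {a<..<b})|OM. w x) = (\<Sum>i. (LINT x:(A i \<inter> {a<..<b})|OM. w x))"
  proof (rule lebesgue_integral_countable_add)
  show "A i \<inter> {a<..<b} : sets (OM)" for i using Om_sets[OF Ab[of i]] .
  show "i ~= j ==> A i \<inter> {a<..<b} \<inter> (A j \<inter> {a<..<b}) = {}" for i j
  using union(1) by (auto simp: disjoint_family_on_def)
  have "(\<Union>i. A i) : sets borel" using Ab by auto
  then show "set_integrable (OM) (\<Union>i. A i \<inter> {a<..<b}) w" using si[of "\<Union>i. A i"] by simp
  qed
  then show ?case using union(3) by simp
  qed
 qed
 fix A assume "A : sets (OM)"
 then obtain A' where A': "A' : sets lebesgue" "A = A' \<inter> {a<..<b}" by (auto simp: sets_restrict_space)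
 then obtain S N N' where S: "A' = S \<union> N" "N \<subseteq> N'" "N' : null_sets lborel" "S : sets lborel"
  by (auto elim: sets_completionE)
 have "AE x in lebesgue. x \<notin> N'" using S(3) by (intro AE_not_in null_sets_completionI)
 then have "AE x in OM. x \<notin> N'" by (subst AE_restrict_space_iff) auto
 then have "AE x in OM. indicat_real A x *\<^sub>R w x = indicat_real (S \<inter> {a<..<b}) x *\<^sub>R w x"
  by eventually_elim (use S A' in \<open>auto simp: indicator_def\<close>)
 moreover have "S \<inter> {a<..<b} : sets (OM)" using S(4) by (intro Om_sets) auto
 ultimately have "(LINT x:A|OM. w x) = (LINT x:(S \<inter> {a<..<b})|OM. w x)"
  unfolding set_lebesgue_integral_def using w \<open>A \<in> sets (Om a b)\<close>
  by (intro integral_cong_AE borel_measurable_scaleR borel_measurable_indicator) auto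
 then show "(LINT x:A|OM. w x) = 0" using bor S(4) by simp
 qed
qed

lemma test_function_primitive:
 assumes t: "test_function a b \<zeta>" and 0: "integral {a..b} \<zeta> = 0"
 shows "\<exists>ph. test_function a b ph & deriv ph = \<zeta>"
proof -
 obtain D where D: "D 0 = \<zeta>" "!!n x. (D n has_real_derivative D (Suc n) x) (at x)"
  using t unfolding test_family by blast
 obtain c d where cd: "a < c" "d < b" "!!x. x \<notin> {c..d} ==> \<zeta> x = 0"
  using t unfolding test_function_def by blast
 have "\<exists>F. \<forall>x::real. -\<infinity> < ereal x --> ereal x < \<infinity> --> (F hvd \<zeta> x) (at x)"
  by (intro einterval_antiderivative) (use test_function_DERIV[OF t] DERIV_isCont in auto)
 then obtain F where F: "!!x. (F has_real_derivative \<zeta> x) (at x)"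
  by (auto simp: has_real_derivative_iff_has_vector_derivative)
 have hI: "(\<zeta> has_integral (F b - F a)) {a..b}"
  using ab F by (intro fundamental_theorem_of_calculus)
  (auto simp: has_real_derivative_iff_has_vector_derivative[symmetric] intro: has_field_derivative_at_within)
 have Fab: "F b = F a" using 0 integral_unique[OF hI] by simp
 have zero1: "(F has_field_derivative 0) (at x within S)" if "x \<notin> {c..d}" for x S
  using F[of x] cd(3)[OF that] by (auto intro: has_field_derivative_at_within)
 have "\<exists>k. \<forall>x\<in>{..<c}. F x = k"
  by (intro has_field_derivative_zero_constant) (use zero1 in auto)
 then have 1: "F x = F a" if "x < c" for x using that cd(1) by auto
 have "\<exists>k. \<forall>x\<in>{d<..}. F x = k"
  by (intro has_field_derivative_zero_constant) (use zero1 in auto)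
 then have 2: "F x = F a" if "x > d" for x using that cd(2) unfolding Fab[symmetric] by auto
 let ?ph = "%x. F x - F a"
 have d: "(?ph has_real_derivative \<zeta> x) (at x)" for x using DERIV_diff[OF F DERIV_const] by simp
 then have "deriv ?ph = \<zeta>" by (intro ext DERIV_imp_deriv)
 moreover have "test_function a b ?ph"
 proof -
  have "((case n of 0 => ?ph | Suc k => D k) has_real_derivative (case Suc n of 0 => ?ph | Suc k => D k) x) (at x)" for n x
  using d D by (cases n) auto
  then have "\<exists>D. D 0 = ?ph & (\<forall>n x. (D n has_real_derivative D (Suc n) x) (at x))"
  by (intro exI[of _ "%n. case n of 0 => ?ph | Suc k => D k"]) simp
  moreover have "F x - F a = 0" if "x \<notin> {c..d}" for x using that 1[of x] 2[of x] by auto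
  ultimately show ?thesis unfolding test_family using cd(1,2) by blast
 qed
 ultimately show ?thesis by blast
qed

text \<open>A test function of mean zero is a derivative of a test function; subtracting a multiple of one of mean non-zero reduces to that case.\<close>

lemma du_bois_reymond:
 assumes u: "integrable (OM) u"
  and 0: "!!ph. test_function a b ph ==> (LINT x|OM. deriv ph x *\<^sub>R u x) = 0"
 shows "\<exists>c::complex. AE x in OM. u x = c"
proof -
 have intphi: "(LINT x|OM. ph x *\<^sub>R (c::complex)) = integral {a..b} ph *\<^sub>R c" if "test_function a b ph" for ph c
  using Om_integral_eq[OF Om_integrable_cont[OF test_function_cont[OF that]]] Om_integrable_cont[OF test_function_cont[OF that]]
  by simp
 have "\<exists>th. test_function a b th & integral {a..b} th ~= 0"
 proof (rule ccontr)
  assume "\<not> ?thesis"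
  then have "AE x in OM. (1::complex) = 0" using intphi by (intro fundamental_lemma) auto
  then have "emeasure (OM) (space (OM)) = 0" by (simp add: eventually_False ae_filter_eq_bot_iff)
  then show False using ab by (simp add: emeasure_restrict_space)
 qed
 then obtain th where th: "test_function a b th" "integral {a..b} th ~= 0" by blast
 define I where "I = integral {a..b} th"
 define K where "K = (LINT x|OM. th x *\<^sub>R u x) /\<^sub>R I"
 have "AE x in OM. u x - K = 0"
 proof (rule fundamental_lemma)
  show "integrable (OM) (%x. u x - K)" using u by simp
  fix et assume eta: "test_function a b et"
  define s where "s = integral {a..b} et / I"
  have z: "test_function a b (%x. et x - s * th x)" by (rule test_function_lincomb[OF eta th(1)])
  have "integral {a..b} (%x. et x - s * th x) = integral {a..b} et - s * I"
  using test_function_cont[OF eta] test_function_cont[OF th(1)] unfolding I_def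
  by (subst Henstock_Kurzweil_Integration.integral_diff) (auto intro!: integrable_continuous_real continuous_intros)
  then have "integral {a..b} (%x. et x - s * th x) = 0" using th(2) by (simp add: s_def I_def)
  then obtain ph where phi: "test_function a b ph" "deriv ph = (%x. et x - s * th x)"
  using test_function_primitive[OF z] by blast
  have i: "integrable (OM) (%x. et x *\<^sub>R u x)" "integrable (OM) (%x. th x *\<^sub>R u x)"
  using u eta th by (auto intro!: Om_integrable_bounded_cont test_function_cont)
  have "0 = (LINT x|OM. et x *\<^sub>R u x - s *\<^sub>R (th x *\<^sub>R u x))"
  using 0[OF phi(1)] unfolding phi(2) by (simp add: alg)
  also have "... = (LINT x|OM. et x *\<^sub>R u x) - s *\<^sub>R (LINT x|OM. th x *\<^sub>R u x)"
  using i by (subst Bochner_Integration.integral_diff) (auto simp del: scaleR_scaleR)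
  also have "(LINT x|OM. th x *\<^sub>R u x) = I *\<^sub>R K" using th(2) by (simp add: K_def I_def)
  also have "s *\<^sub>R I *\<^sub>R K = (LINT x|OM. et x *\<^sub>R K)" using intphi[OF eta] th(2) by (simp add: s_def I_def)
  finally have e: "(LINT x|OM. et x *\<^sub>R u x) - (LINT x|OM. et x *\<^sub>R K) = 0" by simp
  have "integrable (OM) (%x. et x *\<^sub>R K)"
  by (intro Om_integrable_bounded_cont test_function_cont[OF eta]) simp
  then show "(LINT x|OM. et x *\<^sub>R (u x - K)) = 0"
  using i e unfolding scaleR_diff_right by (subst Bochner_Integration.integral_diff) auto
 qed
 then have "AE x in OM. u x = K" by eventually_elim simp
 then show ?thesis by blast
qed

end

context seg
begin

lemma AE_Om_iff: "(AE x in OM. P x) \<longleftrightarrow> negligible {x : {a<..<b}. \<not> P x}"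
proof -
 have "(AE x in OM. P x) \<longleftrightarrow> (AE x in lebesgue. x : {a<..<b} --> P x)"
  by (subst AE_restrict_space_iff) auto
 also have "... \<longleftrightarrow> {x : {a<..<b}. \<not> P x} : null_sets lebesgue"
  by (subst completion.AE_iff_null_sets) (simp add: conj_commute cong: conj_cong)
 finally show ?thesis by (simp add: negligible_iff_null_sets)
qed

lemma integral_cong_AE_Om:
 fixes v v' :: "real => complex"
 assumes "AE x in OM. v x = v' x" "a <= p" "q <= b"
 shows "integral {p..q} v = integral {p..q} v'"
proof (rule integral_spike)
 show "negligible (insert a (insert b {x : {a<..<b}. \<not> v x = v' x}))"
  using assms(1) unfolding AE_Om_iff by simp
 show "v' x = v x" if "x : {p..q} - insert a (insert b {x : {a<..<b}. \<not> v x = v' x})" for x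
  using that assms by auto
qed

lemma AC_cong_AE:
 assumes "ac g v" "AE x in OM. v x = v' x" "v' absolutely_integrable_on {a..b}"
 shows "ac g v'"
 using assms integral_cong_AE_Om[OF assms(2), of a] by (auto simp: AC_def)

lemma continuous_eq_AE:
 fixes g h :: "real => complex"
 assumes g: "cont g" and h: "cont h" and e: "AE x in OM. g x = h x" and x: "x : {a..b}"
 shows "g x = h x"
proof -
 have cd: "cont (%x. g x - h x)" using g h by (intro continuous_intros)
 have "open ({a<..<b} \<inter> (%x. g x - h x) -` (- {0}))"
  by (rule continuous_open_preimage) (auto intro: cos[OF cd])
 moreover have "{a<..<b} \<inter> (%x. g x - h x) -` (- {0}) = {x : {a<..<b}. \<not> g x = h x}" by auto
 ultimately have "{x : {a<..<b}. \<not> g x = h x} = {}"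
  using e open_not_negligible unfolding AE_Om_iff by metis
 then have "g x - h x = 0" if "x : {a<..<b}" for x using that by auto
 then have "g x - h x = 0"
  using continuous_constant_on_closure[of "{a<..<b}" "%x. g x - h x" 0 x] cd x ab
  by (simp add: closure_greaterThanLessThan)
 then show ?thesis by simp
qed

text \<open>Continuous functions that agree almost everywhere agree.\<close>

lemma crep_eq:
 assumes "AE x in OM. u x = g x" "cont g" "x : {a..b}"
 shows "crp u x = g x"
proof -
 have "\<exists>g. cont g & (AE x in OM. u x = g x)" using assms by blast
 from someI_ex[OF this] have "cont (crp u) & (AE x in OM. u x = crp u x)"
  unfolding crep_def .
 then have c: "cont (crp u)" and e: "AE x in OM. u x = crp u x" by auto
 have "AE x in OM. crp u x = g x" using e assms(1) by eventually_elim simp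
 then show ?thesis using continuous_eq_AE[OF c assms(2) _ assms(3)] by blast
qed

lemma AC_L2: "ac u v ==> u : LL"
 using AC_continuous L2_cont by blast

lemma AC_integrable: "ac g v ==> integrable (OM) v"
 unfolding Om_integrable_iff by (rule AC_abs_int)

lemma AC_weak_identity:
 assumes g: "ac g v" and t: "test_function a b ph"
 shows "(LINT x|OM. deriv ph x *\<^sub>R g x) = - (LINT x|OM. ph x *\<^sub>R v x)"
proof -
 have td: "test_function a b (deriv ph)" by (rule test_function_deriv[OF t])
 have phi: "ac (%x. of_real (ph x)) (%x. of_real (deriv ph x))"
 proof (rule AC_smooth)
  show "cont (%x. cr (deriv ph x))"
  using test_function_cont[OF td] by (intro continuous_intros)
  show "((%x. cr (ph x)) hvd cr (deriv ph x)) (at x within {a..b})" for x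
  by (rule has_vector_derivative_of_real)
  (rule has_field_derivative_at_within[OF test_function_DERIV[OF t]])
 qed
 have i: "integrable (OM) (%x. deriv ph x *\<^sub>R g x)" "integrable (OM) (%x. ph x *\<^sub>R v x)"
  by (rule Om_integrable_bounded_cont[OF test_function_cont[OF td] Om_integrable_cont[OF AC_continuous[OF g]]],
  rule Om_integrable_bounded_cont[OF test_function_cont[OF t] AC_integrable[OF g]])
 have "(LINT x|OM. deriv ph x *\<^sub>R g x) = integral {a..b} (%x. g x * of_real (deriv ph x))"
  using Om_integral_eq[OF i(1)] by (simp add: sRc mult.commute)
 also have "... = - integral {a..b} (%x. of_real (ph x) * v x)"
  using AC_by_parts[OF g phi] test_function_ends[OF t ab] by simp
 also have "integral {a..b} (%x. of_real (ph x) * v x) = (LINT x|OM. ph x *\<^sub>R v x)"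
  using Om_integral_eq[OF i(2)] by (simp add: sRc)
 finally show ?thesis .
qed

lemma loc_integrable_int: "integrable (OM) u ==> loc_integrable a b u"
 unfolding loc_integrable_def
proof (intro allI impI)
 fix c d assume u: "integrable (OM) u" and cd: "a < c" "c <= d" "d < b"
 have "u absolutely_integrable_on {c..d}" by (rule abs_int_sub[OF u[unfolded Om_integrable_iff]]) (use cd in auto)
 then show "integrable (lebesgue_on {c..d}) u"
  by (simp add: set_integrable_def integrable_restrict_space)
qed

lemma AC_imp_weak: "ac g v ==> weak_deriv a b 1 g v"
proof -
 assume g: "ac g v"
 have "loc_integrable a b g" by (rule loc_integrable_int[OF Om_integrable_cont[OF AC_continuous[OF g]]])
 moreover have "loc_integrable a b v" by (rule loc_integrable_int[OF AC_integrable[OF g]])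
 ultimately show ?thesis using AC_weak_identity[OF g] unfolding weak_deriv_def by simp
qed

text \<open>The primitive of \<open>v\<close> has the same weak derivative, so it differs from \<open>u\<close> by a constant.\<close>

lemma weak_imp_AC:
 assumes u: "integrable (OM) u" and v: "integrable (OM) v" and w: "weak_deriv a b 1 u v"
 shows "\<exists>g. ac g v & (AE x in OM. u x = g x)"
proof -
 define U where "U x = integral {a..x} v" for x
 have U: "ac U v" using v unfolding Om_integrable_iff by (intro AC_I) (auto simp: U_def)
 have iU: "integrable (OM) U" by (rule Om_integrable_cont[OF AC_continuous[OF U]])
 have "\<exists>c. AE x in OM. u x - U x = c"
 proof (rule du_bois_reymond)
  show "integrable (OM) (%x. u x - U x)" using u iU by simp
  fix ph assume t: "test_function a b ph"
  have c: "cont (deriv ph)" by (rule test_function_cont[OF test_function_deriv[OF t]])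
  have "(LINT x|OM. deriv ph x *\<^sub>R u x) = (LINT x|OM. deriv ph x *\<^sub>R U x)"
  using w t AC_weak_identity[OF U t] unfolding weak_deriv_def by simp
  then show "(LINT x|OM. deriv ph x *\<^sub>R (u x - U x)) = 0"
  unfolding scaleR_diff_right using Om_integrable_bounded_cont[OF c u] Om_integrable_bounded_cont[OF c iU] by simp
 qed
 then obtain c where c: "AE x in OM. u x - U x = c" by blast
 have cc: "ac (%x. c) (%x. 0)" by (intro AC_smooth) auto
 have "ac (%x. U x + c) v" using AC_add[OF U cc] by simp
 moreover have "AE x in OM. u x = U x + c" using c by eventually_elim (simp add: alg)
 ultimately show ?thesis by blast
qed

lemma weak_deriv_step:
 assumes "weak_deriv a b j u v" "weak_deriv a b (Suc j) u w"
 shows "weak_deriv a b 1 v w"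
 unfolding weak_deriv_def
proof (intro conjI allI impI)
 show "loc_integrable a b v" "loc_integrable a b w" using assms unfolding weak_deriv_def by auto
 fix ph assume t: "test_function a b ph"
 have 1: "(LINT x|OM. (deriv ^^ j) (deriv ph) x *\<^sub>R u x) = (- 1) ^ j * (LINT x|OM. deriv ph x *\<^sub>R v x)"
  using assms(1) test_function_deriv[OF t] unfolding weak_deriv_def by blast
 have 2: "(LINT x|OM. (deriv ^^ Suc j) ph x *\<^sub>R u x) = (- 1) ^ Suc j * (LINT x|OM. ph x *\<^sub>R w x)"
  using assms(2) t unfolding weak_deriv_def by blast
 have "(deriv ^^ Suc j) ph = (deriv ^^ j) (deriv ph)" by (simp add: funpow_swap1)
 with 1 2 have "(- 1) ^ j * (LINT x|OM. deriv ph x *\<^sub>R v x) = (- 1) ^ j * (- (LINT x|OM. ph x *\<^sub>R w x))" by simp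
 moreover have "(- 1 :: complex) ^ j ~= 0" by simp
 ultimately have "(LINT x|OM. deriv ph x *\<^sub>R v x) = - (LINT x|OM. ph x *\<^sub>R w x)"
  unfolding mult_cancel_left by blast
 then show "(LINT x|OM. (deriv ^^ 1) ph x *\<^sub>R v x) = (- 1) ^ 1 * (LINT x|OM. ph x *\<^sub>R w x)"
  by simp
qed

lemma weak_deriv_AE_cong:
 assumes w: "weak_deriv a b j u v" and u: "u : borel_measurable (OM)" and g: "integrable (OM) g"
  and e: "AE x in OM. u x = g x"
 shows "weak_deriv a b j g v"
 unfolding weak_deriv_def
proof (intro conjI allI impI)
 show "loc_integrable a b g" using g by (rule loc_integrable_int)
 show "loc_integrable a b v" using w by (simp add: weak_deriv_def)
 fix ph assume t: "test_function a b ph"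
 have "test_function a b ((deriv ^^ j) ph)" by (induction j) (auto simp: t test_function_deriv)
 then have m: "(deriv ^^ j) ph : borel_measurable (OM)" by (intro Om_measurable_cont test_function_cont)
 have "(LINT x|OM. (deriv ^^ j) ph x *\<^sub>R g x) = (LINT x|OM. (deriv ^^ j) ph x *\<^sub>R u x)"
  using e m u g by (intro integral_cong_AE borel_measurable_scaleR) auto
 then show "(LINT x|OM. (deriv ^^ j) ph x *\<^sub>R g x) = (- 1) ^ j * (LINT x|OM. ph x *\<^sub>R v x)"
  using w t unfolding weak_deriv_def by simp
qed

lemma LINT_subinterval:
 fixes v :: "real => complex"
 assumes cd: "a <= c" "d <= b" and 0: "!!x. x \<notin> {c<..<d} ==> ph x = 0"
 shows "(LINT x|OM. ph x *\<^sub>R v x) = (LINT x|Om c d. ph x *\<^sub>R v x)"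
proof -
 have "indicat_real {a<..<b} x *\<^sub>R (ph x *\<^sub>R v x) = indicat_real {c<..<d} x *\<^sub>R (ph x *\<^sub>R v x)" for x
  using 0[of x] cd by (auto simp: indicator_def)
 moreover have "(LINT x|OM. ph x *\<^sub>R v x) = (LINT x|lebesgue. indicat_real {a<..<b} x *\<^sub>R (ph x *\<^sub>R v x))"
  by (rule integral_restrict_space) simp
 moreover have "(LINT x|Om c d. ph x *\<^sub>R v x) = (LINT x|lebesgue. indicat_real {c<..<d} x *\<^sub>R (ph x *\<^sub>R v x))"
  by (rule integral_restrict_space) simp
 ultimately show ?thesis by presburger
qed

lemma weak_deriv_unique:
 assumes w: "weak_deriv a b j u v" "weak_deriv a b j u v'"
 shows "AE x in OM. v x = v' x"
proof -
 define c where "c n = a + (b - a) / real (n + 3)" for n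
 define d where "d n = b - (b - a) / real (n + 3)" for n
 have cd: "a < c n" "c n < d n" "d n < b" for n
 proof -
  define e where "e = (b - a) / real (n + 3)"
  have "e < (b - a) / 2" unfolding e_def by (rule divide_strict_left_mono) (use ab in auto)
  moreover have "e > 0" unfolding e_def using ab by simp
  ultimately show "a < c n" "c n < d n" "d n < b" unfolding c_def d_def e_def[symmetric] by (auto simp: field_simps)
 qed
 have "AE x in lebesgue. x : {c n<..<d n} --> v x = v' x" for n
 proof -
  interpret s: seg "c n" "d n" by standard (rule cd)
  have li: "loc_integrable a b v" "loc_integrable a b v'" using w by (auto simp: weak_deriv_def)
  have i: "integrable (Om (c n) (d n)) v" "integrable (Om (c n) (d n)) v'"
  using li[unfolded loc_integrable_def, rule_format, of "c n" "d n"] cd[of n]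
  unfolding s.Om_integrable_iff by (auto simp: set_integrable_def integrable_restrict_space)
  have "AE x in Om (c n) (d n). v x - v' x = 0"
  proof (rule s.fundamental_lemma)
  show "integrable (Om (c n) (d n)) (%x. v x - v' x)" using i by simp
  fix ph assume t: "test_function (c n) (d n) ph"
  obtain p q where pq: "c n < p" "q < d n" "!!x. x \<notin> {p..q} ==> ph x = 0" using t unfolding test_function_def by blast
  then have z: "x \<notin> {c n<..<d n} ==> ph x = 0" for x by force
  have t2: "test_function a b ph" 
  proof -
  have "a < p" "q < b" using pq cd[of n] by auto
  then show ?thesis using t pq(3) unfolding test_function_def by blast
  qed
  have "(- 1) ^ j * (LINT x|OM. ph x *\<^sub>R v x) = (- 1) ^ j * (LINT x|OM. ph x *\<^sub>R v' x)"
  using w[unfolded weak_deriv_def] t2 by simp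
  then have "(LINT x|OM. ph x *\<^sub>R v x) = (LINT x|OM. ph x *\<^sub>R v' x)" by simp
  moreover have "(LINT x|OM. ph x *\<^sub>R w x) = (LINT x|Om (c n) (d n). ph x *\<^sub>R w x)" for w :: "real => complex"
  by (rule LINT_subinterval) (use cd[of n] z in auto)
  ultimately have "(LINT x|Om (c n) (d n). ph x *\<^sub>R v x) = (LINT x|Om (c n) (d n). ph x *\<^sub>R v' x)"
  by simp
  then show "(LINT x|Om (c n) (d n). ph x *\<^sub>R (v x - v' x)) = 0"
  unfolding scaleR_diff_right
  using s.Om_integrable_bounded_cont[OF test_function_cont[OF t] i(1)] s.Om_integrable_bounded_cont[OF test_function_cont[OF t] i(2)]
  by simp
  qed
  then show ?thesis by (subst (asm) AE_restrict_space_iff) auto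
 qed
 then have "AE x in lebesgue. \<forall>n. x : {c n<..<d n} --> v x = v' x" unfolding AE_all_countable by blast
 then have "AE x in lebesgue. x : {a<..<b} --> v x = v' x"
 proof eventually_elim
  case (elim x)
  show ?case
  proof
  assume x: "x : {a<..<b}"
  define M where "M = min (x - a) (b - x)"
  have m: "M > 0" "M <= x - a" "M <= b - x" using x by (auto simp: M_def)
  obtain n :: nat where n: "(b - a) / M < real n" using reals_Archimedean2 by blast
  have "b - a < real n * M" using n m(1) by (simp add: pos_divide_less_eq)
  also have "... <= M * real (n + 3)" using m by (simp add: mult.commute)
  finally have "(b - a) / real (n + 3) < M" by (subst pos_divide_less_eq) auto
  then have "(b - a) / real (n + 3) < x - a" "(b - a) / real (n + 3) < b - x" using m by auto
  then have "x : {c n<..<d n}" unfolding c_def d_def by auto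
  then show "v x = v' x" using elim by blast
  qed
 qed
 then show ?thesis by (subst AE_restrict_space_iff) auto
qed

lemma Om_measurable_AE:
 fixes u v :: "real => complex"
 assumes u: "u : borel_measurable (OM)" and e: "AE x in OM. u x = v x"
 shows "v : borel_measurable (OM)"
proof -
 have 1: "(%x. indicator {a<..<b} x *\<^sub>R u x) : borel_measurable lebesgue"
  using u by (subst (asm) borel_measurable_restrict_space_iff) auto
 have "AE x in lebesgue. indicat_real {a<..<b} x *\<^sub>R u x = indicat_real {a<..<b} x *\<^sub>R v x"
  using e by (subst (asm) AE_restrict_space_iff) (auto elim!: eventually_mono simp: indicator_def)
 then have "(%x. indicator {a<..<b} x *\<^sub>R v x) : borel_measurable lebesgue" by (rule borel_measurable_AE[OF 1])
 then show ?thesis by (subst borel_measurable_restrict_space_iff) auto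
qed

text \<open>Weak derivatives are unique up to null sets, so any one that is at hand may replace the choice made by the definition.\<close>

lemma Dx_eq:
 assumes w: "weak_deriv a b j u v" and v: "v : LL"
 shows "weak_deriv a b j u (dX j u)" "AE x in OM. dX j u x = v x" "dX j u : LL"
  "nrm (dX j u) = nrm v"
proof -
 show 1: "weak_deriv a b j u (dX j u)" unfolding Dx_def by (rule someI[of _ v]) (rule w)
 show 2: "AE x in OM. dX j u x = v x" by (rule weak_deriv_unique[OF 1 w])
 have 3: "AE x in OM. v x = dX j u x" using 2 by eventually_elim simp
 show "dX j u : LL" "nrm (dX j u) = nrm v"
  using L2_cong_AE[OF v 3 Om_measurable_AE[OF L2_meas[OF v] 3]] by auto
qed

lemma weak_deriv_0: "u : LL ==> weak_deriv a b 0 u u"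
 unfolding weak_deriv_def using loc_integrable_int[OF L2_int] by auto

lemma Hnorm_ge:
 assumes "j <= m" shows "nrm (dX j u) <= hN m u"
proof -
 have "(nrm (dX j u))^2 <= (\<Sum>j\<le>m. (nrm (dX j u))^2)"
  using assms by (intro member_le_sum) auto
 then show ?thesis unfolding Hnorm_def by (rule real_le_rsqrt)
qed

text \<open>Each weak derivative is a primitive of the next, so continuous representatives can be chosen
 successively from the top.\<close>

lemma Hspace_AC:
 assumes u: "u : hS m"
 shows "\<exists>U. (\<forall>j<m. ac (U j) (U (Suc j))) &
  (\<forall>j\<le>m. U j : LL & (AE x in OM. dX j u x = U j x) & nrm (U j) = nrm (dX j u)) &
  (AE x in OM. u x = U 0 x)"
proof -
 have uL: "u : LL" using u by (simp add: Hspace_def)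
 have "\<forall>j. \<exists>v. j <= m --> v : LL & weak_deriv a b j u v" using u unfolding Hspace_def by blast
 then obtain V where V: "!!j. j <= m ==> V j : LL" "!!j. j <= m ==> weak_deriv a b j u (V j)" by metis
 have "\<forall>j. \<exists>g. j < m --> ac g (V (Suc j)) & (AE x in OM. V j x = g x)"
 proof
  fix j
  show "\<exists>g. j < m --> ac g (V (Suc j)) & (AE x in OM. V j x = g x)"
  proof (cases "j < m")
  case True
  have "weak_deriv a b 1 (V j) (V (Suc j))" using V(2)[of j] V(2)[of "Suc j"] True by (intro weak_deriv_step) auto
  then show ?thesis using weak_imp_AC[of "V j" "V (Suc j)"] V(1)[of j] V(1)[of "Suc j"] L2_int True by auto
  qed auto
 qed
 then obtain g where g: "!!j. j < m ==> ac (g j) (V (Suc j))" "!!j. j < m ==> AE x in OM. V j x = g j x" by metis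
 define U where "U j = (if j < m then g j else V j)" for j
 have VU: "AE x in OM. V j x = U j x" if "j <= m" for j using g(2) by (auto simp: U_def)
 have UL: "U j : LL" if "j <= m" for j using that V(1)[of j] AC_L2[OF g(1)[of j]] by (auto simp: U_def)
 have 1: "ac (U j) (U (Suc j))" if j: "j < m" for j
  using AC_cong_AE[OF g(1)[OF j] VU[of "Suc j"]] L2_int[OF UL[of "Suc j"]] j unfolding Om_integrable_iff by (simp add: U_def)
 have 2: "AE x in OM. dX j u x = U j x" "nrm (U j) = nrm (dX j u)" if j: "j <= m" for j
 proof -
  show "AE x in OM. dX j u x = U j x"
  using Dx_eq(2)[OF V(2)[OF j] V(1)[OF j]] VU[OF j] by eventually_elim simp
  show "nrm (U j) = nrm (dX j u)"
  using Dx_eq(4)[OF V(2)[OF j] V(1)[OF j]] L2_cong_AE(2)[OF V(1)[OF j] VU[OF j] L2_meas[OF UL[OF j]]] by simp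
 qed
 have "AE x in OM. V 0 x = u x" using weak_deriv_unique[OF V(2)[of 0] weak_deriv_0[OF uL]] by simp
 then have "AE x in OM. u x = U 0 x" using VU[of 0] by (auto elim: eventually_elim2)
 then show ?thesis using 1 2 UL by blast
qed

end

section \<open>Sobolev regularity with parity\<close>

text \<open>\<open>reg a b m True B u\<close>: the function \<open>u\<close> and its even derivatives of order below \<open>m\<close> vanish at both
 end points, as for an odd periodic extension; with \<open>False\<close> the odd derivatives do. A derivative
 changes the parity and a product behaves as for odd and even functions, so membership in the scale of
 odd functions is stable under odd nonlinearities.\<close>

primrec reg :: "real => real => nat => bool => real => (real => complex) => bool" where
 "reg a b 0 p B u \<longleftrightarrow> u : L2space a b & L2norm a b u <= B"
| "reg a b (Suc m) p B u \<longleftrightarrow> (\<exists>v. AC a b u v & (\<forall>x\<in>{a..b}. cmod (u x) <= B) &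
  (p --> u a = 0 & u b = 0) & reg a b m (\<not> p) B v)"

context seg
begin
abbreviation rg where "rg == reg a b"

lemma reg_SucI:
 "ac u v ==> (!!x. x : {a..b} ==> cmod (u x) <= B) ==> (p ==> u a = 0 & u b = 0) ==> rg m (\<not> p) B v
  ==> rg (Suc m) p B u"
 by auto

lemma reg_SucE:
 assumes "rg (Suc m) p B u"
 obtains v where "ac u v" "!!x. x : {a..b} ==> cmod (u x) <= B" "p ==> u a = 0 & u b = 0" "rg m (\<not> p) B v"
 using assms by auto

lemma reg_L2: "rg m p B u ==> u : LL"
 by (cases m) (auto intro: AC_L2)

lemma reg_mono: "rg m p B u ==> B <= C ==> rg m p C u"
proof (induction m arbitrary: p u)
 case 0 then show ?case by auto
next
 case (Suc m)
 from Suc.prems(1) obtain v where v: "ac u v" "!!x. x : {a..b} ==> cmod (u x) <= B" "p ==> u a = 0 & u b = 0" "rg m (\<not> p) B v"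
  by (rule reg_SucE) blast
 show ?case
  by (rule reg_SucI[OF v(1) order_trans[OF v(2) Suc.prems(2)] v(3) Suc.IH[OF v(4) Suc.prems(2)]])
qed

lemma reg_nonneg: "rg m p B u ==> B >= 0"
proof (cases m)
 case 0
 assume "rg m p B u"
 then have "nrm u <= B" using 0 by simp
 with L2norm_nonneg[of a b u] show "B >= 0" by linarith
next
 case (Suc n)
 assume "rg m p B u"
 then have "cmod (u a) <= B" using Suc ab by auto
 with norm_ge_zero[of "u a"] show "B >= 0" by linarith
qed

lemma reg_continuous: "rg (Suc m) p B u ==> cont u"
 using AC_continuous by auto

lemma reg_sup: "rg (Suc m) p B u ==> x : {a..b} ==> cmod (u x) <= B"
 by auto

declare reg.simps(2) [simp del]

lemma reg_drop: "rg (Suc m) p B u ==> rg m p (B * (1 + sqrt (b - a))) u"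
proof (induction m arbitrary: p u)
 case 0
 have B: "B >= 0" using reg_nonneg[OF 0] .
 have c: "cont u" using reg_continuous[OF 0] .
 have "nrm u <= B * sqrt (b - a)"
  using reg_sup[OF 0] by (intro L2_bounded(2) Om_measurable_cont c) auto
 also have "... <= B * (1 + sqrt (b - a))" using B by (intro mlm) auto
 finally show ?case using L2_cont[OF c] by simp
next
 case (Suc m)
 have B: "B >= 0" using reg_nonneg[OF Suc.prems] .
 have le: "B <= B * (1 + sqrt (b - a))" using B ab mlm[of 1 "1 + sqrt (b - a)" B] by simp
 from Suc.prems obtain v where v: "ac u v" "!!x. x : {a..b} ==> cmod (u x) <= B" "p ==> u a = 0 & u b = 0" "rg (Suc m) (\<not> p) B v"
  by (rule reg_SucE) blast
 show ?case by (rule reg_SucI[OF v(1) order_trans[OF v(2) le] v(3) Suc.IH[OF v(4)]])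
qed

lemma reg_add: "rg m p B u ==> rg m p C v ==> rg m p (B + C) (%x. u x + v x)"
proof (induction m arbitrary: p u v)
 case 0
 then show ?case using L2_add[of u v] by (auto intro: order_trans)
next
 case (Suc m)
 from Suc.prems(1) obtain u' where u: "ac u u'" "!!x. x : {a..b} ==> cmod (u x) <= B" "p ==> u a = 0 & u b = 0" "rg m (\<not> p) B u'"
  by (rule reg_SucE) blast
 from Suc.prems(2) obtain v' where v: "ac v v'" "!!x. x : {a..b} ==> cmod (v x) <= C" "p ==> v a = 0 & v b = 0" "rg m (\<not> p) C v'"
  by (rule reg_SucE) blast
 show ?case
  by (rule reg_SucI[OF AC_add[OF u(1) v(1)] _ _ Suc.IH[OF u(4) v(4)]])
  (use norm_triangle_mono[OF u(2) v(2)] u(3) v(3) in auto)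
qed

lemma reg_cmult: "rg m p B u ==> rg m p (cmod c * B) (%x. c * u x)"
proof (induction m arbitrary: p u)
 case 0
 have "nrm (%x. c * u x) <= cmod c * nrm u" using 0 L2_cmult(2)[of u c] by simp
 also have "... <= cmod c * B" using 0 by (intro mlm) auto
 finally show ?case using 0 L2_cmult(1)[of u c] by simp
next
 case (Suc m)
 from Suc.prems(1) obtain u' where u: "ac u u'" "!!x. x : {a..b} ==> cmod (u x) <= B" "p ==> u a = 0 & u b = 0" "rg m (\<not> p) B u'"
  by (rule reg_SucE) blast
 show ?case
  by (rule reg_SucI[OF AC_cmult[OF u(1)] _ _ Suc.IH[OF u(4)]])
  (use u(2,3) in \<open>auto simp: norm_mult mlm\<close>)
qed

lemma reg_diff: "rg m p B u ==> rg m p C v ==> rg m p (B + C) (%x. u x - v x)"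
 using reg_add[of m p B u C "%x. - 1 * v x"] reg_cmult[of m p C v "-1"] by simp

lemma reg_cnj: "rg m p B u ==> rg m p B (%x. cnj (u x))"
proof (induction m arbitrary: p u)
 case 0 then show ?case using L2_cnj[of u] by simp
next
 case (Suc m)
 from Suc.prems(1) obtain u' where u: "ac u u'" "!!x. x : {a..b} ==> cmod (u x) <= B" "p ==> u a = 0 & u b = 0" "rg m (\<not> p) B u'"
  by (rule reg_SucE) blast
 show ?case
  by (rule reg_SucI[OF AC_cnj[OF u(1)] _ _ Suc.IH[OF u(4)]]) (use u(2,3) in auto)
qed

lemma reg_mult_step:
 assumes u: "rg (Suc m) p B u" and v: "rg (Suc m) q B v"
  and C: "!!p q u v. rg m p B u ==> rg (Suc m) q B v ==> rg m (p ~= q) C (%x. u x * v x)"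
 shows "rg (Suc m) (p ~= q) (max (B * B) (C + C)) (%x. u x * v x)"
proof -
 from u obtain u' where u': "ac u u'" "!!x. x : {a..b} ==> cmod (u x) <= B" "p ==> u a = 0 & u b = 0" "rg m (\<not> p) B u'"
  by (rule reg_SucE) blast
 from v obtain v' where v': "ac v v'" "!!x. x : {a..b} ==> cmod (v x) <= B" "q ==> v a = 0 & v b = 0" "rg m (\<not> q) B v'"
  by (rule reg_SucE) blast
 have par: "((\<not> q) ~= p) = (\<not> (p ~= q))" "((\<not> p) ~= q) = (\<not> (p ~= q))" by auto
 have 1: "rg m (\<not> (p ~= q)) C (%x. v' x * u x)" using C[OF v'(4) u] unfolding par .
 have 2: "rg m (\<not> (p ~= q)) C (%x. u' x * v x)" using C[OF u'(4) v] unfolding par .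
 have 3: "rg m (\<not> (p ~= q)) (max (B * B) (C + C)) (%x. u x * v' x + v x * u' x)"
  using reg_mono[OF reg_add[OF 1 2], of "max (B * B) (C + C)"] by (simp add: mult.commute)
 have B: "B >= 0" by (rule reg_nonneg[OF u])
 show ?thesis
 proof (rule reg_SucI[OF AC_mult[OF u'(1) v'(1)] _ _ 3])
  fix x assume x: "x : {a..b}"
  have "cmod (u x * v x) <= B * B" unfolding norm_mult using u'(2)[OF x] v'(2)[OF x] B by (intro mult_mono) auto
  then show "cmod (u x * v x) <= max (B * B) (C + C)" by simp
 qed (use u'(3) v'(3) in auto)
qed

text \<open>The first statement, where one factor has one derivative more, is the inductive engine: it covers
 the terms of the product rule.\<close>

lemma reg_mult_aux:
 "(\<forall>B. \<exists>C. \<forall>p q u v. rg m p B u --> rg (Suc m) q B v --> rg m (p ~= q) C (%x. u x * v x)) &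
  (\<forall>B. \<exists>C. \<forall>p q u v. rg (Suc m) p B u --> rg (Suc m) q B v --> rg (Suc m) (p ~= q) C (%x. u x * v x))"
proof (induction m)
 case 0
 have A: "\<exists>C. \<forall>p q u v. rg 0 p B u --> rg (Suc 0) q B v --> rg 0 (p ~= q) C (%x. u x * v x)" for B
 proof (intro exI allI impI)
  fix p q u v assume u: "rg 0 p B u" and v: "rg (Suc 0) q B v"
  have uL: "u : LL" "nrm u <= B" using u by auto
  have vb: "cmod (v x) <= B" if "x : {a<..<b}" for x using reg_sup[OF v, of x] that by simp
  have *: "(%x. v x * u x) : LL" "nrm (%x. v x * u x) <= B * nrm u"
  by (rule L2_bounded_mult[OF uL(1) Om_measurable_cont[OF reg_continuous[OF v]] vb], assumption)+
  have "B * nrm u <= B * B" using uL reg_nonneg[OF v] by (intro mlm) auto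
  then show "rg 0 (p ~= q) (B * B) (%x. u x * v x)" using * by (simp add: mult.commute)
 qed
 have "\<exists>C. \<forall>p q u v. rg (Suc 0) p B u --> rg (Suc 0) q B v --> rg (Suc 0) (p ~= q) C (%x. u x * v x)" for B
 proof -
  obtain C where C: "!!p q u v. rg 0 p B u ==> rg (Suc 0) q B v ==> rg 0 (p ~= q) C (%x. u x * v x)"
  using A[of B] by blast
  show ?thesis by (intro exI[of _ "max (B * B) (C + C)"] allI impI reg_mult_step C)
 qed
 then show ?case using A by blast
next
 case (Suc m)
 have A: "\<exists>C. \<forall>p q u v. rg (Suc m) p B u --> rg (Suc (Suc m)) q B v --> rg (Suc m) (p ~= q) C (%x. u x * v x)" for B
 proof -
  define B' where "B' = B * (1 + sqrt (b - a))"
  obtain C where C: "!!p q u v. rg (Suc m) p B' u ==> rg (Suc m) q B' v ==> rg (Suc m) (p ~= q) C (%x. u x * v x)"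
  using Suc.IH by meson
  show ?thesis
  proof (intro exI allI impI)
  fix p q u v assume u: "rg (Suc m) p B u" and v: "rg (Suc (Suc m)) q B v"
  have "B <= B'" using reg_nonneg[OF u] ab mlm[of 1 "1 + sqrt (b - a)" B] by (simp add: B'_def)
  then show "rg (Suc m) (p ~= q) C (%x. u x * v x)"
  using C[OF reg_mono[OF u]] reg_drop[OF v] unfolding B'_def by blast
  qed
 qed
 have "\<exists>C. \<forall>p q u v. rg (Suc (Suc m)) p B u --> rg (Suc (Suc m)) q B v --> rg (Suc (Suc m)) (p ~= q) C (%x. u x * v x)" for B
 proof -
  obtain C where C: "!!p q u v. rg (Suc m) p B u ==> rg (Suc (Suc m)) q B v ==> rg (Suc m) (p ~= q) C (%x. u x * v x)"
  using A[of B] by blast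
  show ?thesis by (intro exI[of _ "max (B * B) (C + C)"] allI impI reg_mult_step C)
 qed
 then show ?case using A by blast
qed

lemma reg_mult:
 "\<exists>C. \<forall>p q u v. rg (Suc m) p B u --> rg (Suc m) q B' v --> rg (Suc m) (p ~= q) C (%x. u x * v x)"
proof -
 obtain C where C: "!!p q u v. rg (Suc m) p (max B B') u ==> rg (Suc m) q (max B B') v ==> rg (Suc m) (p ~= q) C (%x. u x * v x)"
  using reg_mult_aux by meson
 have "rg (Suc m) (p ~= q) C (%x. u x * v x)" if "rg (Suc m) p B u" "rg (Suc m) q B' v" for p q u v
  by (rule C[OF reg_mono[OF that(1)] reg_mono[OF that(2)]]) auto
 then show ?thesis by blast
qed

definition Ck_family :: "nat => (nat => real => real) => bool" where
 "Ck_family k D \<longleftrightarrow> (\<forall>j<k. \<forall>s\<ge>0. (D j has_real_derivative D (Suc j) s) (at s within {0..})) &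
  (\<forall>j\<le>k. continuous_on {0..} (D j))"

lemma Ck_family_bounded:
 assumes "Ck_family k D" "j <= k"
 shows "\<exists>R. \<forall>s. 0 <= s --> s <= B --> \<bar>D j s\<bar> <= R"
proof -
 have "continuous_on {0..B} (D j)"
  using assms unfolding Ck_family_def by (auto intro: cos)
 then have "bounded (D j ` {0..B})" by (intro compact_imp_bounded compact_continuous_image) auto
 then obtain R where "\<forall>y\<in>D j ` {0..B}. norm y <= R" unfolding bounded_iff by blast
 then show ?thesis by (intro exI[of _ R]) auto
qed

text \<open>Induction on the order: the derivative \<open>f'(s) s'\<close> is a product of functions already treated.\<close>

lemma reg_chain:
 assumes D: "Ck_family k D" and "j + Suc m <= k"
 shows "\<exists>C. \<forall>s. (\<forall>x\<in>{a..b}. s x >= 0) --> rg (Suc m) False B (%x. of_real (s x))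
  --> rg (Suc m) False C (%x. of_real (D j (s x)))"
 using assms(2)
proof (induction m arbitrary: j B)
 case 0
 obtain R0 where R0: "!!s. 0 <= s ==> s <= B ==> \<bar>D j s\<bar> <= R0" using Ck_family_bounded[OF D, of j B] 0 by auto
 obtain R1 where R1: "!!s. 0 <= s ==> s <= B ==> \<bar>D (Suc j) s\<bar> <= R1" using Ck_family_bounded[OF D, of "Suc j" B] 0 by auto
 show ?case
 proof (intro exI allI impI)
  fix s assume s: "\<forall>x\<in>{a..b}. s x >= 0" and r: "rg (Suc 0) False B (%x. of_real (s x))"
  from r obtain v where v: "ac (%x. of_real (s x)) v" "!!x. x : {a..b} ==> cmod (of_real (s x)) <= B" "rg 0 True B v"
  by (rule reg_SucE) auto
  have sb: "0 <= s x" "s x <= B" if "x : {a..b}" for x using s v(2)[OF that] that by auto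
  have vL: "v : LL" "nrm v <= B" using v(3) by auto
  have d: "ac (%x. of_real (D j (s x))) (%x. of_real (D (Suc j) (s x)) * v x)"
  by (rule AC_chain[OF v(1)]) (use s D 0 in \<open>auto simp: Ck_family_def\<close>)
  have cs: "cont s" using continuous_on_Re[OF AC_continuous[OF v(1)]] by simp
  have "cont (%x. D (Suc j) (s x))"
  by (rule continuous_on_compose2[OF _ cs]) (use s D 0 in \<open>auto simp: Ck_family_def\<close>)
  then have m: "(%x. cr (D (Suc j) (s x))) : borel_measurable (OM)"
  by (intro Om_measurable_cont continuous_intros)
  have b: "cmod (of_real (D (Suc j) (s x))) <= R1" if "x : {a<..<b}" for x using R1 sb[of x] that by simp
  have "R1 * nrm v <= R1 * B" using vL R1[OF sb, of a] ab by (intro mlm) auto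
  with L2_bounded_mult[OF vL(1) m b] 
  have "rg 0 (\<not> False) (max R0 (R1 * B)) (%x. of_real (D (Suc j) (s x)) * v x)" by simp
  then show "rg (Suc 0) False (max R0 (R1 * B)) (%x. of_real (D j (s x)))"
  using R0 sb by (intro reg_SucI[OF d]) (auto simp: le_max_iff_disj)
 qed
next
 case (Suc m)
 define B' where "B' = B * (1 + sqrt (b - a))"
 obtain C1 where C1: "!!s. (\<forall>x\<in>{a..b}. s x >= 0) ==> rg (Suc m) False B' (%x. of_real (s x))
  ==> rg (Suc m) False C1 (%x. of_real (D (Suc j) (s x)))"
  using Suc.IH[of "Suc j" B'] Suc.prems by auto
 obtain C2 where C2: "!!p q u v. rg (Suc m) p C1 u ==> rg (Suc m) q B v ==> rg (Suc m) (p ~= q) C2 (%x. u x * v x)"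
  using reg_mult[of m C1 B] by blast
 obtain R0 where R0: "!!s. 0 <= s ==> s <= B ==> \<bar>D j s\<bar> <= R0" using Ck_family_bounded[OF D, of j B] Suc.prems by auto
 show ?case
 proof (intro exI allI impI)
  fix s assume s: "\<forall>x\<in>{a..b}. s x >= 0" and r: "rg (Suc (Suc m)) False B (%x. of_real (s x))"
  from r obtain v where v: "ac (%x. of_real (s x)) v" "!!x. x : {a..b} ==> cmod (of_real (s x)) <= B" "rg (Suc m) True B v"
  by (rule reg_SucE) auto
  have sb: "0 <= s x" "s x <= B" if "x : {a..b}" for x using s v(2)[OF that] that by auto
  have d: "ac (%x. of_real (D j (s x))) (%x. of_real (D (Suc j) (s x)) * v x)"
  by (rule AC_chain[OF v(1)]) (use s D Suc.prems in \<open>auto simp: Ck_family_def\<close>)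
  have "rg (Suc m) (False ~= True) C2 (%x. of_real (D (Suc j) (s x)) * v x)"
  by (rule C2[OF C1[OF s] v(3)]) (use reg_drop[OF r] in \<open>simp add: B'_def\<close>)
  then have "rg (Suc m) (\<not> False) (max R0 C2) (%x. of_real (D (Suc j) (s x)) * v x)"
  using reg_mono by fastforce
  then show "rg (Suc (Suc m)) False (max R0 C2) (%x. of_real (D j (s x)))"
  using R0 sb by (intro reg_SucI[OF d]) (auto simp: le_max_iff_disj)
 qed
qed

lemma reg_modulus:
 "\<exists>C. \<forall>p u. rg (Suc m) p B u --> rg (Suc m) False C (%x. of_real ((cmod (u x))^2))"
proof -
 obtain C where C: "!!p q u v. rg (Suc m) p B u ==> rg (Suc m) q B v ==> rg (Suc m) (p ~= q) C (%x. u x * v x)"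
  using reg_mult[of m B B] by blast
 show ?thesis
 proof (intro exI allI impI)
  fix p u assume u: "rg (Suc m) p B u"
  have "of_real ((cmod (u x))^2) = u x * cnj (u x)" for x by (rule complex_norm_square)
  then show "rg (Suc m) False C (%x. of_real ((cmod (u x))^2))" using C[OF u reg_cnj[OF u]] by simp
 qed
qed

lemma reg_chain_modulus:
 assumes D: "Ck_family k D" and j: "j + Suc m <= k"
 shows "\<exists>C. \<forall>p u. rg (Suc m) p B u --> rg (Suc m) False C (%x. of_real (D j ((cmod (u x))^2)))"
proof -
 obtain C1 where C1: "!!p u. rg (Suc m) p B u ==> rg (Suc m) False C1 (%x. of_real ((cmod (u x))^2))"
  using reg_modulus[of m B] by blast
 obtain C where C: "!!s. (\<forall>x\<in>{a..b}. s x >= 0) ==> rg (Suc m) False C1 (%x. of_real (s x))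
  ==> rg (Suc m) False C (%x. of_real (D j (s x)))"
  using reg_chain[OF D j, of C1] by auto
 have "rg (Suc m) False C (%x. of_real (D j ((cmod (u x))^2)))" if "rg (Suc m) p B u" for p u
  by (rule C[OF _ C1[OF that]]) simp
 then show ?thesis by blast
qed

text \<open>\<open>|u|\<^sup>2\<close> and hence \<open>f(|u|\<^sup>2)\<close> are even, so the product with \<open>u\<close> keeps the parity of \<open>u\<close>: the nonlinearity respects the boundary conditions of every order.\<close>

lemma reg_Fnl:
 assumes D: "Ck_family k D" "D 0 = f" and m: "Suc m <= k"
 shows "\<exists>C. \<forall>p u. rg (Suc m) p B u --> rg (Suc m) p C (%x. Fnl f (u x))"
proof -
 obtain C1 where C1: "!!p u. rg (Suc m) p B u ==> rg (Suc m) False C1 (%x. of_real (D 0 ((cmod (u x))^2)))"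
  using reg_chain_modulus[OF D(1), of 0 m B] m by auto
 obtain C where C: "!!p q u v. rg (Suc m) p C1 u ==> rg (Suc m) q B v ==> rg (Suc m) (p ~= q) C (%x. u x * v x)"
  using reg_mult[of m C1 B] by blast
 show ?thesis
 proof (intro exI allI impI)
  fix p u assume u: "rg (Suc m) p B u"
  show "rg (Suc m) p C (%x. Fnl f (u x))"
  using C[OF C1[OF u] u] by (simp add: Fnl_def D(2) sRc)
 qed
qed

lemma ip_cn_deriv:
 assumes u: "ac u v"
 shows "ipr (cN l) v = (- 1) ^ l * u b - u a + fq l * ipr (sN l) u"
proof -
 have e: "ac (%x. of_real (cN l x)) (%x. of_real (- fq l * sN l x))"
  by (rule AC_smooth) (auto simp: cn_def sn_def intro!: has_vector_derivative_of_real derivative_eq_intros continuous_intros)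
 have i: "integrable (OM) (%x. of_real (cN l x) * v x)"
  using abs_int_cont_mult[OF AC_continuous[OF e] AC_abs_int[OF u]] unfolding Om_integrable_iff .
 have i2: "integrable (OM) (%x. of_real (sN l x) * u x)"
  by (intro Om_integrable_cont continuous_intros AC_continuous[OF u])
 have "ipr (cN l) v = integral {a..b} (%x. of_real (cN l x) * v x)"
  unfolding ip_def by (rule Om_integral_eq[OF i])
 also have "... = of_real (cN l b) * u b - of_real (cN l a) * u a - integral {a..b} (%x. u x * of_real (- fq l * sN l x))"
  by (rule AC_by_parts[OF e u])
 also have "integral {a..b} (%x. u x * of_real (- fq l * sN l x)) = - of_real (fq l) * integral {a..b} (%x. of_real (sN l x) * u x)"
  by (subst integral_mult_right[symmetric]) (simp add: mult_ac)
 also have "integral {a..b} (%x. of_real (sN l x) * u x) = ipr (sN l) u"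
  unfolding ip_def by (rule Om_integral_eq[OF i2, symmetric])
 finally show ?thesis by (simp add: cn_ends)
qed

lemma ip_sn_deriv:
 assumes u: "ac u v"
 shows "ipr (sN l) v = - fq l * ipr (cN l) u"
proof -
 have e: "ac (%x. of_real (sN l x)) (%x. of_real (fq l * cN l x))"
  by (rule AC_smooth) (auto simp: cn_def sn_def intro!: has_vector_derivative_of_real derivative_eq_intros continuous_intros)
 have i: "integrable (OM) (%x. of_real (sN l x) * v x)"
  using abs_int_cont_mult[OF AC_continuous[OF e] AC_abs_int[OF u]] unfolding Om_integrable_iff .
 have i2: "integrable (OM) (%x. of_real (cN l x) * u x)"
  by (intro Om_integrable_cont continuous_intros AC_continuous[OF u])
 have "ipr (sN l) v = integral {a..b} (%x. of_real (sN l x) * v x)"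
  unfolding ip_def by (rule Om_integral_eq[OF i])
 also have "... = of_real (sN l b) * u b - of_real (sN l a) * u a - integral {a..b} (%x. u x * of_real (fq l * cN l x))"
  by (rule AC_by_parts[OF e u])
 also have "integral {a..b} (%x. u x * of_real (fq l * cN l x)) = of_real (fq l) * integral {a..b} (%x. of_real (cN l x) * u x)"
  by (subst integral_mult_right[symmetric]) (simp add: mult_ac)
 also have "integral {a..b} (%x. of_real (cN l x) * u x) = ipr (cN l) u"
  unfolding ip_def by (rule Om_integral_eq[OF i2, symmetric])
 finally show ?thesis by (simp add: sn_ends)
qed

text \<open>Integrate by parts \<open>m\<close> times; parity is exactly what makes the boundary terms vanish, sines and cosines alternating.\<close>

lemma reg_ip:
 "rg m p B u ==> \<exists>w e. w : LL & nrm w <= B & trig_system e &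
  (\<forall>l\<ge>1. fq l ^ m * cmod (ipr (if p then sN l else cN l) u) = cmod (ipr (e l) w))"
proof (induction m arbitrary: p u)
 case 0
 show ?case
 proof (intro exI[of _ u] exI[of _ "%l. if p then sN l else cN l"] conjI)
  show "trig_system (%l. if p then sN l else cN l)" using trig_sn trig_cn by (cases p) auto
 qed (use 0 in auto)
next
 case (Suc m)
 from Suc.prems obtain v where v: "ac u v" "!!x. x : {a..b} ==> cmod (u x) <= B" "p ==> u a = 0 & u b = 0" "rg m (\<not> p) B v"
  by (rule reg_SucE) blast
 from Suc.IH[OF v(4)] obtain w e where w: "w : LL" "nrm w <= B" "trig_system e"
  "!!l. l >= 1 ==> fq l ^ m * cmod (ipr (if \<not> p then sN l else cN l) v) = cmod (ipr (e l) w)" by blast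
 have "fq l ^ Suc m * cmod (ipr (if p then sN l else cN l) u) = cmod (ipr (e l) w)" if l: "l >= 1" for l
 proof -
  have "cmod (ipr (if \<not> p then sN l else cN l) v) = fq l * cmod (ipr (if p then sN l else cN l) u)"
  using ip_cn_deriv[OF v(1), of l] ip_sn_deriv[OF v(1), of l] v(3) mu_nonneg[of l]
  by (cases p) (auto simp: norm_mult)
  then show ?thesis using w(4)[OF l] by (cases p) (simp_all add: mult_ac)
 qed
 then show ?case using w by blast
qed

lemma reg_sine_bound:
 assumes u: "rg m True B u" and A: "finite A" "!!l. l : A ==> l >= 1"
 shows "(\<Sum>l\<in>A. (fq l ^ m * cmod (sc u l))^2) <= 2 / (b - a) * B^2"
proof -
 obtain w e where w: "w : LL" "nrm w <= B" "trig_system e"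
  "!!l. l >= 1 ==> fq l ^ m * cmod (ipr (sN l) u) = cmod (ipr (e l) w)"
  using reg_ip[OF u] by auto
 have "(\<Sum>l\<in>A. (fq l ^ m * cmod (sc u l))^2) = (\<Sum>l\<in>A. (2 / (b - a))^2 * (cmod (ipr (e l) w))^2)"
 proof (rule sum.cong[OF refl])
  fix l assume "l : A"
  then have "fq l ^ m * cmod (sc u l) = 2 / (b - a) * cmod (ipr (e l) w)"
  using w(4)[of l] A ab unfolding sine_coeff_ip norm_mult norm_of_real by simp
  then show "(fq l ^ m * cmod (sc u l))^2 = (2 / (b - a))^2 * (cmod (ipr (e l) w))^2"
  by (simp only: pmd)
 qed
 also have "... <= (2 / (b - a))^2 * ((b - a) / 2 * (nrm w)^2)"
  unfolding sum_distrib_left[symmetric] using bessel[OF w(3) A w(1)] by (intro mlm) auto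
 also have "... = 2 / (b - a) * (nrm w)^2" using ab by (intro half_length_cancel) auto
 also have "... <= 2 / (b - a) * B^2" using w(2) ab by (intro mlm power_mono) auto
 finally show ?thesis .
qed

lemma reg_of_seq:
 "(!!j. j < m ==> ac (U j) (U (Suc j))) ==> (!!j x. j < m ==> x : {a..b} ==> cmod (U j x) <= B) ==>
  U m : LL ==> nrm (U m) <= B ==>
  (!!j. j < m ==> even j = p ==> U j a = 0 & U j b = 0) ==> rg m p B (U 0)"
proof (induction m arbitrary: U p)
 case 0 then show ?case by simp
next
 case (Suc m)
 have "rg m (\<not> p) B (U (Suc 0))"
  by (rule Suc.IH[of "%j. U (Suc j)"]) (use Suc.prems in auto)
 then show ?case
  by (rule reg_SucI[rotated 3]) (use Suc.prems(1)[of 0] Suc.prems(2)[of 0] Suc.prems(5)[of 0] in auto)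
qed

lemma AC_sup_bound:
 assumes u: "ac u v" and v: "v : LL" and x: "x : {a..b}"
 shows "cmod (u x) <= (1 / sqrt (b - a) + sqrt (b - a)) * (nrm u + nrm v)"
proof -
 define s where "s = sqrt (b - a)"
 have s: "s > 0" "s * s = b - a" using ab by (auto simp: s_def)
 have one: "(%_. 1) : LL" by (intro L2_cont) auto
 have one_n: "nrm (%_. 1) <= s" using L2_bounded(2)[of "%_. 1" 1] by (simp add: s_def)
 have L1: "(LINT y|OM. cmod (w y)) <= s * nrm w" if "w : LL" for w
 proof -
  have "(LINT y|OM. cmod (w y)) <= nrm w * nrm (%_. 1)" using L2_cauchy_schwarz_norm[OF that one] by simp
  also have "... <= nrm w * s" using one_n by (intro mlm) auto
  finally show ?thesis by (simp add: mult.commute)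
 qed
 have inc: "cmod (u q - u p) <= s * nrm v" if "a <= p" "p <= q" "q <= b" for p q
 proof -
  have ni: "(%x. cmod (v x)) absolutely_integrable_on {a..b}" using L2_int[OF v] unfolding Om_integrable_iff[symmetric] by simp
  have "cmod (u q - u p) <= integral {p..q} (%x. cmod (v x))"
  unfolding AC_diff[OF u that] by (rule norm_integral_le[OF AC_abs_int[OF u] ni that(1,3)]) simp
  also have "... <= integral {a..b} (%x. cmod (v x))"
  using that int_sub[OF ni] by (intro integral_subset_le) auto
  also have "... = (LINT y|OM. cmod (v y))" using L2_int[OF v] by (intro Om_integral_eq[symmetric]) simp
  finally show ?thesis using L1[OF v] by linarith
 qed
 have le: "cmod (u x) <= cmod (u y) + s * nrm v" if "y : {a<..<b}" for y
 proof (cases "x <= y")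
  case True then show ?thesis using inc[of x y] x that norm_triangle_ineq2[of "u x" "u y"] norm_minus_commute[of "u x" "u y"] by auto
 next
  case False then show ?thesis using inc[of y x] x that norm_triangle_ineq2[of "u x" "u y"] by auto
 qed
 have cu: "cont u" by (rule AC_continuous[OF u])
 have vol: "(LINT y|OM. c) = (b - a) * c" for c :: real
  using Om_integral_eq[OF Om_const[of c]] ab by simp
 have M: "Sigma_Algebra.measure (OM) {a<..<b} = b - a" using vol[of 1] by simp
 have "(LINT y|OM. cmod (u x)) <= (LINT y|OM. cmod (u y) + s * nrm v)"
  using le Om_integrable_cont[OF cu] by (intro integral_mono) auto
 then have "(s * s) * cmod (u x) <= s * nrm u + (s * s) * (s * nrm v)"
  using L1[OF AC_L2[OF u]] Om_integrable_cont[OF cu] s(2) by (simp add: M)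
 then have "s * (s * cmod (u x)) <= s * (nrm u + (s * s) * nrm v)" by (simp add: alg)
 then have "s * cmod (u x) <= nrm u + (s * s) * nrm v" by (simp only: mult_le_cancel_left_pos[OF s(1)])
 then have "cmod (u x) <= (nrm u + (s * s) * nrm v) / s" using s(1) by (simp add: pos_le_divide_eq mult.commute)
 also have "... = 1 / s * nrm u + s * nrm v" using s by (simp add: field_simps)
 also have "... <= (1 / s + s) * (nrm u + nrm v)" using s by (simp add: alg)
 finally show ?thesis by (simp add: s_def)
qed

end

section \<open>Sine series\<close>

lemma sum_inverse_squares: "(\<Sum>l=1..n. 1 / (real l)^2) <= 2"
proof (cases "n >= 1")
 case True
 then have "(\<Sum>l=1..n. 1 / (real l)^2) <= 2 - 1 / real n"
 proof (induction n rule: nat_induct_at_least)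
  case (Suc n)
  have "1 / (real (Suc n))^2 <= 1 / (real n * real (Suc n))"
  using Suc.hyps by (intro divide_left_mono) (auto simp: psq)
  also have "... = 1 / real n - 1 / real (Suc n)" using Suc.hyps by (simp add: field_simps)
  finally show ?case using Suc.IH Suc.hyps by simp
 qed simp
 also have "... <= 2" by simp
 finally show ?thesis .
qed simp

lemma sums_bounded_nonneg:
 fixes f :: "nat => real"
 assumes "!!i. 0 <= f i" "!!n. (\<Sum>i<n. f i) <= C"
 shows "summable f" "suminf f <= C"
proof -
 show s: "summable f" using assms by (rule summableI_nonneg_bounded)
 show "suminf f <= C" using suminf_le_const[OF s] assms(2) by blast
qed

context seg
begin

lemma sn_mult_cn: 
 assumes l: "l >= 1"
 shows "sN l x * cN 1 x = (sN (Suc l) x + sN (l - 1) x) / 2"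
proof -
 have e: "fq l * (x - a) + fq 1 * (x - a) = fq (Suc l) * (x - a)"
  "fq l * (x - a) - fq 1 * (x - a) = fq (l - 1) * (x - a)"
  using l ab by (simp_all add: mu_def alg add_divide_distrib diff_divide_distrib of_nat_diff)
 show ?thesis unfolding sn_def cn_def sin_times_cos e ..
qed

text \<open>Sines are \<open>sin th\<close> times polynomials in \<open>cos th\<close>, and by Weierstrass such polynomials
 approximate every continuous function of \<open>th \<in> [0, pi]\<close>.\<close>

lemma sine_complete_real:
 fixes g :: "real => real"
 assumes g: "cont g" and 0: "!!l. l >= 1 ==> integral {a..b} (%x. sN l x * g x) = 0"
  and x: "x : {a..b}"
 shows "g x = 0"
proof -
 let ?c = "cN 1"
 have pw: "integral {a..b} (%x. sN l x * (?c x ^ n * g x)) = 0" for n l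
 proof (induction n arbitrary: l)
  case 0
  then show ?case using assms(2)[of l] by (cases "l = 0") (auto simp: sn_def mu_def)
 next
  case (Suc n)
  have I: "(%x. sN l x * (?c x ^ n * g x)) integrable_on {a..b}" for l
  by (intro integrable_continuous_real continuous_intros g)
  show ?case
  proof (cases "l = 0")
  case True then show ?thesis by (simp add: sn_def mu_def)
  next
  case False
  then have l: "l >= 1" by simp
  have "(%x. sN l x * (?c x ^ Suc n * g x)) =
  (%x. 1/2 * (sN (Suc l) x * (?c x ^ n * g x) + sN (l - 1) x * (?c x ^ n * g x)))"
  proof
  fix x
  have "sN l x * (?c x ^ Suc n * g x) = (sN l x * ?c x) * (?c x ^ n * g x)" by simp
  then show "sN l x * (?c x ^ Suc n * g x) = 1/2 * (sN (Suc l) x * (?c x ^ n * g x) + sN (l - 1) x * (?c x ^ n * g x))"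
  unfolding sn_mult_cn[OF l] by (simp add: alg)
  qed
  then show ?thesis using Suc.IH
  by (simp only: integral_mult_right Henstock_Kurzweil_Integration.integral_add[OF I I]) simp
  qed
 qed
 define q where "q y = g (a + (b - a) / pi * arccos y)" for y
 have rng: "a + (b - a) / pi * arccos y : {a..b}" if "y : {-1..1}" for y
 proof -
  have "0 <= arccos y" "arccos y <= pi" using that arccos_lbound arccos_ubound by auto
  then have "0 <= (b - a) / pi * arccos y" "(b - a) / pi * arccos y <= (b - a) / pi * pi"
  using ab by (auto intro!: mlm mnn simp del: times_divide_eq_left)
  moreover have "(b - a) / pi * pi = b - a" by simp
  ultimately show ?thesis unfolding atLeastAtMost_iff by linarith
 qed
 have cq: "continuous_on {-1..1} q" unfolding q_def
  by (rule continuous_on_compose2[OF g]) (use rng in \<open>auto intro!: continuous_intros\<close>)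
 have gq: "g x = q (?c x)" if "x : {a..b}" for x
 proof -
  have "0 <= pi * (x - a) / (b - a)" "pi * (x - a) / (b - a) <= pi"
  using that ab by (auto simp: pos_divide_le_eq)
  then have "arccos (?c x) = pi * (x - a) / (b - a)" by (simp add: cn_def mu_def arccos_cos)
  then show ?thesis using ab by (simp add: q_def)
 qed
 have "bounded ((%x. sN 1 x * g x) ` {a..b})"
  by (intro compact_imp_bounded compact_continuous_image continuous_intros g) auto
 then obtain K where "\<forall>y\<in>(%x. sN 1 x * g x) ` {a..b}. norm y <= K" unfolding bounded_iff by blast
 then have K: "!!x. x : {a..b} ==> \<bar>sN 1 x * g x\<bar> <= K" by simp
 have K0: "K >= 0" using K[of a] ab by force
 define J where "J = integral {a..b} (%x. sN 1 x * (g x * g x))"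
 have J: "\<bar>J\<bar> <= e * (K * (b - a))" if e: "e > 0" for e
 proof -
  obtain p where p: "real_polynomial_function p" "!!y. y : {-1..1} ==> \<bar>q y - p y\<bar> < e"
  using Stone_Weierstrass_real_polynomial_function[OF _ cq e] by auto
  obtain c n where pc: "p = (%y. \<Sum>i\<le>n. c i * y ^ i)" using p(1) unfolding real_polynomial_function_iff_sum by blast
  have cp: "cont (%x. p (?c x))" unfolding pc by (intro continuous_intros)
  have "integral {a..b} (%x. sN 1 x * (p (?c x) * g x)) = integral {a..b} (%x. \<Sum>i\<le>n. c i * (sN 1 x * (?c x ^ i * g x)))"
  by (simp add: pc sum_distrib_left sum_distrib_right mult_ac)
  also have "... = (\<Sum>i\<le>n. c i * integral {a..b} (%x. sN 1 x * (?c x ^ i * g x)))"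
  by (subst integral_sum) (auto intro!: integrable_continuous_real continuous_intros g)
  also have "... = 0" by (simp only: pw) simp
  finally have z: "integral {a..b} (%x. sN 1 x * (p (?c x) * g x)) = 0" .
  have "J = integral {a..b} (%x. sN 1 x * (g x * g x)) - integral {a..b} (%x. sN 1 x * (p (?c x) * g x))"
  unfolding J_def z by simp
  also have "... = integral {a..b} (%x. sN 1 x * (g x * g x) - sN 1 x * (p (?c x) * g x))"
  by (intro Henstock_Kurzweil_Integration.integral_diff[symmetric] integrable_continuous_real continuous_intros g cp)
  finally have "norm J = norm (integral (cbox a b) (%x. sN 1 x * (g x * g x) - sN 1 x * (p (?c x) * g x)))" by simp
  also have "... <= (e * K) * Sigma_Algebra.measure lborel (cbox a b)"
  proof (rule integrable_bound)
  show "0 <= e * K" using e K0 by simp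
  show "(%x. sN 1 x * (g x * g x) - sN 1 x * (p (?c x) * g x)) integrable_on cbox a b"
  unfolding cbox_interval by (intro integrable_continuous_real continuous_intros g cp)
  fix x assume "x : cbox a b"
  then have x: "x : {a..b}" by simp
  have "?c x : {-1..1}" by (simp add: cn_def)
  then have "\<bar>g x - p (?c x)\<bar> <= e" using p(2)[of "?c x"] gq[OF x] by simp
  then have "\<bar>g x - p (?c x)\<bar> * \<bar>sN 1 x * g x\<bar> <= e * K" using K[OF x] e by (intro mult_mono) auto
  moreover have "sN 1 x * (g x * g x) - sN 1 x * (p (?c x) * g x) = (g x - p (?c x)) * (sN 1 x * g x)"
  by (simp add: alg)
  ultimately show "norm (sN 1 x * (g x * g x) - sN 1 x * (p (?c x) * g x)) <= e * K"
  by (simp only: real_norm_def abs_mult)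
  qed
  finally show ?thesis using ab by (simp add: mult.assoc)
 qed
 have "\<bar>J\<bar> <= 0"
 proof (rule field_le_epsilon)
  fix e :: real assume e: "e > 0"
  define D where "D = K * (b - a) + 1"
  have D: "D > 0" "K * (b - a) <= D" using K0 ab by (auto simp: D_def add_nonneg_pos)
  have "\<bar>J\<bar> <= e / D * (K * (b - a))" using e D by (intro J) auto
  also have "... <= e / D * D" using e D by (intro mlm) auto
  finally show "\<bar>J\<bar> <= 0 + e" using D by simp
 qed
 then have J0: "J = 0" by simp
 have snpos: "sN 1 x > 0" if "x : {a<..<b}" for x
 proof -
  have "0 < pi * (x - a) / (b - a)" "pi * (x - a) / (b - a) < pi"
  using that ab by (auto simp: pos_divide_less_eq)
  then show ?thesis by (simp add: sn_def mu_def sin_gt_zero)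
 qed
 have sg: "sN 1 y * (g y * g y) = 0" if "y : {a<..<b}" for y
 proof (rule has_integral_0_cbox_imp_0[where f="%x. sN 1 x * (g x * g x)"])
  have c: "cont (%x. sN 1 x * (g x * g x))" by (intro continuous_intros g)
  then show "continuous_on (cbox a b) (%x. sN 1 x * (g x * g x))" by simp
  show "((%x. sN 1 x * (g x * g x)) has_integral 0) (cbox a b)"
  using integrable_integral[OF integrable_continuous_real[OF c]] J0 by (simp add: J_def)
  show "0 <= sN 1 x * (g x * g x)" if "x : box a b" for x
  by (intro mnn less_imp_le[OF snpos] zero_le_square) (use that in auto)
 qed (use that ab in auto)
 have "g y = 0" if "y : {a<..<b}" for y using snpos[OF that] sg[OF that] by simp
 then show ?thesis
  using continuous_constant_on_closure[of "{a<..<b}" g 0 x] g x ab by (simp add: closure_greaterThanLessThan)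
qed

lemma sine_complete:
 assumes u: "cont u" and 0: "!!l. l >= 1 ==> sc u l = 0" and x: "x : {a..b}"
 shows "u x = 0"
proof -
 have i: "integrable (OM) (%x. of_real (sN l x) * u x)" for l
  by (intro Om_integrable_cont continuous_intros u)
 have z: "integral {a..b} (%x. of_real (sN l x) * u x) = 0" if "l >= 1" for l
  using 0[OF that] Om_integral_eq[OF i[of l]] ab unfolding sine_coeff_ip ip_def by simp
 have zi: "((%x. of_real (sN l x) * u x) has_integral 0) {a..b}" if "l >= 1" for l
 proof -
  have "cont (%x. of_real (sN l x) * u x)" by (intro continuous_intros u)
  from integrable_integral[OF integrable_continuous_real[OF this]] show ?thesis unfolding z[OF that] .
 qed
 have "Re (u x) = 0"
 proof (rule sine_complete_real[OF _ _ x])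
  show "cont (%x. Re (u x))" using u by (intro continuous_intros)
  show "integral {a..b} (%x. sN l x * Re (u x)) = 0" if "l >= 1" for l
  using has_integral_Re[OF zi[OF that]] by (simp add: integral_unique)
 qed
 moreover have "Im (u x) = 0"
 proof (rule sine_complete_real[OF _ _ x])
  show "cont (%x. Im (u x))" using u by (intro continuous_intros)
  show "integral {a..b} (%x. sN l x * Im (u x)) = 0" if "l >= 1" for l
  using has_integral_Im[OF zi[OF that]] by (simp add: integral_unique)
 qed
 ultimately show ?thesis by (simp add: complex_eq_iff)
qed

lemma sine_coeff_bound:
 assumes g: "g : LL" and l: "l >= 1"
 shows "cmod (sc g l) <= sqrt (2 / (b - a)) * nrm g"
proof -
 have "(cmod (sc g l))^2 <= 2 / (b - a) * (nrm g)^2"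
  using bessel_sine[of "{l}" g] l g by simp
 then have "cmod (sc g l) <= sqrt (2 / (b - a) * (nrm g)^2)" by (rule real_le_rsqrt)
 then show ?thesis by (simp only: real_sqrt_mult real_sqrt_abs abs_of_nonneg L2norm_nonneg)
qed

lemma sine_coeff_diff: "u : LL ==> v : LL ==>
  sc (%x. u x - v x) l = sc u l - sc v l"
 unfolding sine_coeff_ip by (subst ip_diff) (auto intro: continuous_intros simp: alg)

lemma sine_coeff_add: "u : LL ==> v : LL ==>
  sc (%x. u x + v x) l = sc u l + sc v l"
 unfolding sine_coeff_ip by (subst ip_add) (auto intro: continuous_intros simp: alg)

lemma sine_coeff_cmult: "sc (%x. c * u x) l = c * sc u l"
 unfolding sine_coeff_ip ip_cmult by simp

lemma sine_coeff_cong_AE: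
 assumes "AE x in OM. u x = v x" "u : borel_measurable (OM)"
 shows "sc u l = sc v l"
 unfolding sine_coeff_ip using ip_cong_AE[OF assms Om_measurable_AE[OF assms(2,1)] cont_sn] by simp

definition psum :: "(nat => complex) => nat => real => complex" where
 "psum c n x = (\<Sum>l\<in>{1..n}. c l * of_real (sN l x))"

lemma psum_cont: "continuous_on S (psum c n)"
 unfolding psum_def by (intro continuous_intros)

lemma sine_coeff_psum: "l >= 1 ==> sc (psum c n) l = (if l <= n then c l else 0)"
 using ip_trig_sum[OF trig_sn, of "{1..n}" l c] ab unfolding sine_coeff_ip psum_def by auto

lemma L2norm_psum: "(nrm (psum c n))^2 = (b - a) / 2 * (\<Sum>l\<in>{1..n}. (cmod (c l))^2)"
 unfolding psum_def by (rule trig_parseval_finite[OF trig_sn]) auto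

text \<open>The series converges uniformly to some continuous function with the same coefficients as \<open>u\<close>, and completeness identifies the two.\<close>

lemma sine_series_uniform:
 assumes u: "cont u" and s: "summable (%l. cmod (sc u (Suc l)))"
 shows "uniform_limit {a..b} (psum (sc u)) u sequentially"
proof -
 let ?c = "sc u"
 define S where "S x = (\<Sum>l. ?c (Suc l) * of_real (sN (Suc l) x))" for x
 have ps: "psum ?c n x = (\<Sum>l<n. ?c (Suc l) * of_real (sN (Suc l) x))" for n x
  unfolding psum_def by (simp add: sum.atLeast1_atMost_eq)
 have ul: "uniform_limit {a..b} (psum ?c) S sequentially"
 proof -
  have "uniform_limit {a..b} (%n x. \<Sum>l<n. ?c (Suc l) * of_real (sN (Suc l) x)) S sequentially"
  unfolding S_def 
  proof (rule Weierstrass_m_test[OF _ s])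
  show "norm (?c (Suc n) * of_real (sN (Suc n) x)) <= cmod (?c (Suc n))" for n x
  by (simp add: norm_mult sn_def mult_left_le)
  qed
  then show ?thesis by (simp add: ps[abs_def])
 qed
 have cS: "cont S"
  by (rule uniform_limit_theorem[OF _ ul]) (simp_all add: psum_cont)
 have coeff: "sc S l = ?c l" if l: "l >= 1" for l
 proof -
  have "norm (sc S l - ?c l) <= 0"
  proof (rule field_le_epsilon)
  fix e :: real assume e: "e > 0"
  define d where "d = e / (sqrt (2 / (b - a)) * sqrt (b - a) + 1)"
  have d: "d > 0" "sqrt (2 / (b - a)) * (d * sqrt (b - a)) <= e"
  using e ab by (auto simp: d_def field_simps add_nonneg_pos)
  obtain N where N: "!!n x. n >= N ==> x : {a..b} ==> dist (psum ?c n x) (S x) < d"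
  using ul d(1) unfolding uniform_limit_sequentially_iff by blast
  define n where "n = max N l"
  have L: "S : LL" "psum ?c n : LL" using cS psum_cont L2_cont by auto
  have ln: "l <= n" and nN: "n >= N" by (auto simp: n_def)
  have Lb: "nrm (%x. S x - psum ?c n x) <= d * sqrt (b - a)"
  using N[OF nN] by (intro L2_bounded(2) Om_measurable_cont continuous_intros cS psum_cont)
  (auto simp: dist_norm norm_minus_commute less_imp_le)
  have "sc S l - ?c l = sc (%x. S x - psum ?c n x) l"
  using sine_coeff_diff[OF L, of l] sine_coeff_psum[OF l, of ?c n] ln by simp
  also have "cmod ... <= sqrt (2 / (b - a)) * nrm (%x. S x - psum ?c n x)"
  by (rule sine_coeff_bound[OF L2_diff(1)[OF L] l])
  also have "... <= sqrt (2 / (b - a)) * (d * sqrt (b - a))" using Lb ab by (intro mlm) auto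
  finally show "norm (sc S l - ?c l) <= 0 + e" using d(2) by linarith
  qed
  then show ?thesis by simp
 qed
 have "u x = S x" if "x : {a..b}" for x
 proof -
  have "u x - S x = 0"
  by (rule sine_complete[OF _ _ that]) (auto simp: sine_coeff_diff L2_cont u cS coeff intro: continuous_intros u cS)
  then show ?thesis by simp
 qed
 then show ?thesis using ul uniform_limit_cong'[of "{a..b}" "psum ?c" "psum ?c" S u sequentially] by auto
qed

text \<open>Cauchy-Schwarz against \<open>1 / l\<close>, whose squares sum to at most \<open>2\<close>.\<close>

lemma weighted_summable:
 assumes K: "!!n. (\<Sum>l=1..n. (fq l * cmod (c l))^2) <= K^2" and K0: "K >= 0"
 shows "summable (%l. cmod (c (Suc l)))" "(\<Sum>l=1..n. cmod (c l)) <= (b - a) * K"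
proof -
 have fin: "(\<Sum>l=1..n. cmod (c l)) <= (b - a) * K" for n
 proof -
  have "(\<Sum>l=1..n. cmod (c l)) = (\<Sum>l=1..n. \<bar>1 / fq l\<bar> * \<bar>fq l * cmod (c l)\<bar>)"
  proof (rule sum.cong[OF refl])
  fix l assume "l : {1..n}"
  then have "fq l > 0" by (intro mu_pos) auto
  then show "cmod (c l) = \<bar>1 / fq l\<bar> * \<bar>fq l * cmod (c l)\<bar>" by (simp add: abs_mult)
  qed
  also have "... <= L2_set (%l. 1 / fq l) {1..n} * L2_set (%l. fq l * cmod (c l)) {1..n}"
  by (rule L2_set_mult_ineq)
  also have "... <= (b - a) * K"
  proof (rule mult_mono)
  have "(\<Sum>l=1..n. (1 / fq l)^2) = ((b - a) / pi)^2 * (\<Sum>l=1..n. 1 / (real l)^2)"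
  by (simp add: mu_def sum_distrib_left power_divide pmd)
  also have "... <= ((b - a) / pi)^2 * 2" by (intro mlm sum_inverse_squares) auto
  also have "... = (b - a)^2 * (2 / pi^2)" by (simp add: power_divide)
  also have "... <= (b - a)^2 * 1"
  proof (intro mlm)
  have "2 * 2 <= pi * pi" using pi_ge_two by (intro mult_mono) auto
  then show "2 / pi^2 <= 1" by (simp add: psq)
  qed auto
  finally have "(\<Sum>l=1..n. (1 / fq l)^2) <= (b - a)^2" by simp
  then show "L2_set (%l. 1 / fq l) {1..n} <= b - a"
  unfolding L2_set_def using ab by (intro real_le_lsqrt sum_nonneg) auto
  show "L2_set (%l. fq l * cmod (c l)) {1..n} <= K"
  unfolding L2_set_def using K[of n] K0 by (intro real_le_lsqrt sum_nonneg) auto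
  qed (use ab in \<open>auto simp: L2_set_nonneg\<close>)
  finally show ?thesis .
 qed
 then show "(\<Sum>l=1..n. cmod (c l)) <= (b - a) * K" .
 show "summable (%l. cmod (c (Suc l)))"
  by (rule sums_bounded_nonneg(1)[of _ "(b - a) * K"]) (use fin in \<open>simp_all add: sum.atLeast1_atMost_eq\<close>)
qed

lemma sine_sup_bound:
 assumes u: "cont u" and K: "!!n. (\<Sum>l=1..n. (fq l * cmod (sc u l))^2) <= K^2" and K0: "K >= 0"
  and x: "x : {a..b}"
 shows "cmod (u x) <= (b - a) * K"
proof -
 have ul: "uniform_limit {a..b} (psum (sc u)) u sequentially"
  by (rule sine_series_uniform[OF u weighted_summable(1)[OF K K0]])
 have "(%n. psum (sc u) n x) LQ u x" using tendsto_uniform_limitI[OF ul x] .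
 then have "(%n. cmod (psum (sc u) n x)) LQ cmod (u x)" by (rule tendsto_norm)
 then show ?thesis
 proof (rule LIMSEQ_le_const2)
  have "cmod (psum (sc u) n x) <= (b - a) * K" for n
  proof -
  have "cmod (psum (sc u) n x) <= (\<Sum>l=1..n. cmod (sc u l * of_real (sN l x)))"
  unfolding psum_def by (rule norm_sum)
  also have "... <= (\<Sum>l=1..n. cmod (sc u l))"
  by (intro sum_mono) (simp add: norm_mult sn_def mult_left_le)
  finally show ?thesis using weighted_summable(2)[OF K K0, of n] by linarith
  qed
  then show "\<exists>N. \<forall>n\<ge>N. cmod (psum (sc u) n x) <= (b - a) * K" by blast
 qed
qed

lemma L2_diff_psum_tendsto:
 assumes u: "cont u" and s: "summable (%l. cmod (sc u (Suc l)))"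
 shows "(%n. nrm (%x. u x - psum (sc u) n x)) LQ 0"
proof (rule LIMSEQ_I)
 fix e :: real assume e: "e > 0"
 define d where "d = e / (sqrt (b - a) + 1)"
 have d: "d > 0" "d * sqrt (b - a) < e" using e ab by (auto simp: d_def field_simps add_nonneg_pos)
 obtain N where N: "!!n x. n >= N ==> x : {a..b} ==> dist (psum (sc u) n x) (u x) < d"
  using sine_series_uniform[OF u s] d(1) unfolding uniform_limit_sequentially_iff by blast
 have "nrm (%x. u x - psum (sc u) n x) <= d * sqrt (b - a)" if "n >= N" for n
  using N[OF that] by (intro L2_bounded(2) Om_measurable_cont continuous_intros u psum_cont)
  (auto simp: dist_norm norm_minus_commute less_imp_le)
 then show "\<exists>no. \<forall>n\<ge>no. norm (nrm (%x. u x - psum (sc u) n x) - 0) < e"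
  using d(2) by (intro exI[of _ N]) (auto intro: le_less_trans)
qed

lemma parseval_le:
 assumes u: "cont u" and s: "summable (%l. cmod (sc u (Suc l)))"
  and X: "!!n. (\<Sum>l=1..n. (cmod (sc u l))^2) <= X^2" "X >= 0"
 shows "nrm u <= sqrt ((b - a) / 2) * X"
proof -
 let ?P = "psum (sc u)"
 have P: "nrm (?P n) <= sqrt ((b - a) / 2) * X" for n
 proof (rule power2_le_imp_le)
  show "(nrm (?P n))^2 <= (sqrt ((b - a) / 2) * X)^2"
  unfolding L2norm_psum pmd using X(1)[of n] ab by (simp add: mlm)
 qed (use ab X in simp)
 have L: "u : LL" "?P n : LL" for n using u psum_cont L2_cont by auto
 have le: "nrm u <= nrm (%x. u x - ?P n x) + sqrt ((b - a) / 2) * X" for n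
  using L2_add(2)[OF L2_diff(1)[OF L(1) L(2)[of n]] L(2)[of n]] P[of n] by simp
 have "(%n. nrm (%x. u x - ?P n x) + sqrt ((b - a) / 2) * X) LQ 0 + sqrt ((b - a) / 2) * X"
  by (intro tendsto_add L2_diff_psum_tendsto u s tendsto_const)
 then have "nrm u <= 0 + sqrt ((b - a) / 2) * X"
  by (rule LIMSEQ_le_const) (use le in blast)
 then show ?thesis by simp
qed

text \<open>By parts, the square of the norm is minus the integral of the conjugate of \<open>u\<close> times \<open>w\<close>. There \<open>u\<close> may be replaced by its partial sums in the limit.\<close>

lemma gradient_parseval_le:
 assumes u: "ac u v" and v: "ac v w" and w: "w : LL" and z: "u a = 0" "u b = 0"
  and X: "!!n. (\<Sum>l=1..n. (fq l * cmod (sc u l))^2) <= X^2" "X >= 0"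
 shows "nrm v <= sqrt ((b - a) / 2) * X"
proof -
 let ?c = "sc u"
 have cu: "cont u" by (rule AC_continuous[OF u])
 have s: "summable (%l. cmod (?c (Suc l)))" by (rule weighted_summable(1)[OF X])
 have cuL: "(%x. cnj (u x)) : LL" by (intro L2_cont continuous_intros cu)
 have cpL: "(%x. cnj (psum ?c n x)) : LL" for n by (intro L2_cont continuous_intros psum_cont)
 have vL: "v : LL" by (rule AC_L2[OF v])
 have ivv: "integrable (OM) (%x. v x * cnj (v x))" by (rule L2_mult_int[OF vL L2_cnj(1)[OF vL]])
 have iuw: "integrable (OM) (%x. cnj (u x) * w x)" by (rule L2_mult_int[OF cuL w])
 have "of_real ((nrm v)^2) = (LINT x|OM. cr ((cmod (v x))^2))"
  unfolding L2norm_sq by (rule integral_complex_of_real[symmetric])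
 also have "... = (LINT x|OM. v x * cnj (v x))" by (simp only: complex_norm_square)
 also have "... = integral {a..b} (%x. v x * cnj (v x))" by (rule Om_integral_eq[OF ivv])
 also have "... = - integral {a..b} (%x. cnj (u x) * w x)"
  using AC_by_parts[OF v AC_cnj[OF u]] z by simp
 also have "... = - (LINT x|OM. cnj (u x) * w x)" by (simp only: Om_integral_eq[OF iuw])
 finally have e: "of_real ((nrm v)^2) = - (LINT x|OM. cnj (u x) * w x)" .
 have pw: "- (LINT x|OM. cnj (psum ?c n x) * w x) = of_real ((b - a) / 2 * (\<Sum>l=1..n. (fq l * cmod (?c l))^2))" for n
 proof -
  have "(LINT x|OM. cnj (psum ?c n x) * w x) = (LINT x|OM. (\<Sum>l\<in>{1..n}. cnj (?c l) * (of_real (sN l x) * w x)))"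
  by (simp add: psum_def sum_distrib_right sum_distrib_left mult_ac)
  also have "... = (\<Sum>l\<in>{1..n}. cnj (?c l) * ipr (sN l) w)"
  unfolding ip_def using w by (subst Bochner_Integration.integral_sum)
  (auto intro!: integrable_mult_right L2_e_mult continuous_intros)
  also have "... = (\<Sum>l\<in>{1..n}. - of_real ((b - a) / 2 * (fq l * cmod (?c l))^2))"
  proof (rule sum.cong[OF refl])
  fix l
  have "ipr (sN l) w = - of_real (fq l) * (of_real (fq l) * ipr (sN l) u)"
  using ip_sn_deriv[OF v, of l] ip_cn_deriv[OF u, of l] z by simp
  also have "ipr (sN l) u = of_real ((b - a) / 2) * ?c l" using ab by (simp add: sine_coeff_ip)
  finally have "cnj (?c l) * ipr (sN l) w = - (of_real ((b - a) / 2 * (fq l)^2) * (?c l * cnj (?c l)))"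
  by (simp add: psq)
  then show "cnj (?c l) * ipr (sN l) w = - of_real ((b - a) / 2 * (fq l * cmod (?c l))^2)"
  by (simp add: complex_norm_square[symmetric] pmd)
  qed
  finally show ?thesis by (simp add: sum_negf sum_distrib_left)
 qed
 have le: "(nrm v)^2 <= (b - a) / 2 * X^2 + nrm (%x. u x - psum ?c n x) * nrm w" for n
 proof -
  have uL: "u : LL" "psum ?c n : LL" using cu psum_cont L2_cont by auto
  have ipw: "integrable (OM) (%x. cnj (psum ?c n x) * w x)" by (rule L2_mult_int[OF cpL w])
  have "cr ((nrm v)^2) - of_real ((b - a) / 2 * (\<Sum>l=1..n. (fq l * cmod (?c l))^2))
  = - (LINT x|OM. cnj (u x) * w x) + (LINT x|OM. cnj (psum ?c n x) * w x)"
  unfolding e pw[of n, symmetric] by simp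
  also have "... = - (LINT x|OM. cnj (u x - psum ?c n x) * w x)"
  using iuw ipw by (simp add: left_diff_distrib)
  finally have eq: "cr ((nrm v)^2) - of_real ((b - a) / 2 * (\<Sum>l=1..n. (fq l * cmod (?c l))^2))
  = - (LINT x|OM. cnj (u x - psum ?c n x) * w x)" .
  have "\<bar>(nrm v)^2 - (b - a) / 2 * (\<Sum>l=1..n. (fq l * cmod (?c l))^2)\<bar>
  = cmod (cr ((nrm v)^2) - of_real ((b - a) / 2 * (\<Sum>l=1..n. (fq l * cmod (?c l))^2)))"
  by (simp only: of_real_diff[symmetric] norm_of_real)
  also have "... = cmod (LINT x|OM. cnj (u x - psum ?c n x) * w x)"
  unfolding eq norm_minus_cancel ..
  also have "... <= nrm (%x. cnj (u x - psum ?c n x)) * nrm w"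
  by (rule L2_cauchy_schwarz[OF L2_cnj(1)[OF L2_diff(1)[OF uL]] w])
  also have "... = nrm (%x. u x - psum ?c n x) * nrm w" by (simp only: L2_cnj(2))
  finally have "(nrm v)^2 <= (b - a) / 2 * (\<Sum>l=1..n. (fq l * cmod (?c l))^2) + nrm (%x. u x - psum ?c n x) * nrm w"
  by linarith
  also have "(b - a) / 2 * (\<Sum>l=1..n. (fq l * cmod (?c l))^2) <= (b - a) / 2 * X^2"
  using X(1)[of n] ab by (intro mlm) auto
  finally show ?thesis by simp
 qed
 have "(%n. (b - a) / 2 * X^2 + nrm (%x. u x - psum ?c n x) * nrm w) LQ (b - a) / 2 * X^2 + 0 * nrm w"
  by (intro tendsto_intros L2_diff_psum_tendsto cu s)
 then have "(nrm v)^2 <= (b - a) / 2 * X^2 + 0 * nrm w"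
  by (rule LIMSEQ_le_const) (use le in blast)
 also have "... = (sqrt ((b - a) / 2) * X)^2" using ab by (simp add: pmd)
 finally show ?thesis by (rule power2_le_imp_le) (use ab X in simp)
qed

lemma trig_ip_tendsto_0:
 assumes e: "trig_system e" and g: "g : LL"
 shows "(%l. ipr (e l) g) LQ 0"
proof -
 have "summable (%l. (cmod (ipr (e (Suc l)) g))^2)"
 proof (rule sums_bounded_nonneg(1))
  show "(\<Sum>l<n. (cmod (ipr (e (Suc l)) g))^2) <= (b - a) / 2 * (nrm g)^2" for n
  using bessel[OF e, of "{1..n}" g] g by (simp add: sum.atLeast1_atMost_eq)
 qed simp
 then have "(%l. (cmod (ipr (e (Suc l)) g))^2) LQ 0" by (rule summable_LIMSEQ_zero)
 then have "(%l. sqrt ((cmod (ipr (e (Suc l)) g))^2)) LQ sqrt 0" by (rule tendsto_real_sqrt)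
 then have "(%l. cmod (ipr (e (Suc l)) g)) LQ 0" by simp
 then have "(%l. ipr (e (Suc l)) g) LQ 0" by (rule tendsto_norm_zero_cancel)
 then show ?thesis by (rule LIMSEQ_imp_Suc)
qed

text \<open>The boundary terms of an integration by parts oscillate without decay, so decay of
 \<open>nu\<^sub>l\<close> times the sine coefficients forces the traces to vanish.\<close>

lemma vanishing_traces:
 assumes g: "ac g v" and v: "v : LL" and d: "(%l. of_real (fq l) * ipr (sN l) g) LQ 0"
 shows "g a = 0 & g b = 0"
proof -
 have "(%l. ipr (cN l) v - of_real (fq l) * ipr (sN l) g) LQ 0 - 0"
  by (intro tendsto_diff trig_ip_tendsto_0[OF trig_cn v] d)
 then have L: "(%l. (- 1) ^ l * g b - g a) LQ 0" by (simp add: ip_cn_deriv[OF g])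
 have m: "strict_mono (%n::nat. 2 * n)" "strict_mono (%n::nat. Suc (2 * n))" by (auto simp: strict_mono_def)
 have "(%n::nat. g b - g a) LQ 0" using LIMSEQ_subseq_LIMSEQ[OF L m(1)] by (simp add: o_def)
 then have 1: "g b - g a = 0" by (simp add: LIMSEQ_const_iff)
 have "(%n::nat. - g b - g a) LQ 0" using LIMSEQ_subseq_LIMSEQ[OF L m(2)] by (simp add: o_def)
 then have 2: "- g b - g a = 0" by (simp add: LIMSEQ_const_iff)
 from 1 have "g b = g a" by simp
 with 2 have "2 * g a = 0" by (simp add: alg)
 then show ?thesis using \<open>g b = g a\<close> by simp
qed

end

section \<open>The discrete sine transform\<close>

definition gs :: "nat => nat => nat => real" where
 "gs M l j = sin (real j * real l * pi / real M)"

text \<open>Differences of \<open>gs\<close> between neighbouring nodes are multiples of these cosines at the midpoints.\<close>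

definition gc :: "nat => nat => nat => real" where
 "gc M l j = cos ((real j + 1 / 2) * real l * pi / real M)"

lemma half_le_sin:
 assumes x: "0 <= x" "x <= pi / 2"
 shows "x / 2 <= sin x"
proof -
 define y where "y = x / 2"
 have y: "0 <= y" "x = 2 * y" using x by (auto simp: y_def)
 have "sin 0 - 0 * cos 0 <= sin y - y * cos y"
 proof (rule DERIV_nonneg_imp_nondecreasing[OF y(1)])
  fix t assume t: "0 <= t" "t <= y"
  have "((%t. sin t - t * cos t) has_real_derivative t * sin t) (at t)"
  by (auto intro!: derivative_eq_intros)
  moreover have "0 <= t * sin t" using t x y by (intro mnn sin_ge_zero) auto
  ultimately show "\<exists>D. ((%t. sin t - t * cos t) has_real_derivative D) (at t) & D >= 0" by blast
 qed
 then have 1: "y * cos y <= sin y" by simp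
 have c: "0 <= cos y" "0 <= cos x" using x y by (auto intro!: cos_ge_zero)
 have "x / 2 = y * 1" using y by simp
 also have "... <= y * (1 + cos x)" using y c by (intro mlm) auto
 also have "... = 2 * (y * cos y) * cos y" using cos_double_cos[of y] y(2) by (simp add: psq alg)
 also have "... <= 2 * sin y * cos y" using 1 c by (intro mrm) auto
 also have "... = sin x" using sin_double[of y] y(2) by simp
 finally show ?thesis .
qed

lemma sum_block_shift: "sum f {k * M..<k * M + M} = (\<Sum>r<M. f (k * M + r))" for k M :: nat
 using sum.shift_bounds_nat_ivl[of f 0 "k * M" M] by (simp add: lessThan_atLeast0 add.commute)

lemma sum_cos_telescope: "2 * sin (x / 2) * (\<Sum>j=1..n. cos (real j * x)) = sin ((real n + 1 / 2) * x) - sin (x / 2)"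
proof (induction n)
 case (Suc n)
 have A: "(real (Suc n) + 1 / 2) * x = real (Suc n) * x + x / 2" "(real n + 1 / 2) * x = real (Suc n) * x - x / 2"
  by (simp_all add: alg)
 have "2 * sin (x / 2) * cos (real (Suc n) * x) = sin ((real (Suc n) + 1 / 2) * x) - sin ((real n + 1 / 2) * x)"
  unfolding A sin_add sin_diff by simp
 then show ?case using Suc.IH by (simp add: distrib_left)
qed simp

lemma sum_cos_shifted_telescope: "2 * sin (x / 2) * (\<Sum>j<n. cos ((real j + 1 / 2) * x)) = sin (real n * x)"
proof (induction n)
 case (Suc n)
 have A: "real (Suc n) * x = (real n + 1 / 2) * x + x / 2" "real n * x = (real n + 1 / 2) * x - x / 2"
  by (simp_all add: alg)
 have "2 * sin (x / 2) * cos ((real n + 1 / 2) * x) = sin (real (Suc n) * x) - sin (real n * x)"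
  unfolding A sin_add sin_diff by simp
 then show ?case using Suc.IH by (simp add: distrib_left)
qed simp

lemma sin_half_freq_pos: "0 < n ==> n < 2 * M ==> sin (real n * pi / real M / 2) > 0"
proof (rule sin_gt_zero)
 assume n: "0 < n" "n < 2 * M"
 then show "0 < real n * pi / real M / 2" by simp
 have "real n < 2 * real M" using n by linarith
 then have "real n * pi < 2 * real M * pi" by simp
 then show "real n * pi / real M / 2 < pi" using n by (simp add: field_simps)
qed

lemma sum_cos_nodes:
 assumes n: "0 < n" "n < 2 * M"
 shows "(\<Sum>j=1..M - 1. cos (real j * (real n * pi / real M))) = - (1 + (- 1) ^ n) / 2"
proof -
 let ?x = "real n * pi / real M"
 have M: "M > 0" using n by simp
 have s: "sin (?x / 2) > 0" using sin_half_freq_pos[OF n] by simp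
 have "(real (M - 1) + 1 / 2) * ?x = real n * pi - ?x / 2" using M by (simp add: of_nat_diff field_simps)
 then have "sin ((real (M - 1) + 1 / 2) * ?x) = - ((- 1) ^ n * sin (?x / 2))"
  by (simp add: sin_diff sin_npi cos_npi)
 then have "2 * sin (?x / 2) * (\<Sum>j=1..M - 1. cos (real j * ?x)) = 2 * sin (?x / 2) * (- (1 + (- 1) ^ n) / 2)"
  unfolding sum_cos_telescope by (simp add: alg)
 then show ?thesis using s by (simp only: mult_cancel_left) simp
qed

lemma sum_cos_midpoints:
 assumes n: "0 < n" "n < 2 * M"
 shows "(\<Sum>j<M. cos ((real j + 1 / 2) * (real n * pi / real M))) = 0"
proof -
 let ?x = "real n * pi / real M"
 have s: "sin (?x / 2) > 0" using sin_half_freq_pos[OF n] by simp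
 have "real M * ?x = real n * pi" using n by simp
 then have "2 * sin (?x / 2) * (\<Sum>j<M. cos ((real j + 1 / 2) * ?x)) = 0"
  unfolding sum_cos_shifted_telescope by (simp add: sin_npi)
 then show ?thesis using s by simp
qed

lemma gs_orth_less:
 assumes "1 <= k" "k < l" "l <= M - 1"
 shows "(\<Sum>j=1..M - 1. gs M l j * gs M k j) = 0" "(\<Sum>j<M. gc M l j * gc M k j) = 0"
proof -
 have par: "(- 1 :: real) ^ (l - k) = (- 1) ^ (l + k)"
 proof -
  have e: "l + k = (l - k) + 2 * k" using assms by simp
  show ?thesis unfolding e power_add power_mult by simp
 qed
 have A: "real j * real l * pi / real M - real j * real k * pi / real M = real j * (real (l - k) * pi / real M)"
  "real j * real l * pi / real M + real j * real k * pi / real M = real j * (real (l + k) * pi / real M)" for j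
  using assms by (simp_all add: of_nat_diff field_simps)
 have B: "(real j + 1 / 2) * real l * pi / real M - (real j + 1 / 2) * real k * pi / real M = (real j + 1 / 2) * (real (l - k) * pi / real M)"
  "(real j + 1 / 2) * real l * pi / real M + (real j + 1 / 2) * real k * pi / real M = (real j + 1 / 2) * (real (l + k) * pi / real M)" for j
  using assms by (simp_all add: of_nat_diff diff_divide_distrib add_divide_distrib alg)
 have lk: "0 < l - k" "l - k < 2 * M" "0 < l + k" "l + k < 2 * M" using assms by auto
 have "(\<Sum>j=1..M - 1. gs M l j * gs M k j) =
  ((\<Sum>j=1..M - 1. cos (real j * (real (l - k) * pi / real M))) - (\<Sum>j=1..M - 1. cos (real j * (real (l + k) * pi / real M)))) / 2"
  unfolding gs_def sin_times_sin A by (simp add: sum_subtractf sum_divide_distrib[symmetric])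
 also have "... = 0" unfolding sum_cos_nodes[OF lk(1,2)] sum_cos_nodes[OF lk(3,4)] par by simp
 finally show "(\<Sum>j=1..M - 1. gs M l j * gs M k j) = 0" .
 have "(\<Sum>j<M. gc M l j * gc M k j) =
  ((\<Sum>j<M. cos ((real j + 1 / 2) * (real (l - k) * pi / real M))) + (\<Sum>j<M. cos ((real j + 1 / 2) * (real (l + k) * pi / real M)))) / 2"
  unfolding gc_def cos_times_cos B by (simp add: sum.distrib sum_divide_distrib[symmetric])
 also have "... = 0" unfolding sum_cos_midpoints[OF lk(1,2)] sum_cos_midpoints[OF lk(3,4)] by simp
 finally show "(\<Sum>j<M. gc M l j * gc M k j) = 0" .
qed

lemma gs_orth_same:
 assumes "1 <= l" "l <= M - 1"
 shows "(\<Sum>j=1..M - 1. gs M l j * gs M l j) = real M / 2" "(\<Sum>j<M. gc M l j * gc M l j) = real M / 2"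
proof -
 have A: "real j * real l * pi / real M + real j * real l * pi / real M = real j * (real (2 * l) * pi / real M)" 
  "(real j + 1 / 2) * real l * pi / real M + (real j + 1 / 2) * real l * pi / real M = (real j + 1 / 2) * (real (2 * l) * pi / real M)" for j
  by simp_all
 have "(\<Sum>j=1..M - 1. gs M l j * gs M l j) = (\<Sum>j=1..M - 1. (1 - cos (real j * (real (2 * l) * pi / real M))) / 2)"
  unfolding gs_def sin_times_sin A by simp
 also have "... = (real (M - 1) - (\<Sum>j=1..M - 1. cos (real j * (real (2 * l) * pi / real M)))) / 2"
  by (simp add: sum_subtractf sum_divide_distrib[symmetric])
 also have "(\<Sum>j=1..M - 1. cos (real j * (real (2 * l) * pi / real M))) = - (1 + (- 1) ^ (2 * l)) / 2"
  using assms by (intro sum_cos_nodes) auto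
 finally show "(\<Sum>j=1..M - 1. gs M l j * gs M l j) = real M / 2" using assms by (simp add: of_nat_diff power_mult)
 have "(\<Sum>j<M. gc M l j * gc M l j) = (\<Sum>j<M. (1 + cos ((real j + 1 / 2) * (real (2 * l) * pi / real M))) / 2)"
  unfolding gc_def cos_times_cos A by simp
 also have "... = (real M + (\<Sum>j<M. cos ((real j + 1 / 2) * (real (2 * l) * pi / real M)))) / 2"
  by (simp add: sum.distrib sum_divide_distrib[symmetric])
 also have "(\<Sum>j<M. cos ((real j + 1 / 2) * (real (2 * l) * pi / real M))) = 0"
  using assms by (intro sum_cos_midpoints) auto
 finally show "(\<Sum>j<M. gc M l j * gc M l j) = real M / 2" by simp
qed

lemma gs_orth:
 assumes "l : {1..M - 1}" "k : {1..M - 1}"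
 shows "(\<Sum>j=1..M - 1. gs M l j * gs M k j) = (if l = k then real M / 2 else 0)"
  "(\<Sum>j<M. gc M l j * gc M k j) = (if l = k then real M / 2 else 0)"
proof -
 consider "k < l" | "l < k" | "l = k" by linarith
 then have "(\<Sum>j=1..M - 1. gs M l j * gs M k j) = (if l = k then real M / 2 else 0) &
  (\<Sum>j<M. gc M l j * gc M k j) = (if l = k then real M / 2 else 0)"
 proof cases
  case 1 then show ?thesis using gs_orth_less[of k l M] assms by simp
 next
  case 2 then show ?thesis using gs_orth_less[of l k M] assms by (simp add: mult.commute)
 next
  case 3 then show ?thesis using gs_orth_same[of l M] assms by simp
 qed
 then show "(\<Sum>j=1..M - 1. gs M l j * gs M k j) = (if l = k then real M / 2 else 0)"
  "(\<Sum>j<M. gc M l j * gc M k j) = (if l = k then real M / 2 else 0)" by auto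
qed

lemma orth_parseval:
 fixes e :: "nat => nat => real" and c :: "nat => complex"
 assumes fin: "finite A" "finite J"
  and o: "!!l k. l : A ==> k : A ==> (\<Sum>j\<in>J. e l j * e k j) = (if l = k then ka else 0)"
 shows "(\<Sum>j\<in>J. (cmod (\<Sum>l\<in>A. c l * of_real (e l j)))^2) = ka * (\<Sum>l\<in>A. (cmod (c l))^2)"
proof -
 have "cr (\<Sum>j\<in>J. (cmod (\<Sum>l\<in>A. c l * of_real (e l j)))^2) =
  (\<Sum>j\<in>J. (\<Sum>l\<in>A. c l * of_real (e l j)) * cnj (\<Sum>k\<in>A. c k * of_real (e k j)))"
  unfolding of_real_sum complex_norm_square ..
 also have "... = (\<Sum>j\<in>J. \<Sum>l\<in>A. \<Sum>k\<in>A. (c l * cnj (c k)) * of_real (e l j * e k j))"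
  by (simp add: sum_product mult_ac)
 also have "... = (\<Sum>l\<in>A. \<Sum>j\<in>J. \<Sum>k\<in>A. (c l * cnj (c k)) * of_real (e l j * e k j))"
  by (rule sum.swap)
 also have "... = (\<Sum>l\<in>A. \<Sum>k\<in>A. \<Sum>j\<in>J. (c l * cnj (c k)) * of_real (e l j * e k j))"
  by (intro sum.cong refl sum.swap)
 also have "... = (\<Sum>l\<in>A. \<Sum>k\<in>A. (c l * cnj (c k)) * of_real (\<Sum>j\<in>J. e l j * e k j))"
  by (simp add: sum_distrib_left)
 also have "... = (\<Sum>l\<in>A. \<Sum>k\<in>A. if l = k then (c l * cnj (c k)) * of_real ka else 0)"
  by (intro sum.cong refl) (simp add: o)
 also have "... = (\<Sum>l\<in>A. of_real (ka * (cmod (c l))^2))"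
  using fin by (intro sum.cong refl) (simp add: sum.delta complex_norm_square[symmetric] mult.commute)
 finally have "cr (\<Sum>j\<in>J. (cmod (\<Sum>l\<in>A. c l * of_real (e l j)))^2) = of_real (ka * (\<Sum>l\<in>A. (cmod (c l))^2))"
  by (simp add: sum_distrib_left)
 then show ?thesis using of_real_eq_iff by blast
qed

lemma dst_gs: "dst M v l = of_real (2 / real M) * (\<Sum>j=1..M - 1. of_real (gs M l j) * v j)"
 by (simp add: dst_def gs_def sRc)

definition synth :: "nat => (nat => complex) => nat => complex" where
 "synth M c j = (\<Sum>l=1..M - 1. c l * of_real (gs M l j))"

lemma dst_sum: "dst M (%j. \<Sum>k\<in>A. v k j) l = (\<Sum>k\<in>A. dst M (v k) l)"
 unfolding dst_gs sum_distrib_left by (rule sum.swap)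

lemma dst_diff: "dst M (%j. u j - v j) l = dst M u l - dst M v l"
 by (simp add: dst_gs sum_subtractf right_diff_distrib)

lemma dst_add: "dst M (%j. u j + v j) l = dst M u l + dst M v l"
 by (simp add: dst_gs sum.distrib distrib_left)

lemma dst_cmult: "dst M (%j. z * v j) l = z * dst M v l"
 by (simp add: dst_gs sum_distrib_left mult_ac)

lemma dst_cong: "(!!j. j : {1..M - 1} ==> u j = v j) ==> dst M u l = dst M v l"
 unfolding dst_gs by (intro arg_cong[where f="%x. _ * x"] sum.cong) auto

lemma gs_sym: "gs M l j = gs M j l" by (simp add: gs_def mult.commute)

lemma dst_synth:
 assumes k: "k : {1..M - 1}"
 shows "dst M (synth M c) k = c k"
proof -
 have M: "M > 0" using k by auto
 have "(\<Sum>j=1..M - 1. of_real (gs M k j) * synth M c j) = (\<Sum>j=1..M - 1. \<Sum>l=1..M - 1. c l * of_real (gs M l j * gs M k j))"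
  by (simp add: synth_def sum_distrib_left mult_ac)
 also have "... = (\<Sum>l=1..M - 1. c l * of_real (\<Sum>j=1..M - 1. gs M l j * gs M k j))"
  by (subst sum.swap) (simp add: sum_distrib_left)
 also have "... = (\<Sum>l=1..M - 1. if l = k then c l * of_real (real M / 2) else 0)"
  using k by (intro sum.cong refl) (subst gs_orth(1), auto)
 also have "... = c k * of_real (real M / 2)" using k by (simp add: sum.delta)
 finally have eq: "(\<Sum>j=1..M - 1. of_real (gs M k j) * synth M c j) = c k * of_real (real M / 2)" .
 show ?thesis unfolding dst_gs eq using M by simp
qed

lemma synth_dst:
 assumes j: "j : {1..M - 1}"
 shows "synth M (dst M v) j = v j"
proof -
 have M: "M > 0" using j by auto
 have "synth M (dst M v) j = (\<Sum>l=1..M - 1. \<Sum>i=1..M - 1. of_real (2 / real M) * (v i * of_real (gs M i l * gs M j l)))"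
  unfolding synth_def dst_gs sum_distrib_left sum_distrib_right
 proof (intro sum.cong refl)
  fix l i
  show "of_real (2 / real M) * (of_real (gs M l i) * v i) * of_real (gs M l j) = of_real (2 / real M) * (v i * of_real (gs M i l * gs M j l))"
  unfolding gs_sym[of M l i] gs_sym[of M l j] by simp
 qed
 also have "... = (\<Sum>i=1..M - 1. of_real (2 / real M) * (v i * of_real (\<Sum>l=1..M - 1. gs M i l * gs M j l)))"
  by (subst sum.swap) (simp add: sum_distrib_left)
 also have "... = (\<Sum>i=1..M - 1. if i = j then of_real (2 / real M) * (v i * of_real (real M / 2)) else 0)"
  using j by (intro sum.cong refl) (subst gs_orth(1), auto)
 also have "... = v j" using j M by (simp add: sum.delta)
 finally show ?thesis .
qed

lemma synth_ends: "synth M c 0 = 0" "synth M c M = 0"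
proof -
 show "synth M c 0 = 0" by (simp add: synth_def gs_def)
 have "gs M l M = 0" for l
 proof (cases "M = 0")
  case False
  then have "real M * real l * pi / real M = real l * pi" by simp
  then show ?thesis by (simp add: gs_def sin_npi)
 qed (simp add: gs_def)
 then show "synth M c M = 0" by (simp add: synth_def)
qed

lemma parseval_grid: "(\<Sum>j=1..M - 1. (cmod (synth M c j))^2) = real M / 2 * (\<Sum>l=1..M - 1. (cmod (c l))^2)"
 unfolding synth_def by (rule orth_parseval) (use gs_orth(1) in auto)

lemma parseval_gradient:
 "(\<Sum>j<M. (cmod (synth M c (Suc j) - synth M c j))^2) =
  real M / 2 * (\<Sum>l=1..M - 1. (2 * sin (real l * pi / real M / 2) * cmod (c l))^2)"
proof -
 have "synth M c (Suc j) - synth M c j = (\<Sum>l=1..M - 1. (of_real (2 * sin (real l * pi / real M / 2)) * c l) * of_real (gc M l j))" for j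
 proof -
  have "gs M l (Suc j) - gs M l j = 2 * sin (real l * pi / real M / 2) * gc M l j" for l
  proof -
  have A: "real (Suc j) * real l * pi / real M = (real j + 1 / 2) * real l * pi / real M + real l * pi / real M / 2"
  "real j * real l * pi / real M = (real j + 1 / 2) * real l * pi / real M - real l * pi / real M / 2"
  by (simp_all add: alg add_divide_distrib diff_divide_distrib)
  show ?thesis unfolding gs_def gc_def A sin_add sin_diff by simp
  qed
  then have "of_real (gs M l (Suc j)) - of_real (gs M l j) = cr (2 * sin (real l * pi / real M / 2) * gc M l j)" for l
  unfolding of_real_diff[symmetric] by simp
  then show ?thesis
  by (simp add: synth_def sum_subtractf[symmetric] right_diff_distrib[symmetric] mult_ac)
 qed
 then have "(\<Sum>j<M. (cmod (synth M c (Suc j) - synth M c j))^2) =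
  (\<Sum>j<M. (cmod (\<Sum>l=1..M - 1. (of_real (2 * sin (real l * pi / real M / 2)) * c l) * of_real (gc M l j)))^2)" by simp
 also have "... = real M / 2 * (\<Sum>l=1..M - 1. (cmod (of_real (2 * sin (real l * pi / real M / 2)) * c l))^2)"
  by (rule orth_parseval) (use gs_orth(2) in auto)
 also have "... = real M / 2 * (\<Sum>l=1..M - 1. (2 * sin (real l * pi / real M / 2) * cmod (c l))^2)"
  by (simp add: norm_mult pmd)
 finally show ?thesis .
qed

text \<open>Weight \<open>1\<close> gives the \<open>L\<^sup>2\<close> norm of the interpolant, weight \<open>fq\<close> that of its gradient, weight \<open>fq ^ m\<close> the norm of \<open>H\<^sup>m\<^sub>s\<close>.\<close>

definition wn :: "nat => (nat => real) => (nat => complex) => real" where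
 "wn M w c = L2_set (%l. w l * cmod (c l)) {1..M - 1}"

lemma wn_nonneg [simp]: "wn M w c >= 0" by (simp add: wn_def L2_set_nonneg)

lemma wn_sq: "(wn M w c)^2 = (\<Sum>l=1..M - 1. (w l * cmod (c l))^2)"
 unfolding wn_def L2_set_def by (rule real_sqrt_pow2) (simp add: sum_nonneg)

lemma wn_mono:
 assumes "!!l. l : {1..M - 1} ==> 0 <= w l" "!!l. l : {1..M - 1} ==> w l * cmod (c l) <= w' l * cmod (d l)"
 shows "wn M w c <= wn M w' d"
 unfolding wn_def using assms by (intro L2_set_mono) auto

lemma wn_scale: "r >= 0 ==> wn M (%l. r * w l) c = r * wn M w c"
 unfolding wn_def by (simp add: L2_set_right_distrib mult.assoc)

lemma wn_cmult: "wn M w (%l. z * c l) = cmod z * wn M w c"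
 unfolding wn_def by (simp add: L2_set_right_distrib norm_mult mult_ac)

lemma wn_add:
 assumes "!!l. l : {1..M - 1} ==> 0 <= w l"
 shows "wn M w (%l. c l + d l) <= wn M w c + wn M w d"
proof -
 have "wn M w (%l. c l + d l) <= L2_set (%l. w l * cmod (c l) + w l * cmod (d l)) {1..M - 1}"
  unfolding wn_def
  using assms by (intro L2_set_mono) (auto simp: distrib_left[symmetric] intro!: mlm norm_triangle_ineq)
 also have "... <= wn M w c + wn M w d" unfolding wn_def by (rule L2_set_triangle_ineq)
 finally show ?thesis .
qed

lemma wn_uminus: "wn M w (%l. - c l) = wn M w c" by (simp add: wn_def)

lemma wn_cong: "(!!l. l : {1..M - 1} ==> c l = d l) ==> wn M w c = wn M w d"
 unfolding wn_def by (intro L2_set_cong) auto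

lemma wn_diff:
 assumes "!!l. l : {1..M - 1} ==> 0 <= w l"
 shows "wn M w (%l. c l - d l) <= wn M w c + wn M w d"
 using wn_add[of M w c "%l. - d l"] assms by (simp add: wn_uminus)

lemma wn_sum:
 assumes "!!l. l : {1..M - 1} ==> 0 <= w l"
 shows "finite A ==> wn M w (%l. \<Sum>i\<in>A. c i l) <= (\<Sum>i\<in>A. wn M w (c i))"
proof (induction A rule: finite_induct)
 case empty then show ?case by (simp add: wn_def L2_set_def)
next
 case (insert i A)
 then show ?case using wn_add[of M w "c i" "%l. \<Sum>i\<in>A. c i l"] assms by fastforce
qed

lemma wn_one_dst: "(\<Sum>j=1..M - 1. (cmod (v j))^2) = real M / 2 * (wn M (%_. 1) (dst M v))^2"
 using parseval_grid[of M "dst M v"] by (simp add: synth_dst wn_sq)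

context seg
begin

lemma mu_h: "h = (b - a) / real M ==> M > 0 ==> real l * pi / real M = fq l * h"
 using ab by (simp add: mu_def)

lemma mu_le_h: "h = (b - a) / real M ==> l <= M ==> M > 0 ==> fq l * h <= pi"
proof -
 assume h: "h = (b - a) / real M" "l <= M" "M > 0"
 have "real l * pi / real M <= pi" using h(2,3) by (simp add: pos_divide_le_eq mult.commute)
 then show ?thesis unfolding mu_h[OF h(1,3)] .
qed

text \<open>The eigenvalue of the difference quotient lies between \<open>nu / 2\<close> and \<open>nu\<close>, as \<open>x / 2 <= sin x <= x\<close> on \<open>[0, pi / 2]\<close>.\<close>

lemma gradient_equiv:
 assumes h: "h = (b - a) / real M" and M: "M > 0"
 shows "(\<Sum>j<M. (cmod (synth M c (Suc j) - synth M c j))^2) <= real M / 2 * (h * wn M (fq) c)^2"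
  "real M / 2 * (h * (1 / 2 * wn M (fq) c))^2 <= (\<Sum>j<M. (cmod (synth M c (Suc j) - synth M c j))^2)"
proof -
 have h0: "h > 0" using h M ab by simp
 have sb: "0 <= sin (fq l * h / 2)" "2 * sin (fq l * h / 2) <= h * fq l" "h * (1 / 2 * fq l) <= 2 * sin (fq l * h / 2)"
  if l: "l : {1..M - 1}" for l
 proof -
  have x: "0 <= fq l * h / 2" "fq l * h / 2 <= pi / 2"
  using mu_le_h[OF h, of l] l M h0 mu_nonneg[of l] by auto
  show "0 <= sin (fq l * h / 2)" using x by (intro sin_ge_zero) auto
  show "2 * sin (fq l * h / 2) <= h * fq l" using sin_x_le_x[OF x(1)] by (simp add: mult.commute)
  have "fq l * h / 2 / 2 <= sin (fq l * h / 2)"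
  using x by (intro half_le_sin) auto
  then show "h * (1 / 2 * fq l) <= 2 * sin (fq l * h / 2)" by (simp add: field_simps)
 qed
 have eq: "(\<Sum>j<M. (cmod (synth M c (Suc j) - synth M c j))^2) =
  real M / 2 * (\<Sum>l=1..M - 1. (2 * sin (fq l * h / 2) * cmod (c l))^2)"
  unfolding parseval_gradient mu_h[OF h M] ..
 have "(\<Sum>l=1..M - 1. (2 * sin (fq l * h / 2) * cmod (c l))^2) <= (\<Sum>l=1..M - 1. (h * (fq l * cmod (c l)))^2)"
  using sb by (intro sum_mono power_mono) (auto simp: mult.assoc[symmetric] intro!: mrm)
 also have "... = (h * wn M (fq) c)^2" by (simp add: pmd wn_sq sum_distrib_left)
 finally show "(\<Sum>j<M. (cmod (synth M c (Suc j) - synth M c j))^2) <= real M / 2 * (h * wn M (fq) c)^2"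
  unfolding eq by (intro mlm) auto
 have "(h * (1 / 2 * wn M (fq) c))^2 = (\<Sum>l=1..M - 1. (h * (1 / 2 * fq l) * cmod (c l))^2)"
  by (simp add: pmd wn_sq sum_distrib_left power_divide mult_ac)
 also have "... <= (\<Sum>l=1..M - 1. (2 * sin (fq l * h / 2) * cmod (c l))^2)"
  using sb h0 mu_nonneg by (intro sum_mono power_mono mrm) auto
 finally show "real M / 2 * (h * (1 / 2 * wn M (fq) c))^2 <= (\<Sum>j<M. (cmod (synth M c (Suc j) - synth M c j))^2)"
  unfolding eq by (intro mlm) auto
qed

lemma wn_one_le_mu: "wn M (%_. 1) c <= (b - a) * wn M (fq) c"
proof -
 have "1 * cmod (c l) <= ((b - a) * fq l) * cmod (c l)" if "l : {1..M - 1}" for l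
 proof (rule mrm)
  have "1 * 1 <= pi * real l" using that pi_ge_two by (intro mult_mono) auto
  then show "1 <= (b - a) * fq l" using ab by (simp add: mu_def)
 qed simp
 then have "wn M (%_. 1) c <= wn M (%l. (b - a) * fq l) c" by (intro wn_mono) auto
 then show ?thesis using ab by (simp add: wn_scale)
qed

lemma wn_mu_le_one:
 assumes h: "h = (b - a) / real M" and M: "M > 0"
 shows "wn M (fq) c <= pi / h * wn M (%_. 1) c"
proof -
 have h0: "h > 0" using h M ab by simp
 have "wn M (fq) c <= wn M (%_. pi / h * 1) c"
 proof (rule wn_mono)
  fix l assume "l : {1..M - 1}"
  then have "fq l * h <= pi" using mu_le_h[OF h, of l] M by auto
  then have "fq l <= pi / h * 1" using h0 by (simp add: pos_le_divide_eq)
  then show "fq l * cmod (c l) <= (pi / h * 1) * cmod (c l)" by (rule mrm) simp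
 qed (simp add: mu_nonneg)
 then show ?thesis using h0 by (subst (asm) wn_scale) auto
qed

lemma synth_sup: "cmod (synth M c j) <= (b - a) * wn M (fq) c"
proof -
 let ?d = "%l. if l : {1..M - 1} then c l else 0"
 have "cmod (synth M c j) <= (\<Sum>l=1..M - 1. cmod (c l * of_real (gs M l j)))" unfolding synth_def by (rule norm_sum)
 also have "... <= (\<Sum>l=1..M - 1. cmod (?d l))"
  by (intro sum_mono) (simp add: norm_mult gs_def mult_left_le)
 also have "... <= (b - a) * wn M (fq) c"
 proof (rule weighted_summable(2))
  fix n
  have "(\<Sum>l=1..n. (fq l * cmod (?d l))^2) = (\<Sum>l\<in>{1..n} \<inter> {1..M - 1}. (fq l * cmod (c l))^2)"
  by (rule sum.mono_neutral_cong_right) auto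
  also have "... <= (\<Sum>l=1..M - 1. (fq l * cmod (c l))^2)" by (rule sum_mono2) auto
  finally show "(\<Sum>l=1..n. (fq l * cmod (?d l))^2) <= (wn M (fq) c)^2" by (simp only: wn_sq)
 qed simp
 finally show ?thesis .
qed

text \<open>Aliasing: on the grid the block of frequencies \<open>k M + r\<close>, \<open>0 < r < M\<close>, is indistinguishable, up to
 the sign \<open>(-1)^(j k)\<close>, from the frequencies \<open>r\<close>, so that its discrete norm is at most its \<open>L\<^sup>2\<close> norm.
 The sum over the blocks converges because the weights \<open>nu^m\<close> grow.\<close>

lemma gs_alias: "M > 0 ==> gs M (k * M + r) j = (- 1) ^ (j * k) * gs M r j"
proof -
 assume M: "M > 0"
 have "real j * real (k * M + r) * pi / real M = real j * real r * pi / real M + real (j * k) * pi"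
  using M by (simp add: field_simps)
 then show ?thesis unfolding gs_def by (simp add: sin_add sin_npi cos_npi del: of_nat_mult)
qed

lemma aliasing:
 assumes h: "h = (b - a) / real M" and M: "M > 0" and m: "m >= 1"
  and B: "!!n. (\<Sum>l=1..n. (fq l ^ m * cmod (c l))^2) <= B^2" "B >= 0"
  and u: "!!j. j : {1..M - 1} ==> (%n. \<Sum>l=1..n. c l * of_real (gs M l j)) LQ u j"
 shows "wn M (%_. 1) (%l. dst M u l - c l) <= sqrt 2 * B * h ^ m"
proof -
 have h0: "h > 0" using h M ab by simp
 define R where "R k j = (\<Sum>r<M. c (k * M + r) * of_real (gs M (k * M + r) j))" for k j
 have R: "R k j = (- 1) ^ (j * k) * synth M (%r. c (k * M + r)) j" for k j
 proof -
  have "{..<M} = insert 0 {1..M - 1}" using M by auto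
  then have "R k j = c (k * M) * of_real (gs M (k * M) j) + (\<Sum>r=1..M - 1. c (k * M + r) * of_real (gs M (k * M + r) j))"
  unfolding R_def by simp
  also have "gs M (k * M) j = 0" using gs_alias[OF M, of k 0 j] by (simp add: gs_def)
  finally have "R k j = (\<Sum>r=1..M - 1. c (k * M + r) * of_real (gs M (k * M + r) j))" by simp
  also have "... = (- 1) ^ (j * k) * synth M (%r. c (k * M + r)) j"
  unfolding synth_def sum_distrib_left by (intro sum.cong refl) (simp add: gs_alias[OF M])
  finally show ?thesis .
 qed
 define bk where "bk k = sqrt (\<Sum>l\<in>{k * M..<k * M + M}. (fq l ^ m * cmod (c l))^2)" for k
 have bk0: "bk k >= 0" for k by (simp add: bk_def sum_nonneg)
 have block: "wn M (%_. 1) (dst M (R k)) <= h ^ m * ((1 / real k) * bk k)" if k: "k >= 1" for k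
 proof -
  have "real M / 2 * (wn M (%_. 1) (dst M (R k)))^2 = (\<Sum>j=1..M - 1. (cmod (R k j))^2)"
  by (rule wn_one_dst[symmetric])
  also have "... = (\<Sum>j=1..M - 1. (cmod (synth M (%r. c (k * M + r)) j))^2)"
  by (simp add: R norm_mult norm_power)
  also have "... = real M / 2 * (\<Sum>r=1..M - 1. (cmod (c (k * M + r)))^2)" by (rule parseval_grid)
  finally have 1: "(wn M (%_. 1) (dst M (R k)))^2 = (\<Sum>r=1..M - 1. (cmod (c (k * M + r)))^2)" using M by simp
  have kpi: "real k <= (fq (k * M) * h) ^ m"
  proof -
  have "fq (k * M) * h = real k * pi" using mu_h[OF h M, of "k * M"] M by simp
  moreover have "real k <= real k * pi" using pi_ge_two mlm[of 1 pi "real k"] by simp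
  moreover have "real k * pi <= (real k * pi) ^ m"
  proof (rule self_le_power)
  have "1 * 1 <= real k * pi" using k pi_ge_two by (intro mult_mono) auto
  then show "1 <= real k * pi" by simp
  qed (use m in simp)
  ultimately show ?thesis by simp
  qed
  have cb: "(cmod (c l))^2 <= (h ^ m * (1 / real k))^2 * (fq l ^ m * cmod (c l))^2" if l: "l >= k * M" for l
  proof -
  have "(fq (k * M) * h) ^ m <= (fq l * h) ^ m"
  using h0 mu_nonneg[of "k * M"] by (intro power_mono mrm mu_mono l) auto
  then have "real k <= h ^ m * fq l ^ m" using kpi by (simp add: pmd mult.commute)
  then have "1 <= (h ^ m * fq l ^ m) / real k" using k by (simp add: pos_le_divide_eq)
  then have "1 <= h ^ m * (1 / real k) * fq l ^ m" by simp
  then have "1 * cmod (c l) <= (h ^ m * (1 / real k) * fq l ^ m) * cmod (c l)" by (rule mrm) simp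
  then have "(cmod (c l))^2 <= (h ^ m * (1 / real k) * fq l ^ m * cmod (c l))^2" by (intro power_mono) auto
  then show ?thesis by (simp only: pmd mult.assoc)
  qed
  have "(\<Sum>r=1..M - 1. (cmod (c (k * M + r)))^2) <= (\<Sum>r<M. (cmod (c (k * M + r)))^2)"
  using M by (intro sum_mono2) auto
  also have "... = (\<Sum>l\<in>{k * M..<k * M + M}. (cmod (c l))^2)"
  using sum.shift_bounds_nat_ivl[of "%l. (cmod (c l))^2" 0 "k * M" M] by (simp add: lessThan_atLeast0 add.commute)
  also have "... <= (\<Sum>l\<in>{k * M..<k * M + M}. (h ^ m * (1 / real k))^2 * (fq l ^ m * cmod (c l))^2)"
  using cb by (intro sum_mono) auto
  also have "... = (h ^ m * (1 / real k))^2 * (bk k)^2"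
  by (simp add: bk_def sum_nonneg sum_distrib_left[symmetric])
  finally have "(wn M (%_. 1) (dst M (R k)))^2 <= (h ^ m * ((1 / real k) * bk k))^2"
  unfolding 1 by (simp only: pmd mult.assoc)
  then show ?thesis by (rule power2_le_imp_le) (use h0 bk0 in simp)
 qed
 have sumb: "(\<Sum>k=1..K. (1 / real k) * bk k) <= sqrt 2 * B" for K
 proof -
  have "(\<Sum>k=1..K. (1 / real k) * bk k) = (\<Sum>k=1..K. \<bar>1 / real k\<bar> * \<bar>bk k\<bar>)" using bk0 by simp
  also have "... <= L2_set (%k. 1 / real k) {1..K} * L2_set bk {1..K}" by (rule L2_set_mult_ineq)
  also have "... <= sqrt 2 * B"
  proof (rule mult_mono)
  show "L2_set (%k. 1 / real k) {1..K} <= sqrt 2"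
  unfolding L2_set_def using sum_inverse_squares[of K] by (simp add: power_divide)
  have "(\<Sum>k=1..K. (bk k)^2) = (\<Sum>k=1..K. \<Sum>l\<in>{k * M..<k * M + M}. (fq l ^ m * cmod (c l))^2)"
  by (simp add: bk_def sum_nonneg)
  also have "... <= (\<Sum>k<Suc K. \<Sum>l\<in>{k * M..<k * M + M}. (fq l ^ m * cmod (c l))^2)"
  by (rule sum_mono2) (auto intro!: sum_nonneg)
  also have "... = (\<Sum>l<Suc K * M. (fq l ^ m * cmod (c l))^2)" by (rule sum.nat_group)
  also have "... <= (\<Sum>l=1..Suc K * M. (fq l ^ m * cmod (c l))^2)"
  proof -
  have "(\<Sum>l<Suc K * M. (fq l ^ m * cmod (c l))^2) = (\<Sum>l\<in>{..<Suc K * M} - {0}. (fq l ^ m * cmod (c l))^2)"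
  using m by (intro sum.mono_neutral_right) (auto simp: mu_def power_0_left)
  also have "... <= (\<Sum>l=1..Suc K * M. (fq l ^ m * cmod (c l))^2)"
  by (rule sum_mono2) auto
  finally show ?thesis .
  qed
  also have "... <= B^2" by (rule B)
  finally show "L2_set bk {1..K} <= B" unfolding L2_set_def using B(2) by (intro real_le_lsqrt sum_nonneg) auto
  qed (use B in \<open>auto simp: L2_set_nonneg\<close>)
  finally show ?thesis .
 qed
 define U where "U K j = (\<Sum>l<Suc K * M. c l * of_real (gs M l j))" for K j
 have U_R: "U K j = R 0 j + (\<Sum>k=1..K. R k j)" for K j
 proof -
  have "U K j = (\<Sum>k<Suc K. \<Sum>l\<in>{k * M..<k * M + M}. c l * of_real (gs M l j))"
  unfolding U_def by (rule sum.nat_group[symmetric])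
  also have "... = (\<Sum>k<Suc K. R k j)"
  by (simp only: R_def sum_block_shift)
  also have "{..<Suc K} = insert 0 {1..K}" by auto
  finally show ?thesis by simp
 qed
 have fin: "wn M (%_. 1) (%l. dst M (U K) l - c l) <= sqrt 2 * B * h ^ m" for K
 proof -
  have "wn M (%_. 1) (%l. dst M (U K) l - c l) = wn M (%_. 1) (%l. \<Sum>k=1..K. dst M (R k) l)"
  proof (rule wn_cong)
  fix l assume l: "l : {1..M - 1}"
  have "R 0 = synth M c" by (rule ext) (simp add: R)
  then have "dst M (R 0) l = c l" using dst_synth[OF l] by simp
  moreover have "U K = (%j. R 0 j + (\<Sum>k=1..K. R k j))" by (rule ext) (rule U_R)
  ultimately show "dst M (U K) l - c l = (\<Sum>k=1..K. dst M (R k) l)" by (simp add: dst_add dst_sum)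
  qed
  also have "... <= (\<Sum>k=1..K. wn M (%_. 1) (dst M (R k)))" by (rule wn_sum) auto
  also have "... <= (\<Sum>k=1..K. h ^ m * ((1 / real k) * bk k))" using block by (intro sum_mono) auto
  also have "... = h ^ m * (\<Sum>k=1..K. (1 / real k) * bk k)" by (rule sum_distrib_left[symmetric])
  also have "... <= h ^ m * (sqrt 2 * B)" using sumb h0 by (intro mlm) auto
  finally show ?thesis by (simp add: mult_ac)
 qed
 have lim: "(%K. U K j) LQ u j" if j: "j : {1..M - 1}" for j
 proof -
  have "strict_mono (%K. Suc K * M - 1)" using M by (auto simp: strict_mono_Suc_iff)
  from LIMSEQ_subseq_LIMSEQ[OF u[OF j] this]
  have "(%K. \<Sum>l=1..Suc K * M - 1. c l * of_real (gs M l j)) LQ u j" by (simp add: o_def)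
  moreover have "(\<Sum>l=1..Suc K * M - 1. c l * of_real (gs M l j)) = U K j" for K
  proof -
  have *: "(\<Sum>l<N. c l * of_real (gs M l j)) = (\<Sum>l=1..N - 1. c l * of_real (gs M l j))" if "N > 0" for N
  proof -
  have "{..<N} = insert 0 {1..N - 1}" using that by auto
  then show ?thesis by (simp add: gs_def)
  qed
  show ?thesis unfolding U_def by (rule *[symmetric]) (use M in simp)
  qed
  ultimately show ?thesis by simp
 qed
 have "(%K. wn M (%_. 1) (%l. dst M (U K) l - c l)) LQ wn M (%_. 1) (%l. dst M u l - c l)"
  unfolding wn_def L2_set_def dst_gs
  by (intro tendsto_real_sqrt tendsto_sum tendsto_power tendsto_mult tendsto_const tendsto_norm tendsto_diff lim)
 then show ?thesis by (rule LIMSEQ_le_const2) (use fin in blast)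
qed

end

section \<open>Differences of the nonlinearity\<close>

text \<open>Size, Lipschitz constant and second differences in one predicate. The class is closed under products and composition with \<open>f\<close>, hence contains \<open>f(|z|\<^sup>2) z\<close>.\<close>

definition sd :: "real => real => (complex => complex) => bool" where
 "sd R La Ph \<longleftrightarrow>
  (\<forall>z. cmod z <= R --> cmod (Ph z) <= La) &
  (\<forall>z w. cmod z <= R --> cmod w <= R --> cmod (Ph z - Ph w) <= La * cmod (z - w)) &
  (\<forall>z w z' w'. cmod z <= R --> cmod w <= R --> cmod z' <= R --> cmod w' <= R -->
  cmod ((Ph z - Ph w) - (Ph z' - Ph w')) <=
  La * (cmod ((z - w) - (z' - w')) + cmod (z - z') * (cmod (z - w) + cmod (z' - w'))))"

lemma sdD:
 assumes "sd R La Ph"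
 shows "cmod z <= R ==> cmod (Ph z) <= La"
  "cmod z <= R ==> cmod w <= R ==> cmod (Ph z - Ph w) <= La * cmod (z - w)"
  "cmod z <= R ==> cmod w <= R ==> cmod z' <= R ==> cmod w' <= R ==>
  cmod ((Ph z - Ph w) - (Ph z' - Ph w')) <=
  La * (cmod ((z - w) - (z' - w')) + cmod (z - z') * (cmod (z - w) + cmod (z' - w')))"
 using assms unfolding sd_def by blast+

lemma sd_mono:
 assumes "sd R La Ph" "La <= La'" shows "sd R La' Ph"
 unfolding sd_def
proof (intro conjI allI impI)
 fix z w z' w' assume b: "cmod z <= R"
 show "cmod (Ph z) <= La'" using sdD(1)[OF assms(1) b] assms(2) by linarith
 assume w: "cmod w <= R"
 show "cmod (Ph z - Ph w) <= La' * cmod (z - w)"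
  using sdD(2)[OF assms(1) b w] mrm[OF assms(2), of "cmod (z - w)"] by simp
 assume b': "cmod z' <= R" "cmod w' <= R"
 show "cmod ((Ph z - Ph w) - (Ph z' - Ph w')) <=
  La' * (cmod ((z - w) - (z' - w')) + cmod (z - z') * (cmod (z - w) + cmod (z' - w')))"
  by (rule order_trans[OF sdD(3)[OF assms(1) b w b'] mrm[OF assms(2)]]) simp
qed

lemma sd_id: "sd R (max 1 R) (%z. z)"
 unfolding sd_def
proof (intro conjI allI impI)
 fix z w z' w' :: complex
 have "1 * (cmod ((z - w) - (z' - w')) + 0) <= max 1 R * (cmod ((z - w) - (z' - w')) + cmod (z - z') * (cmod (z - w) + cmod (z' - w')))"
  by (intro mult_mono add_left_mono) auto
 then show "cmod ((z - w) - (z' - w')) <= max 1 R * (cmod ((z - w) - (z' - w')) + cmod (z - z') * (cmod (z - w) + cmod (z' - w')))" by simp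
 show "cmod (z - w) <= max 1 R * cmod (z - w)" using mrm[of 1 "max 1 R" "cmod (z - w)"] by simp
qed auto

lemma sd_cnj: "sd R La Ph ==> sd R La (%z. cnj (Ph z))"
 unfolding sd_def by (simp flip: complex_cnj_diff)

lemma sd_mult:
 assumes P: "sd R La Ph" and Q: "sd R La Ps"
 shows "sd R (La^2 * (4 + 2 * \<bar>R\<bar>)) (%z. Ph z * Ps z)"
proof -
 have ge: "La^2 <= La^2 * (4 + 2 * \<bar>R\<bar>)" "2 * La^2 <= La^2 * (4 + 2 * \<bar>R\<bar>)"
  using mlm[of 1 "4 + 2 * \<bar>R\<bar>" "La^2"] mlm[of 2 "4 + 2 * \<bar>R\<bar>" "La^2"] by simp_all
 show ?thesis unfolding sd_def
 proof (intro conjI allI impI)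
  fix z w z' w' assume z: "cmod z <= R"
  have L: "La >= 0" using order_trans[OF norm_ge_zero sdD(1)[OF P z]] .
  have "cmod (Ph z * Ps z) <= La * La" unfolding norm_mult using sdD(1)[OF P z] sdD(1)[OF Q z] L by (intro mult_mono) auto
  then show "cmod (Ph z * Ps z) <= La^2 * (4 + 2 * \<bar>R\<bar>)" using ge by (simp add: psq)
  assume w: "cmod w <= R"
  have "cmod (Ph z * Ps z - Ph w * Ps w) = cmod ((Ph z - Ph w) * Ps z + Ph w * (Ps z - Ps w))" by (simp add: alg)
  also have "... <= (La * cmod (z - w)) * La + La * (La * cmod (z - w))"
  using sdD(1)[OF P w] sdD(1)[OF Q z] sdD(2)[OF P z w] sdD(2)[OF Q z w] L
  by (intro norm_triangle_mono) (auto simp: norm_mult intro!: mult_mono)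
  also have "... = 2 * La^2 * cmod (z - w)" by (simp add: psq)
  also have "... <= La^2 * (4 + 2 * \<bar>R\<bar>) * cmod (z - w)" using ge by (intro mrm) auto
  finally show "cmod (Ph z * Ps z - Ph w * Ps w) <= La^2 * (4 + 2 * \<bar>R\<bar>) * cmod (z - w)" .
  assume z': "cmod z' <= R" and w': "cmod w' <= R"
  define E where "E = cmod ((z - w) - (z' - w'))"
  define d where "d = cmod (z - z')"
  define p where "p = cmod (z - w)"
  define p' where "p' = cmod (z' - w')"
  have pos: "0 <= E" "0 <= d" "0 <= p" "0 <= p'" by (simp_all add: E_def d_def p_def p'_def)
  have ww: "cmod (w - w') <= d + E"
  using norm_triangle_ineq4[of "z - z'" "(z - w) - (z' - w')"] by (simp add: E_def d_def)
  have p2: "p <= 2 * \<bar>R\<bar>" using norm_triangle_ineq4[of z w] z w by (simp add: p_def)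
  have "cmod ((Ph z * Ps z - Ph w * Ps w) - (Ph z' * Ps z' - Ph w' * Ps w')) =
  cmod ((((Ph z - Ph w) - (Ph z' - Ph w')) * Ps z + (Ph z' - Ph w') * (Ps z - Ps z'))
  + ((Ph w - Ph w') * (Ps z - Ps w) + Ph w' * ((Ps z - Ps w) - (Ps z' - Ps w'))))"
  by (simp add: alg)
  also have "... <= ((La * (E + d * (p + p'))) * La + (La * p') * (La * d))
  + ((La * (d + E)) * (La * p) + La * (La * (E + d * (p + p'))))"
  unfolding E_def d_def p_def p'_def
  proof (intro norm_triangle_mono)
  show "cmod (((Ph z - Ph w) - (Ph z' - Ph w')) * Ps z) <= La * (cmod ((z - w) - (z' - w')) + cmod (z - z') * (cmod (z - w) + cmod (z' - w'))) * La"
  unfolding norm_mult using sdD(3)[OF P z w z' w'] sdD(1)[OF Q z] L by (intro mult_mono) auto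
  show "cmod ((Ph z' - Ph w') * (Ps z - Ps z')) <= La * cmod (z' - w') * (La * cmod (z - z'))"
  unfolding norm_mult using sdD(2)[OF P z' w'] sdD(2)[OF Q z z'] L by (intro mult_mono) auto
  have "cmod (Ph w - Ph w') <= La * (d + E)"
  using sdD(2)[OF P w w'] mlm[OF ww L] by linarith
  then show "cmod ((Ph w - Ph w') * (Ps z - Ps w)) <= La * (cmod (z - z') + cmod ((z - w) - (z' - w'))) * (La * cmod (z - w))"
  unfolding norm_mult using sdD(2)[OF Q z w] L by (intro mult_mono) (auto simp: E_def d_def)
  show "cmod (Ph w' * ((Ps z - Ps w) - (Ps z' - Ps w'))) <= La * (La * (cmod ((z - w) - (z' - w')) + cmod (z - z') * (cmod (z - w) + cmod (z' - w'))))"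
  unfolding norm_mult using sdD(3)[OF Q z w z' w'] sdD(1)[OF P w'] L by (intro mult_mono) auto
  qed
  also have "... = La^2 * (2 * (E + d * (p + p')) + d * (p + p') + p * E)" by (simp add: psq alg)
  also have "... <= La^2 * ((4 + 2 * \<bar>R\<bar>) * (E + d * (p + p')))"
  proof (rule mlm)
  have "p * E <= 2 * \<bar>R\<bar> * E" using p2 pos by (intro mrm) auto
  also have "... <= 2 * \<bar>R\<bar> * (E + d * (p + p'))" using pos by (intro mlm) auto
  finally have "p * E <= 2 * \<bar>R\<bar> * (E + d * (p + p'))" .
  moreover have "d * (p + p') <= E + d * (p + p')" using pos(1) by simp
  ultimately have "2 * (E + d * (p + p')) + d * (p + p') + p * E
  <= 2 * (E + d * (p + p')) + (E + d * (p + p')) + 2 * \<bar>R\<bar> * (E + d * (p + p'))"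
  by (intro add_mono order_refl)
  also have "... = (3 + 2 * \<bar>R\<bar>) * (E + d * (p + p'))" by (simp add: alg)
  also have "... <= (4 + 2 * \<bar>R\<bar>) * (E + d * (p + p'))" using pos by (intro mrm) auto
  finally show "2 * (E + d * (p + p')) + d * (p + p') + p * E <= (4 + 2 * \<bar>R\<bar>) * (E + d * (p + p'))" .
  qed simp
  finally show "cmod ((Ph z * Ps z - Ph w * Ps w) - (Ph z' * Ps z' - Ph w' * Ps w')) <=
  La^2 * (4 + 2 * \<bar>R\<bar>) * (cmod ((z - w) - (z' - w')) + cmod (z - z') * (cmod (z - w) + cmod (z' - w')))"
  by (simp add: E_def d_def p_def p'_def mult.assoc)
 qed
qed

context seg
begin

lemma Ck_deriv: "Ck_family k D ==> j < k ==> A \<subseteq> {0..} ==> s : A ==> (D j has_real_derivative D (Suc j) s) (at s within A)"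
 unfolding Ck_family_def by (rule DERIV_subset[of _ _ _ "{0..}"]) auto

lemma Ck_bound:
 assumes D: "Ck_family k D" and j: "j <= k"
 shows "\<exists>La\<ge>0. \<forall>s\<in>{0..S}. \<bar>D j s\<bar> <= La"
proof -
 obtain R where R: "!!s. 0 <= s ==> s <= S ==> \<bar>D j s\<bar> <= R" using Ck_family_bounded[OF D j, of S] by auto
 show ?thesis
 proof (intro exI[of _ "\<bar>R\<bar>"] conjI ballI)
  fix s assume "s : {0..S}" then show "\<bar>D j s\<bar> <= \<bar>R\<bar>" using R[of s] by auto
 qed simp
qed

lemma Ck_lipschitz:
 assumes D: "Ck_family k D" and j: "Suc j <= k"
 shows "\<exists>La\<ge>0. \<forall>s\<in>{0..S}. \<forall>r\<in>{0..S}. \<bar>D j s - D j r\<bar> <= La * \<bar>s - r\<bar>"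
proof -
 obtain La where L: "La >= 0" "!!s. s : {0..S} ==> \<bar>D (Suc j) s\<bar> <= La" using Ck_bound[OF D j, of S] by blast
 have "\<bar>D j s - D j r\<bar> <= La * \<bar>s - r\<bar>" if sr: "s : {0..S}" "r : {0..S}" for s r
 proof -
  have "norm (D j s - D j r) <= La * norm (s - r)"
  proof (rule field_differentiable_bound[of "{0..S}"])
  show "(D j has_field_derivative D (Suc j) x) (at x within {0..S})" if "x : {0..S}" for x
  using Ck_deriv[OF D _ _ that] j by auto
  show "norm (D (Suc j) x) <= La" if "x : {0..S}" for x using L(2)[OF that] by simp
  qed (use sr in auto)
  then show ?thesis by simp
 qed
 then show ?thesis using L(1) by blast
qed

lemma Ck_taylor:
 assumes D: "Ck_family k D" and j: "Suc (Suc j) <= k"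
 shows "\<exists>La\<ge>0. \<forall>s\<in>{0..S}. \<forall>r\<in>{0..S}. \<bar>D j r - D j s - D (Suc j) s * (r - s)\<bar> <= La * (r - s)^2"
proof -
 obtain La where L: "La >= 0" "!!s r. s : {0..S} ==> r : {0..S} ==> \<bar>D (Suc j) s - D (Suc j) r\<bar> <= La * \<bar>s - r\<bar>"
  using Ck_lipschitz[OF D j, of S] by blast
 have "\<bar>D j r - D j s - D (Suc j) s * (r - s)\<bar> <= La * (r - s)^2" if sr: "s : {0..S}" "r : {0..S}" for s r
 proof -
  let ?I = "{min s r..max s r}"
  have "norm ((D j r - D (Suc j) s * r) - (D j s - D (Suc j) s * s)) <= (La * \<bar>r - s\<bar>) * norm (r - s)"
  proof (rule field_differentiable_bound[of ?I "%t. D j t - D (Suc j) s * t" "%t. D (Suc j) t - D (Suc j) s"])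
  fix x assume x: "x : ?I"
  have "(D j has_real_derivative D (Suc j) x) (at x within ?I)"
  using Ck_deriv[OF D _ _ x] j sr by auto
  then show "((%t. D j t - D (Suc j) s * t) has_field_derivative D (Suc j) x - D (Suc j) s) (at x within ?I)"
  by (auto intro!: derivative_eq_intros)
  have "\<bar>D (Suc j) x - D (Suc j) s\<bar> <= La * \<bar>x - s\<bar>" using x sr by (intro L(2)) auto
  also have "... <= La * \<bar>r - s\<bar>" using x L(1) by (intro mlm) auto
  finally show "norm (D (Suc j) x - D (Suc j) s) <= La * \<bar>r - s\<bar>" by simp
  qed auto
  then show ?thesis by (simp add: alg psq abs_mult_self_eq)
 qed
 then show ?thesis using L(1) by blast
qed

text \<open>Move from \<open>r\<close> to \<open>s\<close> and from \<open>r'\<close> to \<open>s'\<close> simultaneously and bound the derivative of the difference along the way.\<close>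

lemma Ck_second_difference:
 assumes D: "Ck_family k D" and j: "Suc (Suc j) <= k" and S: "S >= 0"
 shows "\<exists>La\<ge>0. \<forall>s\<in>{0..S}. \<forall>r\<in>{0..S}. \<forall>s'\<in>{0..S}. \<forall>r'\<in>{0..S}.
  \<bar>(D j s - D j r) - (D j s' - D j r')\<bar> <= La * (\<bar>(s - r) - (s' - r')\<bar> + \<bar>s - s'\<bar> * \<bar>s' - r'\<bar>)"
proof -
 obtain A where A: "A >= 0" "!!s. s : {0..S} ==> \<bar>D (Suc j) s\<bar> <= A" using Ck_bound[OF D, of "Suc j" S] j by auto
 obtain B where B: "B >= 0" "!!s r. s : {0..S} ==> r : {0..S} ==> \<bar>D (Suc j) s - D (Suc j) r\<bar> <= B * \<bar>s - r\<bar>"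
  using Ck_lipschitz[OF D j, of S] by blast
 have "\<bar>(D j s - D j r) - (D j s' - D j r')\<bar> <= (A + B * (1 + S)) * (\<bar>(s - r) - (s' - r')\<bar> + \<bar>s - s'\<bar> * \<bar>s' - r'\<bar>)"
  if m: "s : {0..S}" "r : {0..S}" "s' : {0..S}" "r' : {0..S}" for s r s' r'
 proof -
  define e where "e = s - r" define e' where "e' = s' - r'"
  let ?g = "%th. D j (r + th * e) - D j (r' + th * e')"
  let ?K = "A * \<bar>e - e'\<bar> + B * (\<bar>s - s'\<bar> + \<bar>e - e'\<bar>) * \<bar>e'\<bar>"
  have rng: "r + th * e : {0..S}" "r' + th * e' : {0..S}" if "th : {0..1}" for th
  proof -
  have conv: "p + th * (q - p) : {0..S}" if "p : {0..S}" "q : {0..S}" for p q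
  proof -
  have "(1 - th) *\<^sub>R p + th *\<^sub>R q : {0..S}"
  using that \<open>th \<in> {0..1}\<close> by (intro convexD[OF convex_real_interval(5)]) auto
  then show ?thesis by (simp add: alg)
  qed
  show "r + th * e : {0..S}" "r' + th * e' : {0..S}" unfolding e_def e'_def using conv m by auto
  qed
  have "norm (?g 1 - ?g 0) <= ?K * norm (1 - 0 :: real)"
  proof (rule field_differentiable_bound[of "{0..1}" ?g "%th. D (Suc j) (r + th * e) * e - D (Suc j) (r' + th * e') * e'"])
  fix th :: real assume th: "th : {0..1}"
  have d1: "((%th. D j (p + th * q)) has_real_derivative D (Suc j) (p + th * q) * q) (at th within {0..1})"
  if "!!th. th : {0..1} ==> p + th * q : {0..S}" for p q
  proof -
  have q1: "(D j has_real_derivative D (Suc j) (p + th * q)) (at (p + th * q) within (%th. p + th * q) ` {0..1})"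
  proof (rule Ck_deriv[OF D])
  show "j < k" using j by simp
  show "p + th * q : (%th. p + th * q) ` {0..1}" using th by (rule imageI)
  show "(%th. p + th * q) ` {0..1} \<subseteq> {0..}"
  proof
  fix y assume "y : (%th. p + th * q) ` {0..1}"
  then obtain et where "et : {0..1}" "y = p + et * q" by blast
  then show "y : {0..}" using that[of et] by simp
  qed
  qed
  have q2: "((%th. p + th * q) has_real_derivative q) (at th within {0..1})"
  by (auto intro!: derivative_eq_intros)
  show ?thesis using DERIV_image_chain[OF q1 q2] by (simp add: o_def)
  qed
  show "(?g has_field_derivative D (Suc j) (r + th * e) * e - D (Suc j) (r' + th * e') * e') (at th within {0..1})"
  using rng by (intro DERIV_diff d1) auto
  have 1: "\<bar>D (Suc j) (r + th * e)\<bar> <= A" by (rule A(2)[OF rng(1)[OF th]])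
  have "\<bar>(r + th * e) - (r' + th * e')\<bar> = \<bar>(s - s') - (1 - th) * (e - e')\<bar>" by (simp add: e_def e'_def alg)
  also have "... <= \<bar>s - s'\<bar> + \<bar>(1 - th) * (e - e')\<bar>" by (rule abs_triangle_ineq4)
  also have "\<bar>(1 - th) * (e - e')\<bar> <= 1 * \<bar>e - e'\<bar>" unfolding abs_mult using th by (intro mrm) auto
  finally have "\<bar>(r + th * e) - (r' + th * e')\<bar> <= \<bar>s - s'\<bar> + \<bar>e - e'\<bar>" by simp
  from order_trans[OF B(2)[OF rng[OF th]] mlm[OF this B(1)]]
  have 2: "\<bar>D (Suc j) (r + th * e) - D (Suc j) (r' + th * e')\<bar> <= B * (\<bar>s - s'\<bar> + \<bar>e - e'\<bar>)" .
  have "D (Suc j) (r + th * e) * e - D (Suc j) (r' + th * e') * e' =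
  D (Suc j) (r + th * e) * (e - e') + (D (Suc j) (r + th * e) - D (Suc j) (r' + th * e')) * e'" by (simp add: alg)
  also have "\<bar>...\<bar> <= ?K"
  by (rule order_trans[OF abs_triangle_ineq], unfold abs_mult) (intro add_mono mrm 1 2; simp)
  finally show "norm (D (Suc j) (r + th * e) * e - D (Suc j) (r' + th * e') * e') <= ?K" by simp
  qed auto
  then have "\<bar>(D j s - D j r) - (D j s' - D j r')\<bar> <= ?K" by (simp add: e_def e'_def alg)
  also have "?K <= A * \<bar>e - e'\<bar> + B * (\<bar>s - s'\<bar> * \<bar>e'\<bar> + \<bar>e - e'\<bar> * S)"
  proof -
  have "\<bar>e - e'\<bar> * \<bar>e'\<bar> <= \<bar>e - e'\<bar> * S" using m by (intro mlm) (auto simp: e'_def)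
  then have "B * ((\<bar>s - s'\<bar> + \<bar>e - e'\<bar>) * \<bar>e'\<bar>) <= B * (\<bar>s - s'\<bar> * \<bar>e'\<bar> + \<bar>e - e'\<bar> * S)"
  using B(1) by (intro mlm) (auto simp: distrib_right)
  then show ?thesis by (simp add: mult.assoc)
  qed
  also have "... <= (A + B * (1 + S)) * (\<bar>e - e'\<bar> + \<bar>s - s'\<bar> * \<bar>e'\<bar>)"
  using A(1) B(1) S by (simp add: alg)
  finally show ?thesis by (simp add: e_def e'_def)
 qed
 moreover have "A + B * (1 + S) >= 0" using A(1) B(1) S by simp
 ultimately show ?thesis by blast
qed

lemma sd_chain:
 assumes D: "Ck_family k D" and j: "Suc (Suc j) <= k" and s: "sd R La (%z. of_real (s z))" and pos: "!!z. s z >= 0" and L: "La >= 0"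
 shows "\<exists>La'. sd R La' (%z. of_real (D j (s z)))"
proof -
 obtain A where A: "A >= 0" "!!s. s : {0..La} ==> \<bar>D j s\<bar> <= A" using Ck_bound[OF D, of j La] j by auto
 obtain B where B: "B >= 0" "!!s r. s : {0..La} ==> r : {0..La} ==> \<bar>D j s - D j r\<bar> <= B * \<bar>s - r\<bar>"
  using Ck_lipschitz[OF D, of j La] j by auto
 obtain C where C: "C >= 0" "!!s r s' r'. s : {0..La} ==> r : {0..La} ==> s' : {0..La} ==> r' : {0..La} ==>
  \<bar>(D j s - D j r) - (D j s' - D j r')\<bar> <= C * (\<bar>(s - r) - (s' - r')\<bar> + \<bar>s - s'\<bar> * \<bar>s' - r'\<bar>)"
  using Ck_second_difference[OF D j L] by blast
 define K where "K = A + B * La + C * (La + La * La)"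
 have K: "A <= K" "B * La <= K" "C * (La + La * La) <= K" using A(1) B(1) C(1) L by (auto simp: K_def)
 have m: "s z : {0..La}" if "cmod z <= R" for z using sdD(1)[OF s that] pos[of z] by simp
 have l: "\<bar>s z - s w\<bar> <= La * cmod (z - w)" if "cmod z <= R" "cmod w <= R" for z w
  using sdD(2)[OF s that] by (simp flip: of_real_diff)
 have "sd R K (%z. of_real (D j (s z)))" unfolding sd_def
 proof (intro conjI allI impI)
  fix z w z' w' assume z: "cmod z <= R"
  show "cmod (of_real (D j (s z))) <= K" using A(2)[OF m[OF z]] K by simp
  assume w: "cmod w <= R"
  have "\<bar>D j (s z) - D j (s w)\<bar> <= B * (La * cmod (z - w))"
  using B(2)[OF m[OF z] m[OF w]] mlm[OF l[OF z w] B(1)] by linarith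
  also have "... <= K * cmod (z - w)" unfolding mult.assoc[symmetric] using K by (intro mrm) auto
  finally show "cmod (of_real (D j (s z)) - of_real (D j (s w))) <= K * cmod (z - w)" by (simp flip: of_real_diff)
  assume z': "cmod z' <= R" and w': "cmod w' <= R"
  define E where "E = cmod ((z - w) - (z' - w'))"
  define d where "d = cmod (z - z')"
  define q where "q = cmod (z - w) + cmod (z' - w')"
  have pos': "0 <= E" "0 <= d" "0 <= q" by (simp_all add: E_def d_def q_def)
  have "\<bar>(s z - s w) - (s z' - s w')\<bar> <= La * (E + d * q)"
  using sdD(3)[OF s z w z' w'] by (simp add: E_def d_def q_def flip: of_real_diff)
  moreover have "\<bar>s z - s z'\<bar> * \<bar>s z' - s w'\<bar> <= (La * d) * (La * q)"
  proof (rule mult_mono)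
  show "\<bar>s z - s z'\<bar> <= La * d" unfolding d_def by (rule l[OF z z'])
  have "La * cmod (z' - w') <= La * q" using L by (intro mlm) (auto simp: q_def)
  then show "\<bar>s z' - s w'\<bar> <= La * q" using l[OF z' w'] by linarith
  qed (use L pos' in auto)
  moreover have "(La * d) * (La * q) <= (La * La) * (E + d * q)"
  using mnn[OF mnn[OF L L] pos'(1)] by (simp add: alg)
  ultimately have "\<bar>(s z - s w) - (s z' - s w')\<bar> + \<bar>s z - s z'\<bar> * \<bar>s z' - s w'\<bar> <= (La + La * La) * (E + d * q)"
  unfolding distrib_right by linarith
  then have "\<bar>(D j (s z) - D j (s w)) - (D j (s z') - D j (s w'))\<bar> <= C * ((La + La * La) * (E + d * q))"
  using C(2)[OF m[OF z] m[OF w] m[OF z'] m[OF w']] mlm[OF _ C(1)] by (meson order_trans)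
  also have "... <= K * (E + d * q)" unfolding mult.assoc[symmetric] using K(3) pos' by (intro mrm) auto
  finally have "\<bar>(D j (s z) - D j (s w)) - (D j (s z') - D j (s w'))\<bar> <= K * (E + d * q)" .
  then show "cmod (of_real (D j (s z)) - of_real (D j (s w)) - (of_real (D j (s z')) - of_real (D j (s w')))) <=
  K * (cmod (z - w - (z' - w')) + cmod (z - z') * (cmod (z - w) + cmod (z' - w')))"
  unfolding of_real_diff[symmetric] norm_of_real E_def d_def q_def .
 qed
 then show ?thesis by blast
qed

lemma sd_Fnl:
 assumes D: "Ck_family k D" "D 0 = f" and k: "k >= 2"
 shows "\<exists>La\<ge>0. sd R La (Fnl f)"
proof -
 let ?L1 = "(max 1 R)^2 * (4 + 2 * \<bar>R\<bar>)"
 have "sd R ?L1 (%z. z * cnj z)" by (rule sd_mult[OF sd_id sd_cnj[OF sd_id]])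
 then have s: "sd R ?L1 (%z. of_real ((cmod z)^2))" by (simp only: complex_norm_square)
 obtain L2 where L2: "sd R L2 (%z. of_real (D 0 ((cmod z)^2)))"
  using sd_chain[OF D(1) _ s, of 0] k by auto
 define L3 where "L3 = max L2 (max 1 R)"
 have "sd R (L3^2 * (4 + 2 * \<bar>R\<bar>)) (%z. of_real (D 0 ((cmod z)^2)) * z)"
  by (rule sd_mult[OF sd_mono[OF L2] sd_mono[OF sd_id]]) (auto simp: L3_def)
 moreover have "(%z. of_real (D 0 ((cmod z)^2)) * z) = Fnl f"
  by (rule ext) (simp add: Fnl_def D(2) sRc)
 moreover have "L3^2 * (4 + 2 * \<bar>R\<bar>) >= 0" by simp
 ultimately show ?thesis by metis
qed

text \<open>Triples \<open>u(t - ts), u(t), u(t + r ts)\<close> of values of a curve with bounded second time derivative, with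
 all norms in \<open>H\<^sup>1\<close>.\<close>

definition Zt :: "real => real => real => (real => complex) => (real => complex) => (real => complex) => bool" where
 "Zt C t r um u0 up \<longleftrightarrow> rg 1 False C u0 & rg 1 False (C * t) (%x. u0 x - um x) &
  rg 1 False (C * t^2) (%x. up x - u0 x - of_real r * (u0 x - um x))"

lemma reg1_mult:
 assumes u: "rg 1 False A u" and v: "rg 1 False B v"
 shows "rg 1 False (2 * (A * B)) (%x. u x * v x)"
proof -
 have AB: "A >= 0" "B >= 0" using reg_nonneg[OF u] reg_nonneg[OF v] by auto
 from u obtain u' where u': "ac u u'" "!!x. x : {a..b} ==> cmod (u x) <= A" "rg 0 True A u'"
  unfolding One_nat_def by (rule reg_SucE) auto
 from v obtain v' where v': "ac v v'" "!!x. x : {a..b} ==> cmod (v x) <= B" "rg 0 True B v'"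
  unfolding One_nat_def by (rule reg_SucE) auto
 have L: "u' : LL" "nrm u' <= A" "v' : LL" "nrm v' <= B" using u' v' by auto
 have 1: "(%x. u x * v' x) : LL" "nrm (%x. u x * v' x) <= A * nrm v'"
  using L2_bounded_mult[OF L(3) Om_measurable_cont[OF AC_continuous[OF u'(1)]], of A] u'(2) by auto
 have 2: "(%x. v x * u' x) : LL" "nrm (%x. v x * u' x) <= B * nrm u'"
  using L2_bounded_mult[OF L(1) Om_measurable_cont[OF AC_continuous[OF v'(1)]], of B] v'(2) by auto
 have "A * nrm v' <= A * B" "B * nrm u' <= A * B"
  using mlm[OF L(4) AB(1)] mlm[OF L(2) AB(2)] by (auto simp: mult.commute)
 then have 3: "rg 0 True (2 * (A * B)) (%x. u x * v' x + v x * u' x)"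
  using L2_add[OF 1(1) 2(1)] 1(2) 2(2) by auto
 show ?thesis unfolding One_nat_def
 proof (rule reg_SucI[OF AC_mult[OF u'(1) v'(1)]])
  fix x assume x: "x : {a..b}"
  have "cmod (u x * v x) <= A * B" unfolding norm_mult using u'(2)[OF x] v'(2)[OF x] AB by (intro mult_mono) auto
  then show "cmod (u x * v x) <= 2 * (A * B)" using mnn[OF AB] by linarith
 qed (use 3 in auto)
qed

lemma reg1_rcmult: "rg 1 False A u ==> 0 <= r ==> r <= 1 ==> rg 1 False A (%x. of_real r * u x)"
 using reg_mono[OF reg_cmult[of 1 False A u "of_real r"], of A] reg_nonneg[of 1 False A u] mrm[of r 1 A] by simp

lemma Zt_next:
 assumes Z: "Zt C t r um u0 up" and t: "0 < t" "t <= 1" and r: "0 <= r" "r <= 1"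
 shows "rg 1 False (2 * (C * t)) (%x. up x - u0 x)" "rg 1 False (3 * C) up" "rg 1 False (2 * C) um" "C >= 0"
proof -
 have z: "rg 1 False C u0" "rg 1 False (C * t) (%x. u0 x - um x)"
  "rg 1 False (C * t^2) (%x. up x - u0 x - of_real r * (u0 x - um x))" using Z unfolding Zt_def by auto
 show C: "C >= 0" by (rule reg_nonneg[OF z(1)])
 have ct: "C * t^2 <= C * t" "C * t <= C"
  using C t mlm[of "t * t" t C] mlm[of t 1 C] mlm[of t 1 t] by (auto simp: psq)
 show A: "rg 1 False (2 * (C * t)) (%x. up x - u0 x)"
  using reg_mono[OF reg_add[OF z(3) reg1_rcmult[OF z(2) r]], of "2 * (C * t)"] ct by simp
 show "rg 1 False (3 * C) up"
  using reg_mono[OF reg_add[OF A z(1)], of "3 * C"] ct by simp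
 show "rg 1 False (2 * C) um"
  using reg_mono[OF reg_diff[OF z(1) z(2)], of "2 * C"] ct by simp
qed

lemma Zt_mono:
 assumes Z: "Zt C t r um u0 up" and t: "0 < t" and C: "C <= C'"
 shows "Zt C' t r um u0 up"
 using Z unfolding Zt_def by (auto intro!: reg_mono[of _ _ C] reg_mono[of _ _ "C * t" _ "C' * t"] reg_mono[of _ _ "C * t^2" _ "C' * t^2"] mrm C less_imp_le[OF t])

lemma Zt_cnj: "Zt C t r um u0 up ==> Zt C t r (%x. cnj (um x)) (%x. cnj (u0 x)) (%x. cnj (up x))"
 unfolding Zt_def using reg_cnj[of 1 False C u0] reg_cnj[of 1 False "C * t" "%x. u0 x - um x"]
  reg_cnj[of 1 False "C * t^2" "%x. up x - u0 x - of_real r * (u0 x - um x)"] by simp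

text \<open>Leibniz rule for the first and second differences.\<close>

lemma Zt_mult:
 assumes U: "Zt C t r um u0 up" and V: "Zt C t r vm v0 vp" and t: "0 < t" "t <= 1" and r: "0 <= r" "r <= 1"
 shows "Zt (14 * C^2) t r (%x. um x * vm x) (%x. u0 x * v0 x) (%x. up x * vp x)"
proof -
 have u: "rg 1 False C u0" "rg 1 False (C * t) (%x. u0 x - um x)"
  "rg 1 False (C * t^2) (%x. up x - u0 x - of_real r * (u0 x - um x))" using U unfolding Zt_def by auto
 have v: "rg 1 False C v0" "rg 1 False (C * t) (%x. v0 x - vm x)"
  "rg 1 False (C * t^2) (%x. vp x - v0 x - of_real r * (v0 x - vm x))" using V unfolding Zt_def by auto
 note un = Zt_next[OF U t r] and vn = Zt_next[OF V t r]
 have C: "C >= 0" by (rule un(4))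
 show ?thesis unfolding Zt_def
 proof (intro conjI)
  show "rg 1 False (14 * C^2) (%x. u0 x * v0 x)"
  using reg_mono[OF reg1_mult[OF u(1) v(1)], of "14 * C^2"] by (simp add: psq)
  have "rg 1 False (2 * ((C * t) * C) + 2 * ((2 * C) * (C * t))) (%x. (u0 x - um x) * v0 x + um x * (v0 x - vm x))"
  by (rule reg_add[OF reg1_mult[OF u(2) v(1)] reg1_mult[OF un(3) v(2)]])
  moreover have "(%x. (u0 x - um x) * v0 x + um x * (v0 x - vm x)) = (%x. u0 x * v0 x - um x * vm x)"
  by (rule ext) (simp add: alg)
  ultimately show "rg 1 False (14 * C^2 * t) (%x. u0 x * v0 x - um x * vm x)"
  using reg_mono t C by (simp add: psq)
  have "rg 1 False ((2 * (C * (C * t^2)) + 2 * ((C * t^2) * C)) + (2 * ((2 * (C * t)) * (2 * (C * t))) + 2 * ((C * t) * (C * t))))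
  (%x. (u0 x * (vp x - v0 x - of_real r * (v0 x - vm x)) + (up x - u0 x - of_real r * (u0 x - um x)) * v0 x)
  + ((up x - u0 x) * (vp x - v0 x) + (of_real r * (u0 x - um x)) * (v0 x - vm x)))"
  by (rule reg_add[OF reg_add[OF reg1_mult[OF u(1) v(3)] reg1_mult[OF u(3) v(1)]]
  reg_add[OF reg1_mult[OF un(1) vn(1)] reg1_mult[OF reg1_rcmult[OF u(2) r] v(2)]]])
  moreover have "(%x. (u0 x * (vp x - v0 x - of_real r * (v0 x - vm x)) + (up x - u0 x - of_real r * (u0 x - um x)) * v0 x)
  + ((up x - u0 x) * (vp x - v0 x) + (of_real r * (u0 x - um x)) * (v0 x - vm x)))
  = (%x. up x * vp x - u0 x * v0 x - of_real r * (u0 x * v0 x - um x * vm x))"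
  by (rule ext) (simp add: alg)
  ultimately show "rg 1 False (14 * C^2 * t^2) (%x. up x * vp x - u0 x * v0 x - of_real r * (u0 x * v0 x - um x * vm x))"
  using reg_mono t C by (simp add: psq)
 qed
qed

lemma L2_real_mult:
 assumes c: "cont c" "!!x. x : {a..b} ==> \<bar>c x\<bar> <= K" and w: "w : LL" "nrm w <= W" and K: "K >= 0"
 shows "(%x. of_real (c x) * w x) : LL" "nrm (%x. of_real (c x) * w x) <= K * W"
proof -
 have m: "(%x. cr (c x)) : borel_measurable (OM)" by (intro Om_measurable_cont continuous_intros c(1))
 have b: "cmod (of_real (c x)) <= K" if "x : {a<..<b}" for x using c(2)[of x] that by simp
 show "(%x. of_real (c x) * w x) : LL" by (rule L2_bounded_mult(1)[OF w(1) m b])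
 have "nrm (%x. of_real (c x) * w x) <= K * nrm w" by (rule L2_bounded_mult(2)[OF w(1) m b])
 then show "nrm (%x. of_real (c x) * w x) <= K * W" using mlm[OF w(2) K] by linarith
qed

lemma second_difference_bound:
 fixes g g' :: "real => real"
 assumes T: "!!s r. s : {0..S} ==> r : {0..S} ==> \<bar>g r - g s - g' s * (r - s)\<bar> <= L * (r - s)^2"
  and L: "L >= 0" "!!s. s : {0..S} ==> \<bar>g' s\<bar> <= L"
  and s: "sm : {0..S}" "s0 : {0..S}" "sp : {0..S}" and r: "0 <= r" "r <= 1" and C: "C >= 0" and t: "t >= 0"
  and d: "\<bar>sp - s0\<bar> <= 2 * (C * t)" "\<bar>s0 - sm\<bar> <= C * t" "\<bar>sp - s0 - r * (s0 - sm)\<bar> <= C * t^2"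
 shows "\<bar>g sp - g s0 - r * (g s0 - g sm)\<bar> <= L * (C + 5 * C^2) * t^2"
proof -
 define \<rho>1 where "\<rho>1 = g sp - g s0 - g' s0 * (sp - s0)"
 define \<rho>2 where "\<rho>2 = g sm - g s0 - g' s0 * (sm - s0)"
 have "(sp - s0)^2 <= (2 * (C * t))^2" using d(1) abs_le_square_iff[of "sp - s0" "2 * (C * t)"] C t by simp
 then have 1: "\<bar>\<rho>1\<bar> <= L * (4 * C^2 * t^2)"
  using T[OF s(2,3)] mlm[of "(sp - s0)^2" "(2 * (C * t))^2" L] L unfolding \<rho>1_def by (simp add: pmd)
 have "(sm - s0)^2 <= (C * t)^2" using d(2) abs_le_square_iff[of "sm - s0" "C * t"] C t by (simp add: abs_minus_commute)
 then have 2: "\<bar>\<rho>2\<bar> <= L * (C^2 * t^2)"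
  using T[OF s(2,1)] mlm[of "(sm - s0)^2" "(C * t)^2" L] L unfolding \<rho>2_def by (simp add: pmd)
 have 3: "\<bar>g' s0 * (sp - s0 - r * (s0 - sm))\<bar> <= L * (C * t^2)"
  unfolding abs_mult using L(2)[OF s(2)] d(3) L(1) by (intro mult_mono) auto
 have 4: "\<bar>r * \<rho>2\<bar> <= \<bar>\<rho>2\<bar>" unfolding abs_mult using r by (intro mult_left_le_one_le) auto
 have "g sp - g s0 - r * (g s0 - g sm) = g' s0 * (sp - s0 - r * (s0 - sm)) + \<rho>1 + r * \<rho>2"
  by (simp add: \<rho>1_def \<rho>2_def alg)
 then have "\<bar>g sp - g s0 - r * (g s0 - g sm)\<bar> <= L * (C * t^2) + L * (4 * C^2 * t^2) + L * (C^2 * t^2)"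
  using 1 2 3 4 by linarith
 also have "... = L * (C + 5 * C^2) * t^2" by (simp add: alg)
 finally show ?thesis .
qed

lemma Zt_chain:
 assumes D: "Ck_family k D" and j: "Suc (Suc (Suc j)) <= k" and C: "C >= 0"
 shows "\<exists>C'. \<forall>t r sm s0 sp. 0 < t --> t <= 1 --> 0 <= r --> r <= 1 -->
  (\<forall>x\<in>{a..b}. 0 <= sm x & 0 <= s0 x & 0 <= sp x) -->
  Zt C t r (%x. of_real (sm x)) (%x. of_real (s0 x)) (%x. of_real (sp x)) -->
  Zt C' t r (%x. of_real (D j (sm x))) (%x. of_real (D j (s0 x))) (%x. of_real (D j (sp x)))"
proof -
 define S where "S = 3 * C"
 define La where "La L \<longleftrightarrow> L >= 0 & (\<forall>s\<in>{0..S}. \<bar>D j s\<bar> <= L & \<bar>D (Suc j) s\<bar> <= L & \<bar>D (Suc (Suc j)) s\<bar> <= L) &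
  (\<forall>s\<in>{0..S}. \<forall>r\<in>{0..S}. \<bar>D j s - D j r\<bar> <= L * \<bar>s - r\<bar> & \<bar>D (Suc j) s - D (Suc j) r\<bar> <= L * \<bar>s - r\<bar> &
  \<bar>D j r - D j s - D (Suc j) s * (r - s)\<bar> <= L * (r - s)^2 &
  \<bar>D (Suc j) r - D (Suc j) s - D (Suc (Suc j)) s * (r - s)\<bar> <= L * (r - s)^2)" for L
 obtain L where "La L"
 proof -
  have jk: "j <= k" "Suc j <= k" "Suc (Suc j) <= k" using j by auto
  obtain B0 where B0: "!!s. s : {0..S} ==> \<bar>D j s\<bar> <= B0" "B0 >= 0" using Ck_bound[OF D jk(1), of S] by blast
  obtain B1 where B1: "!!s. s : {0..S} ==> \<bar>D (Suc j) s\<bar> <= B1" "B1 >= 0" using Ck_bound[OF D jk(2), of S] by blast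
  obtain B2 where B2: "!!s. s : {0..S} ==> \<bar>D (Suc (Suc j)) s\<bar> <= B2" "B2 >= 0" using Ck_bound[OF D jk(3), of S] by blast
  obtain P0 where P0: "!!s r. s : {0..S} ==> r : {0..S} ==> \<bar>D j s - D j r\<bar> <= P0 * \<bar>s - r\<bar>" "P0 >= 0"
  using Ck_lipschitz[OF D jk(2), of S] by blast
  obtain P1 where P1: "!!s r. s : {0..S} ==> r : {0..S} ==> \<bar>D (Suc j) s - D (Suc j) r\<bar> <= P1 * \<bar>s - r\<bar>" "P1 >= 0"
  using Ck_lipschitz[OF D jk(3), of S] by blast
  obtain T0 where T0: "!!s r. s : {0..S} ==> r : {0..S} ==> \<bar>D j r - D j s - D (Suc j) s * (r - s)\<bar> <= T0 * (r - s)^2" "T0 >= 0"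
  using Ck_taylor[OF D jk(3), of S] by blast
  obtain T1 where T1: "!!s r. s : {0..S} ==> r : {0..S} ==> \<bar>D (Suc j) r - D (Suc j) s - D (Suc (Suc j)) s * (r - s)\<bar> <= T1 * (r - s)^2" "T1 >= 0"
  using Ck_taylor[OF D j, of S] by blast
  define L where "L = B0 + B1 + B2 + P0 + P1 + T0 + T1"
  have le: "B0 <= L" "B1 <= L" "B2 <= L" "P0 <= L" "P1 <= L" "T0 <= L" "T1 <= L" "L >= 0"
  using B0 B1 B2 P0 P1 T0 T1 by (auto simp: L_def)
  have "La L" unfolding La_def
  proof (intro conjI ballI)
  show "L >= 0" by (rule le(8))
  fix s assume s: "s : {0..S}"
  show "\<bar>D j s\<bar> <= L" "\<bar>D (Suc j) s\<bar> <= L" "\<bar>D (Suc (Suc j)) s\<bar> <= L"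
  using B0(1)[OF s] B1(1)[OF s] B2(1)[OF s] le by linarith+
  fix r assume r: "r : {0..S}"
  have "P0 * \<bar>s - r\<bar> <= L * \<bar>s - r\<bar>" "P1 * \<bar>s - r\<bar> <= L * \<bar>s - r\<bar>" "T0 * (r - s)^2 <= L * (r - s)^2" "T1 * (r - s)^2 <= L * (r - s)^2"
  by (intro mrm le; simp)+
  then show "\<bar>D j s - D j r\<bar> <= L * \<bar>s - r\<bar>" "\<bar>D (Suc j) s - D (Suc j) r\<bar> <= L * \<bar>s - r\<bar>"
  "\<bar>D j r - D j s - D (Suc j) s * (r - s)\<bar> <= L * (r - s)^2"
  "\<bar>D (Suc j) r - D (Suc j) s - D (Suc (Suc j)) s * (r - s)\<bar> <= L * (r - s)^2"
  using P0(1)[OF s r] P1(1)[OF s r] T0(1)[OF s r] T1(1)[OF s r] by linarith+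
  qed
  then show ?thesis using that by blast
 qed
 then have L0: "L >= 0" and B: "!!s. s : {0..S} ==> \<bar>D j s\<bar> <= L" "!!s. s : {0..S} ==> \<bar>D (Suc j) s\<bar> <= L" "!!s. s : {0..S} ==> \<bar>D (Suc (Suc j)) s\<bar> <= L"
  and P: "!!s r. s : {0..S} ==> r : {0..S} ==> \<bar>D j s - D j r\<bar> <= L * \<bar>s - r\<bar>" "!!s r. s : {0..S} ==> r : {0..S} ==> \<bar>D (Suc j) s - D (Suc j) r\<bar> <= L * \<bar>s - r\<bar>"
  and T: "!!s r. s : {0..S} ==> r : {0..S} ==> \<bar>D j r - D j s - D (Suc j) s * (r - s)\<bar> <= L * (r - s)^2"
  "!!s r. s : {0..S} ==> r : {0..S} ==> \<bar>D (Suc j) r - D (Suc j) s - D (Suc (Suc j)) s * (r - s)\<bar> <= L * (r - s)^2"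
  unfolding La_def by blast+
 define C' where "C' = L * (1 + 2 * C + 9 * C^2 + 5 * (C * C^2))"
 have C2: "C^2 >= 0" "C * C^2 >= 0" using C by auto
 have le: "L <= C'" "L * C <= C'" "L * (C + 5 * C^2) <= C'" "L * C * C + L * C <= C'" 
  "L * (C + 5 * C^2) * C + L * C + L * (3 * C) * C <= C'"
 proof -
  have "L * 1 <= C'" "L * C <= C'" "L * (C + 5 * C^2) <= C'" "L * (C^2 + C) <= C'" "L * (C^2 + 5 * (C * C^2) + C + 3 * C^2) <= C'"
  unfolding C'_def using L0 C C2 by (intro mlm; linarith)+
  then show "L <= C'" "L * C <= C'" "L * (C + 5 * C^2) <= C'" "L * C * C + L * C <= C'" 
  "L * (C + 5 * C^2) * C + L * C + L * (3 * C) * C <= C'"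
  by (simp_all add: alg psq)
 qed
 show ?thesis
 proof (intro exI allI impI)
  fix t r sm s0 sp
  assume t: "0 < t" "t <= 1" and r: "0 <= r" "r <= (1::real)"
  and pos: "\<forall>x\<in>{a..b}. 0 <= sm x & 0 <= s0 x & 0 <= sp x"
  and Z: "Zt C t r (%x. of_real (sm x)) (%x. of_real (s0 x)) (%x. of_real (sp x))"
  have z: "rg (Suc 0) False C (%x. of_real (s0 x))" "rg (Suc 0) False (C * t) (%x. of_real (s0 x) - of_real (sm x))"
  "rg (Suc 0) False (C * t^2) (%x. of_real (sp x) - of_real (s0 x) - of_real r * (of_real (s0 x) - of_real (sm x)))"
  using Z unfolding Zt_def by auto
  note zn = Zt_next[OF Z t r]
  obtain s' where s': "ac (%x. of_real (s0 x)) s'" "!!x. x : {a..b} ==> cmod (of_real (s0 x)) <= C" "rg 0 True C s'"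
  using z(1) by (rule reg_SucE) auto
  obtain e1 where e1: "ac (%x. of_real (s0 x) - of_real (sm x)) e1" "!!x. x : {a..b} ==> cmod (of_real (s0 x) - of_real (sm x)) <= C * t" "rg 0 True (C * t) e1"
  using z(2) by (rule reg_SucE) auto
  obtain e2 where e2: "ac (%x. of_real (sp x) - of_real (s0 x) - of_real r * (of_real (s0 x) - of_real (sm x))) e2"
  "!!x. x : {a..b} ==> cmod (of_real (sp x) - of_real (s0 x) - of_real r * (of_real (s0 x) - of_real (sm x))) <= C * t^2" "rg 0 True (C * t^2) e2"
  using z(3) by (rule reg_SucE) auto
  have lL: "s' : LL" "nrm s' <= C" "e1 : LL" "nrm e1 <= C * t" "e2 : LL" "nrm e2 <= C * t^2"
  using s'(3) e1(3) e2(3) by auto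
  have ACm: "ac (%x. of_real (sm x)) (%x. s' x - e1 x)"
  using AC_diff_fun[OF s'(1) e1(1)] by simp
  have ACp: "ac (%x. of_real (sp x)) (%x. s' x + (of_real r * e1 x + e2 x))"
  using AC_add[OF s'(1) AC_add[OF AC_cmult[OF e1(1), of "of_real r"] e2(1)]] by simp
  have fd: "!!r. r >= 0 ==> (D j has_real_derivative D (Suc j) r) (at r within {0..})" "continuous_on {0..} (D (Suc j))"
  using D j unfolding Ck_family_def by auto
  have A0: "ac (%x. of_real (D j (s0 x))) (%x. of_real (D (Suc j) (s0 x)) * s' x)"
  by (rule AC_chain[OF s'(1) _ fd]) (use pos in auto)
  have Am: "ac (%x. of_real (D j (sm x))) (%x. of_real (D (Suc j) (sm x)) * (s' x - e1 x))"
  by (rule AC_chain[OF ACm _ fd]) (use pos in auto)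
  have Ap: "ac (%x. of_real (D j (sp x))) (%x. of_real (D (Suc j) (sp x)) * (s' x + (of_real r * e1 x + e2 x)))"
  by (rule AC_chain[OF ACp _ fd]) (use pos in auto)
  have cs: "cont s0" "cont sm" "cont sp"
  using continuous_on_Re[OF AC_continuous[OF s'(1)]] continuous_on_Re[OF AC_continuous[OF ACm]] continuous_on_Re[OF AC_continuous[OF ACp]] by simp_all
  have cD: "cont (%x. D (Suc j) (s0 x))" "cont (%x. D (Suc j) (sm x))" "cont (%x. D (Suc j) (sp x))"
  by (rule continuous_on_compose2[OF fd(2)]; use cs pos in auto)+
  have rng: "sm x : {0..S}" "s0 x : {0..S}" "sp x : {0..S}" if x: "x : {a..b}" for x
  proof -
  have "\<bar>sp x\<bar> <= 3 * C" using reg_sup[OF zn(2)[unfolded One_nat_def] x] by simp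
  moreover have "\<bar>sm x\<bar> <= 2 * C" using reg_sup[OF zn(3)[unfolded One_nat_def] x] by simp
  moreover have "\<bar>s0 x\<bar> <= C" using s'(2)[OF x] by simp
  ultimately show "sm x : {0..S}" "s0 x : {0..S}" "sp x : {0..S}" using pos x C by (auto simp: S_def)
  qed
  have d: "\<bar>sp x - s0 x\<bar> <= 2 * (C * t)" "\<bar>s0 x - sm x\<bar> <= C * t" "\<bar>sp x - s0 x - r * (s0 x - sm x)\<bar> <= C * t^2" if x: "x : {a..b}" for x
  using reg_sup[OF zn(1)[unfolded One_nat_def] x] e1(2)[OF x] e2(2)[OF x]
  by (simp_all flip: of_real_diff of_real_mult)
  have sd0: "\<bar>D j (sp x) - D j (s0 x) - r * (D j (s0 x) - D j (sm x))\<bar> <= L * (C + 5 * C^2) * t^2" if x: "x : {a..b}" for x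
  by (rule second_difference_bound[OF T(1) L0 B(2) rng[OF x] r C _ d[OF x]]) (use t in auto)
  have sd1: "\<bar>D (Suc j) (sp x) - D (Suc j) (s0 x) - r * (D (Suc j) (s0 x) - D (Suc j) (sm x))\<bar> <= L * (C + 5 * C^2) * t^2" if x: "x : {a..b}" for x
  by (rule second_difference_bound[OF T(2) L0 B(3) rng[OF x] r C _ d[OF x]]) (use t in auto)
  show "Zt C' t r (%x. of_real (D j (sm x))) (%x. of_real (D j (s0 x))) (%x. of_real (D j (sp x)))"
  unfolding Zt_def One_nat_def
  proof (intro conjI)
  show "rg (Suc 0) False C' (%x. of_real (D j (s0 x)))"
  proof (rule reg_SucI[OF A0])
  show "cmod (of_real (D j (s0 x))) <= C'" if "x : {a..b}" for x using B(1)[OF rng(2)[OF that]] le(1) by simp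
  show "rg 0 (\<not> False) C' (%x. of_real (D (Suc j) (s0 x)) * s' x)"
  using L2_real_mult[OF cD(1) B(2)[OF rng(2)] lL(1,2) L0] le(2) by simp
  qed simp
  have 1: "(%x. of_real (D (Suc j) (s0 x)) * s' x - of_real (D (Suc j) (sm x)) * (s' x - e1 x)) =
  (%x. of_real (D (Suc j) (s0 x) - D (Suc j) (sm x)) * s' x + of_real (D (Suc j) (sm x)) * e1 x)"
  by (rule ext) (simp add: alg)
  have Lip: "\<bar>D (Suc j) (s0 x) - D (Suc j) (sm x)\<bar> <= L * (C * t)" if x: "x : {a..b}" for x
  using P(2)[OF rng(2,1)[OF x]] mlm[OF d(2)[OF x] L0] by linarith
  show "rg (Suc 0) False (C' * t) (%x. of_real (D j (s0 x)) - of_real (D j (sm x)))"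
  proof (rule reg_SucI[OF AC_diff_fun[OF A0 Am]])
  fix x assume x: "x : {a..b}"
  have "\<bar>D j (s0 x) - D j (sm x)\<bar> <= L * (C * t)"
  using P(1)[OF rng(2,1)[OF x]] mlm[OF d(2)[OF x] L0] by linarith
  also have "... <= C' * t" unfolding mult.assoc[symmetric] using le(2) t by (intro mrm) auto
  finally show "cmod (of_real (D j (s0 x)) - of_real (D j (sm x))) <= C' * t" by (simp flip: of_real_diff)
  next
  have a: "(%x. of_real (D (Suc j) (s0 x) - D (Suc j) (sm x)) * s' x) : LL"
  "nrm (%x. of_real (D (Suc j) (s0 x) - D (Suc j) (sm x)) * s' x) <= L * (C * t) * C"
  using L2_real_mult[OF continuous_on_diff[OF cD(1,2)] Lip lL(1,2)] L0 C t by auto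
  have b: "(%x. of_real (D (Suc j) (sm x)) * e1 x) : LL"
  "nrm (%x. of_real (D (Suc j) (sm x)) * e1 x) <= L * (C * t)"
  using L2_real_mult[OF cD(2) B(2)[OF rng(1)] lL(3,4) L0] by auto
  have "L * (C * t) * C + L * (C * t) = (L * C * C + L * C) * t" by (simp add: alg)
  also have "... <= C' * t" using le(4) t by (intro mrm) auto
  finally show "rg 0 (\<not> False) (C' * t) (%x. of_real (D (Suc j) (s0 x)) * s' x - of_real (D (Suc j) (sm x)) * (s' x - e1 x))"
  unfolding 1 using L2_add[OF a(1) b(1)] a(2) b(2) by auto
  qed simp
  have 2: "(%x. of_real (D (Suc j) (sp x)) * (s' x + (of_real r * e1 x + e2 x)) - of_real (D (Suc j) (s0 x)) * s' x
  - of_real r * (of_real (D (Suc j) (s0 x)) * s' x - of_real (D (Suc j) (sm x)) * (s' x - e1 x))) =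
  (%x. of_real (D (Suc j) (sp x) - D (Suc j) (s0 x) - r * (D (Suc j) (s0 x) - D (Suc j) (sm x))) * s' x
  + of_real (D (Suc j) (sp x)) * e2 x + of_real (r * (D (Suc j) (sp x) - D (Suc j) (sm x))) * e1 x)"
  by (rule ext) (simp add: alg)
  show "rg (Suc 0) False (C' * t^2) (%x. of_real (D j (sp x)) - of_real (D j (s0 x)) - of_real r * (of_real (D j (s0 x)) - of_real (D j (sm x))))"
  proof (rule reg_SucI[OF AC_diff_fun[OF AC_diff_fun[OF Ap A0] AC_cmult[OF AC_diff_fun[OF A0 Am]]]])
  fix x assume x: "x : {a..b}"
  have "\<bar>D j (sp x) - D j (s0 x) - r * (D j (s0 x) - D j (sm x))\<bar> <= C' * t^2"
  using sd0[OF x] mrm[OF le(3), of "t^2"] by simp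
  then show "cmod (of_real (D j (sp x)) - of_real (D j (s0 x)) - of_real r * (of_real (D j (s0 x)) - of_real (D j (sm x)))) <= C' * t^2"
  unfolding of_real_diff[symmetric] of_real_mult[symmetric] norm_of_real .
  next
  have a: "(%x. of_real (D (Suc j) (sp x) - D (Suc j) (s0 x) - r * (D (Suc j) (s0 x) - D (Suc j) (sm x))) * s' x) : LL"
  "nrm (%x. of_real (D (Suc j) (sp x) - D (Suc j) (s0 x) - r * (D (Suc j) (s0 x) - D (Suc j) (sm x))) * s' x) <= L * (C + 5 * C^2) * t^2 * C"
  proof -
  have c: "cont (%x. D (Suc j) (sp x) - D (Suc j) (s0 x) - r * (D (Suc j) (s0 x) - D (Suc j) (sm x)))"
  by (intro continuous_intros cD)
  have n: "0 <= L * (C + 5 * C^2) * t^2"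
  by (intro mnn ann L0 C) auto
  note q = L2_real_mult[where c="%x. D (Suc j) (sp x) - D (Suc j) (s0 x) - r * (D (Suc j) (s0 x) - D (Suc j) (sm x))", OF c sd1 lL(1,2) n]
  show "(%x. of_real (D (Suc j) (sp x) - D (Suc j) (s0 x) - r * (D (Suc j) (s0 x) - D (Suc j) (sm x))) * s' x) : LL"
  by (rule q(1))
  show "nrm (%x. of_real (D (Suc j) (sp x) - D (Suc j) (s0 x) - r * (D (Suc j) (s0 x) - D (Suc j) (sm x))) * s' x) <= L * (C + 5 * C^2) * t^2 * C"
  by (rule q(2))
  qed
  have b: "(%x. of_real (D (Suc j) (sp x)) * e2 x) : LL"
  "nrm (%x. of_real (D (Suc j) (sp x)) * e2 x) <= L * (C * t^2)"
  using L2_real_mult[OF cD(3) B(2)[OF rng(3)] lL(5,6) L0] by auto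
  have Lip3: "\<bar>r * (D (Suc j) (sp x) - D (Suc j) (sm x))\<bar> <= L * (3 * (C * t))" if x: "x : {a..b}" for x
  proof -
  have "\<bar>sp x - sm x\<bar> <= 3 * (C * t)" using d(1,2)[OF x] by linarith
  then have "\<bar>D (Suc j) (sp x) - D (Suc j) (sm x)\<bar> <= L * (3 * (C * t))"
  using P(2)[OF rng(3,1)[OF x]] mlm[OF _ L0] by (meson order_trans)
  moreover have "\<bar>r * (D (Suc j) (sp x) - D (Suc j) (sm x))\<bar> <= \<bar>D (Suc j) (sp x) - D (Suc j) (sm x)\<bar>"
  unfolding abs_mult using r by (intro mult_left_le_one_le) auto
  ultimately show ?thesis by linarith
  qed
  have c: "(%x. of_real (r * (D (Suc j) (sp x) - D (Suc j) (sm x))) * e1 x) : LL"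
  "nrm (%x. of_real (r * (D (Suc j) (sp x) - D (Suc j) (sm x))) * e1 x) <= L * (3 * (C * t)) * (C * t)"
  proof -
  have c: "cont (%x. r * (D (Suc j) (sp x) - D (Suc j) (sm x)))"
  by (intro continuous_intros cD)
  have n: "0 <= L * (3 * (C * t))"
  by (intro mnn L0 C) (use t in auto)
  note q = L2_real_mult[where c="%x. r * (D (Suc j) (sp x) - D (Suc j) (sm x))", OF c Lip3 lL(3,4) n]
  show "(%x. of_real (r * (D (Suc j) (sp x) - D (Suc j) (sm x))) * e1 x) : LL"
  by (rule q(1))
  show "nrm (%x. of_real (r * (D (Suc j) (sp x) - D (Suc j) (sm x))) * e1 x) <= L * (3 * (C * t)) * (C * t)"
  by (rule q(2))
  qed
  have "L * (C + 5 * C^2) * t^2 * C + L * (C * t^2) + L * (3 * (C * t)) * (C * t) = (L * (C + 5 * C^2) * C + L * C + L * (3 * C) * C) * t^2"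
  by (simp add: alg psq)
  also have "... <= C' * t^2" using le(5) by (intro mrm) auto
  finally show "rg 0 (\<not> False) (C' * t^2) (%x. of_real (D (Suc j) (sp x)) * (s' x + (of_real r * e1 x + e2 x)) - of_real (D (Suc j) (s0 x)) * s' x
  - of_real r * (of_real (D (Suc j) (s0 x)) * s' x - of_real (D (Suc j) (sm x)) * (s' x - e1 x)))"
  unfolding 2 using L2_add[OF L2_add(1)[OF a(1) b(1)] c(1)] L2_add(2)[OF a(1) b(1)] a(2) b(2) c(2) by auto
  qed simp
  qed
 qed
qed

lemma Zt_Fnl:
 assumes D: "Ck_family k D" "D 0 = f" and k: "k >= 3" and C: "C >= 0"
 shows "\<exists>C'\<ge>0. \<forall>t r um u0 up. 0 < t --> t <= 1 --> 0 <= r --> r <= 1 -->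
  Zt C t r um u0 up --> Zt C' t r (%x. Fnl f (um x)) (%x. Fnl f (u0 x)) (%x. Fnl f (up x))"
proof -
 obtain C1 where C1: "!!t r sm s0 sp. 0 < t ==> t <= 1 ==> 0 <= r ==> r <= 1 ==>
  (\<forall>x\<in>{a..b}. 0 <= sm x & 0 <= s0 x & 0 <= sp x) ==>
  Zt (14 * C^2) t r (%x. of_real (sm x)) (%x. of_real (s0 x)) (%x. of_real (sp x)) ==>
  Zt C1 t r (%x. of_real (D 0 (sm x))) (%x. of_real (D 0 (s0 x))) (%x. of_real (D 0 (sp x)))"
 proof -
  have "Suc (Suc (Suc 0)) <= k" "14 * C^2 >= 0" using k by auto
  from Zt_chain[OF D(1) this] show ?thesis using that by blast
 qed
 show ?thesis
 proof (intro exI[of _ "14 * (max C1 C)^2"] conjI allI impI)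
  fix t r um u0 up assume t: "0 < t" "t <= 1" "0 <= r" "r <= (1::real)" and Z: "Zt C t r um u0 up"
  have "Zt (14 * C^2) t r (%x. um x * cnj (um x)) (%x. u0 x * cnj (u0 x)) (%x. up x * cnj (up x))"
  by (rule Zt_mult[OF Z Zt_cnj[OF Z] t])
  then have s: "Zt (14 * C^2) t r (%x. of_real ((cmod (um x))^2)) (%x. of_real ((cmod (u0 x))^2)) (%x. of_real ((cmod (up x))^2))"
  by (simp only: complex_norm_square)
  have "Zt C1 t r (%x. of_real (D 0 ((cmod (um x))^2))) (%x. of_real (D 0 ((cmod (u0 x))^2))) (%x. of_real (D 0 ((cmod (up x))^2)))"
  by (rule C1[OF t _ s]) simp
  then have "Zt (14 * (max C1 C)^2) t r (%x. of_real (D 0 ((cmod (um x))^2)) * um x) (%x. of_real (D 0 ((cmod (u0 x))^2)) * u0 x) (%x. of_real (D 0 ((cmod (up x))^2)) * up x)"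
  by (intro Zt_mult[OF Zt_mono[OF _ t(1)] Zt_mono[OF Z t(1)] t]) auto
  then show "Zt (14 * (max C1 C)^2) t r (%x. Fnl f (um x)) (%x. Fnl f (u0 x)) (%x. Fnl f (up x))"
  by (simp add: Fnl_def D(2) sRc)
 qed simp
qed

lemma reg1_odd: "rg 1 False B u ==> u a = 0 ==> u b = 0 ==> rg 1 True B u"
 unfolding One_nat_def by (auto elim!: reg_SucE intro!: reg_SucI)

lemma Fnl_0 [simp]: "Fnl f 0 = 0" by (simp add: Fnl_def)

text \<open>The remainder inherits the boundary values \<open>0\<close>, so its weighted sine coefficients are controlled by
 its \<open>H\<^sup>1\<close> norm.\<close>

lemma Fnl_extrapolation:
 assumes D: "Ck_family k D" "D 0 = f" and k: "k >= 3" and C: "C >= 0"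
 shows "\<exists>K\<ge>0. \<forall>t r um u0 up n. 0 < t --> t <= 1 --> 0 <= r --> r <= 1 --> Zt C t r um u0 up -->
  (\<forall>y\<in>{a, b}. um y = 0 & u0 y = 0 & up y = 0) -->
  (\<Sum>l=1..n. (fq l * cmod (sc (%x. Fnl f (up x) - Fnl f (u0 x) - of_real r * (Fnl f (u0 x) - Fnl f (um x))) l))^2) <= (K * t^2)^2"
proof -
 obtain C' where C': "C' >= 0" "!!t r um u0 up. 0 < t ==> t <= 1 ==> 0 <= r ==> r <= 1 ==>
  Zt C t r um u0 up ==> Zt C' t r (%x. Fnl f (um x)) (%x. Fnl f (u0 x)) (%x. Fnl f (up x))"
  using Zt_Fnl[OF D k C] by blast
 show ?thesis
 proof (intro exI[of _ "sqrt (2 / (b - a)) * C'"] conjI allI impI)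
  fix t r um u0 up n assume t: "0 < t" "t <= 1" "0 <= r" "r <= (1::real)" and Z: "Zt C t r um u0 up"
  and z: "\<forall>y\<in>{a, b}. um y = 0 & u0 y = 0 & up y = 0"
  let ?R = "%x. Fnl f (up x) - Fnl f (u0 x) - of_real r * (Fnl f (u0 x) - Fnl f (um x))"
  have "rg 1 False (C' * t^2) ?R" using C'(2)[OF t Z] unfolding Zt_def by blast
  then have R: "rg 1 True (C' * t^2) ?R" by (rule reg1_odd) (use z in auto)
  have "(\<Sum>l=1..n. (fq l * cmod (sc ?R l))^2) <= 2 / (b - a) * (C' * t^2)^2"
  using reg_sine_bound[OF R, of "{1..n}"] by simp
  also have "... = (sqrt (2 / (b - a)) * C' * t^2)^2" using ab by (simp add: pmd)
  finally show "(\<Sum>l=1..n. (fq l * cmod (sc ?R l))^2) <= (sqrt (2 / (b - a)) * C' * t^2)^2" .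
 qed (use C' ab in simp)
qed

end

section \<open>The linear propagator and the scheme as a discrete Duhamel formula\<close>

text \<open>The solution of the homogeneous equation with \<open>y(0) = 0\<close>, \<open>y'(0) = 1 / \<epsilon>\<^sup>2\<close>.\<close>

definition Kn :: "real => real => real => complex" where
 "Kn ep nu s = (cis (s * beta_p ep nu) - cis (s * beta_m ep nu)) / (\<i> * of_real (sqrt (1 + 4 * ep^2 * nu^2)))"

text \<open>The moments of order \<open>0\<close> and \<open>1\<close> of the kernel over a step, as functions of the elapsed time \<open>s\<close>. At \<open>s = ts\<close> they are the weights of the newest term of the scheme; at \<open>s = 0\<close> they give those of the previous one.\<close>

definition Pk :: "real => real => real => real => complex" where
 "Pk ep nu ts s = (cis ((s - ts) * beta_p ep nu) * (of_real ts * sigma ts (beta_p ep nu))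
  - cis ((s - ts) * beta_m ep nu) * (of_real ts * sigma ts (beta_m ep nu))) / (\<i> * of_real (sqrt (1 + 4 * ep^2 * nu^2)))"

definition Qk :: "real => real => real => real => complex" where
 "Qk ep nu ts s = (cis ((s - ts) * beta_p ep nu) * (of_real ts * (sigma ts (beta_p ep nu) - 1) / (\<i> * of_real (beta_p ep nu)))
  - cis ((s - ts) * beta_m ep nu) * (of_real ts * (sigma ts (beta_m ep nu) - 1) / (\<i> * of_real (beta_m ep nu)))) / (\<i> * of_real (sqrt (1 + 4 * ep^2 * nu^2)))"

lemma cis_linear_deriv: "((%s. cis ((t - s) * q)) hvd (- (\<i> * of_real q * cis ((t - s) * q)))) (at s within A)"
proof -
 have "((%z::complex. exp (\<i> * ((of_real t - z) * of_real q))) has_field_derivative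
  (- (\<i> * of_real q * exp (\<i> * ((of_real t - of_real s) * of_real q))))) (at (of_real s))"
  by (auto intro!: derivative_eq_intros)
 from has_vector_derivative_real_field[OF this] show ?thesis by (simp add: cis_conv_exp)
qed

lemma sigma_eq:
 assumes "q ~= 0" shows "of_real ts * sigma ts q = (cis (ts * q) - 1) / (\<i> * of_real q)"
proof (cases "ts = 0")
 case False
 define x where "x = ts * q / 2"
 have x: "x ~= 0" using False assms by (simp add: x_def)
 have "of_real ts * sigma ts q = of_real (ts * (sin x / x)) * cis x"
  using x by (simp add: sigma_def x_def[symmetric] sRc)
 also have "ts * (sin x / x) = 2 * sin x / q" using False assms by (simp add: x_def field_simps)
 also have "of_real (2 * sin x / q) * cis x = (cis x * cis x - 1) / (\<i> * of_real q)"
 proof -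
  have "cis x * cis x - 1 = \<i> * of_real (2 * sin x) * cis x"
  proof (rule complex_eqI)
  have "cos x * cos x = 1 - sin x * sin x" using sin_cos_squared_add3[of x] by linarith
  then show "Re (cis x * cis x - 1) = Re (\<i> * of_real (2 * sin x) * cis x)" by simp
  show "Im (cis x * cis x - 1) = Im (\<i> * of_real (2 * sin x) * cis x)" by simp
  qed
  then show ?thesis using assms by (simp add: field_simps)
 qed
 also have "cis x * cis x = cis (ts * q)" by (simp add: cis_mult x_def mult.commute)
 finally show ?thesis .
qed simp

lemma cis_integral:
 assumes q: "q ~= 0" and t: "ts >= 0"
 shows "((%v. cis ((s - v) * q)) has_integral cis ((s - ts) * q) * (of_real ts * sigma ts q)) {0..ts}"
  "((%v. of_real v * cis ((s - v) * q)) has_integral cis ((s - ts) * q) * (of_real ts * (sigma ts q - 1) / (\<i> * of_real q))) {0..ts}"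
proof -
 have e: "cis (s * q) = cis ((s - ts) * q) * cis (ts * q)" by (simp add: cis_mult alg)
 have iq: "\<i> * cr q ~= 0" using q by simp
 define j where "j = \<i> * cr q"
 define E where "E = cis ((s - ts) * q)"
 define X where "X = cis (ts * q)"
 have EX: "cis ((s - 0) * q) = E * X" unfolding E_def X_def using e by simp
 have j: "j ~= 0" using iq by (simp add: j_def)
 have d: "((%v. cis ((s - v) * q)) hvd - (j * cis ((s - v) * q))) (at v within {0..ts})" for v
  unfolding j_def by (rule cis_linear_deriv)
 have d1: "((%v. (- 1 / j) * cis ((s - v) * q)) hvd cis ((s - v) * q)) (at v within {0..ts})" for v
  using has_vector_derivative_mult_right[OF d, of "- 1 / j" v] j by simp
 have "((%v. cis ((s - v) * q)) has_integral (- 1 / j) * cis ((s - ts) * q) - (- 1 / j) * cis ((s - 0) * q)) {0..ts}"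
  by (rule fundamental_theorem_of_calculus[OF t d1])
 also have "(- 1 / j) * cis ((s - ts) * q) - (- 1 / j) * cis ((s - 0) * q) = cis ((s - ts) * q) * (of_real ts * sigma ts q)"
  unfolding sigma_eq[OF q] j_def[symmetric] EX unfolding E_def[symmetric] X_def[symmetric] using j by (simp add: field_simps)
 finally show "((%v. cis ((s - v) * q)) has_integral cis ((s - ts) * q) * (of_real ts * sigma ts q)) {0..ts}" .
 have of: "((%v. cr v) hvd 1) (at v within {0..ts})" for v
  using has_vector_derivative_of_real[OF DERIV_ident] by simp
 have "((%v. of_real v * ((- 1 / j) * cis ((s - v) * q)) - (1 / j^2) * cis ((s - v) * q)) has_vector_derivative
  (of_real v * cis ((s - v) * q) + 1 * ((- 1 / j) * cis ((s - v) * q)) - (1 / j^2) * (- (j * cis ((s - v) * q))))) (at v within {0..ts})" for v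
  by (rule has_vector_derivative_diff[OF has_vector_derivative_mult[OF of d1] has_vector_derivative_mult_right[OF d]])
 then have d2: "((%v. of_real v * ((- 1 / j) * cis ((s - v) * q)) - (1 / j^2) * cis ((s - v) * q)) has_vector_derivative
  (of_real v * cis ((s - v) * q))) (at v within {0..ts})" for v
  using j by (simp add: psq)
 have "((%v. of_real v * cis ((s - v) * q)) has_integral
  (of_real ts * ((- 1 / j) * cis ((s - ts) * q)) - (1 / j^2) * cis ((s - ts) * q)) - (of_real 0 * ((- 1 / j) * cis ((s - 0) * q)) - (1 / j^2) * cis ((s - 0) * q))) {0..ts}"
  by (rule fundamental_theorem_of_calculus[OF t d2])
 also have "(of_real ts * ((- 1 / j) * cis ((s - ts) * q)) - (1 / j^2) * cis ((s - ts) * q)) - (of_real 0 * ((- 1 / j) * cis ((s - 0) * q)) - (1 / j^2) * cis ((s - 0) * q))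
  = cis ((s - ts) * q) * ((of_real ts * sigma ts q - of_real ts) / j)"
  unfolding sigma_eq[OF q] j_def[symmetric] EX unfolding E_def[symmetric] X_def[symmetric] using j by (simp add: field_simps psq)
 also have "(of_real ts * sigma ts q - of_real ts) / j = of_real ts * (sigma ts q - 1) / (\<i> * of_real q)"
  by (simp add: j_def right_diff_distrib)
 finally show "((%v. of_real v * cis ((s - v) * q)) has_integral cis ((s - ts) * q) * (of_real ts * (sigma ts q - 1) / (\<i> * of_real q))) {0..ts}" .
qed

context
 fixes ep nu :: real
 assumes eps: "ep > 0" and mu: "nu > 0"
begin

abbreviation (input) "rt \<equiv> sqrt (1 + 4 * ep^2 * nu^2)"

lemma root_sq: "rt^2 = 1 + 4 * ep^2 * nu^2" by (rule real_sqrt_pow2) simp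
lemma root_gt: "rt > 1" using eps mu by simp
lemma root_ge: "rt >= 2 * ep * nu"
 by (rule real_le_rsqrt) (simp add: pmd)
lemma beta_sum: "beta_p ep nu + beta_m ep nu = 1 / ep^2"
 using eps by (simp add: beta_p_def beta_m_def add_divide_distrib[symmetric])
lemma beta_eq: "beta ep nu = rt / ep^2"
 using eps by (simp add: beta_def beta_p_def beta_m_def diff_divide_distrib[symmetric])
lemma beta_prod: "beta_p ep nu * beta_m ep nu = - (nu^2 / ep^2)"
proof -
 have "beta_p ep nu * beta_m ep nu = (1 - rt\<^sup>2) / (4 * (ep^2)^2)"
  using eps by (simp add: beta_p_def beta_m_def psq alg)
 also have "... = - (nu^2 / ep^2)" using eps unfolding root_sq by (simp add: psq)
 finally show ?thesis .
qed
lemma beta_signs: "beta_p ep nu > 0" "beta_m ep nu < 0"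
proof -
 have "1 + rt > 0" "1 - rt < 0" using root_gt by linarith+
 moreover have "2 * ep^2 > 0" using eps by simp
 ultimately show "beta_p ep nu > 0" "beta_m ep nu < 0"
  unfolding beta_p_def beta_m_def by (blast intro: divide_pos_pos divide_neg_pos)+
qed
lemma beta_pos: "beta ep nu > 0" using beta_signs by (simp add: beta_def)

text \<open>The second bound, which degenerates as \<open>\<epsilon>\<close> tends to \<open>0\<close>, gives the gain of a frequency behind the boundary conditions.\<close>

lemma Kn_bound: "cmod (Kn ep nu s) <= 2" "nu * cmod (Kn ep nu s) <= 1 / ep"
proof -
 have n: "cmod (Kn ep nu s) <= 2 / rt"
  unfolding Kn_def norm_divide using norm_triangle_ineq4[of "cis (s * beta_p ep nu)" "cis (s * beta_m ep nu)"] root_gt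
  by (simp add: norm_mult divide_right_mono)
 have "2 / rt <= 2" using root_gt by (simp add: divide_simps)
 then show "cmod (Kn ep nu s) <= 2" using n by linarith
 have "nu * cmod (Kn ep nu s) <= nu * (2 / rt)" using n mu by (intro mlm) auto
 also have "... <= 1 / ep"
 proof -
  have r: "rt > 0" using root_gt by simp
  have "nu * (2 / rt) = (2 * ep * nu) / rt / ep" using eps r by simp
  also have "... <= 1 / ep" using root_ge r eps by (intro divide_right_mono) simp_all
  finally show ?thesis .
 qed
 finally show "nu * cmod (Kn ep nu s) <= 1 / ep" .
qed

lemma d0_eq: "d0 ep s nu = of_real (ep^2) * Kn ep nu s"
proof -
 define x where "x = s * beta ep nu / 2"
 have p: "cis (s * beta_p ep nu) = cis (s / (2 * ep^2)) * cis x"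
  "cis (s * beta_m ep nu) = cis (s / (2 * ep^2)) * cis (- x)"
 proof -
  have "s * beta_p ep nu = s * (beta_p ep nu + beta_m ep nu) / 2 + x" "s * beta_m ep nu = s * (beta_p ep nu + beta_m ep nu) / 2 + (- x)"
  unfolding x_def beta_def by (simp_all add: field_simps)
  then show "cis (s * beta_p ep nu) = cis (s / (2 * ep^2)) * cis x"
  "cis (s * beta_m ep nu) = cis (s / (2 * ep^2)) * cis (- x)"
  unfolding cis_mult beta_sum by (simp_all add: mult.commute)
 qed
 have d: "cis x - cis (- x) = \<i> * of_real (2 * sin x)" by (rule complex_eqI) simp_all
 have "Kn ep nu s = cis (s / (2 * ep^2)) * (cis x - cis (- x)) / (\<i> * of_real rt)"
  unfolding Kn_def p by (simp only: right_diff_distrib)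
 also have "... = cis (s / (2 * ep^2)) * of_real (2 * sin x / rt)" unfolding d by simp
 finally have K: "Kn ep nu s = cis (s / (2 * ep^2)) * of_real (2 * sin x / rt)" .
 have "s * sinc x = ep^2 * (2 * sin x / rt)"
 proof (cases "s = 0")
  case False
  then have x: "x ~= 0" using beta_pos by (simp add: x_def)
  have "s * sinc x = s * sin x / x" using x by simp
  also have "... = 2 * sin x / beta ep nu" using False x beta_pos by (simp add: x_def field_simps)
  also have "... = ep^2 * (2 * sin x / rt)" unfolding beta_eq using eps root_gt by (simp add: field_simps)
  finally show ?thesis .
 qed (simp add: x_def)
 then show ?thesis unfolding d0_def x_def[symmetric] K by (simp add: sRc mult_ac)
qed

lemma c0_eq: "c0 ep s nu = of_real (beta_p ep nu / beta ep nu) * cis (s * beta_m ep nu) - of_real (beta_m ep nu / beta ep nu) * cis (s * beta_p ep nu)"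
 unfolding c0_def by (simp add: sRc divide_inverse alg)

lemma c0_bound: "cmod (c0 ep s nu) <= 1"
proof -
 have "cmod (c0 ep s nu) <= \<bar>beta_p ep nu / beta ep nu\<bar> * 1 + \<bar>beta_m ep nu / beta ep nu\<bar> * 1"
  unfolding c0_eq by (rule order_trans[OF norm_triangle_ineq4]) (simp add: norm_mult norm_divide)
 also have "... = (beta_p ep nu - beta_m ep nu) / beta ep nu"
  using beta_signs beta_pos by (simp add: diff_divide_distrib)
 also have "... = 1" using beta_pos by (simp add: beta_def)
 finally show ?thesis .
qed

lemma c0_deriv: "((%s. c0 ep (t - s) nu) hvd of_real (nu^2) * Kn ep nu (t - s)) (at s within A)"
proof -
 let ?p = "cr (beta_p ep nu)" let ?m = "cr (beta_m ep nu)"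
 let ?A = "cis ((t - s) * beta_p ep nu)" let ?B = "cis ((t - s) * beta_m ep nu)"
 have "((%s. c0 ep (t - s) nu) has_vector_derivative
  (of_real (beta_p ep nu / beta ep nu) * (- (\<i> * ?m * ?B)) - of_real (beta_m ep nu / beta ep nu) * (- (\<i> * ?p * ?A)))) (at s within A)"
  unfolding c0_eq by (rule has_vector_derivative_diff; rule has_vector_derivative_mult_right; rule cis_linear_deriv)
 moreover have "of_real (beta_p ep nu / beta ep nu) * (- (\<i> * ?m * ?B)) - of_real (beta_m ep nu / beta ep nu) * (- (\<i> * ?p * ?A))
  = \<i> * of_real (beta_p ep nu * beta_m ep nu / beta ep nu) * (?A - ?B)" using beta_pos by (simp add: field_simps)
 moreover have "beta_p ep nu * beta_m ep nu / beta ep nu = - (nu^2 / rt)"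
  unfolding beta_prod beta_eq using eps root_gt by (simp add: field_simps)
 moreover have "\<i> * of_real (- (nu^2 / rt)) * (?A - ?B) = of_real (nu^2) * Kn ep nu (t - s)"
 proof -
  have "cr rt ~= 0" using root_gt by simp
  then show ?thesis unfolding Kn_def of_real_minus of_real_divide by (simp add: field_simps del: of_real_power)
 qed
 ultimately show ?thesis by simp
qed

lemma d0_deriv: "((%s. d0 ep (t - s) nu) hvd (- c0 ep (t - s) nu - \<i> * Kn ep nu (t - s))) (at s within A)"
proof -
 let ?p = "cr (beta_p ep nu)" let ?m = "cr (beta_m ep nu)"
 let ?A = "cis ((t - s) * beta_p ep nu)" let ?B = "cis ((t - s) * beta_m ep nu)"
 let ?k = "of_real (ep^2) / (\<i> * cr rt)"
 have rt: "cr rt ~= 0" using root_gt by simp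
 have d0: "d0 ep s nu = ?k * cis (s * beta_p ep nu) - ?k * cis (s * beta_m ep nu)" for s
  unfolding d0_eq Kn_def by (simp add: diff_divide_distrib right_diff_distrib)
 have "((%s. d0 ep (t - s) nu) hvd (?k * (- (\<i> * ?p * ?A)) - ?k * (- (\<i> * ?m * ?B)))) (at s within A)"
  unfolding d0 by (rule has_vector_derivative_diff; rule has_vector_derivative_mult_right; rule cis_linear_deriv)
 moreover have "?k * (- (\<i> * ?p * ?A)) - ?k * (- (\<i> * ?m * ?B)) = - c0 ep (t - s) nu - \<i> * Kn ep nu (t - s)"
 proof -
  define E where "E = cr (ep^2)"
  define R where "R = cr rt"
  have E: "E ~= 0" using eps by (simp add: E_def)
  have R: "R ~= 0" using rt by (simp add: R_def)
  have s: "?p + ?m = 1 / E" unfolding E_def of_real_add[symmetric] beta_sum by simp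
  have b: "cr (beta ep nu) = R / E" unfolding beta_eq E_def R_def by simp
  have c: "c0 ep (t - s) nu = (E / R) * (?p * ?B - ?m * ?A)"
  unfolding c0_eq of_real_divide b using E R by (simp add: field_simps)
  have k: "Kn ep nu (t - s) = (?A - ?B) / (\<i> * R)" unfolding Kn_def R_def ..
  have "- c0 ep (t - s) nu - \<i> * Kn ep nu (t - s) = - (E / R) * (?p * ?B - ?m * ?A + (1 / E) * (?A - ?B))"
  unfolding c k using E R by (simp add: field_simps)
  also have "... = - (E / R) * (?p * ?A - ?m * ?B)" unfolding s[symmetric] by (simp add: alg)
  also have "... = (E / (\<i> * R)) * (- (\<i> * ?p * ?A)) - (E / (\<i> * R)) * (- (\<i> * ?m * ?B))"
  using R by (simp add: field_simps)
  finally show ?thesis unfolding E_def R_def by simp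
 qed
 ultimately show ?thesis by simp
qed

text \<open>\<open>c0 (t - s) y(s) + d0 (t - s) y'(s)\<close> interpolates between the free evolution of the data and \<open>y(t)\<close>; its derivative in \<open>s\<close> is the kernel times the source.\<close>

lemma duhamel:
 assumes t: "t >= 0"
  and y: "!!s. s : {0..t} ==> (y hvd y1 s) (at s within {0..t})"
  and y1: "!!s. s : {0..t} ==> (y1 hvd y2 s) (at s within {0..t})"
  and ode: "!!s. 0 < s ==> s < t ==> of_real (ep^2) * y2 s - \<i> * y1 s + of_real (nu^2) * y s = F s"
 shows "((%s. Kn ep nu (t - s) * F s) has_integral (y t - (c0 ep t nu * y 0 + d0 ep t nu * y1 0))) {0..t}"
proof -
 let ?W = "%s. c0 ep (t - s) nu * y s + d0 ep (t - s) nu * y1 s"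
 have W: "(?W hvd ((c0 ep (t - s) nu * y1 s + of_real (nu^2) * Kn ep nu (t - s) * y s) +
  (d0 ep (t - s) nu * y2 s + (- c0 ep (t - s) nu - \<i> * Kn ep nu (t - s)) * y1 s))) (at s within {0..t})" if s: "s : {0..t}" for s
  by (intro has_vector_derivative_add has_vector_derivative_mult y y1 s c0_deriv d0_deriv)
 have "((%s. Kn ep nu (t - s) * F s) has_integral (?W t - ?W 0)) {0..t}"
 proof (rule fundamental_theorem_of_calculus_interior[OF t])
  show "continuous_on {0..t} ?W"
  using W by (meson continuous_on_eq_continuous_within has_vector_derivative_continuous)
  fix s assume s: "s : {0<..<t}"
  have "at s within {0..t} = at s" using s by (intro at_within_interior) auto
  moreover have "(c0 ep (t - s) nu * y1 s + of_real (nu^2) * Kn ep nu (t - s) * y s) +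
  (d0 ep (t - s) nu * y2 s + (- c0 ep (t - s) nu - \<i> * Kn ep nu (t - s)) * y1 s) = Kn ep nu (t - s) * F s"
  using s unfolding d0_eq by (subst ode[symmetric]) (auto simp: alg)
  ultimately show "(?W hvd Kn ep nu (t - s) * F s) (at s)" using W[of s] s by simp
 qed
 moreover have "c0 ep 0 nu = 1" "d0 ep 0 nu = 0"
  using beta_pos by (simp_all add: c0_def d0_def beta_def flip: scaleR_left_diff_distrib)
 ultimately show ?thesis by simp
qed

lemma init_values: "c0 ep 0 nu = 1" "d0 ep 0 nu = 0"
  using beta_pos by (simp_all add: c0_def d0_def beta_def flip: scaleR_left_diff_distrib)

lemma kernel_moments:
 assumes t: "ts >= 0"
 shows "((%v. Kn ep nu (s - v)) has_integral Pk ep nu ts s) {0..ts}"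
  "((%v. of_real v * Kn ep nu (s - v)) has_integral Qk ep nu ts s) {0..ts}"
proof -
 have n: "beta_p ep nu ~= 0" "beta_m ep nu ~= 0" using beta_signs by auto
 show "((%v. Kn ep nu (s - v)) has_integral Pk ep nu ts s) {0..ts}"
  unfolding Kn_def Pk_def by (rule has_integral_divide[OF has_integral_diff[OF cis_integral(1)[OF n(1) t] cis_integral(1)[OF n(2) t]]])
 have e: "of_real v * Kn ep nu (s - v) = (of_real v * cis ((s - v) * beta_p ep nu) - of_real v * cis ((s - v) * beta_m ep nu)) / (\<i> * of_real rt)" for v
  unfolding Kn_def by (simp add: right_diff_distrib)
 show "((%v. of_real v * Kn ep nu (s - v)) has_integral Qk ep nu ts s) {0..ts}"
  unfolding e Qk_def by (rule has_integral_divide[OF has_integral_diff[OF cis_integral(2)[OF n(1) t] cis_integral(2)[OF n(2) t]]])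
qed

lemma Kn_cont: "continuous_on A (%v. Kn ep nu (s - v))"
 unfolding Kn_def cis_conv_exp using root_gt by (intro continuous_intros) auto

text \<open>\<open>dd\<close> and \<open>- cc\<close> are the sum and the product of the two characteristic exponentials over one step.\<close>

lemma char_rec:
 assumes q: "q = beta_p ep nu \<or> q = beta_m ep nu"
 shows "cis ((s + 2 * ts) * q) = dd ep ts nu * cis ((s + ts) * q) + cc ep ts * cis (s * q)"
proof -
 let ?A = "cis (ts * beta_p ep nu)" let ?B = "cis (ts * beta_m ep nu)"
 define x where "x = ts * beta ep nu / 2"
 have p: "ts * beta_p ep nu = ts / (2 * ep^2) + x" "ts * beta_m ep nu = ts / (2 * ep^2) + (- x)"
 proof -
  have "ts * beta_p ep nu = ts * (beta_p ep nu + beta_m ep nu) / 2 + x" "ts * beta_m ep nu = ts * (beta_p ep nu + beta_m ep nu) / 2 + (- x)"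
  unfolding x_def beta_def by (simp_all add: field_simps)
  then show "ts * beta_p ep nu = ts / (2 * ep^2) + x" "ts * beta_m ep nu = ts / (2 * ep^2) + (- x)"
  unfolding beta_sum by simp_all
 qed
 have "?A + ?B = cis (ts / (2 * ep^2)) * (cis x + cis (- x))" unfolding p distrib_left cis_mult ..
 also have "cis x + cis (- x) = of_real (2 * cos x)" by (rule complex_eqI) simp_all
 finally have dd: "dd ep ts nu = ?A + ?B" unfolding dd_def x_def[symmetric] by (simp add: sRc mult_ac)
 have "ts * beta_p ep nu + ts * beta_m ep nu = ts / ep^2" unfolding distrib_left[symmetric] beta_sum by simp
 then have cc: "cc ep ts = - (?A * ?B)" unfolding cc_def cis_mult by simp
 have 1: "cis ((s + ts) * q) = cis (s * q) * cis (ts * q)" "cis ((s + 2 * ts) * q) = cis (s * q) * (cis (ts * q) * cis (ts * q))"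
  unfolding cis_mult by (simp_all add: alg)
 show ?thesis using q unfolding 1 dd cc by (elim disjE) (simp_all add: alg)
qed

lemma propagator_rec:
 "c0 ep (s + 2 * ts) nu = dd ep ts nu * c0 ep (s + ts) nu + cc ep ts * c0 ep s nu"
 "d0 ep (s + 2 * ts) nu = dd ep ts nu * d0 ep (s + ts) nu + cc ep ts * d0 ep s nu"
 "Pk ep nu ts (s + 2 * ts) = dd ep ts nu * Pk ep nu ts (s + ts) + cc ep ts * Pk ep nu ts s"
 "Qk ep nu ts (s + 2 * ts) = dd ep ts nu * Qk ep nu ts (s + ts) + cc ep ts * Qk ep nu ts s"
proof -
 have lin: "!!X Y X1 Y1 X0 Y0 k. X = dd ep ts nu * X1 + cc ep ts * X0 ==> Y = dd ep ts nu * Y1 + cc ep ts * Y0 ==>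
  (X * k - Y * l) = dd ep ts nu * (X1 * k - Y1 * l) + cc ep ts * (X0 * k - Y0 * l)" for l
  by (simp add: alg)
 have sh: "s + 2 * ts - ts = (s - ts) + 2 * ts" "s + ts - ts = (s - ts) + ts" by simp_all
 note P = char_rec[of "beta_p ep nu", simplified] and Q = char_rec[of "beta_m ep nu", simplified]
 have dv: "!!X Y Z r. X = dd ep ts nu * Y + cc ep ts * Z ==> X / r = dd ep ts nu * (Y / r) + cc ep ts * (Z / r)"
  by (simp add: add_divide_distrib)
 show "c0 ep (s + 2 * ts) nu = dd ep ts nu * c0 ep (s + ts) nu + cc ep ts * c0 ep s nu"
  using lin[OF Q[of s ts] P[of s ts], of "of_real (beta_p ep nu / beta ep nu)" "of_real (beta_m ep nu / beta ep nu)"]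
  unfolding c0_eq by (simp only: mult.commute)
 have "Kn ep nu (s + 2 * ts) = dd ep ts nu * Kn ep nu (s + ts) + cc ep ts * Kn ep nu s"
  unfolding Kn_def by (rule dv) (use lin[OF P[of s ts] Q[of s ts], of 1 1] in simp)
 then show "d0 ep (s + 2 * ts) nu = dd ep ts nu * d0 ep (s + ts) nu + cc ep ts * d0 ep s nu"
  unfolding d0_eq by (simp add: alg)
 show "Pk ep nu ts (s + 2 * ts) = dd ep ts nu * Pk ep nu ts (s + ts) + cc ep ts * Pk ep nu ts s"
  unfolding Pk_def sh by (rule dv) (rule lin[OF P Q])
 show "Qk ep nu ts (s + 2 * ts) = dd ep ts nu * Qk ep nu ts (s + ts) + cc ep ts * Qk ep nu ts s"
  unfolding Qk_def sh by (rule dv) (rule lin[OF P Q])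
qed

lemma scheme_weights:
 "pp ep ts nu = Pk ep nu ts ts" "qq ep ts nu = Qk ep nu ts ts"
 "pp_star ep ts nu = - (cc ep ts * Pk ep nu ts 0)" "qq_star ep ts nu = - (cc ep ts * Qk ep nu ts 0)"
proof -
 have eb: "ep^2 * beta ep nu = rt" unfolding beta_eq using eps by simp
 define R where "R = cr rt"
 have R: "R ~= 0" using root_gt by (simp add: R_def)
 have b: "cr (beta_p ep nu) ~= 0" "cr (beta_m ep nu) ~= 0" using beta_signs by auto
 have cn: "cnj (sigma ts q) = cis ((0 - ts) * q) * sigma ts q" for q
  unfolding sigma_def by (simp add: sRc cis_cnj mult_ac cis_mult flip: mult.assoc)
 have ci: "1 / cis x = cis (- x)" for x by (simp add: divide_inverse)
 show "pp ep ts nu = Pk ep nu ts ts"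
  unfolding pp_def Pk_def eb of_real_divide R_def[symmetric] using R by (simp add: field_simps)
 show "qq ep ts nu = Qk ep nu ts ts"
  unfolding qq_def Qk_def eb of_real_divide R_def[symmetric] using R b by (simp add: field_simps)
 show "pp_star ep ts nu = - (cc ep ts * Pk ep nu ts 0)"
  unfolding pp_star_def Pk_def eb of_real_divide R_def[symmetric] cn cc_def using R by (simp add: field_simps)
 have q: "(1 - sigma ts q) / (cis (ts * q) * of_real q) = cis ((0 - ts) * q) * ((1 - sigma ts q) / of_real q)" for q
 proof -
  have "(1 - sigma ts q) / (cis (ts * q) * of_real q) = (1 / cis (ts * q)) * ((1 - sigma ts q) / of_real q)" by simp
  then show ?thesis unfolding ci by simp
 qed
 show "qq_star ep ts nu = - (cc ep ts * Qk ep nu ts 0)"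
  unfolding qq_star_def Qk_def eb of_real_divide R_def[symmetric] q cc_def using R b by (simp add: field_simps)
qed

end

text \<open>A source entering at step \<open>j\<close> is afterwards propagated by the homogeneous recurrence; the terms \<open>X j 0\<close> are the corrections due to its value at elapsed time \<open>0\<close> not being zero.\<close>

lemma three_term_solution:
 fixes c :: "nat => complex" and Z :: "real => complex" and X :: "nat => real => complex"
 assumes Z: "!!s. Z (s + 2 * ts) = d * Z (s + ts) + e * Z s"
  and X: "!!j s. X j (s + 2 * ts) = d * X j (s + ts) + e * X j s"
  and c0: "c 0 = Z 0" and c1: "c 1 = Z ts + X 0 ts"
  and cs: "!!n. c (Suc (Suc n)) = e * c n + d * c (Suc n) + X (Suc n) ts + e * X n 0"
 shows "c n = Z (real n * ts) + (\<Sum>j<n. X j (real n * ts - real j * ts))"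
proof (induction n rule: induct_nat_012)
 case (ge2 n)
 have z: "Z (real (Suc (Suc n)) * ts) = d * Z (real (Suc n) * ts) + e * Z (real n * ts)"
  using Z[of "real n * ts"] by (simp add: alg)
 have x: "X j (real (Suc (Suc n)) * ts - real j * ts) = d * X j (real (Suc n) * ts - real j * ts) + e * X j (real n * ts - real j * ts)" for j
  using X[of j "real n * ts - real j * ts"] by (simp add: alg)
 have l: "real (Suc (Suc n)) * ts - real (Suc n) * ts = ts" by (simp add: alg)
 have "(\<Sum>j<Suc (Suc n). X j (real (Suc (Suc n)) * ts - real j * ts)) =
  (\<Sum>j<Suc n. X j (real (Suc (Suc n)) * ts - real j * ts)) + X (Suc n) ts"
  by (subst sum.lessThan_Suc) (simp only: l)
 also have "... = d * (\<Sum>j<Suc n. X j (real (Suc n) * ts - real j * ts)) + e * (\<Sum>j<Suc n. X j (real n * ts - real j * ts)) + X (Suc n) ts"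
  unfolding x sum.distrib sum_distrib_left ..
 also have "(\<Sum>j<Suc n. X j (real n * ts - real j * ts)) = (\<Sum>j<n. X j (real n * ts - real j * ts)) + X n 0" by simp
 finally show ?case unfolding cs z ge2 by (simp only: alg)
qed (use c0 c1 in simp_all)

lemma integral_pieces:
 fixes g :: "real => complex"
 assumes t: "ts > 0"
 shows "continuous_on {0..real n * ts} g ==> integral {0..real n * ts} g = (\<Sum>j<n. integral {0..ts} (%v. g (real j * ts + v)))"
proof (induction n)
 case (Suc n)
 have le: "real n * ts <= real (Suc n) * ts" "0 <= real n * ts" using t by (auto intro: mrm)
 have c: "continuous_on {0..real n * ts} g" by (rule cos[OF Suc.prems]) (use le in auto)
 have "integral {0..real (Suc n) * ts} g = integral {0..real n * ts} g + integral {real n * ts..real (Suc n) * ts} g"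
  by (rule Henstock_Kurzweil_Integration.integral_combine[symmetric, OF le(2,1) integrable_continuous_real[OF Suc.prems]])
 also have "integral {real n * ts..real (Suc n) * ts} g = integral {0..ts} (g \<circ> (%v. v + real n * ts))"
 proof -
  have e: "{0 + real n * ts..ts + real n * ts} = {real n * ts..real (Suc n) * ts}" by (simp add: alg)
  have "continuous_on {0 + real n * ts..ts + real n * ts} g" unfolding e
  by (rule cos[OF Suc.prems]) (use le in auto)
  from integral_shift[OF this] show ?thesis unfolding e by simp
 qed
 finally show ?case using Suc.IH[OF c] by (simp add: o_def add.commute)
qed simp

text \<open>Minkowski's inequality for vectors of coefficients, by testing the integral against itself.\<close>

lemma (in seg) wn_integral_le:
 assumes t: "p <= (q::real)" and w: "!!l. w l >= 0"
  and g: "!!l. l : {1..M - 1} ==> (g l has_integral I l) {p..q}"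
  and G: "!!v. v : {p..q} ==> wn M w (%l. g l v) <= G"
 shows "wn M w I <= (q - p) * G"
proof -
 let ?N = "wn M w I"
 let ?h = "%v. \<Sum>l=1..M - 1. (of_real ((w l)^2) * cnj (I l)) * g l v"
 have G0: "0 <= G" using order_trans[OF wn_nonneg G[of p]] t by simp
 have hi: "(?h has_integral (\<Sum>l=1..M - 1. (of_real ((w l)^2) * cnj (I l)) * I l)) {p..q}"
  by (intro has_integral_sum has_integral_mult_right g) auto
 have "(\<Sum>l=1..M - 1. (of_real ((w l)^2) * cnj (I l)) * I l) = of_real (?N^2)"
  unfolding wn_sq of_real_sum
  by (intro sum.cong refl) (simp add: pmd complex_norm_square mult_ac del: of_real_power)
 then have hi: "(?h has_integral of_real (?N^2)) {p..q}" using hi by simp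
 have "norm (cr (?N^2)) <= ?N * G * Sigma_Algebra.measure lborel {p..q}"
 proof (rule has_integral_bound_real[OF _ _ hi, of _ "{}"])
  show "0 <= ?N * G" using G0 by simp
  fix v assume v: "v : {p..q} - {}"
  have "norm (?h v) <= (\<Sum>l=1..M - 1. \<bar>w l * cmod (I l)\<bar> * \<bar>w l * cmod (g l v)\<bar>)"
  by (rule order_trans[OF norm_sum]) (simp add: norm_mult psq mult_ac w)
  also have "... <= ?N * wn M w (%l. g l v)" unfolding wn_def by (rule L2_set_mult_ineq)
  also have "... <= ?N * G" using G v by (intro mlm) auto
  finally show "norm (?h v) <= ?N * G" .
 qed simp
 then have "?N * ?N <= ?N * ((q - p) * G)" using t by (simp add: psq norm_mult mult_ac)
 then show ?thesis
 proof (cases "?N = 0")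
  case True then show ?thesis using t G0 by simp
 next
  case False
  then have "?N > 0" using wn_nonneg[of M w I] by linarith
  then show ?thesis using \<open>?N * ?N <= ?N * ((q - p) * G)\<close> by simp
 qed
qed

context seg
begin

lemma scheme_duhamel:
 assumes S: "ewi_sp a b f ep u0 u1 M ts Ps" and e: "ep > 0" and l: "l : {1..M - 1}"
 shows "dst M (Ps n) l = (c0 ep (real n * ts) (fq l) * dst M (ndl M u0) l + d0 ep (real n * ts) (fq l) * dst M (ndl M u1) l)
  + (\<Sum>j<n. Pk ep (fq l) ts (real n * ts - real j * ts) * dst M (%i. Fnl f (Ps j i)) l
  + Qk ep (fq l) ts (real n * ts - real j * ts) * dst M (Dnl f ts (ndl M u0) (ndl M u1) Ps j) l)"
proof -
 let ?nu = "fq l"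
 have m: "?nu > 0" using l by (intro mu_pos) auto
 let ?v0 = "ndl M u0" and ?v1 = "ndl M u1"
 let ?D = "Dnl f ts ?v0 ?v1 Ps" and ?F = "%n j. Fnl f (Ps n j)"
 let ?Z = "%s. c0 ep s ?nu * dst M ?v0 l + d0 ep s ?nu * dst M ?v1 l"
 let ?X = "%j s. Pk ep ?nu ts s * dst M (?F j) l + Qk ep ?nu ts s * dst M (?D j) l"
 note S' = S[unfolded ewi_sp_def Let_def]
 have syn: "dst M u l = c l" if "!!j. j : {1..M - 1} ==> u j = (\<Sum>l=1..M - 1. sin (real j * real l * pi / real M) *\<^sub>R c l)" for u c
 proof -
  have "dst M u l = dst M (synth M c) l"
  by (rule dst_cong) (simp add: that synth_def gs_def sRc mult.commute)
  then show ?thesis using dst_synth[OF l] by simp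
 qed
 note R = propagator_rec[OF e m] and W = scheme_weights[OF e m] and I = init_values[OF e m]
 have step1: "dst M (Ps 1) l = c0 ep ts ?nu * dst M ?v0 l + d0 ep ts ?nu * dst M ?v1 l
  + pp ep ts ?nu * dst M (?F 0) l + qq ep ts ?nu * dst M (?D 0) l"
  by (rule syn) (use S' in blast)
 have step: "dst M (Ps (n + 1)) l = cc ep ts * dst M (Ps (n - 1)) l + dd ep ts ?nu * dst M (Ps n) l
  + pp ep ts ?nu * dst M (?F n) l + qq ep ts ?nu * dst M (?D n) l
  - pp_star ep ts ?nu * dst M (?F (n - 1)) l - qq_star ep ts ?nu * dst M (?D (n - 1)) l" if "n >= 1" for n
  by (rule syn) (use S' that in blast)
 show ?thesis
 proof (rule three_term_solution[where d = "dd ep ts ?nu" and e = "cc ep ts" and Z = ?Z and X = ?X and c = "%n. dst M (Ps n) l"])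
  show "?Z (s + 2 * ts) = dd ep ts ?nu * ?Z (s + ts) + cc ep ts * ?Z s" for s
  unfolding R(1)[of s] R(2)[of s] by (simp add: alg)
  show "?X j (s + 2 * ts) = dd ep ts ?nu * ?X j (s + ts) + cc ep ts * ?X j s" for j s
  unfolding R(3)[of ts s] R(4)[of ts s] by (simp add: alg)
  show "dst M (Ps 0) l = ?Z 0" unfolding I using S' by (auto intro!: dst_cong)
  show "dst M (Ps 1) l = ?Z ts + ?X 0 ts" unfolding step1 W by simp
  show "dst M (Ps (Suc (Suc n))) l = cc ep ts * dst M (Ps n) l + dd ep ts ?nu * dst M (Ps (Suc n)) l + ?X (Suc n) ts + cc ep ts * ?X n 0" for n
  using step[of "Suc n"] unfolding W by (simp add: alg)
 qed
qed

text \<open>Subtracting the two Duhamel formulas: the error is the propagated data error plus a sum over the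
 steps of local consistency errors, each damped only by the bounded kernel.\<close>

lemma error_accumulation:
 assumes S: "ewi_sp a b f ep u0 u1 M ts Ps" and e: "0 < ep" "ep <= 1" and t: "ts > 0" and w: "!!l. w l >= 0"
  and y: "!!l s. l : {1..M - 1} ==> s : {0..real n * ts} ==> (y l hvd y1 l s) (at s within {0..real n * ts})"
  and y1: "!!l s. l : {1..M - 1} ==> s : {0..real n * ts} ==> (y1 l hvd y2 l s) (at s within {0..real n * ts})"
  and ode: "!!l s. l : {1..M - 1} ==> 0 < s ==> s < real n * ts ==>
  of_real (ep^2) * y2 l s - \<i> * y1 l s + of_real ((fq l)^2) * y l s = F l s"
  and F: "!!l. l : {1..M - 1} ==> continuous_on {0..real n * ts} (F l)"
  and G: "!!j v. j < n ==> v : {0..ts} ==> wn M w (%l. F l (real j * ts + v) -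
  (dst M (%i. Fnl f (Ps j i)) l + of_real v * dst M (Dnl f ts (ndl M u0) (ndl M u1) Ps j) l)) <= G j"
 shows "wn M w (%l. y l (real n * ts) - dst M (Ps n) l) <=
  wn M w (%l. y l 0 - dst M (ndl M u0) l) + 2 * wn M w (%l. y1 l 0 - dst M (ndl M u1) l)
  + (\<Sum>j<n. 2 * ts * G j)"
proof -
 let ?t = "real n * ts" let ?v0 = "dst M (ndl M u0)" let ?v1 = "dst M (ndl M u1)"
 let ?K = "%l. Kn ep (fq l)"
 let ?f = "%j. dst M (%i. Fnl f (Ps j i))" let ?d = "%j. dst M (Dnl f ts (ndl M u0) (ndl M u1) Ps j)"
 let ?g = "%j l v. F l (real j * ts + v) - (?f j l + of_real v * ?d j l)"
 let ?I = "%j l. integral {0..ts} (%v. ?K l (?t - (real j * ts + v)) * ?g j l v)"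
 have mp: "fq l > 0" if "l : {1..M - 1}" for l using that by (intro mu_pos) auto
 have Kb: "cmod (?K l s) <= 2" if "l : {1..M - 1}" for l s by (rule Kn_bound(1)[OF e(1) mp[OF that]])
 have Kc: "continuous_on A (%v. ?K l (?t - v))" if "l : {1..M - 1}" for l A by (rule Kn_cont[OF e(1) mp[OF that]])
 have Kc': "continuous_on A (%v. ?K l (?t - (real j * ts + v)))" if "l : {1..M - 1}" for l j A
  using Kn_cont[OF e(1) mp[OF that], of A "?t - real j * ts"] by (simp add: diff_diff_eq)
 have Fc: "continuous_on {0..ts} (%v. F l (real j * ts + v))" if l: "l : {1..M - 1}" and j: "j < n" for l j
 proof (rule continuous_on_compose2[OF F[OF l]])
  have "real (Suc j) * ts <= ?t" using j t by (intro mrm) auto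
  then show "(+) (real j * ts) ` {0..ts} \<subseteq> {0..?t}" using t by (auto simp: alg)
 qed (intro continuous_intros)
 have rep: "y l ?t - dst M (Ps n) l =
  (c0 ep ?t (fq l) * (y l 0 - ?v0 l) + d0 ep ?t (fq l) * (y1 l 0 - ?v1 l)) + (\<Sum>j<n. ?I j l)" if l: "l : {1..M - 1}" for l
 proof -
  have "((%s. ?K l (?t - s) * F l s) has_integral (y l ?t - (c0 ep ?t (fq l) * y l 0 + d0 ep ?t (fq l) * y1 l 0))) {0..?t}"
  by (rule duhamel[OF e(1) mp[OF l] _ y[OF l] y1[OF l] ode[OF l]]) (use t in auto)
  then have 1: "y l ?t = c0 ep ?t (fq l) * y l 0 + d0 ep ?t (fq l) * y1 l 0 + integral {0..?t} (%s. ?K l (?t - s) * F l s)"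
  by (simp add: integral_unique)
  have 2: "integral {0..?t} (%s. ?K l (?t - s) * F l s) = (\<Sum>j<n. integral {0..ts} (%v. ?K l (?t - (real j * ts + v)) * F l (real j * ts + v)))"
  by (rule integral_pieces[OF t]) (intro continuous_intros Kc F l)
  have 3: "integral {0..ts} (%v. ?K l (?t - (real j * ts + v)) * F l (real j * ts + v)) =
  ?I j l + (Pk ep (fq l) ts (?t - real j * ts) * ?f j l + Qk ep (fq l) ts (?t - real j * ts) * ?d j l)" if j: "j < n" for j
  proof -
  have i1: "((%v. ?K l (?t - (real j * ts + v)) * ?g j l v) has_integral ?I j l) {0..ts}"
  by (intro integrable_integral integrable_continuous_real continuous_intros Kc' Fc l j)
  note k = kernel_moments[OF e(1) mp[OF l] less_imp_le[OF t], of "?t - real j * ts"]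
  have i2: "((%v. ?K l (?t - real j * ts - v) * ?f j l + (of_real v * ?K l (?t - real j * ts - v)) * ?d j l) has_integral
  (Pk ep (fq l) ts (?t - real j * ts) * ?f j l + Qk ep (fq l) ts (?t - real j * ts) * ?d j l)) {0..ts}"
  by (intro has_integral_add has_integral_mult_left k)
  have "(%v. ?K l (?t - (real j * ts + v)) * F l (real j * ts + v)) = (%v. ?K l (?t - (real j * ts + v)) * ?g j l v +
  (?K l (?t - real j * ts - v) * ?f j l + (of_real v * ?K l (?t - real j * ts - v)) * ?d j l))"
  by (rule ext) (simp add: alg)
  then show ?thesis using integral_unique[OF has_integral_add[OF i1 i2]] by simp
  qed
  have 4: "integral {0..?t} (%s. ?K l (?t - s) * F l s) = (\<Sum>j<n. ?I j l) +
  (\<Sum>j<n. Pk ep (fq l) ts (?t - real j * ts) * ?f j l + Qk ep (fq l) ts (?t - real j * ts) * ?d j l)"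
  unfolding 2 sum.distrib[symmetric] by (intro sum.cong refl 3) auto
  show ?thesis unfolding 1 4 scheme_duhamel[OF S e(1) l] by (simp only: alg)
 qed
 have I: "wn M w (?I j) <= 2 * ts * G j" if j: "j < n" for j
 proof -
  have "wn M w (?I j) <= (ts - 0) * (2 * G j)"
  proof (rule wn_integral_le[OF _ w])
  show "((%v. ?K l (?t - (real j * ts + v)) * ?g j l v) has_integral ?I j l) {0..ts}" if "l : {1..M - 1}" for l
  by (intro integrable_integral integrable_continuous_real continuous_intros Kc' Fc that j)
  fix v assume v: "v : {0..ts}"
  have "wn M w (%l. ?K l (?t - (real j * ts + v)) * ?g j l v) <= wn M (%l. 2 * w l) (%l. ?g j l v)"
  proof (rule wn_mono)
  fix l assume l: "l : {1..M - 1}"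
  have "w l * (cmod (?K l (?t - (real j * ts + v))) * cmod (?g j l v)) <= w l * (2 * cmod (?g j l v))"
  by (intro mlm mrm Kb l w) simp_all
  then show "w l * cmod (?K l (?t - (real j * ts + v)) * ?g j l v) <= 2 * w l * cmod (?g j l v)" by (simp only: norm_mult mult_ac)
  qed (rule w)
  also have "... = 2 * wn M w (%l. ?g j l v)" by (rule wn_scale) simp
  also have "... <= 2 * G j" using G[OF j v] by simp
  finally show "wn M w (%l. ?K l (?t - (real j * ts + v)) * ?g j l v) <= 2 * G j" .
  qed (use t in simp)
  then show ?thesis by (simp add: mult_ac)
 qed
 have "wn M w (%l. y l ?t - dst M (Ps n) l) = wn M w (%l. (c0 ep ?t (fq l) * (y l 0 - ?v0 l) + d0 ep ?t (fq l) * (y1 l 0 - ?v1 l)) + (\<Sum>j<n. ?I j l))"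
  by (rule wn_cong) (rule rep)
 also have "... <= wn M w (%l. c0 ep ?t (fq l) * (y l 0 - ?v0 l) + d0 ep ?t (fq l) * (y1 l 0 - ?v1 l)) + wn M w (%l. \<Sum>j<n. ?I j l)"
  by (rule wn_add) (rule w)
 also have "wn M w (%l. \<Sum>j<n. ?I j l) <= (\<Sum>j<n. wn M w (?I j))" by (rule wn_sum) (auto simp: w)
 also have "... <= (\<Sum>j<n. 2 * ts * G j)" by (rule sum_mono) (use I in auto)
 also have "wn M w (%l. c0 ep ?t (fq l) * (y l 0 - ?v0 l) + d0 ep ?t (fq l) * (y1 l 0 - ?v1 l)) <=
  wn M w (%l. c0 ep ?t (fq l) * (y l 0 - ?v0 l)) + wn M w (%l. d0 ep ?t (fq l) * (y1 l 0 - ?v1 l))"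
  by (rule wn_add) (rule w)
 also have "wn M w (%l. c0 ep ?t (fq l) * (y l 0 - ?v0 l)) <= wn M w (%l. y l 0 - ?v0 l)"
 proof (rule wn_mono[OF w])
  fix l assume l: "l : {1..M - 1}"
  have "w l * (cmod (c0 ep ?t (fq l)) * cmod (y l 0 - ?v0 l)) <= w l * (1 * cmod (y l 0 - ?v0 l))"
  by (intro mlm mrm c0_bound[OF e(1) mp[OF l]] w) simp_all
  then show "w l * cmod (c0 ep ?t (fq l) * (y l 0 - ?v0 l)) <= w l * cmod (y l 0 - ?v0 l)" by (simp only: norm_mult mult_1)
 qed
 also have "wn M w (%l. d0 ep ?t (fq l) * (y1 l 0 - ?v1 l)) <= wn M (%l. 2 * w l) (%l. y1 l 0 - ?v1 l)"
 proof (rule wn_mono[OF w])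
  fix l assume l: "l : {1..M - 1}"
  have "cmod (d0 ep ?t (fq l)) <= 1 * 2"
  unfolding d0_eq[OF e(1) mp[OF l]] norm_mult by (intro mult_mono Kb l) (use e in \<open>auto simp: power_le_one norm_power\<close>)
  then have "w l * (cmod (d0 ep ?t (fq l)) * cmod (y1 l 0 - ?v1 l)) <= w l * (2 * cmod (y1 l 0 - ?v1 l))"
  by (intro mlm mrm w) simp_all
  then show "w l * cmod (d0 ep ?t (fq l) * (y1 l 0 - ?v1 l)) <= 2 * w l * cmod (y1 l 0 - ?v1 l)" by (simp only: norm_mult mult_ac)
 qed
 also have "wn M (%l. 2 * w l) (%l. y1 l 0 - ?v1 l) = 2 * wn M w (%l. y1 l 0 - ?v1 l)" by (rule wn_scale) simp
 finally show ?thesis by simp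
qed

end

section \<open>From Sobolev functions to sine coefficients\<close>

text \<open>This turns bounds at almost every time into bounds at every time once the quantity is known to be continuous, here finitely many coefficients.\<close>

lemma AE_continuous_le:
 fixes g :: "real => real"
 assumes T: "0 < T" and g: "continuous_on {0..T} g" and ae: "AE t in lebesgue_on {0..T}. g t <= B" and t: "t : {0..T}"
 shows "g t <= B"
proof -
 interpret I: seg 0 T by unfold_locales (rule T)
 have "AE t in lebesgue. t : {0..T} --> g t <= B"
  using ae by (subst (asm) AE_restrict_space_iff) auto
 then have "AE t in lebesgue. t : {0<..<T} --> cr (max (g t - B) 0) = 0" by eventually_elim auto
 then have z: "AE t in Om 0 T. cr (max (g t - B) 0) = 0"
  by (subst AE_restrict_space_iff) auto
 have "cr (max (g t - B) 0) = 0"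
  by (rule I.continuous_eq_AE[OF _ _ z t]) (intro continuous_intros g)+
 then show ?thesis by (simp add: max_def split: if_splits)
qed

lemma ext_norm_le:
 assumes "ext_norm X N u <= ennreal C" shows "u : X" "N u <= max C 0"
proof -
 show "u : X" using assms unfolding ext_norm_def by (auto split: if_splits simp: top_unique)
 then show "N u <= max C 0" using assms unfolding ext_norm_def
  by (cases "C >= 0") (auto simp: ennreal_le_iff ennreal_neg ennreal_eq_0_iff)
qed

lemma LinfT_AE: "LinfT T N u <= K ==> AE t in lebesgue_on {0..T}. N (u t) <= K"
 unfolding LinfT_def using esssup_AE[of "%t. N (u t)" "lebesgue_on {0..T}"]
 by (auto elim: eventually_mono intro: order_trans)

lemma LinfT_H:
 assumes "LinfT T (H_ext a b m) u <= ennreal C"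
 shows "AE t in lebesgue_on {0..T}. u t : Hspace a b m & Hnorm a b m (u t) <= max C 0"
 using LinfT_AE[OF assms] by eventually_elim (use ext_norm_le in blast)

lemma LinfT_X:
 assumes "LinfT T (Xnorm a b m) u <= ennreal C"
 shows "AE t in lebesgue_on {0..T}. u t : Hspace a b m & Hnorm a b m (u t) <= max C 0"
 using LinfT_AE[OF assms]
proof eventually_elim
 fix t assume "Xnorm a b m (u t) <= ennreal C"
 moreover have "H_ext a b m (u t) <= Xnorm a b m (u t)"
  unfolding Xnorm_def by (rule order_trans[OF add_increasing[OF zero_le order_refl] add_increasing2[OF zero_le order_refl]])
 ultimately have "H_ext a b m (u t) <= ennreal C" by (rule order_trans[rotated])
 then show "u t : Hspace a b m & Hnorm a b m (u t) <= max C 0" using ext_norm_le by blast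
qed

lemma Hspace_L2: "u : Hspace a b m ==> u : L2space a b" by (simp add: Hspace_def)

lemma Hnorm_mono: "i <= m ==> Hnorm a b i u <= Hnorm a b m u"
 unfolding Hnorm_def by (intro real_sqrt_le_mono sum_mono2) auto

context seg
begin

lemma wn_le: "K >= 0 ==> (wn M w c <= K) = ((\<Sum>l=1..M - 1. (w l * cmod (c l))^2) <= K^2)"
 unfolding wn_sq[symmetric] by (simp add: power2_le_iff_abs_le)

lemma wn_Suc_le: "K >= 0 ==> (wn (Suc n) w c <= K) = ((\<Sum>l=1..n. (w l * cmod (c l))^2) <= K^2)"
 using wn_le[of K "Suc n" w c] by simp

lemma wn_cont:
 assumes "!!l. l : {1..M - 1} ==> continuous_on A (%t. Y l t)"
 shows "continuous_on A (%t. wn M w (%l. Y l t))"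
 unfolding wn_def L2_set_def using assms by (intro continuous_intros) auto

text \<open>All frequencies are bounded below by the first.\<close>

lemma wn_power_le:
 assumes "i <= m"
 shows "wn M (%l. fq l ^ i) c <= 1 / fq 1 ^ (m - i) * wn M (%l. fq l ^ m) c"
proof -
 have p: "fq 1 > 0" by (rule mu_pos) simp
 have "wn M (%l. fq l ^ i) c <= wn M (%l. 1 / fq 1 ^ (m - i) * fq l ^ m) c"
 proof (rule wn_mono)
  fix l assume l: "l : {1..M - 1}"
  have q: "fq l >= 0" by (rule mu_nonneg)
  have "fq l ^ i * fq 1 ^ (m - i) <= fq l ^ i * fq l ^ (m - i)"
  using l by (intro mlm power_mono mu_mono zero_le_power q) (use p in auto)
  also have "... = fq l ^ m" using assms by (simp flip: power_add)
  finally have "fq l ^ i <= 1 / fq 1 ^ (m - i) * fq l ^ m" using p by (simp add: field_simps)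
  then show "fq l ^ i * cmod (c l) <= 1 / fq 1 ^ (m - i) * fq l ^ m * cmod (c l)" by (intro mrm) auto
  show "0 <= fq l ^ i" by (intro zero_le_power q)
 qed
 also have "... = 1 / fq 1 ^ (m - i) * wn M (%l. fq l ^ m) c" using p by (intro wn_scale) auto
 finally show ?thesis .
qed

text \<open>A Poincare-type statement: the weighted coefficients of a function vanishing at the ends
 control it in \<open>C\<close> and in \<open>H\<^sup>1\<close>.\<close>

definition kap :: real where "kap = (b - a) + sqrt ((b - a) / 2)"

lemma kap_nonneg: "kap >= 0" using ab by (simp add: kap_def)

lemma grad_bound_reg:
 assumes u: "ac u v" and v: "ac v w" and w: "w : LL" and z: "u a = 0" "u b = 0"
  and X: "!!n. wn (Suc n) (fq) (sc u) <= X"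
 shows "rg 1 False (kap * X) u"
proof -
 have X0: "X >= 0" using order_trans[OF wn_nonneg X] .
 have S: "(\<Sum>l=1..n. (fq l * cmod (sc u l))^2) <= X^2" for n using X[of n] wn_Suc_le[OF X0] by simp
 have le: "(b - a) * X <= kap * X" "sqrt ((b - a) / 2) * X <= kap * X"
  using ab X0 by (auto simp: kap_def intro!: mrm)
 show ?thesis unfolding One_nat_def
 proof (rule reg_SucI[OF u])
  show "cmod (u x) <= kap * X" if "x : {a..b}" for x
  using sine_sup_bound[OF AC_continuous[OF u] S X0 that] le(1) by linarith
  show "rg 0 (\<not> False) (kap * X) v"
  using gradient_parseval_le[OF u v w z S X0] le(2) AC_L2[OF v] by simp
 qed simp
qed

text \<open>Taking a coefficient is a bounded functional on \<open>L\<^sup>2\<close>.\<close>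

lemma coeff_deriv:
 assumes d: "has_Dt a b u t v" and l: "l >= 1"
 shows "((%s. sc (u s) l) hvd sc v l) (at t within {0..})"
proof -
 have v: "v : LL" and ut: "u t : LL" and us: "\<forall>\<^sub>F s in at t within {0..}. u s : LL"
  and lim: "((%s. nrm (%x. (u s x - u t x) /\<^sub>R (s - t) - v x)) \<longlongrightarrow> 0) (at t within {0..})"
  using d unfolding has_Dt_def by auto
 have "((%s. norm (sc (u s) l - sc (u t) l - (s - t) *\<^sub>R sc v l) / norm (s - t)) \<longlongrightarrow> 0) (at t within {0..})"
 proof (rule Lim_null_comparison)
  show "((%s. sqrt (2 / (b - a)) * nrm (%x. (u s x - u t x) /\<^sub>R (s - t) - v x)) \<longlongrightarrow> 0) (at t within {0..})"
  using tendsto_mult_left[OF lim, of "sqrt (2 / (b - a))"] by simp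
  have "\<forall>\<^sub>F s in at t within {0..}. s ~= t" by (simp add: eventually_at_filter)
  with us show "\<forall>\<^sub>F s in at t within {0..}. norm (norm (sc (u s) l - sc (u t) l - (s - t) *\<^sub>R sc v l) / norm (s - t))
  <= sqrt (2 / (b - a)) * nrm (%x. (u s x - u t x) /\<^sub>R (s - t) - v x)"
  proof eventually_elim
  fix s assume us: "u s : LL" and ne: "s ~= t"
  let ?i = "cr (1 / (s - t))"
  have e: "(%x. (u s x - u t x) /\<^sub>R (s - t) - v x) = (%x. ?i * (u s x - u t x) - v x)"
  by (rule ext) (simp add: sRc divide_inverse)
  have L: "(%x. ?i * (u s x - u t x)) : LL" by (rule L2_cmult(1)[OF L2_diff(1)[OF us ut]])
  have "sc (%x. ?i * (u s x - u t x) - v x) l = ?i * (sc (u s) l - sc (u t) l) - sc v l"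
  unfolding sine_coeff_diff[OF L v] sine_coeff_cmult sine_coeff_diff[OF us ut] ..
  also have "... = ?i * (sc (u s) l - sc (u t) l - (s - t) *\<^sub>R sc v l)"
  using ne by (simp add: sRc field_simps flip: of_real_diff)
  finally have "norm (sc (u s) l - sc (u t) l - (s - t) *\<^sub>R sc v l) / norm (s - t) =
  cmod (sc (%x. ?i * (u s x - u t x) - v x) l)"
  by (simp add: norm_mult norm_divide divide_inverse norm_inverse flip: of_real_diff)
  also have "... <= sqrt (2 / (b - a)) * nrm (%x. ?i * (u s x - u t x) - v x)"
  by (rule sine_coeff_bound[OF L2_diff(1)[OF L v] l])
  finally show "norm (norm (sc (u s) l - sc (u t) l - (s - t) *\<^sub>R sc v l) / norm (s - t))
  <= sqrt (2 / (b - a)) * nrm (%x. (u s x - u t x) /\<^sub>R (s - t) - v x)" unfolding e by simp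
  qed
 qed
 then show ?thesis unfolding has_vector_derivative_def has_derivative_iff_norm
  by (auto intro: bounded_linear_scaleR_left)
qed

lemma coeff_cont:
 assumes c: "cont_time J (LL) (nrm) g" and l: "l >= 1"
 shows "continuous_on J (%s. sc (g s) l)"
 unfolding continuous_on_def
proof
 fix t assume t: "t : J"
 have L: "g s : LL" if "s : J" for s using c that by (auto simp: cont_time_def)
 have lim: "((%s. nrm (%x. g s x - g t x)) \<longlongrightarrow> 0) (at t within J)" using c t by (auto simp: cont_time_def)
 have "((%s. sc (g s) l - sc (g t) l) \<longlongrightarrow> 0) (at t within J)"
 proof (rule Lim_null_comparison)
  show "((%s. sqrt (2 / (b - a)) * nrm (%x. g s x - g t x)) \<longlongrightarrow> 0) (at t within J)"
  using tendsto_mult_left[OF lim, of "sqrt (2 / (b - a))"] by simp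
  show "\<forall>\<^sub>F s in at t within J. norm (sc (g s) l - sc (g t) l) <= sqrt (2 / (b - a)) * nrm (%x. g s x - g t x)"
  unfolding eventually_at_filter
  proof (rule always_eventually, intro allI impI)
  fix s assume s: "s : J"
  show "norm (sc (g s) l - sc (g t) l) <= sqrt (2 / (b - a)) * nrm (%x. g s x - g t x)"
  using sine_coeff_bound[OF L2_diff(1)[OF L[OF s] L[OF t]] l] unfolding sine_coeff_diff[OF L[OF s] L[OF t]] .
  qed
 qed
 then show "((%s. sc (g s) l) \<longlongrightarrow> sc (g t) l) (at t within J)"
  by (rule Lim_null[THEN iffD2])
qed

text \<open>A chain of successive derivatives fixes representatives once and for all, so that traces of derivatives
 are plain values.\<close>

definition hseq :: "nat => real => (real => complex) => (nat => real => complex) => bool" where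
 "hseq m C u U \<longleftrightarrow> U 0 = u & (\<forall>j<m. ac (U j) (U (Suc j))) &
  (\<forall>j\<le>m. U j : LL & nrm (U j) <= C)"

lemma Hspace_crep:
 assumes u: "u : hS m" and m: "m >= 1"
 shows "\<exists>U. hseq m (hN m u) (crp u) U & (\<forall>j\<in>{1..m}. AE x in OM. dX j u x = U j x)"
  "AE x in OM. u x = crp u x"
proof -
 obtain U where U: "!!j. j < m ==> ac (U j) (U (Suc j))"
  "!!j. j <= m ==> U j : LL & (AE x in OM. dX j u x = U j x) & nrm (U j) = nrm (dX j u)"
  "AE x in OM. u x = U 0 x"
  using Hspace_AC[OF u] by blast
 have c: "crp u x = U 0 x" if "x : {a..b}" for x
  using crep_eq[OF U(3) AC_continuous[OF U(1)] that] m by simp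
 have AE: "AE x in OM. U 0 x = crp u x"
  by (rule AE_I2) (use c in auto)
 show *: "AE x in OM. u x = crp u x" using U(3) AE by eventually_elim simp
 have L: "U j : LL" "nrm (U j) <= hN m u" if "j <= m" for j
  using U(2)[OF that] Hnorm_ge[OF that, of u] by auto
 have m0: "crp u : borel_measurable (OM)"
  by (rule Om_measurable_AE[OF L2_meas[OF L(1)[of 0]] AE]) simp
 have L0: "crp u : LL" "nrm (crp u) = nrm (U 0)"
  using L2_cong_AE[OF L(1)[of 0] AE m0] by auto
 let ?U = "%j. if j = 0 then crp u else U j"
 have "hseq m (hN m u) (crp u) ?U"
  unfolding hseq_def
 proof (intro conjI allI impI)
  fix j assume j: "j < m"
  show "ac (?U j) (?U (Suc j))"
  using AC_cong[OF U(1)[OF j], of "?U j" "?U (Suc j)"] c by simp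
 next
  fix j assume "j <= m" then show "?U j : LL" "nrm (?U j) <= hN m u"
  using L L(2)[of 0] L0 by auto
 qed simp
 moreover have "\<forall>j\<in>{1..m}. AE x in OM. dX j u x = ?U j x" using U(2) by auto
 ultimately show "\<exists>U. hseq m (hN m u) (crp u) U & (\<forall>j\<in>{1..m}. AE x in OM. dX j u x = U j x)" by blast
qed

definition supc :: real where "supc = 1 + (1 / sqrt (b - a) + sqrt (b - a)) * 2"

lemma supc_ge: "supc >= 1" using ab by (simp add: supc_def)

lemma hseq_sup: "hseq m C u U ==> j < m ==> x : {a..b} ==> cmod (U j x) <= supc * C"
proof -
 assume h: "hseq m C u U" and j: "j < m" and x: "x : {a..b}"
 have A: "ac (U j) (U (Suc j))" and L: "nrm (U j) <= C" "U (Suc j) : LL" "nrm (U (Suc j)) <= C"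
  using h j by (auto simp: hseq_def)
 have C: "C >= 0" using order_trans[OF L2norm_nonneg L(1)] .
 have "cmod (U j x) <= (1 / sqrt (b - a) + sqrt (b - a)) * (nrm (U j) + nrm (U (Suc j)))"
  by (rule AC_sup_bound[OF A L(2) x])
 also have "... <= (1 / sqrt (b - a) + sqrt (b - a)) * (C + C)" using L ab by (intro mlm) auto
 also have "... <= supc * C" using C by (simp add: supc_def alg)
 finally show ?thesis .
qed

lemma hseq_reg:
 assumes h: "hseq m C u U" and j: "j <= m" and z: "!!i. i < j ==> even i = p ==> U i a = 0 & U i b = 0"
 shows "rg j p (supc * C) u"
proof -
 have u: "u = U 0" using h by (simp add: hseq_def)
 have LC: "nrm (U j) <= C" using h j by (auto simp: hseq_def)
 have C: "C >= 0" using order_trans[OF L2norm_nonneg LC] .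
 have "C <= supc * C" using mrm[OF supc_ge C] by simp
 then show ?thesis unfolding u using h j z LC
  by (intro reg_of_seq) (auto simp: hseq_def intro: hseq_sup[OF h])
qed

lemma hseq_shift: "hseq (m + i) C u U ==> hseq m C (U i) (%j. U (i + j))"
 by (auto simp: hseq_def)

lemma hseq_ip:
 assumes h: "hseq m C u U" 
 shows "j <= m ==> (!!i. i < j ==> even i ==> U i a = 0 & U i b = 0) ==>
  cmod (ipr (if even j then sN l else cN l) (U j)) = fq l ^ j * cmod (ipr (sN l) u)"
proof (induction j)
 case 0 then show ?case using h by (simp add: hseq_def)
next
 case (Suc j)
 have A: "ac (U j) (U (Suc j))" using h Suc.prems by (simp add: hseq_def)
 have IH: "cmod (ipr (if even j then sN l else cN l) (U j)) = fq l ^ j * cmod (ipr (sN l) u)"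
  by (rule Suc.IH) (use Suc.prems in auto)
 show ?case
 proof (cases "even j")
  case True
  then have "U j a = 0" "U j b = 0" using Suc.prems(2)[of j] by auto
  then show ?thesis using ip_cn_deriv[OF A, of l] IH True by (simp add: norm_mult mu_nonneg)
 next
  case False
  then show ?thesis using ip_sn_deriv[OF A, of l] IH by (simp add: norm_mult mu_nonneg)
 qed
qed

lemma sine_coeff_cmod: "cmod (sc u l) = 2 / (b - a) * cmod (ipr (sN l) u)"
 unfolding sine_coeff_ip norm_mult norm_of_real using ab by simp

lemma bounded_wn_tendsto_0:
 assumes X: "!!n. wn (Suc n) w c <= X"
 shows "(%l. w l * cmod (c l)) LQ 0"
proof -
 have X0: "X >= 0" using order_trans[OF wn_nonneg X] .
 have b: "(\<Sum>l<n. (w (Suc l) * cmod (c (Suc l)))^2) <= X^2" for n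
 proof -
  have "(\<Sum>l<n. (w (Suc l) * cmod (c (Suc l)))^2) = (\<Sum>l=1..n. (w l * cmod (c l))^2)"
  by (rule sum.reindex_bij_witness[of _ "%l. l - 1" Suc]) auto
  then show ?thesis using X[of n] wn_Suc_le[OF X0] by simp
 qed
 have "summable (%l. (w (Suc l) * cmod (c (Suc l)))^2)" by (rule sums_bounded_nonneg(1)[OF _ b]) simp
 then have "(%l. (w (Suc l) * cmod (c (Suc l)))^2) LQ 0" by (rule summable_LIMSEQ_zero)
 then have "(%l. sqrt ((w (Suc l) * cmod (c (Suc l)))^2)) LQ sqrt 0" by (rule tendsto_real_sqrt)
 then have "(%l. \<bar>w (Suc l) * cmod (c (Suc l))\<bar>) LQ 0" by simp
 then have "(%l. w (Suc l) * cmod (c (Suc l))) LQ 0" by (rule tendsto_rabs_zero_cancel)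
 then show ?thesis by (rule LIMSEQ_imp_Suc)
qed

text \<open>With the lower traces gone, \<open>j\<close> integrations by parts turn decay of the coefficients of \<open>u\<close> into decay of those of \<open>U j\<close>.\<close>

lemma hseq_vanish:
 assumes h: "hseq m C u U" and j: "j < m" "even j" and z: "!!i. i < j ==> even i ==> U i a = 0 & U i b = 0"
  and X: "!!n. wn (Suc n) (%l. fq l ^ Suc j) (sc u) <= X"
 shows "U j a = 0 & U j b = 0"
proof (rule vanishing_traces)
 show "ac (U j) (U (Suc j))" "U (Suc j) : LL" using h j by (auto simp: hseq_def)
 have lim: "(%l. (b - a) / 2 * (fq l ^ Suc j * cmod (sc u l))) LQ (b - a) / 2 * 0"
  by (intro tendsto_mult_left bounded_wn_tendsto_0[OF X])
 have e: "(b - a) / 2 * (fq l ^ Suc j * cmod (sc u l)) = cmod (of_real (fq l) * ipr (sN l) (U j))" for l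
  using hseq_ip[OF h less_imp_le[OF j(1)] z, of l] j(2) ab
  unfolding sine_coeff_cmod by (simp add: norm_mult mu_nonneg mult_ac)
 show "(%l. of_real (fq l) * ipr (sN l) (U j)) LQ 0"
  by (rule tendsto_norm_zero_cancel, rule lim[unfolded e mult_zero_right])
qed

lemma reg_wn:
 assumes "rg m True B u"
 shows "wn M (%l. fq l ^ m) (sc u) <= sqrt (2 / (b - a)) * B"
proof -
 have B: "B >= 0" by (rule reg_nonneg[OF assms])
 have "(\<Sum>l=1..M - 1. (fq l ^ m * cmod (sc u l))^2) <= 2 / (b - a) * B^2"
  by (rule reg_sine_bound[OF assms]) auto
 also have "... = (sqrt (2 / (b - a)) * B)^2" using ab by (simp add: pmd)
 finally show ?thesis using B ab by (subst wn_le) auto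
qed

lemma grid_sn:
 assumes "M > 0" shows "sN l (gr M j) = gs M l j"
proof -
 have *: "pi * real l / L * (real j * (L / real M)) = real j * real l * pi / real M" if "L ~= 0" for L using that by simp
 have "fq l * (gr M j - a) = real j * real l * pi / real M"
  using *[of "b - a"] ab unfolding mu_def grid_def by simp
 then show ?thesis unfolding sn_def gs_def by simp
qed

lemma grid_in: "M > 0 ==> j <= M ==> gr M j : {a..b}"
proof -
 assume M: "M > 0" "j <= M"
 have "real j * ((b - a) / real M) <= real M * ((b - a) / real M)" using ab M by (intro mrm) auto
 then show ?thesis using ab M by (auto simp: grid_def)
qed

lemma grid_ends: "gr M 0 = a" "M > 0 ==> gr M M = b" by (simp_all add: grid_def)

text \<open>Absolute convergence of the sine series lets the samples be regrouped by residue classes of frequencies.\<close>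

lemma function_aliasing:
 assumes h: "h = (b - a) / real M" and M: "M > 0" and m: "m >= 1" and u: "cont u"
  and X: "!!n. wn (Suc n) (%l. fq l ^ m) (sc u) <= X"
 shows "wn M (%_. 1) (%l. dst M (%j. u (gr M j)) l - sc u l) <= sqrt 2 * X * h ^ m"
proof (rule aliasing[OF h M m])
 have X0: "X >= 0" using order_trans[OF wn_nonneg X] .
 show "(\<Sum>l=1..n. (fq l ^ m * cmod (sc u l))^2) <= X^2" for n using X[of n] wn_Suc_le[OF X0] by simp
 show "X >= 0" by (rule X0)
 let ?K = "1 / fq 1 ^ (m - 1) * X"
 have p: "fq 1 > 0" by (rule mu_pos) simp
 have K0: "?K >= 0" using X0 p by simp
 have "wn (Suc n) (fq) (sc u) <= ?K" for n
 proof -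
  have "wn (Suc n) (%l. fq l ^ 1) (sc u) <= 1 / fq 1 ^ (m - 1) * wn (Suc n) (%l. fq l ^ m) (sc u)"
  by (rule wn_power_le[OF m])
  also have "... <= ?K" using X p by (intro mlm) auto
  finally show ?thesis by simp
 qed
 then have "(\<Sum>l=1..n. (fq l * cmod (sc u l))^2) <= ?K^2" for n using wn_Suc_le[OF K0] by simp
 from weighted_summable(1)[OF this K0] have "uniform_limit {a..b} (psum (sc u)) u sequentially"
  by (rule sine_series_uniform[OF u])
 fix j assume j: "j : {1..M - 1}"
 have "(%n. psum (sc u) n (gr M j)) LQ u (gr M j)"
  by (rule tendsto_uniform_limitI[OF \<open>uniform_limit {a..b} (psum (sine_coeff a b u)) u sequentially\<close> grid_in[OF M]]) (use j in auto)
 then show "(%n. \<Sum>l=1..n. sc u l * of_real (gs M l j)) LQ u (gr M j)"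
  unfolding psum_def grid_sn[OF M] .
qed

lemma wn_increment:
 assumes w: "!!l. w l >= 0" and pq: "p <= q" and sub: "{p..q} \<subseteq> {0..T}"
  and d: "!!l s. l : {1..M - 1} ==> s : {0..T} ==> (Y l hvd Y1 l s) (at s within {0..T})"
  and G: "!!s. s : {p..q} ==> wn M w (%l. Y1 l s - c l) <= G"
 shows "wn M w (%l. Y l q - Y l p - of_real (q - p) * c l) <= (q - p) * G"
proof (rule wn_integral_le[OF pq w _ G])
 fix l assume l: "l : {1..M - 1}"
 have "(Y1 l has_integral (Y l q - Y l p)) {p..q}"
  by (rule fundamental_theorem_of_calculus[OF pq]) (use d[OF l] sub hvw in blast)
 from has_integral_diff[OF this has_integral_const_real[of "c l" p q]] pq
 show "((%s. Y1 l s - c l) has_integral (Y l q - Y l p - of_real (q - p) * c l)) {p..q}"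
  by (simp add: sRc)
qed

end

section \<open>Solutions of the wave-type equation in sine coefficients\<close>

text \<open>A solution for one \<open>\<epsilon>\<close> with the bounds of the hypotheses collected in one constant \<open>C\<close>. All constants below are functions of \<open>C\<close> and the interval; uniformity in \<open>\<epsilon>\<close> is thereby visible from their definitions.\<close>

locale wave = seg +
 fixes f :: "real => real" and T C ep :: real and \<psi> :: "real => real => complex" and m0 :: nat
 assumes T: "0 < T" and eps: "0 < ep" "ep <= 1" and C: "0 <= C" and m0: "2 <= m0"
  and sol: "!!t. t : {0..T} ==> \<psi> t : Hspace a b 2 \<inter> H10 a b"
  and D1: "!!t. t : {0..T} ==> has_Dt a b \<psi> t (Dt a b \<psi> t)"
  and D1H: "!!t. t : {0..T} ==> Dt a b \<psi> t : H10 a b"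
  and D2: "!!t. t : {0..T} ==> has_Dt a b (Dt a b \<psi>) t (Dt a b (Dt a b \<psi>) t)"
  and D2c: "cont_time {0..T} (L2space a b) (L2norm a b) (Dt a b (Dt a b \<psi>))"
  and pde: "!!t. 0 < t ==> t <= T ==> AE x in Om a b.
  \<i> * Dt a b \<psi> t x - (ep^2) *\<^sub>R Dt a b (Dt a b \<psi>) t x + Dx a b 2 (\<psi> t) x + Fnl f (\<psi> t x) = 0"
  and B0: "AE t in lebesgue_on {0..T}. \<psi> t : Hspace a b m0 & Hnorm a b m0 (\<psi> t) <= C"
  and B1: "AE t in lebesgue_on {0..T}. Hnorm a b 1 (Dt a b \<psi> t) <= C"
  and B2: "AE t in lebesgue_on {0..T}. Dt a b (Dt a b \<psi>) t : Hspace a b 1 & Hnorm a b 1 (Dt a b (Dt a b \<psi>) t) <= C"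
begin

definition u :: "real => real => complex" where "u t = crp (\<psi> t)"
definition Y :: "nat => real => complex" where "Y l t = sc (\<psi> t) l"
definition Y1 :: "nat => real => complex" where "Y1 l t = sc (dT \<psi> t) l"
definition Y2 :: "nat => real => complex" where "Y2 l t = sc (dT (dT \<psi>) t) l"
definition Fh :: "nat => real => complex" where "Fh l t = sc (%x. Fnl f (u t x)) l"

lemma sine_coeff_crep: "w : hS m ==> m >= 1 ==> sc (crp w) l = sc w l"
 by (rule sine_coeff_cong_AE[symmetric, OF Hspace_crep(2) L2_meas[OF Hspace_L2]])

lemma AE_time: "AE t in lebesgue_on {0..T}. t : {0..T}"
 by (rule AE_I2) simp

lemma hseqD:
 "hseq m K g U ==> U 0 = g" "hseq m K g U ==> j < m ==> ac (U j) (U (Suc j))"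
 "hseq m K g U ==> j <= m ==> U j : LL" "hseq m K g U ==> j <= m ==> nrm (U j) <= K"
 by (simp_all add: hseq_def)

lemma u_facts:
 assumes t: "t : {0..T}"
 shows "\<exists>U. hseq 2 (hN 2 (\<psi> t)) (u t) U & (AE x in OM. dX 2 (\<psi> t) x = U 2 x)"
  "AE x in OM. \<psi> t x = u t x" "u t a = 0" "u t b = 0" "sc (u t) l = Y l t" "\<psi> t : LL"
  "u t : LL" "cont (u t)"
proof -
 have H: "\<psi> t : hS 2" "\<psi> t : hZ" using sol[OF t] by auto
 obtain U where U: "hseq 2 (hN 2 (\<psi> t)) (u t) U" "\<forall>j\<in>{1..2}. AE x in OM. dX j (\<psi> t) x = U j x"
  using Hspace_crep(1)[OF H(1)] unfolding u_def by auto
 then show "\<exists>U. hseq 2 (hN 2 (\<psi> t)) (u t) U & (AE x in OM. dX 2 (\<psi> t) x = U 2 x)" by auto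
 show "AE x in OM. \<psi> t x = u t x" unfolding u_def by (rule Hspace_crep(2)[OF H(1)]) simp
 show "u t a = 0" "u t b = 0" using H(2) by (auto simp: H10_def u_def)
 show "sc (u t) l = Y l t" unfolding u_def Y_def by (rule sine_coeff_crep[OF H(1)]) simp
 show "\<psi> t : LL" by (rule Hspace_L2[OF H(1)])
 have "ac (U 0) (U (Suc 0))" "U 0 : LL" "U 0 = u t" by (rule hseqD[OF U(1)]; simp)+
 then show "u t : LL" "cont (u t)" using AC_continuous[of "U 0"] by auto
qed

lemma Y_deriv: "l >= 1 ==> t : {0..T} ==> (Y l hvd Y1 l t) (at t within {0..T})"
 unfolding Y_def Y1_def by (rule hvw[OF coeff_deriv[OF D1]]) auto

lemma Y1_deriv: "l >= 1 ==> t : {0..T} ==> (Y1 l hvd Y2 l t) (at t within {0..T})"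
 unfolding Y1_def Y2_def by (rule hvw[OF coeff_deriv[OF D2]]) auto

lemma Y_cont: "l >= 1 ==> continuous_on {0..T} (Y l)"
 by (rule continuous_on_vector_derivative) (rule Y_deriv)
lemma Y1_cont: "l >= 1 ==> continuous_on {0..T} (Y1 l)"
 by (rule continuous_on_vector_derivative) (rule Y1_deriv)
lemma Y2_cont: "l >= 1 ==> continuous_on {0..T} (Y2 l)"
 unfolding Y2_def by (rule coeff_cont[OF D2c])

definition c1 :: real where "c1 = sqrt (2 / (b - a)) * (supc * C)"
definition c2 :: real where "c2 = 2 * sqrt (2 / (b - a)) * C"

lemma c_nonneg: "c1 >= 0" "c2 >= 0" "supc * C >= 0"
 using C ab supc_ge by (auto simp: c1_def c2_def)

lemma H10_wn:
 assumes w: "w : hZ" and le: "hN 1 w <= C"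
 shows "wn M (fq) (sc w) <= c1"
proof -
 have H: "w : hS 1" and z: "crp w a = 0" "crp w b = 0" using w by (auto simp: H10_def)
 obtain U where U: "hseq 1 (hN 1 w) (crp w) U" using Hspace_crep(1)[OF H] by auto
 have "rg 1 True (supc * hN 1 w) (crp w)"
  by (rule hseq_reg[OF U]) (use z U in \<open>auto simp: hseq_def\<close>)
 then have "rg 1 True (supc * C) (crp w)"
  by (rule reg_mono) (use le supc_ge in \<open>auto intro!: mlm\<close>)
 moreover have "sc (crp w) = sc w" by (rule ext) (rule sine_coeff_crep[OF H], simp)
 ultimately show ?thesis unfolding c1_def using reg_wn[of 1 "supc * C" "crp w" M] by simp
qed

lemma Y1_bound: assumes t: "t : {0..T}" shows "wn M (fq) (%l. Y1 l t) <= c1"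
proof (rule AE_continuous_le[OF T _ _ t])
 show "continuous_on {0..T} (%t. wn M (fq) (%l. Y1 l t))" by (rule wn_cont) (rule Y1_cont, simp)
 show "AE t in lebesgue_on {0..T}. wn M (fq) (%l. Y1 l t) <= c1"
  using B1 AE_time by eventually_elim (unfold Y1_def, rule H10_wn[OF D1H])
qed

lemma Y_bound: assumes t: "t : {0..T}" shows "wn M (fq) (%l. Y l t) <= c1"
proof (rule AE_continuous_le[OF T _ _ t])
 show "continuous_on {0..T} (%t. wn M (fq) (%l. Y l t))" by (rule wn_cont) (rule Y_cont, simp)
 show "AE t in lebesgue_on {0..T}. wn M (fq) (%l. Y l t) <= c1"
  using B0 AE_time
 proof eventually_elim
  fix t assume 1: "\<psi> t : hS m0 & hN m0 (\<psi> t) <= C" and t: "t : {0..T}"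
  note 2 = sol[OF t]
  have "hN 1 (\<psi> t) <= C" using 1 Hnorm_mono[of 1 m0 a b "\<psi> t"] m0 by linarith
  then show "wn M (fq) (%l. Y l t) <= c1" unfolding Y_def using 2 by (intro H10_wn) auto
 qed
qed

lemma Y_lipschitz:
 assumes pq: "0 <= p" "p <= q" "q <= T" shows "wn M (fq) (%l. Y l q - Y l p) <= (q - p) * c1"
proof -
 have "wn M (fq) (%l. Y l q - Y l p - of_real (q - p) * 0) <= (q - p) * c1"
  by (rule wn_increment[where c = "%_. 0" and T = T and ?Y1.0 = Y1]) (use pq Y_deriv Y1_bound mu_nonneg in auto)
 then show ?thesis by simp
qed

text \<open>The second time derivative lies in \<open>H\<^sup>1\<close> but need not vanish at the ends. Its traces enter the
 coefficients with alternating signs only, so they cancel between frequencies of equal parity.\<close>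

lemma trace_cancellation:
 assumes g: "g : hS 1" "hN 1 g <= C"
 shows "wn (Suc n) (%_. 1) (%l. of_real (fq l) * sc g l - of_real (fq (l + 2 * K)) * sc g (l + 2 * K)) <= c2"
proof -
 obtain U where U: "hseq 1 (hN 1 g) (crp g) U" using Hspace_crep(1)[OF g(1)] by auto
 have A: "ac (U 0) (U 1)" and L: "U 1 : LL" "nrm (U 1) <= C" and U0: "U 0 = crp g"
  using hseqD(2)[OF U, of 0] hseqD(3,4)[OF U, of 1] hseqD(1)[OF U] g(2) by auto
 let ?e = "%l. ipr (cN l) (U 1)"
 let ?k = "cr (2 / (b - a))"
 have s: "of_real (fq l) * sc g l = ?k * (?e l - ((- 1) ^ l * U 0 b - U 0 a))" for l
 proof -
  have "sc g l = ?k * ipr (sN l) (U 0)"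
  using sine_coeff_crep[OF g(1), of l] sine_coeff_ip[of "crp g" l] U0 by simp
  then show ?thesis unfolding ip_cn_deriv[OF A, of l] by simp
 qed
 have eq: "of_real (fq l) * sc g l - of_real (fq (l + 2 * K)) * sc g (l + 2 * K) = ?k * (?e l - ?e (l + 2 * K))" for l
  unfolding s by (simp add: power_add power_mult right_diff_distrib)
 have bes: "wn (Suc n) (%_. 1) (%l. ?e (l + i)) <= sqrt ((b - a) / 2) * C" for i
 proof -
  have "(\<Sum>l=1..n. (1 * cmod (?e (l + i)))^2) = (\<Sum>l\<in>{1 + i..n + i}. (cmod (?e l))^2)"
  by (subst sum.shift_bounds_cl_nat_ivl) simp
  also have "... <= (b - a) / 2 * (nrm (U 1))^2" by (rule bessel[OF trig_cn _ _ L(1)]) auto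
  also have "... <= (b - a) / 2 * C^2" using L(2) ab by (intro mlm power_mono) auto
  also have "... = (sqrt ((b - a) / 2) * C)^2" using ab by (simp add: pmd)
  finally show ?thesis using C ab by (subst wn_Suc_le) auto
 qed
 have "wn (Suc n) (%_. 1) (%l. ?k * (?e l - ?e (l + 2 * K))) = cmod ?k * wn (Suc n) (%_. 1) (%l. ?e l - ?e (l + 2 * K))" by (rule wn_cmult)
 also have "... <= cmod ?k * (wn (Suc n) (%_. 1) ?e + wn (Suc n) (%_. 1) (%l. ?e (l + 2 * K)))"
  by (intro mlm wn_diff) auto
 also have "... <= cmod ?k * (sqrt ((b - a) / 2) * C + sqrt ((b - a) / 2) * C)"
  using bes[of 0] bes[of "2 * K"] by (intro mlm add_mono) auto
 also have "... = c2"
 proof -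
  have r: "2 / (b - a) * sqrt ((b - a) / 2) = sqrt (2 / (b - a))"
  proof -
  have ss: "sqrt (2 / (b - a)) * sqrt (2 / (b - a)) = 2 / (b - a)" using ab by simp
  have sx: "sqrt (2 / (b - a)) * sqrt ((b - a) / 2) = 1" using ab by (simp flip: real_sqrt_mult)
  have "(sqrt (2 / (b - a)) * sqrt (2 / (b - a))) * sqrt ((b - a) / 2) = sqrt (2 / (b - a))"
  unfolding mult.assoc sx by (rule mult_1_right)
  then show ?thesis unfolding ss .
  qed
  have "cmod ?k = 2 / (b - a)" using ab by (simp only: norm_of_real) simp
  moreover have "k * (x * C + x * C) = 2 * (k * x) * C" for k x :: real by (simp add: alg)
  ultimately show ?thesis unfolding c2_def r[symmetric] by (simp only:)
 qed
 finally show ?thesis unfolding eq .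
qed

text \<open>Integrate the cancelled combination in time and send the second frequency to infinity; its contribution disappears because \<open>\<partial>\<^sub>t\<psi>\<close>, unlike \<open>\<partial>\<^sub>t\<^sub>t\<psi>\<close>, vanishes at the ends.\<close>

lemma Y1_lipschitz:
 assumes pq: "0 <= p" "p <= q" "q <= T" shows "wn M (fq) (%l. Y1 l q - Y1 l p) <= (q - p) * c2"
proof -
 have sub: "{p..q} \<subseteq> {0..T}" using pq by auto
 let ?z = "%K l r. of_real (fq l) * Y2 l r - of_real (fq (l + 2 * K)) * Y2 (l + 2 * K) r"
 let ?Z = "%K l r. of_real (fq l) * Y1 l r - of_real (fq (l + 2 * K)) * Y1 (l + 2 * K) r"
 have zb: "wn (Suc n) (%_. 1) (%l. ?z K l r) <= c2" if r: "r : {0..T}" for r K n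
 proof (rule AE_continuous_le[OF T _ _ r])
  show "continuous_on {0..T} (%r. wn (Suc n) (%_. 1) (%l. ?z K l r))"
  by (rule wn_cont) (intro continuous_intros Y2_cont; simp)
  show "AE r in lebesgue_on {0..T}. wn (Suc n) (%_. 1) (%l. ?z K l r) <= c2"
  using B2 by eventually_elim (unfold Y2_def, rule trace_cancellation; simp)
 qed
 have Zb: "wn (Suc n) (%_. 1) (%l. ?Z K l q - ?Z K l p) <= (q - p) * c2" for n K
 proof (rule wn_integral_le[OF pq(2)])
  fix l assume l: "l : {1..Suc n - 1}"
  have "(?Z K l hvd ?z K l r) (at r within {p..q})" if "r : {p..q}" for r
  by (rule hvw[OF _ sub], intro has_vector_derivative_diff has_vector_derivative_mult_right Y1_deriv)
  (use l that sub in auto)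
  then show "((%r. ?z K l r) has_integral (?Z K l q - ?Z K l p)) {p..q}"
  by (rule fundamental_theorem_of_calculus[OF pq(2)])
 qed (use zb sub in auto)
 have Z0: "(%K. of_real (fq (l + 2 * K)) * Y1 (l + 2 * K) r) LQ 0" if r: "r : {0..T}" for l r
 proof -
  have "(%l. fq l * cmod (Y1 l r)) LQ 0" by (rule bounded_wn_tendsto_0) (rule Y1_bound[OF r])
  then have "(%l. cmod (of_real (fq l) * Y1 l r)) LQ 0" by (simp add: norm_mult mu_nonneg)
  then have "(%l. of_real (fq l) * Y1 l r) LQ 0" by (rule tendsto_norm_zero_cancel)
  moreover have "strict_mono (%K. l + 2 * K)" by (auto simp: strict_mono_def)
  ultimately show ?thesis by (rule LIMSEQ_subseq_LIMSEQ[unfolded o_def])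
 qed
 have lim: "(%K. wn (Suc n) (%_. 1) (%l. ?Z K l q - ?Z K l p)) \<longlonglongrightarrow>
  wn (Suc n) (%_. 1) (%l. (of_real (fq l) * Y1 l q - 0) - (of_real (fq l) * Y1 l p - 0))" for n
  unfolding wn_def L2_set_def by (intro tendsto_intros Z0) (use pq in auto)
 have b: "wn (Suc n) (fq) (%l. Y1 l q - Y1 l p) <= (q - p) * c2" for n
 proof -
  have "wn (Suc n) (%_. 1) (%l. (of_real (fq l) * Y1 l q - 0) - (of_real (fq l) * Y1 l p - 0)) <= (q - p) * c2"
  by (rule LIMSEQ_le_const2[OF lim]) (use Zb in blast)
  moreover have "wn (Suc n) (fq) (%l. Y1 l q - Y1 l p) <= wn (Suc n) (%_. 1) (%l. (of_real (fq l) * Y1 l q - 0) - (of_real (fq l) * Y1 l p - 0))"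
  by (rule wn_mono) (auto simp: mu_nonneg norm_mult simp flip: right_diff_distrib)
  ultimately show ?thesis by linarith
 qed
 show ?thesis
 proof (cases M)
  case 0 then show ?thesis using pq c_nonneg by (simp add: wn_def)
 next
  case (Suc n) then show ?thesis using b[of n] by simp
 qed
qed

subsection \<open>Regularity of time differences\<close>

definition h2z :: "(real => complex) => bool" where
 "h2z g \<longleftrightarrow> (\<exists>v w. ac g v & ac v w & w : LL & g a = 0 & g b = 0)"

lemma h2z_diff: "h2z g ==> h2z h ==> h2z (%x. g x - h x)"
 unfolding h2z_def by (elim exE conjE, intro exI conjI, rule AC_diff_fun, assumption, assumption, rule AC_diff_fun, assumption, assumption, rule L2_diff(1), assumption, assumption) auto

lemma h2z_cmult: "h2z g ==> h2z (%x. c * g x)"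
 unfolding h2z_def by (elim exE conjE, intro exI conjI, rule AC_cmult, assumption, rule AC_cmult, assumption, rule L2_cmult(1), assumption) auto

lemma h2z_reg: "h2z g ==> (!!n. wn (Suc n) (fq) (sc g) <= X) ==> rg 1 False (kap * X) g"
 unfolding h2z_def using grad_bound_reg by blast

lemma h2z_u: "t : {0..T} ==> h2z (u t)"
proof -
 assume t: "t : {0..T}"
 obtain U where "hseq 2 (hN 2 (\<psi> t)) (u t) U" using u_facts(1)[OF t] by blast
 then have "ac (U 0) (U (Suc 0))" "ac (U (Suc 0)) (U (Suc (Suc 0)))" "U (Suc (Suc 0)) : LL" "U 0 = u t"
  by - (erule hseqD; simp)+
 then show "h2z (u t)" unfolding h2z_def using u_facts(3,4)[OF t] by metis
qed

lemma u_diff_reg: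
 assumes pq: "0 <= p" "p <= q" "q <= T" shows "rg 1 False (kap * ((q - p) * c1)) (%x. u q x - u p x)"
proof (rule h2z_reg[OF h2z_diff[OF h2z_u h2z_u]])
 fix n
 have "sc (%x. u q x - u p x) = (%l. Y l q - Y l p)"
  using u_facts(5,7)[of q] u_facts(5,7)[of p] pq by (intro ext) (simp add: sine_coeff_diff)
 then show "wn (Suc n) (fq) (sc (%x. u q x - u p x)) <= (q - p) * c1"
  using Y_lipschitz[OF pq] by simp
qed (use pq in auto)

lemma u_reg: "t : {0..T} ==> rg 1 False (kap * c1) (u t)"
proof -
 assume t: "t : {0..T}"
 have "sc (u t) = (%l. Y l t)" by (rule ext) (rule u_facts(5)[OF t])
 then show "rg 1 False (kap * c1) (u t)" using Y_bound[OF t] by (intro h2z_reg[OF h2z_u[OF t]]) simp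
qed

lemma u_sup: "t : {0..T} ==> x : {a..b} ==> cmod (u t x) <= kap * c1"
 using reg_sup[OF u_reg[unfolded One_nat_def]] .

lemma u_lip: "p : {0..T} ==> q : {0..T} ==> x : {a..b} ==> cmod (u q x - u p x) <= kap * c1 * \<bar>q - p\<bar>"
proof (induction p q rule: linorder_wlog)
 case (le p q)
 then show ?case using reg_sup[OF u_diff_reg[of p q, unfolded One_nat_def], of x] by (simp add: mult_ac)
next
 case (sym p q) then show ?case by (simp add: norm_minus_commute abs_minus_commute)
qed

lemma u_time_cont: "x : {a..b} ==> continuous_on {0..T} (%t. u t x)"
proof (rule lipschitz_on_continuous_on[of "kap * c1"], rule lipschitz_onI)
 fix s r assume "x : {a..b}" "s : {0..T}" "r : {0..T}"
 then show "dist (u s x) (u r x) <= kap * c1 * dist s r" using u_lip[of r s x] by (simp add: dist_norm)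
next
 show "0 <= kap * c1" by (intro mnn kap_nonneg c_nonneg)
qed

text \<open>Both increments are compared with \<open>v\<close> and \<open>ts\<close> times the velocity at time \<open>t\<close>, which then cancels.\<close>

lemma Zt_u:
 assumes t: "0 < ts" "ts <= 1" "ts <= t" "0 <= v" "v <= ts" "t + v <= T"
 shows "Zt (kap * (c1 + 2 * c2)) ts (v / ts) (u (t - ts)) (u t) (u (t + v))"
 unfolding Zt_def
proof (intro conjI)
 have k: "kap * c1 <= kap * (c1 + 2 * c2)" using kap_nonneg c_nonneg by (intro mlm) auto
 show "rg 1 False (kap * (c1 + 2 * c2)) (u t)" by (rule reg_mono[OF u_reg k]) (use t in auto)
 show "rg 1 False (kap * (c1 + 2 * c2) * ts) (%x. u t x - u (t - ts) x)"
 proof (rule reg_mono[OF u_diff_reg])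
  show "kap * ((t - (t - ts)) * c1) <= kap * (c1 + 2 * c2) * ts" using mrm[OF k, of ts] t by (simp add: mult_ac)
 qed (use t in auto)
 let ?r = "cr (v / ts)"
 let ?g = "%x. u (t + v) x - u t x - ?r * (u t x - u (t - ts) x)"
 have m: "t + v : {0..T}" "t : {0..T}" "t - ts : {0..T}" using t by auto
 have sc: "sc ?g l = (Y l (t + v) - Y l t - of_real v * Y1 l t) - ?r * (Y l t - Y l (t - ts) - of_real ts * Y1 l t)" for l
 proof -
  note L = u_facts(7)[OF m(1)] u_facts(7)[OF m(2)] u_facts(7)[OF m(3)]
  have "sc ?g l = (Y l (t + v) - Y l t) - ?r * (Y l t - Y l (t - ts))"
  by (unfold sine_coeff_diff[OF L2_diff(1)[OF L(1,2)] L2_cmult(1)[OF L2_diff(1)[OF L(2,3)]]] sine_coeff_cmult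
  sine_coeff_diff[OF L(1,2)] sine_coeff_diff[OF L(2,3)] u_facts(5)[OF m(1)] u_facts(5)[OF m(2)] u_facts(5)[OF m(3)], rule refl)
  moreover have rt: "?r * of_real ts = of_real v" using t by simp
  have "?r * (Y l t - Y l (t - ts) - of_real ts * Y1 l t) = ?r * (Y l t - Y l (t - ts)) - (?r * of_real ts) * Y1 l t"
  by (simp only: right_diff_distrib mult.assoc)
  then have "(Y l (t + v) - Y l t) - ?r * (Y l t - Y l (t - ts)) =
  (Y l (t + v) - Y l t - of_real v * Y1 l t) - ?r * (Y l t - Y l (t - ts) - of_real ts * Y1 l t)" unfolding rt by simp
  ultimately show ?thesis by (rule trans)
 qed
 have "wn M (fq) (%l. Y l (t + v) - Y l t - of_real (t + v - t) * Y1 l t) <= (t + v - t) * (ts * c2)" for M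
 proof (rule wn_increment[where T = T and ?Y1.0 = Y1])
  fix s assume s: "s : {t..t + v}"
  have "wn M (fq) (%l. Y1 l s - Y1 l t) <= (s - t) * c2" by (rule Y1_lipschitz) (use s t in auto)
  also have "... <= ts * c2" using s t c_nonneg by (intro mrm) auto
  finally show "wn M (fq) (%l. Y1 l s - Y1 l t) <= ts * c2" .
 qed (use t Y_deriv mu_nonneg in auto)
 then have 1: "wn M (fq) (%l. Y l (t + v) - Y l t - of_real v * Y1 l t) <= c2 * ts^2" for M
 proof -
  have "v * (ts * c2) <= ts * (ts * c2)" using t c_nonneg by (intro mrm) auto
  then show ?thesis using \<open>!!M. wn M (mu a b) (%l. Y l (t + v) - Y l t - of_real (t + v - t) * Y1 l t) <= (t + v - t) * (ts * c2)\<close>[of M]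
  by (simp add: psq mult_ac)
 qed
 have "wn M (fq) (%l. Y l t - Y l (t - ts) - of_real (t - (t - ts)) * Y1 l t) <= (t - (t - ts)) * (ts * c2)" for M
 proof (rule wn_increment[where T = T and ?Y1.0 = Y1])
  fix s assume s: "s : {t - ts..t}"
  have "wn M (fq) (%l. Y1 l s - Y1 l t) = wn M (fq) (%l. - (Y1 l t - Y1 l s))" by simp
  also have "... = wn M (fq) (%l. Y1 l t - Y1 l s)" by (rule wn_uminus)
  also have "... <= (t - s) * c2" by (rule Y1_lipschitz) (use s t in auto)
  also have "... <= ts * c2" using s t c_nonneg by (intro mrm) auto
  finally show "wn M (fq) (%l. Y1 l s - Y1 l t) <= ts * c2" .
 qed (use t Y_deriv mu_nonneg in auto)
 then have 2: "wn M (fq) (%l. Y l t - Y l (t - ts) - of_real ts * Y1 l t) <= c2 * ts^2" for M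
  by (simp add: psq mult_ac)
 have w: "wn (Suc n) (fq) (sc ?g) <= (c1 + 2 * c2) * ts^2" for n
 proof -
  have "wn (Suc n) (fq) (sc ?g) <= wn (Suc n) (fq) (%l. Y l (t + v) - Y l t - of_real v * Y1 l t)
  + wn (Suc n) (fq) (%l. ?r * (Y l t - Y l (t - ts) - of_real ts * Y1 l t))"
  unfolding sc[abs_def] by (rule wn_diff) (rule mu_nonneg)
  also have "wn (Suc n) (fq) (%l. ?r * (Y l t - Y l (t - ts) - of_real ts * Y1 l t)) = cmod ?r * wn (Suc n) (fq) (%l. Y l t - Y l (t - ts) - of_real ts * Y1 l t)"
  by (rule wn_cmult)
  also have "... <= 1 * (c2 * ts^2)"
  using t by (intro mult_mono 2) (auto simp: norm_divide)
  finally have "wn (Suc n) (fq) (sc ?g) <= 2 * c2 * ts^2" using 1[of "Suc n"] by simp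
  also have "... <= (c1 + 2 * c2) * ts^2" using c_nonneg by (intro mrm) auto
  finally show ?thesis .
 qed
 have "rg 1 False (kap * ((c1 + 2 * c2) * ts^2)) ?g"
  by (rule h2z_reg[OF h2z_diff[OF h2z_diff[OF h2z_u[OF m(1)] h2z_u[OF m(2)]] h2z_cmult[OF h2z_diff[OF h2z_u[OF m(2)] h2z_u[OF m(3)]]]] w])
 then show "rg 1 False (kap * (c1 + 2 * c2) * ts^2) ?g" by (simp only: mult.assoc)
qed

text \<open>The increment over the first step, for the calculus of triples.\<close>

lemma Zt_first:
 assumes t: "0 < ts" "ts <= 1" "0 <= v" "v <= ts" "v <= T"
 shows "Zt (kap * (c1 + 2 * c2)) ts 0 (u 0) (u v) (u v)"
 unfolding Zt_def
proof (intro conjI)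
 have k: "kap * c1 <= kap * (c1 + 2 * c2)" using kap_nonneg c_nonneg by (intro mlm) auto
 show "rg 1 False (kap * (c1 + 2 * c2)) (u v)" by (rule reg_mono[OF u_reg k]) (use t in auto)
 show "rg 1 False (kap * (c1 + 2 * c2) * ts) (%x. u v x - u 0 x)"
 proof (rule reg_mono[OF u_diff_reg])
  have "v * (kap * c1) <= ts * (kap * c1)" by (intro mrm mnn kap_nonneg c_nonneg t(4))
  then have "kap * ((v - 0) * c1) <= kap * c1 * ts" by (simp add: mult_ac)
  then show "kap * ((v - 0) * c1) <= kap * (c1 + 2 * c2) * ts" using mrm[OF k, of ts] t by linarith
 qed (use t in auto)
 have "rg 1 False (kap * 0) (%x. u v x - u v x)"
 proof (rule h2z_reg[OF h2z_diff[OF h2z_u h2z_u]])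
  show "wn (Suc n) (fq) (sc (%x. u v x - u v x)) <= 0" for n
  by (simp add: sine_coeff_def wn_def L2_set_def)
 qed (use t in auto)
 then show "rg 1 False (kap * (c1 + 2 * c2) * ts^2) (%x. u v x - u v x - of_real 0 * (u v x - u 0 x))"
  using reg_mono[of 1 False "kap * 0" _ "kap * (c1 + 2 * c2) * ts^2"] kap_nonneg c_nonneg by simp
qed

text \<open>The bound is inherited from almost every time by continuity.\<close>

lemma u_space_lip:
 assumes t: "t : {0..T}" and x: "a <= x" "x <= y" "y <= b"
 shows "cmod (u t y - u t x) <= supc * C * (y - x)"
proof (rule AE_continuous_le[OF T _ _ t])
 show "continuous_on {0..T} (%t. cmod (u t y - u t x))" by (intro continuous_intros u_time_cont) (use x in auto)
 show "AE t in lebesgue_on {0..T}. cmod (u t y - u t x) <= supc * C * (y - x)"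
  using B0
 proof eventually_elim
  fix t assume 1: "\<psi> t : hS m0 & hN m0 (\<psi> t) <= C"
  obtain U where U: "hseq m0 (hN m0 (\<psi> t)) (u t) U" using Hspace_crep(1)[of "\<psi> t" m0] 1 m0 unfolding u_def by auto
  have A: "ac (U 0) (U 1)" "U 0 = u t" using hseqD(2)[OF U, of 0] hseqD(1)[OF U] m0 by auto
  have le: "supc * hN m0 (\<psi> t) <= supc * C" using 1 supc_ge by (intro mlm) auto
  have "cmod (U 1 z) <= supc * C" if "z : {x..y}" for z using hseq_sup[OF U, of 1 z] that x m0 le by auto
  then have "norm (integral {x..y} (U 1)) <= integral {x..y} (%_. supc * C)"
  by (intro norm_integral_le AC_abs_int[OF A(1)]) (use x in auto)
  then show "cmod (u t y - u t x) <= supc * C * (y - x)"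
  using AC_diff[OF A(1) x] x unfolding A(2) by (simp add: mult_ac)
 qed
qed

subsection \<open>The equation for the coefficients\<close>

lemma coefficient_ode:
 assumes t: "0 < t" "t <= T" and l: "l >= 1" and F: "(%x. Fnl f (u t x)) : LL"
 shows "of_real (ep^2) * Y2 l t - \<i> * Y1 l t + of_real ((fq l)^2) * Y l t = Fh l t"
proof -
 have tt: "t : {0..T}" using t by auto
 obtain U where U: "hseq 2 (hN 2 (\<psi> t)) (u t) U" "AE x in OM. dX 2 (\<psi> t) x = U 2 x"
  using u_facts(1)[OF tt] by blast
 have A: "ac (U 0) (U (Suc 0))" "ac (U (Suc 0)) (U 2)" "U 2 : LL" "U 0 = u t"
  using hseqD(2)[OF U(1), of 0] hseqD(2)[OF U(1), of 1] hseqD(3)[OF U(1), of 2] hseqD(1)[OF U(1)]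
  by (auto simp: numeral_2_eq_2)
 have L: "dT \<psi> t : LL" "dT (dT \<psi>) t : LL"
  using D1[OF tt] D2[OF tt] by (auto simp: has_Dt_def)
 let ?g = "%x. \<i> * dT \<psi> t x - of_real (ep^2) * dT (dT \<psi>) t x + U 2 x + Fnl f (u t x)"
 note l1 = L2_cmult(1)[OF L(1), of \<i>] and l2 = L2_cmult(1)[OF L(2), of "of_real (ep^2)"]
 note l3 = L2_diff(1)[OF l1 l2]
 note l4 = L2_add(1)[OF l3 A(3)]
 have "AE x in OM. ?g x = 0"
  using pde[OF t] U(2) u_facts(2)[OF tt] by eventually_elim (simp add: sRc)
 then have "sc ?g l = sc (%x. 0) l"
  by (rule sine_coeff_cong_AE[OF _ L2_meas[OF L2_add(1)[OF l4 F]]])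
 also have "... = 0" by (simp add: sine_coeff_def)
 also have "sc ?g l = \<i> * Y1 l t - of_real (ep^2) * Y2 l t + sc (U 2) l + Fh l t"
  unfolding sine_coeff_add[OF l4 F] sine_coeff_add[OF l3 A(3)] sine_coeff_diff[OF l1 l2] sine_coeff_cmult Fh_def Y1_def Y2_def ..
 also have "sc (U 2) l = - of_real ((fq l)^2) * Y l t"
  using ip_sn_deriv[OF A(2), of l] ip_cn_deriv[OF A(1), of l] u_facts(3,4)[OF tt] u_facts(5)[OF tt, of l]
  unfolding sine_coeff_ip A(4) by (simp add: psq mult_ac)
 finally show ?thesis by (simp add: alg)
qed

context
 fixes R La :: real
 assumes sdF: "sd R La (Fnl f)" and R: "kap * c1 <= R" and Lam: "La >= 0"
begin

lemma Fu_cont: "t : {0..T} ==> cont (%x. Fnl f (u t x))"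
proof -
 assume t: "t : {0..T}"
 have r: "cmod (u t x) <= R" if "x : {a..b}" for x using u_sup[OF t that] R by linarith
 show ?thesis unfolding continuous_on_def
 proof
  fix x assume x: "x : {a..b}"
  have c: "((%y. u t y) \<longlongrightarrow> u t x) (at x within {a..b})" using u_facts(8)[OF t] x by (simp add: continuous_on_def)
  have "((%y. Fnl f (u t y) - Fnl f (u t x)) \<longlongrightarrow> 0) (at x within {a..b})"
  proof (rule Lim_null_comparison)
  show "((%y. La * cmod (u t y - u t x)) \<longlongrightarrow> 0) (at x within {a..b})"
  using tendsto_mult_left[OF tendsto_norm_zero[OF LIM_zero[OF c]], of La] by simp
  show "\<forall>\<^sub>F y in at x within {a..b}. norm (Fnl f (u t y) - Fnl f (u t x)) <= La * cmod (u t y - u t x)"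
  unfolding eventually_at_filter
  by (rule always_eventually, intro allI impI, rule sdD(2)[OF sdF r r[OF x]])
  qed
  then show "((%y. Fnl f (u t y)) \<longlongrightarrow> Fnl f (u t x)) (at x within {a..b})" by (rule Lim_null[THEN iffD2])
 qed
qed

lemma Fh_cont: "l >= 1 ==> continuous_on {0..T} (Fh l)"
proof (rule lipschitz_on_continuous_on[of "sqrt (2 / (b - a)) * (La * (kap * c1) * sqrt (b - a))"], rule lipschitz_onI)
 fix p q assume l: "l >= 1" and p: "p : {0..T}" and q: "q : {0..T}"
 note L = L2_cont[OF Fu_cont[OF p]] L2_cont[OF Fu_cont[OF q]]
 have r: "cmod (u t x) <= R" if "x : {a..b}" "t : {0..T}" for x t using u_sup[OF that(2,1)] R by linarith
 have m: "(%x. Fnl f (u p x) - Fnl f (u q x)) : borel_measurable (OM)" by (rule L2_meas[OF L2_diff(1)[OF L]])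
 have "cmod (Fnl f (u p x) - Fnl f (u q x)) <= La * (kap * c1) * \<bar>p - q\<bar>" if x: "x : {a<..<b}" for x
 proof -
  have x': "x : {a..b}" using x by auto
  have "cmod (Fnl f (u p x) - Fnl f (u q x)) <= La * cmod (u p x - u q x)" by (rule sdD(2)[OF sdF r[OF x' p] r[OF x' q]])
  also have "... <= La * (kap * c1 * \<bar>p - q\<bar>)" by (rule mlm[OF u_lip[OF q p x'] Lam])
  finally show ?thesis by (simp add: mult_ac)
 qed
 from L2_bounded(2)[OF m this]
 have "nrm (%x. Fnl f (u p x) - Fnl f (u q x)) <= La * (kap * c1) * \<bar>p - q\<bar> * sqrt (b - a)" .
 then have "sqrt (2 / (b - a)) * nrm (%x. Fnl f (u p x) - Fnl f (u q x)) <= sqrt (2 / (b - a)) * (La * (kap * c1) * \<bar>p - q\<bar> * sqrt (b - a))"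
  by (rule mlm) (use ab in auto)
 moreover have "dist (Fh l p) (Fh l q) <= sqrt (2 / (b - a)) * nrm (%x. Fnl f (u p x) - Fnl f (u q x))"
  unfolding Fh_def dist_norm sine_coeff_diff[OF L, symmetric] by (rule sine_coeff_bound[OF L2_diff(1)[OF L] l])
 ultimately show "dist (Fh l p) (Fh l q) <= sqrt (2 / (b - a)) * (La * (kap * c1) * sqrt (b - a)) * dist p q"
  by (simp add: dist_real_def mult_ac)
next
 show "0 <= sqrt (2 / (b - a)) * (La * (kap * c1) * sqrt (b - a))"
  by (intro mnn Lam kap_nonneg c_nonneg) (use ab in auto)
qed

lemma ode: "l >= 1 ==> 0 < t ==> t <= T ==> of_real (ep^2) * Y2 l t - \<i> * Y1 l t + of_real ((fq l)^2) * Y l t = Fh l t"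
 by (rule coefficient_ode) (auto intro!: L2_cont Fu_cont)

text \<open>Duhamel's formula gains one power of the frequency (with a constant depending on \<open>ep\<close>), because the
 kernel decays like \<open>1 / (ep nu)\<close>.\<close>

lemma frequency_gain:
 assumes t: "t : {0..T}" and F: "!!s. s : {0..T} ==> wn M (%l. fq l ^ j) (%l. Fh l s) <= B"
  and X0: "wn M (%l. fq l ^ Suc j) (%l. Y l 0) <= X0" and X1: "wn M (%l. fq l ^ j) (%l. Y1 l 0) <= X1"
 shows "wn M (%l. fq l ^ Suc j) (%l. Y l t) <= X0 + X1 + T * (1 / ep * B)"
proof -
 let ?w = "%l. fq l ^ Suc j" let ?m = "%l. fq l"
 have w: "?w l >= 0" "?m l ^ j >= 0" for l using mu_nonneg by (auto intro!: zero_le_power mnn)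
 have mp: "?m l > 0" "l >= 1" if "l : {1..M - 1}" for l using that by (auto intro!: mu_pos)
 have sub: "{0..t} \<subseteq> {0..T}" using t by auto
 let ?I = "%l. Y l t - (c0 ep t (?m l) * Y l 0 + d0 ep t (?m l) * Y1 l 0)"
 have hi: "((%s. Kn ep (?m l) (t - s) * Fh l s) has_integral ?I l) {0..t}" if l: "l : {1..M - 1}" for l
 proof (rule duhamel[OF eps(1) mp(1)[OF l]])
  show "(Y l hvd Y1 l s) (at s within {0..t})" if "s : {0..t}" for s
  by (rule hvw[OF Y_deriv[OF mp(2)[OF l]] sub]) (use that sub in auto)
  show "(Y1 l hvd Y2 l s) (at s within {0..t})" if "s : {0..t}" for s
  by (rule hvw[OF Y1_deriv[OF mp(2)[OF l]] sub]) (use that sub in auto)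
  show "of_real (ep^2) * Y2 l s - \<i> * Y1 l s + of_real ((?m l)^2) * Y l s = Fh l s" if "0 < s" "s < t" for s
  by (rule ode) (use that t mp(2)[OF l] in auto)
 qed (use t in auto)
 have B0: "B >= 0" using order_trans[OF wn_nonneg F[OF t]] .
 have "wn M ?w ?I <= (t - 0) * (1 / ep * B)"
 proof (rule wn_integral_le[OF _ w(1) hi])
  fix s assume s: "s : {0..t}"
  have "wn M ?w (%l. Kn ep (?m l) (t - s) * Fh l s) <= wn M (%l. 1 / ep * ?m l ^ j) (%l. Fh l s)"
  proof (rule wn_mono[OF w(1)])
  fix l assume l: "l : {1..M - 1}"
  have "?m l ^ j * cmod (Fh l s) * (?m l * cmod (Kn ep (?m l) (t - s))) <= ?m l ^ j * cmod (Fh l s) * (1 / ep)"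
  by (intro mlm Kn_bound(2)[OF eps(1) mp(1)[OF l]]) (use w in simp)
  then show "?w l * cmod (Kn ep (?m l) (t - s) * Fh l s) <= 1 / ep * ?m l ^ j * cmod (Fh l s)"
  by (simp add: norm_mult mult_ac)
  qed
  also have "... = 1 / ep * wn M (%l. ?m l ^ j) (%l. Fh l s)" using eps by (intro wn_scale) auto
  also have "... <= 1 / ep * B" using eps F s sub by (intro mlm) auto
  finally show "wn M ?w (%l. Kn ep (?m l) (t - s) * Fh l s) <= 1 / ep * B" .
 qed (use t in auto)
 also have "... <= T * (1 / ep * B)" using t eps B0 by (intro mrm) auto
 finally have I: "wn M ?w ?I <= T * (1 / ep * B)" .
 have c: "wn M ?w (%l. c0 ep t (?m l) * Y l 0) <= wn M ?w (%l. Y l 0)"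
 proof (rule wn_mono[OF w(1)])
  fix l assume l: "l : {1..M - 1}"
  have "?w l * (cmod (c0 ep t (?m l)) * cmod (Y l 0)) <= ?w l * (1 * cmod (Y l 0))"
  by (intro mlm mrm c0_bound[OF eps(1) mp(1)[OF l]] w) simp
  then show "?w l * cmod (c0 ep t (?m l) * Y l 0) <= ?w l * cmod (Y l 0)" by (simp only: norm_mult mult_1)
 qed
 have d: "wn M ?w (%l. d0 ep t (?m l) * Y1 l 0) <= wn M (%l. ?m l ^ j) (%l. Y1 l 0)"
 proof (rule wn_mono[OF w(1)])
  fix l assume l: "l : {1..M - 1}"
  have "?m l * cmod (d0 ep t (?m l)) = ep^2 * (?m l * cmod (Kn ep (?m l) t))"
  unfolding d0_eq[OF eps(1) mp(1)[OF l]] norm_mult norm_of_real by simp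
  also have "... <= ep^2 * (1 / ep)" by (intro mlm Kn_bound(2)[OF eps(1) mp(1)[OF l]]) simp
  also have "... <= 1" using eps by (simp add: psq)
  finally have "?m l ^ j * cmod (Y1 l 0) * (?m l * cmod (d0 ep t (?m l))) <= ?m l ^ j * cmod (Y1 l 0) * 1"
  by (intro mlm) (use w in simp_all)
  then show "?w l * cmod (d0 ep t (?m l) * Y1 l 0) <= ?m l ^ j * cmod (Y1 l 0)" by (simp add: norm_mult mult_ac)
 qed
 have "wn M ?w (%l. Y l t) = wn M ?w (%l. (c0 ep t (?m l) * Y l 0 + d0 ep t (?m l) * Y1 l 0) + ?I l)" by simp
 also have "... <= wn M ?w (%l. c0 ep t (?m l) * Y l 0 + d0 ep t (?m l) * Y1 l 0) + wn M ?w ?I" by (rule wn_add[OF w(1)])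
 also have "wn M ?w (%l. c0 ep t (?m l) * Y l 0 + d0 ep t (?m l) * Y1 l 0) <= wn M ?w (%l. c0 ep t (?m l) * Y l 0) + wn M ?w (%l. d0 ep t (?m l) * Y1 l 0)"
  by (rule wn_add[OF w(1)])
 finally show ?thesis using I c d X0 X1 by linarith
qed

text \<open>Hence the solution satisfies the compatibility conditions that make its odd extension smooth: the even
 derivatives vanish at the ends, one after the other.\<close>

lemma compatibility:
 assumes m: "m <= m0" and CF: "!!j g. 1 <= j ==> j <= m ==> rg j True (supc * C) g ==> rg j True (CF j) (%x. Fnl f (g x))"
  and X0: "!!M. wn M (%l. fq l ^ m) (%l. Y l 0) <= X0" and X1: "!!M. wn M (%l. fq l ^ m) (%l. Y1 l 0) <= X1"
  and j: "1 <= j" "j <= m"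
 shows "AE t in lebesgue_on {0..T}. \<exists>U. hseq m0 C (u t) U & (\<forall>i<j. even i --> U i a = 0 & U i b = 0)"
 using j
proof (induction j rule: nat_induct_at_least)
 case base
 show ?case using B0 AE_time
 proof eventually_elim
  fix t assume 1: "\<psi> t : hS m0 & hN m0 (\<psi> t) <= C" and t: "t : {0..T}"
  note z = u_facts(3,4)[OF t]
  obtain U where "hseq m0 (hN m0 (\<psi> t)) (u t) U" using Hspace_crep(1)[of "\<psi> t" m0] 1 m0 unfolding u_def by auto
  then have "hseq m0 C (u t) U" "U 0 = u t" using 1 by (auto simp: hseq_def)
  then show "\<exists>U. hseq m0 C (u t) U & (\<forall>i<1. even i --> U i a = 0 & U i b = 0)" using z by auto
 qed
next
 case (Suc j)
 then have IH: "AE t in lebesgue_on {0..T}. \<exists>U. hseq m0 C (u t) U & (\<forall>i<j. even i --> U i a = 0 & U i b = 0)" by simp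
 show ?case
 proof (cases "even j")
  case False
  show ?thesis using IH by eventually_elim (use False less_Suc_eq in blast)
 next
  case True
  let ?B = "sqrt (2 / (b - a)) * CF j"
  have Fb: "wn M (%l. fq l ^ j) (%l. Fh l s) <= ?B" if s: "s : {0..T}" for M s
  proof (rule AE_continuous_le[OF T _ _ s])
  show "continuous_on {0..T} (%s. wn M (%l. fq l ^ j) (%l. Fh l s))" by (rule wn_cont) (rule Fh_cont, simp)
  show "AE s in lebesgue_on {0..T}. wn M (%l. fq l ^ j) (%l. Fh l s) <= ?B" using IH
  proof eventually_elim
  fix s assume "\<exists>U. hseq m0 C (u s) U & (\<forall>i<j. even i --> U i a = 0 & U i b = 0)"
  then obtain U where U: "hseq m0 C (u s) U" "!!i. i < j ==> even i ==> U i a = 0 & U i b = 0" by blast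
  have "rg j True (supc * C) (u s)" by (rule hseq_reg[OF U(1)]) (use U(2) Suc m in auto)
  then have "rg j True (CF j) (%x. Fnl f (u s x))" using Suc by (intro CF) auto
  then show "wn M (%l. fq l ^ j) (%l. Fh l s) <= ?B" unfolding Fh_def by (rule reg_wn)
  qed
  qed
  have p: "fq 1 > 0" by (rule mu_pos) simp
  let ?X = "1 / fq 1 ^ (m - Suc j) * X0 + 1 / fq 1 ^ (m - j) * X1 + T * (1 / ep * ?B)"
  have Yb: "wn M (%l. fq l ^ Suc j) (%l. Y l t) <= ?X" if t: "t : {0..T}" for M t
  proof (rule frequency_gain[OF t Fb])
  have "wn M (%l. fq l ^ Suc j) (%l. Y l 0) <= 1 / fq 1 ^ (m - Suc j) * wn M (%l. fq l ^ m) (%l. Y l 0)"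
  by (rule wn_power_le) (use Suc in auto)
  also have "... <= 1 / fq 1 ^ (m - Suc j) * X0" using p X0 by (intro mlm) auto
  finally show "wn M (%l. fq l ^ Suc j) (%l. Y l 0) <= 1 / fq 1 ^ (m - Suc j) * X0" .
  have "wn M (%l. fq l ^ j) (%l. Y1 l 0) <= 1 / fq 1 ^ (m - j) * wn M (%l. fq l ^ m) (%l. Y1 l 0)"
  by (rule wn_power_le) (use Suc in auto)
  also have "... <= 1 / fq 1 ^ (m - j) * X1" using p X1 by (intro mlm) auto
  finally show "wn M (%l. fq l ^ j) (%l. Y1 l 0) <= 1 / fq 1 ^ (m - j) * X1" .
  qed
  show ?thesis using IH AE_time
  proof eventually_elim
  fix t assume ex: "\<exists>U. hseq m0 C (u t) U & (\<forall>i<j. even i --> U i a = 0 & U i b = 0)" and t: "t : {0..T}"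
  have sc: "sc (u t) = (%l. Y l t)" by (rule ext) (rule u_facts(5)[OF t])
  note Yt = Yb[OF t]
  from ex obtain U where U: "hseq m0 C (u t) U" "!!i. i < j ==> even i ==> U i a = 0 & U i b = 0" by blast
  have "U j a = 0 & U j b = 0"
  by (rule hseq_vanish[OF U(1) _ True U(2) Yt[folded sc]]) (use Suc m in auto)
  then show "\<exists>U. hseq m0 C (u t) U & (\<forall>i<Suc j. even i --> U i a = 0 & U i b = 0)"
  using U less_Suc_eq by blast
  qed
 qed
qed

text \<open>Compatibility supplies the boundary conditions, the hypotheses the size; the constants do not depend on those of the bootstrap.\<close>

lemma spatial_regularity:
 assumes m: "1 <= m" "m <= m0" and CF: "!!j g. 1 <= j ==> j <= m ==> rg j True (supc * C) g ==> rg j True (CF j) (%x. Fnl f (g x))"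
  and X0: "!!M. wn M (%l. fq l ^ m) (%l. Y l 0) <= X0" and X1: "!!M. wn M (%l. fq l ^ m) (%l. Y1 l 0) <= X1"
  and t: "t : {0..T}"
 shows "wn M (%l. fq l ^ m) (%l. Y l t) <= c1" "wn M (%l. fq l ^ m) (%l. Fh l t) <= sqrt (2 / (b - a)) * CF m"
proof -
 have "AE t in lebesgue_on {0..T}. \<exists>U. hseq m0 C (u t) U & (\<forall>i<m. even i --> U i a = 0 & U i b = 0)"
  by (rule compatibility[OF m(2) CF X0 X1 m(1) order_refl])
 then have R: "AE t in lebesgue_on {0..T}. rg m True (supc * C) (u t)"
 proof eventually_elim
  fix t assume "\<exists>U. hseq m0 C (u t) U & (\<forall>i<m. even i --> U i a = 0 & U i b = 0)"
  then obtain U where U: "hseq m0 C (u t) U" "!!i. i < m ==> even i ==> U i a = 0 & U i b = 0" by blast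
  show "rg m True (supc * C) (u t)" by (rule hseq_reg[OF U(1)]) (use U(2) m in auto)
 qed
 show "wn M (%l. fq l ^ m) (%l. Y l t) <= c1"
 proof (rule AE_continuous_le[OF T _ _ t])
  show "continuous_on {0..T} (%t. wn M (%l. fq l ^ m) (%l. Y l t))" by (rule wn_cont) (rule Y_cont, simp)
  show "AE t in lebesgue_on {0..T}. wn M (%l. fq l ^ m) (%l. Y l t) <= c1"
  using R AE_time
  proof eventually_elim
  fix t assume r: "rg m True (supc * C) (u t)" and t: "t : {0..T}"
  have sc: "sc (u t) = (%l. Y l t)" by (rule ext) (rule u_facts(5)[OF t])
  show "wn M (%l. fq l ^ m) (%l. Y l t) <= c1" using reg_wn[OF r, of M] unfolding c1_def sc by simp
  qed
 qed
 show "wn M (%l. fq l ^ m) (%l. Fh l t) <= sqrt (2 / (b - a)) * CF m"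
 proof (rule AE_continuous_le[OF T _ _ t])
  show "continuous_on {0..T} (%t. wn M (%l. fq l ^ m) (%l. Fh l t))" by (rule wn_cont) (rule Fh_cont, simp)
  show "AE t in lebesgue_on {0..T}. wn M (%l. fq l ^ m) (%l. Fh l t) <= sqrt (2 / (b - a)) * CF m"
  using R by eventually_elim (unfold Fh_def, rule reg_wn, rule CF, use m in auto)
 qed
qed

end

text \<open>By Fubini the space-time supremum bounds almost every time slice almost everywhere, and continuity in
 space and in time removes both exceptional sets.\<close>

lemma sup_cylinder:
 assumes t: "t : {0..T}" and x: "x : {a..b}"
 shows "ennreal (cmod (u t x)) <= Linf_cyl a b T \<psi>"
proof (cases "Linf_cyl a b T \<psi>")
 case top then show ?thesis by simp
next
 case (real ka)
 let ?S = "{0..T} \<times> {a<..<b}"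
 have S: "?S : sets lebesgue" by (intro sets_completionI_sets) (simp add: borel_Times)
 have "AE z in lebesgue_on ?S. (%(t, x). ennreal (cmod (\<psi> t x))) z <= ennreal ka"
  using esssup_AE[of "%(t, x). ennreal (cmod (\<psi> t x))" "lebesgue_on ?S"] unfolding Linf_cyl_def[symmetric] real by simp
 then have "AE z in lebesgue. z : ?S --> (%(t, x). ennreal (cmod (\<psi> t x))) z <= ennreal ka"
  by (subst (asm) AE_restrict_space_iff) (use S in auto)
 then have "AE z in lborel \<Otimes>\<^sub>M lborel. z : ?S --> (%(t, x). ennreal (cmod (\<psi> t x))) z <= ennreal ka"
  unfolding AE_completion_iff lborel_prod .
 from lborel_pair.AE_pair[OF this]
 have "AE t in lborel. AE x in lborel. (t, x) : ?S --> cmod (\<psi> t x) <= ka"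
  using real by simp
 then have "AE t in lebesgue. AE x in lborel. (t, x) : ?S --> cmod (\<psi> t x) <= ka" by (rule AE_completion)
 then have 1: "AE t in lebesgue_on {0..T}. AE x in lborel. (t, x) : ?S --> cmod (\<psi> t x) <= ka"
  by (subst AE_restrict_space_iff) (auto elim: eventually_mono)
 have 2: "AE t in lebesgue_on {0..T}. cmod (u t x) <= ka"
  using 1 AE_time
 proof eventually_elim
  fix t assume A: "AE x in lborel. (t, x) : ?S --> cmod (\<psi> t x) <= ka" and t: "t : {0..T}"
  have "AE x in lebesgue. x : {a<..<b} --> cmod (\<psi> t x) <= ka"
  using AE_completion[OF A] t by (auto elim: eventually_mono)
  then have "AE x in Om a b. cmod (\<psi> t x) <= ka" by (subst AE_restrict_space_iff) auto
  then have z: "AE x in Om a b. cr (max (cmod (u t x) - ka) 0) = 0"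
  using u_facts(2)[of t] t by (auto elim: eventually_elim2)
  have "cr (max (cmod (u t x) - ka) 0) = 0"
  by (rule continuous_eq_AE[OF _ _ z x]) (use u_facts(8)[of t] t in \<open>auto intro!: continuous_intros\<close>)
  then show "cmod (u t x) <= ka" by (simp add: max_def split: if_splits)
 qed
 have "cmod (u t x) <= ka"
  by (rule AE_continuous_le[OF T _ 2 t]) (intro continuous_intros u_time_cont x)
 then show ?thesis unfolding real(2) by (intro ennreal_leI)
qed

end

section \<open>Stability on the grid and accumulation of errors\<close>

lemma time_le: "n <= N ==> 0 < ts ==> real N * ts <= T ==> real n * ts <= T"
 by (rule order_trans[OF mrm[OF of_nat_mono less_imp_le]])

context seg
begin

lemma sum_shift_interior:
 assumes "g M = (0::real)" "M > 0"
 shows "(\<Sum>i<M. g (Suc i)) = (\<Sum>i=1..M - 1. g i)"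
proof -
 obtain n where n: "M = Suc n" using assms(2) by (cases M) auto
 have "(\<Sum>i<Suc n. g (Suc i)) = (\<Sum>i<n. g (Suc i)) + g (Suc n)" by simp
 also have "(\<Sum>i<n. g (Suc i)) = (\<Sum>i=1..n. g i)" by (rule sum.reindex_bij_witness[of _ "%i. i - 1" Suc]) auto
 finally show ?thesis using assms(1) n by simp
qed

lemma synth_dst_full:
 assumes "v 0 = 0" "v M = 0" "i <= M" shows "synth M (dst M v) i = v i"
proof -
 consider "i = 0" | "i = M" | "i : {1..M - 1}" using assms(3) by force
 then show ?thesis using assms synth_ends synth_dst by cases auto
qed

text \<open>A grid function vanishing at the ends whose increments are \<open>O(h)\<close> is bounded in the discrete
 \<open>H\<^sup>1\<close> norm.\<close>

lemma increments_wn: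
 assumes h: "h = (b - a) / real M" and M: "M > 0" and z: "v 0 = 0" "v M = 0"
  and K: "K >= 0" "!!i. i < M ==> cmod (v (Suc i) - v i) <= K * h"
 shows "wn M (fq) (dst M v) <= 3 * K"
proof -
 have hp: "h > 0" using h M ab by simp
 have "real M / 2 * (h * (1 / 2 * wn M (fq) (dst M v)))^2 <= (\<Sum>i<M. (cmod (synth M (dst M v) (Suc i) - synth M (dst M v) i))^2)"
  by (rule gradient_equiv(2)[OF h M])
 also have "... = (\<Sum>i<M. (cmod (v (Suc i) - v i))^2)" by (intro sum.cong refl) (simp add: synth_dst_full[OF z])
 also have "... <= (\<Sum>i<M. (K * h)^2)" by (intro sum_mono power_mono K(2)) auto
 also have "... = real M * (K * h)^2" by simp
 finally have "real M * h^2 * (wn M (fq) (dst M v))^2 <= real M * h^2 * (8 * K^2)"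
  by (simp add: pmd power_divide mult_ac)
 then have "(wn M (fq) (dst M v))^2 <= 8 * K^2" using M hp by simp
 also have "... <= (3 * K)^2" by (simp add: pmd)
 finally show ?thesis by (rule power2_le_imp_le) (use K in simp)
qed

lemma stability_one:
 assumes F: "sd R La (Fnl f)" and L: "La >= 0" and M: "M > 0" and UV: "!!i. i : {1..M - 1} ==> cmod (U i) <= R & cmod (V i) <= R"
 shows "wn M (%_. 1) (%l. dst M (%i. Fnl f (U i)) l - dst M (%i. Fnl f (V i)) l) <= La * wn M (%_. 1) (%l. dst M U l - dst M V l)"
proof -
 let ?g = "%i. Fnl f (U i) - Fnl f (V i)" let ?e = "%i. U i - V i"
 have "real M / 2 * (wn M (%_. 1) (dst M ?g))^2 = (\<Sum>i=1..M - 1. (cmod (?g i))^2)" by (rule wn_one_dst[symmetric])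
 also have "... <= (\<Sum>i=1..M - 1. (La * cmod (?e i))^2)"
  by (intro sum_mono power_mono sdD(2)[OF F]) (use UV in auto)
 also have "... = La^2 * (\<Sum>i=1..M - 1. (cmod (?e i))^2)" by (simp add: pmd sum_distrib_left)
 also have "... = La^2 * (real M / 2 * (wn M (%_. 1) (dst M ?e))^2)" unfolding wn_one_dst ..
 finally have "real M / 2 * (wn M (%_. 1) (dst M ?g))^2 <= real M / 2 * (La * wn M (%_. 1) (dst M ?e))^2"
  by (simp add: pmd mult_ac)
 then have "(wn M (%_. 1) (dst M ?g))^2 <= (La * wn M (%_. 1) (dst M ?e))^2" using M by simp
 then have "wn M (%_. 1) (dst M ?g) <= La * wn M (%_. 1) (dst M ?e)" by (rule power2_le_imp_le) (use L in simp)
 then show ?thesis unfolding dst_diff[abs_def] .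
qed

text \<open>In the discrete \<open>H\<^sup>1\<close> norm, second differences of the nonlinearity enter; the differences of the exact
 solution are \<open>O(h)\<close>, those of the numerical one are compared with them.\<close>

lemma stability_gradient:
 assumes F: "sd R La (Fnl f)" and L: "La >= 0" and R: "R >= 0" and B: "B >= 0" and h: "h = (b - a) / real M" and M: "M > 0"
  and UV: "!!i. i <= M ==> cmod (U i) <= R" "!!i. i <= M ==> cmod (V i) <= R"
  and z: "U 0 = 0" "U M = 0" "V 0 = 0" "V M = 0" and dU: "!!i. i < M ==> cmod (U (Suc i) - U i) <= B * h"
 shows "wn M (fq) (%l. dst M (%i. Fnl f (U i)) l - dst M (%i. Fnl f (V i)) l)
  <= 3 * La * (1 + 2 * R + 2 * B * (b - a)) * wn M (fq) (%l. dst M U l - dst M V l)"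
proof -
 have hp: "h > 0" using h M ab by simp
 define g where "g = (%i. Fnl f (U i) - Fnl f (V i))"
 define e where "e = (%i. U i - V i)"
 define W where "W = wn M (fq) (dst M e)"
 define S where "S = 1 + 2 * R + 2 * B * (b - a)"
 have W0: "W >= 0" by (simp add: W_def)
 have S0: "S >= 0" using R B ab by (simp add: S_def)
 have gz: "g 0 = 0" "g M = 0" and ez: "e 0 = 0" "e M = 0" using z by (auto simp: g_def e_def)
 let ?de = "%i. cmod (e (Suc i) - e i)"
 have pt: "cmod (g (Suc i) - g i) <= La * ((1 + 2 * R) * ?de i + 2 * B * h * cmod (e (Suc i)))" if i: "i < M" for i
 proof -
  have b: "cmod (U (Suc i)) <= R" "cmod (U i) <= R" "cmod (V (Suc i)) <= R" "cmod (V i) <= R" using UV i by auto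
  have de: "(U (Suc i) - U i) - (V (Suc i) - V i) = e (Suc i) - e i" by (simp add: e_def)
  have "g (Suc i) - g i = (Fnl f (U (Suc i)) - Fnl f (U i)) - (Fnl f (V (Suc i)) - Fnl f (V i))" by (simp add: g_def)
  then have "cmod (g (Suc i) - g i) <= La * (?de i + cmod (e (Suc i)) * (cmod (U (Suc i) - U i) + cmod (V (Suc i) - V i)))"
  using sdD(3)[OF F b] unfolding de unfolding e_def by simp
  also have "... <= La * ((1 + 2 * R) * ?de i + 2 * B * h * cmod (e (Suc i)))"
  proof (rule mlm[OF _ L])
  have "cmod (V (Suc i) - V i) <= B * h + ?de i"
  using dU[OF i] norm_triangle_ineq4[of "U (Suc i) - U i" "e (Suc i) - e i"] by (simp add: de[symmetric])
  then have "cmod (e (Suc i)) * (cmod (U (Suc i) - U i) + cmod (V (Suc i) - V i)) <= cmod (e (Suc i)) * (B * h + (B * h + ?de i))"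
  using dU[OF i] by (intro mlm add_mono) auto
  moreover have "cmod (e (Suc i)) * ?de i <= 2 * R * ?de i"
  using norm_triangle_ineq4[of "U (Suc i)" "V (Suc i)"] b by (intro mrm) (auto simp: e_def)
  ultimately show "?de i + cmod (e (Suc i)) * (cmod (U (Suc i) - U i) + cmod (V (Suc i) - V i)) <= (1 + 2 * R) * ?de i + 2 * B * h * cmod (e (Suc i))"
  by (simp add: alg)
  qed
  finally show ?thesis .
 qed
 have sq: "(cmod (g (Suc i) - g i))^2 <= 2 * La^2 * ((1 + 2 * R)^2 * (?de i)^2 + (2 * B * h)^2 * (cmod (e (Suc i)))^2)" if i: "i < M" for i
 proof -
  have "(cmod (g (Suc i) - g i))^2 <= (La * ((1 + 2 * R) * ?de i + 2 * B * h * cmod (e (Suc i))))^2" by (rule power_mono[OF pt[OF i]]) simp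
  also have "... = La^2 * ((1 + 2 * R) * ?de i + 2 * B * h * cmod (e (Suc i)))^2" by (rule pmd)
  also have "... <= La^2 * (2 * ((1 + 2 * R) * ?de i)^2 + 2 * (2 * B * h * cmod (e (Suc i)))^2)"
  using sum_squares_bound[of "(1 + 2 * R) * ?de i" "2 * B * h * cmod (e (Suc i))"] by (intro mlm) (auto simp: power2_sum)
  also have "... = 2 * La^2 * ((1 + 2 * R)^2 * (?de i)^2 + (2 * B * h)^2 * (cmod (e (Suc i)))^2)"
  by (simp only: pmd) (simp only: alg)
  finally show ?thesis .
 qed
 have s1: "(\<Sum>i<M. (?de i)^2) <= real M / 2 * (h * W)^2"
 proof -
  have "(\<Sum>i<M. (?de i)^2) = (\<Sum>i<M. (cmod (synth M (dst M e) (Suc i) - synth M (dst M e) i))^2)"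
  by (intro sum.cong refl) (simp add: synth_dst_full[OF ez])
  then show ?thesis using gradient_equiv(1)[OF h M, of "dst M e"] by (simp add: W_def)
 qed
 have s2: "(\<Sum>i<M. (cmod (e (Suc i)))^2) <= real M / 2 * ((b - a) * W)^2"
 proof -
  have "(\<Sum>i<M. (cmod (e (Suc i)))^2) = (\<Sum>i=1..M - 1. (cmod (e i))^2)" by (rule sum_shift_interior) (use ez M in auto)
  also have "... = real M / 2 * (wn M (%_. 1) (dst M e))^2" by (rule wn_one_dst)
  also have "... <= real M / 2 * ((b - a) * W)^2" unfolding W_def by (intro mlm power_mono wn_one_le_mu) auto
  finally show ?thesis .
 qed
 have "real M / 2 * (h * (1 / 2 * wn M (fq) (dst M g)))^2 <= (\<Sum>i<M. (cmod (synth M (dst M g) (Suc i) - synth M (dst M g) i))^2)"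
  by (rule gradient_equiv(2)[OF h M])
 also have "... = (\<Sum>i<M. (cmod (g (Suc i) - g i))^2)" by (intro sum.cong refl) (simp add: synth_dst_full[OF gz])
 also have "... <= (\<Sum>i<M. 2 * La^2 * ((1 + 2 * R)^2 * (?de i)^2 + (2 * B * h)^2 * (cmod (e (Suc i)))^2))" by (intro sum_mono sq) auto
 also have "... = 2 * La^2 * ((1 + 2 * R)^2 * (\<Sum>i<M. (?de i)^2) + (2 * B * h)^2 * (\<Sum>i<M. (cmod (e (Suc i)))^2))"
  by (simp only: sum_distrib_left[symmetric] sum.distrib)
 also have "... <= 2 * La^2 * ((1 + 2 * R)^2 * (real M / 2 * (h * W)^2) + (2 * B * h)^2 * (real M / 2 * ((b - a) * W)^2))"
  by (intro mlm add_mono s1 s2) auto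
 also have "... = real M * h^2 * (La^2 * W^2 * ((1 + 2 * R)^2 + (2 * B * (b - a))^2))"
  by (simp only: pmd) (simp add: field_simps)
 also have "... <= real M * h^2 * (La^2 * W^2 * S^2)"
 proof (intro mlm)
  have "0 <= 2 * ((1 + 2 * R) * (2 * B * (b - a)))" using R B ab by simp
  moreover have "S^2 = (1 + 2 * R)^2 + (2 * B * (b - a))^2 + 2 * ((1 + 2 * R) * (2 * B * (b - a)))"
  unfolding S_def psq by (simp add: alg)
  ultimately show "(1 + 2 * R)^2 + (2 * B * (b - a))^2 <= S^2" by linarith
 qed auto
 finally have "real M * h^2 * (wn M (fq) (dst M g))^2 <= real M * h^2 * (8 * (La * S * W)^2)"
  by (simp add: pmd power_divide mult_ac)
 then have "(wn M (fq) (dst M g))^2 <= 8 * (La * S * W)^2" using M hp by simp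
 also have "... <= (3 * (La * S * W))^2" by (simp add: pmd)
 finally have "wn M (fq) (dst M g) <= 3 * (La * S * W)" by (rule power2_le_imp_le) (use L S0 W0 in simp)
 then show ?thesis unfolding g_def W_def e_def S_def dst_diff[abs_def] by (simp only: mult.assoc)
qed

end

lemma discrete_gronwall:
 fixes E :: "nat => real"
 assumes q: "q >= 0" and E: "!!n. n <= N ==> E n <= P + q * (\<Sum>j<n. E j)"
 shows "n <= N ==> E n <= P * (1 + q) ^ n"
proof (induction n rule: less_induct)
 case (less n)
 have s: "P + q * (\<Sum>j<n. P * (1 + q) ^ j) = P * (1 + q) ^ n" for n
  by (induction n) (simp_all add: alg)
 have "E n <= P + q * (\<Sum>j<n. E j)" by (rule E[OF less.prems])
 also have "... <= P + q * (\<Sum>j<n. P * (1 + q) ^ j)"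
  using q less by (intro add_left_mono mlm sum_mono) auto
 finally show ?case unfolding s .
qed

text \<open>The constant of the final estimate: \<open>L\<close> Lipschitz, \<open>\<alpha>\<close> aliasing, \<open>K\<close> extrapolation, \<open>K1\<close> first step.\<close>

definition Cg :: "real => real => real => real => real => real" where
 "Cg L T \<alpha> K K1 = (1 + 2 * L) * (3 * \<alpha> + 2 * K1 + 2 * T * (K + 3 * (1 + L) * \<alpha>)) * exp (6 * L * T)"

text \<open>The first step contributes \<open>O(ts\<^sup>2)\<close> once, each later step \<open>O(ts\<^sup>3)\<close>, and there are at most \<open>T / ts\<close> of
 them.\<close>

lemma error_gronwall:
 fixes E G :: "nat => real"
 assumes t: "0 < ts" "ts <= 1" "real N * ts <= T" and pos: "L >= 0" "\<alpha> >= 0" "s >= 0" "K >= 0" "K1 >= 0" "!!n. E n >= 0"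
  and E0: "E 0 <= \<alpha> * s" and step: "!!n. n <= N ==> E n <= 3 * (\<alpha> * s) + (\<Sum>j<n. 2 * ts * G j)"
  and G0: "G 0 <= K1 * ts + ((1 + L) * (\<alpha> * s) + L * E 0)"
  and Gj: "!!j. 0 < j ==> G j <= K * ts^2 + 2 * ((1 + L) * (\<alpha> * s) + L * E j) + ((1 + L) * (\<alpha> * s) + L * E (j - 1))"
  and n: "n <= N"
 shows "E n <= Cg L T \<alpha> K K1 * (s + ts^2)"
proof -
 define A where "A = \<alpha> * s"
 define P where "P = 3 * A + 2 * K1 * ts^2 + 2 * T * (K * ts^2 + 3 * (1 + L) * A)"
 have A0: "A >= 0" using pos by (simp add: A_def)
 have T0: "T >= 0" using t by (meson mnn of_nat_0_le_iff order_trans less_imp_le)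
 have P0: "P >= A" using A0 pos T0 by (simp add: P_def)
 have E0': "E 0 <= A" using E0 by (simp add: A_def)
 have Gall: "2 * ts * G j <= 2 * ts * (K * ts^2 + 3 * (1 + L) * A) + 2 * ts * L * (2 * E j + E (j - 1)) + (if j = 0 then 2 * K1 * ts^2 else 0)" for j
 proof (cases "j = 0")
  case True
  have "G j <= K1 * ts + ((1 + L) * A + L * E 0)" using G0 True by (simp add: A_def)
  also have "... <= (K * ts^2 + 3 * (1 + L) * A) + L * (2 * E j + E (j - 1)) + K1 * ts"
  proof -
  have "(1 + L) * A <= 3 * (1 + L) * A" using pos A0 by (simp add: mrm)
  moreover have "L * E 0 <= L * (2 * E 0 + E 0)" using pos(1) pos(6)[of 0] by (intro mlm) auto
  moreover have "0 <= K * ts^2" using pos by simp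
  ultimately show ?thesis using True by simp
  qed
  finally have "2 * ts * G j <= 2 * ts * ((K * ts^2 + 3 * (1 + L) * A) + L * (2 * E j + E (j - 1)) + K1 * ts)"
  using t by (intro mlm) auto
  then show ?thesis using True by (simp add: alg psq)
 next
  case False
  have "G j <= (K * ts^2 + 3 * (1 + L) * A) + L * (2 * E j + E (j - 1))"
  using Gj[of j] False by (simp add: A_def[symmetric] alg)
  then have "2 * ts * G j <= 2 * ts * ((K * ts^2 + 3 * (1 + L) * A) + L * (2 * E j + E (j - 1)))"
  using t by (intro mlm) auto
  then show ?thesis using False by (simp add: alg)
 qed
 have shift: "(\<Sum>j<n. E (j - 1)) <= E 0 + (\<Sum>j<n. E j)" for n
 proof (cases n)
  case (Suc k)
  have "(\<Sum>j<Suc k. E (j - 1)) = E 0 + (\<Sum>j<k. E j)" by (subst sum.lessThan_Suc_shift) simp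
  then show ?thesis using Suc pos(6)[of k] by simp
 qed (use pos in simp)
 have rec: "E n <= (1 + 2 * L) * P + (6 * ts * L) * (\<Sum>j<n. E j)" if n: "n <= N" for n
 proof -
  have nt: "real n * ts <= T" by (rule time_le[OF n t(1,3)])
  have "E n <= 3 * A + (\<Sum>j<n. 2 * ts * G j)" using step[OF n] by (simp add: A_def)
  also have "(\<Sum>j<n. 2 * ts * G j) <= (\<Sum>j<n. 2 * ts * (K * ts^2 + 3 * (1 + L) * A) + 2 * ts * L * (2 * E j + E (j - 1)) + (if j = 0 then 2 * K1 * ts^2 else 0))"
  by (intro sum_mono Gall)
  also have "... = real n * (2 * ts * (K * ts^2 + 3 * (1 + L) * A)) + 2 * ts * L * (2 * (\<Sum>j<n. E j) + (\<Sum>j<n. E (j - 1))) + (\<Sum>j<n. if j = 0 then 2 * K1 * ts^2 else 0)"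
  proof -
  have "(\<Sum>j<n. c) = real n * c" for c :: real by simp
  moreover have "(\<Sum>j<n. 2 * ts * L * (2 * E j + E (j - 1))) = 2 * ts * L * (2 * (\<Sum>j<n. E j) + (\<Sum>j<n. E (j - 1)))"
  by (simp only: sum_distrib_left[symmetric] sum.distrib)
  ultimately show ?thesis by (subst sum.distrib, subst sum.distrib) (simp only:)
  qed
  also have "... <= 2 * T * (K * ts^2 + 3 * (1 + L) * A) + 2 * ts * L * (2 * (\<Sum>j<n. E j) + (A + (\<Sum>j<n. E j))) + 2 * K1 * ts^2"
  proof (intro add_mono)
  have "real n * ts * (2 * (K * ts^2 + 3 * (1 + L) * A)) <= T * (2 * (K * ts^2 + 3 * (1 + L) * A))"
  using pos A0 by (intro mrm nt) auto
  then show "real n * (2 * ts * (K * ts^2 + 3 * (1 + L) * A)) <= 2 * T * (K * ts^2 + 3 * (1 + L) * A)" by (simp only: mult_ac)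
  show "2 * ts * L * (2 * (\<Sum>j<n. E j) + (\<Sum>j<n. E (j - 1))) <= 2 * ts * L * (2 * (\<Sum>j<n. E j) + (A + (\<Sum>j<n. E j)))"
  using t pos(1) shift[of n] E0' by (intro mlm) auto
  show "(\<Sum>j<n. if j = 0 then 2 * K1 * ts^2 else 0) <= 2 * K1 * ts^2" using pos by (simp add: sum.delta)
  qed
  finally have "E n <= P + 2 * ts * L * A + (6 * ts * L) * (\<Sum>j<n. E j)" by (simp add: P_def alg)
  moreover have "2 * ts * L * A <= 2 * L * P"
  proof -
  have "ts * (2 * L * A) <= 1 * (2 * L * A)" using t pos A0 by (intro mrm) auto
  also have "... <= 2 * L * P" using P0 pos(1) by (simp add: mlm)
  finally show ?thesis by (simp only: mult_ac)
  qed
  ultimately show ?thesis by (simp add: alg)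
 qed
 have q: "6 * ts * L >= 0" using t pos by simp
 have PP: "0 <= (1 + 2 * L) * P" using pos(1) P0 A0 by simp
 have "E n <= ((1 + 2 * L) * P) * (1 + 6 * ts * L) ^ n" by (rule discrete_gronwall[OF q rec n])
 also have "... <= ((1 + 2 * L) * P) * exp (6 * L * T)"
 proof (rule mlm[OF _ PP])
  have "(1 + 6 * ts * L) ^ n <= exp (6 * ts * L) ^ n" using q by (intro power_mono exp_ge_add_one_self) auto
  also have "... = exp (real n * (6 * ts * L))" by (simp add: exp_of_nat_mult)
  also have "... <= exp (6 * L * T)"
  proof -
  have "(real n * ts) * (6 * L) <= T * (6 * L)"
  using time_le[OF n t(1,3)] pos by (intro mrm) auto
  then show ?thesis by (simp add: mult_ac)
  qed
  finally show "(1 + 6 * ts * L) ^ n <= exp (6 * L * T)" .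
 qed
 also have "... <= ((1 + 2 * L) * ((3 * \<alpha> + 2 * K1 + 2 * T * (K + 3 * (1 + L) * \<alpha>)) * (s + ts^2))) * exp (6 * L * T)"
 proof (intro mrm mlm)
  have nn: "0 <= \<alpha> * ts^2" "0 <= K1 * s" "0 <= T * (K * s)" "0 <= T * ((1 + L) * (\<alpha> * ts^2))" using pos T0 by auto
  have "P = 3 * (\<alpha> * s) + 2 * (K1 * ts^2) + 2 * (T * (K * ts^2)) + 6 * (T * ((1 + L) * (\<alpha> * s)))" by (simp add: P_def A_def alg)
  moreover have "(3 * \<alpha> + 2 * K1 + 2 * T * (K + 3 * (1 + L) * \<alpha>)) * (s + ts^2) =
  3 * (\<alpha> * s) + 2 * (K1 * ts^2) + 2 * (T * (K * ts^2)) + 6 * (T * ((1 + L) * (\<alpha> * s)))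
  + (3 * (\<alpha> * ts^2) + 2 * (K1 * s) + 2 * (T * (K * s)) + 6 * (T * ((1 + L) * (\<alpha> * ts^2))))" by (simp add: alg)
  ultimately show "P <= (3 * \<alpha> + 2 * K1 + 2 * T * (K + 3 * (1 + L) * \<alpha>)) * (s + ts^2)" using nn by linarith
 qed (use pos in auto)
 also have "... = Cg L T \<alpha> K K1 * (s + ts^2)" by (simp only: Cg_def mult_ac)
 finally show ?thesis .
qed

section \<open>Convergence for one value of the parameter\<close>

text \<open>One run of the scheme, with all bounds that the error analysis uses as hypotheses. \<open>N\<close> is the number of steps considered, and \<open>w1\<close> is a continuous representative of the initial velocity.\<close>

locale scheme = wave +
 fixes R La X Kx K1 KD h ts :: real and m M N :: nat and Ps :: "nat => nat => complex" and u0 u1 w1 :: "real => complex"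
 assumes sdF: "sd R La (Fnl f)" and Lam: "La >= 0" and R: "kap * c1 + 1 <= R" and m: "2 <= m"
  and M: "M > 0" and h: "h = (b - a) / real M" and tau: "0 < ts" "ts <= 1" and N: "real N * ts <= T"
  and ewi: "ewi_sp a b f ep u0 u1 M ts Ps"
  and v0: "!!i. i <= M ==> nodal a b M u0 i = u 0 (grid a b M i)"
  and w1: "continuous_on {a..b} w1" "!!i. i <= M ==> nodal a b M u1 i = w1 (grid a b M i)" "!!l. sine_coeff a b w1 l = Y1 l 0"
  and XY: "!!t n. t : {0..T} ==> wn n (%l. mu a b l ^ m) (%l. Y l t) <= X"
  and XF: "!!t n. t : {0..T} ==> wn n (%l. mu a b l ^ m) (%l. Fh l t) <= X"
  and X1: "!!n. wn n (%l. mu a b l ^ m) (%l. Y1 l 0) <= X"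
  and Kx: "!!t v. ts <= t ==> 0 <= v ==> v <= ts ==> t + v <= T ==>
  wn M (mu a b) (%l. Fh l (t + v) - Fh l t - of_real (v / ts) * (Fh l t - Fh l (t - ts))) <= Kx * ts^2"
  and K1: "!!v. 0 <= v ==> v <= ts ==> v <= T ==> wn M (mu a b) (%l. Fh l v - Fh l 0) <= K1 * ts"
  and KD: "wn M (mu a b) (dst M (Dnl f ts (nodal a b M u0) (nodal a b M u1) Ps 0)) <= KD"
  and Kpos: "Kx >= 0" "K1 >= 0"
begin

definition ug :: "real => nat => complex" where "ug t i = u t (gr M i)"

lemma X_nonneg: "X >= 0" using order_trans[OF wn_nonneg X1] .
lemma KD_nonneg: "KD >= 0" using order_trans[OF wn_nonneg KD] .
lemma h_pos: "h > 0" using h M ab by simp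

lemma R': "kap * c1 <= R" using R by simp

lemma aliasing_one:
 "t : {0..T} ==> wn M (%_. 1) (%l. dst M (ug t) l - Y l t) <= sqrt 2 * X * h ^ m"
 "t : {0..T} ==> wn M (%_. 1) (%l. dst M (%i. Fnl f (ug t i)) l - Fh l t) <= sqrt 2 * X * h ^ m"
 "wn M (%_. 1) (%l. dst M (ndl M u1) l - Y1 l 0) <= sqrt 2 * X * h ^ m"
proof -
 have m1: "1 <= m" using m by simp
 {
  assume t: "t : {0..T}"
  have s: "sc (u t) = (%l. Y l t)" by (rule ext) (rule u_facts(5)[OF t])
  show "wn M (%_. 1) (%l. dst M (ug t) l - Y l t) <= sqrt 2 * X * h ^ m"
  using function_aliasing[OF h M m1 u_facts(8)[OF t], unfolded s, OF XY[OF t]] unfolding ug_def[abs_def] .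
  have s: "sc (%x. Fnl f (u t x)) = (%l. Fh l t)" by (rule ext) (simp add: Fh_def)
  show "wn M (%_. 1) (%l. dst M (%i. Fnl f (ug t i)) l - Fh l t) <= sqrt 2 * X * h ^ m"
  using function_aliasing[OF h M m1 Fu_cont[OF sdF R' Lam t], unfolded s, OF XF[OF t]] unfolding ug_def[abs_def] .
 }
 have s: "sc w1 = (%l. Y1 l 0)" by (rule ext) (rule w1(3))
 have d: "dst M (%j. w1 (gr M j)) l = dst M (ndl M u1) l" for l 
 proof (rule dst_cong)
  fix j assume "j : {1..M - 1}"
  then have "j <= M" by auto
  then show "w1 (gr M j) = ndl M u1 j" by (rule w1(2)[symmetric])
 qed
 show "wn M (%_. 1) (%l. dst M (ndl M u1) l - Y1 l 0) <= sqrt 2 * X * h ^ m"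
  using function_aliasing[OF h M m1 w1(1), unfolded s, OF X1] unfolding d .
qed

text \<open>Frequencies on the grid are at most \<open>pi / h\<close>.\<close>

lemma inverse_estimate:
 assumes "wn M (%_. 1) c <= sqrt 2 * X * h ^ m" shows "wn M (fq) c <= pi * sqrt 2 * X * h ^ (m - 1)"
proof -
 have "wn M (fq) c <= pi / h * wn M (%_. 1) c" by (rule wn_mu_le_one[OF h M])
 also have "... <= pi / h * (sqrt 2 * X * h ^ m)" using assms h_pos by (intro mlm) auto
 also have "h ^ m = h * h ^ (m - 1)" using m by (metis power_eq_if not_numeral_le_zero)
 also have "pi / h * (sqrt 2 * X * (h * h ^ (m - 1))) = pi * sqrt 2 * X * h ^ (m - 1)" using h_pos by simp
 finally show ?thesis .
qed

lemma Psi_ends: "Ps n 0 = 0" "Ps n M = 0"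
 using ewi unfolding ewi_sp_def Let_def YM_def by auto

lemma ug_ends: "t : {0..T} ==> ug t 0 = 0 & ug t M = 0"
 using u_facts(3,4) grid_ends(1) grid_ends(2)[OF M] by (simp add: ug_def)

lemma ug_sup: "t : {0..T} ==> i <= M ==> cmod (ug t i) <= kap * c1"
 unfolding ug_def by (rule u_sup[OF _ grid_in[OF M]])

lemma ug_increment: "t : {0..T} ==> i < M ==> cmod (ug t (Suc i) - ug t i) <= supc * C * h"
proof -
 assume t: "t : {0..T}" and i: "i < M"
 have d: "gr M (Suc i) - gr M i = h" unfolding grid_def h[symmetric] by (simp add: alg)
 have "a <= gr M i" "gr M (Suc i) <= b" using grid_in[OF M, of i] grid_in[OF M, of "Suc i"] i by auto
 moreover have "gr M i <= gr M (Suc i)" using d h_pos by linarith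
 ultimately show ?thesis using u_space_lip[OF t] unfolding ug_def by (metis d)
qed

text \<open>The error in a weighted norm, as long as the numerical solution stays in the ball of radius \<open>R\<close>.\<close>

lemma weighted_error:
 assumes w: "!!l. w l >= 0" and pos: "L >= 0" "\<alpha> >= 0" "s >= 0" "ka >= 0"
  and al: "!!t. t : {0..T} ==> wn M w (%l. dst M (ug t) l - Y l t) <= \<alpha> * s"
  "!!t. t : {0..T} ==> wn M w (%l. dst M (%i. Fnl f (ug t i)) l - Fh l t) <= \<alpha> * s"
  "wn M w (%l. dst M (ndl M u1) l - Y1 l 0) <= \<alpha> * s"
  and st: "!!t j. t : {0..T} ==> (!!i. i <= M ==> cmod (Ps j i) <= R) ==>
  wn M w (%l. dst M (%i. Fnl f (ug t i)) l - dst M (%i. Fnl f (Ps j i)) l) <= L * wn M w (%l. dst M (ug t) l - dst M (Ps j) l)"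
  and ka: "!!c. wn M w c <= ka * wn M (fq) c"
  and n: "n <= N" and bd: "!!j i. j < n ==> i <= M ==> cmod (Ps j i) <= R"
 shows "wn M w (%l. Y l (real n * ts) - dst M (Ps n) l) <= Cg L T \<alpha> (ka * Kx) (ka * (K1 + KD)) * (s + ts^2)"
proof -
 define E where "E = (%j. wn M w (%l. Y l (real j * ts) - dst M (Ps j) l))"
 define S where "S = (%j. (1 + L) * (\<alpha> * s) + L * E j)"
 define G where "G = (%j::nat. if j = 0 then ka * (K1 + KD) * ts + S 0 else ka * Kx * ts^2 + 2 * S j + S (j - 1))"
 let ?f = "%j. dst M (%i. Fnl f (Ps j i))" let ?D = "%j. Dnl f ts (ndl M u0) (ndl M u1) Ps j"
 have E0: "E j >= 0" for j by (simp add: E_def)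
 have S0: "S j >= 0" for j using pos E0[of j] by (simp add: S_def)
 have nt: "real n * ts <= T" by (rule time_le[OF n tau(1) N])
 have tj: "real j * ts : {0..T}" if "j <= n" for j
  using time_le[OF that tau(1) nt] tau by simp
 have neg: "wn M w (%l. c l - d l) = wn M w (%l. d l - c l)" for c d
  using wn_uminus[of M w "%l. c l - d l"] by simp
 have sF: "wn M w (%l. Fh l (real j * ts) - ?f j l) <= S j" if j: "j < n" for j
 proof -
  let ?t = "real j * ts" have t: "?t : {0..T}" by (rule tj) (use j in simp)
  have "wn M w (%l. Fh l ?t - ?f j l) = wn M w (%l. (Fh l ?t - dst M (%i. Fnl f (ug ?t i)) l) + (dst M (%i. Fnl f (ug ?t i)) l - ?f j l))" by simp
  also have "... <= wn M w (%l. Fh l ?t - dst M (%i. Fnl f (ug ?t i)) l) + wn M w (%l. dst M (%i. Fnl f (ug ?t i)) l - ?f j l)" by (rule wn_add[OF w])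
  also have "... <= \<alpha> * s + L * wn M w (%l. dst M (ug ?t) l - dst M (Ps j) l)"
  unfolding neg[of "%l. Fh l ?t"] by (intro add_mono al(2) st t bd[OF j])
  also have "wn M w (%l. dst M (ug ?t) l - dst M (Ps j) l) = wn M w (%l. (dst M (ug ?t) l - Y l ?t) + (Y l ?t - dst M (Ps j) l))" by simp
  also have "L * ... <= L * (\<alpha> * s + E j)"
  unfolding E_def by (intro mlm order_trans[OF wn_add[OF w]] add_mono al(1) t pos order_refl)
  finally show ?thesis by (simp add: S_def alg)
 qed
 have dD: "dst M (?D j) l = of_real (1 / ts) * (?f j l - ?f (j - 1) l)" if "0 < j" for j l
 proof -
  have "?D j = (%i. of_real (1 / ts) * (Fnl f (Ps j i) - Fnl f (Ps (j - 1) i)))"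
  using that by (intro ext) (simp add: Dnl_def sRc divide_inverse)
  then show ?thesis by (simp only: dst_cmult dst_diff)
 qed
 have GB: "wn M w (%l. Fh l (real j * ts + v) - (?f j l + of_real v * dst M (?D j) l)) <= G j" if j: "j < n" and v: "v : {0..ts}" for j v
 proof -
  have "real (Suc j) * ts <= T" using tj[of "Suc j"] j by simp
  then have tv: "real j * ts + v <= T" using v by (simp add: alg)
  show ?thesis
  proof (cases "j = 0")
  case True
  have e: "(%l. Fh l (real j * ts + v) - (?f j l + of_real v * dst M (?D j) l)) =
  (%l. (Fh l v - Fh l 0) + ((Fh l (real 0 * ts) - ?f 0 l) - of_real v * dst M (?D 0) l))"
  using True by (intro ext) simp
  have "wn M w (%l. (Fh l v - Fh l 0) + ((Fh l (real 0 * ts) - ?f 0 l) - of_real v * dst M (?D 0) l)) <=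
  wn M w (%l. Fh l v - Fh l 0) + (wn M w (%l. Fh l (real 0 * ts) - ?f 0 l) + wn M w (%l. of_real v * dst M (?D 0) l))"
  by (intro order_trans[OF wn_add[OF w]] add_left_mono wn_diff[OF w])
  also have "... <= ka * (K1 * ts) + (S 0 + ts * (ka * KD))"
  proof (intro add_mono)
  show "wn M w (%l. Fh l v - Fh l 0) <= ka * (K1 * ts)"
  by (rule order_trans[OF ka mlm[OF K1 pos(4)]]) (use v tv True in auto)
  show "wn M w (%l. Fh l (real 0 * ts) - ?f 0 l) <= S 0" by (rule sF) (use j True in simp)
  have "wn M w (dst M (?D 0)) <= ka * KD" by (rule order_trans[OF ka mlm[OF KD pos(4)]])
  then show "wn M w (%l. of_real v * dst M (?D 0) l) <= ts * (ka * KD)"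
  unfolding wn_cmult norm_of_real using v tau by (intro mult_mono) auto
  qed
  also have "... = G j" using True by (simp add: G_def alg)
  finally show ?thesis unfolding e .
  next
  case False
  then have j0: "0 < j" by simp
  let ?t = "real j * ts" let ?r = "cr (v / ts)"
  have tm: "?t - ts = real (j - 1) * ts" using j0 by (simp add: of_nat_diff alg)
  have t1: "ts <= ?t" using j0 tau by (simp add: Suc_le_eq mult_le_cancel_right1)
  have vr: "of_real v * (of_real (1 / ts) * z) = ?r * z" for z by simp
  have e: "(%l. Fh l (?t + v) - (?f j l + of_real v * dst M (?D j) l)) =
  (%l. (Fh l (?t + v) - Fh l ?t - ?r * (Fh l ?t - Fh l (?t - ts))) + ((1 + ?r) * (Fh l ?t - ?f j l) - ?r * (Fh l (?t - ts) - ?f (j - 1) l)))"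
  unfolding dD[OF j0] vr by (intro ext) (simp only: alg, simp)
  have "wn M w (%l. (Fh l (?t + v) - Fh l ?t - ?r * (Fh l ?t - Fh l (?t - ts))) + ((1 + ?r) * (Fh l ?t - ?f j l) - ?r * (Fh l (?t - ts) - ?f (j - 1) l)))
  <= wn M w (%l. Fh l (?t + v) - Fh l ?t - ?r * (Fh l ?t - Fh l (?t - ts))) +
  (wn M w (%l. (1 + ?r) * (Fh l ?t - ?f j l)) + wn M w (%l. ?r * (Fh l (?t - ts) - ?f (j - 1) l)))"
  by (intro order_trans[OF wn_add[OF w]] add_left_mono wn_diff[OF w])
  also have "... <= ka * (Kx * ts^2) + (2 * S j + 1 * S (j - 1))"
  proof (intro add_mono)
  show "wn M w (%l. Fh l (?t + v) - Fh l ?t - ?r * (Fh l ?t - Fh l (?t - ts))) <= ka * (Kx * ts^2)"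
  by (rule order_trans[OF ka mlm[OF Kx pos(4)]]) (use v tv t1 in auto)
  have r1: "cmod ?r <= 1" using v tau by (simp add: norm_divide)
  have r2: "cmod (1 + ?r) <= 2" using norm_triangle_ineq[of 1 ?r] r1 by simp
  show "wn M w (%l. (1 + ?r) * (Fh l ?t - ?f j l)) <= 2 * S j"
  unfolding wn_cmult using sF[OF j] by (intro mult_mono r2) auto
  show "wn M w (%l. ?r * (Fh l (?t - ts) - ?f (j - 1) l)) <= 1 * S (j - 1)"
  unfolding wn_cmult tm using sF[of "j - 1"] j j0 by (intro mult_mono r1) auto
  qed
  also have "... = G j" using False by (simp add: G_def)
  finally show ?thesis unfolding e .
  qed
 qed
 have d0: "dst M (ndl M u0) l = dst M (ug 0) l" for l
 proof (rule dst_cong)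
  fix i assume "i : {1..M - 1}"
  then have "i <= M" by auto
  then show "ndl M u0 i = ug 0 i" unfolding ug_def by (rule v0)
 qed
 have dP: "dst M (Ps 0) l = dst M (ug 0) l" for l
 proof (rule dst_cong)
  fix i assume i: "i : {1..M - 1}"
  then have "Ps 0 i = ndl M u0 i" using ewi unfolding ewi_sp_def Let_def by blast
  moreover have "i <= M" using i by auto
  ultimately show "Ps 0 i = ug 0 i" unfolding ug_def by (simp only: v0)
 qed
 have T0: "0 : {0..T}" using T by simp
 have step: "E k <= 3 * (\<alpha> * s) + (\<Sum>j<k. 2 * ts * G j)" if k: "k <= n" for k
 proof -
  have sub: "{0..real k * ts} \<subseteq> {0..T}" using tj[OF k] by auto
  have "E k <= wn M w (%l. Y l 0 - dst M (ndl M u0) l) + 2 * wn M w (%l. Y1 l 0 - dst M (ndl M u1) l) + (\<Sum>j<k. 2 * ts * G j)"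
  unfolding E_def
  proof (rule error_accumulation[OF ewi eps tau(1) w])
  fix l r assume l: "l : {1..M - 1}" and r: "r : {0..real k * ts}"
  then have l1: "l >= 1" and rT: "r : {0..T}" using sub by auto
  show "(Y l hvd Y1 l r) (at r within {0..real k * ts})"
  by (rule hvw[OF Y_deriv[OF l1 rT] sub])
  show "(Y1 l hvd Y2 l r) (at r within {0..real k * ts})"
  by (rule hvw[OF Y1_deriv[OF l1 rT] sub])
  next
  fix l r assume l: "l : {1..M - 1}" and r: "0 < r" "r < real k * ts"
  show "of_real (ep^2) * Y2 l r - \<i> * Y1 l r + of_real ((fq l)^2) * Y l r = Fh l r"
  by (rule ode[OF sdF R' Lam]) (use l r tj[OF k] in auto)
  next
  fix l assume "l : {1..M - 1}"
  then show "continuous_on {0..real k * ts} (Fh l)"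
  by (intro cos[OF Fh_cont[OF sdF R' Lam] sub]) auto
  next
  fix j v assume "j < k" "v : {0..ts}"
  then show "wn M w (%l. Fh l (real j * ts + v) - (?f j l + of_real v * dst M (?D j) l)) <= G j" using k by (intro GB) auto
  qed
  moreover have "wn M w (%l. Y l 0 - dst M (ndl M u0) l) <= \<alpha> * s" unfolding d0 neg[of "%l. Y l 0"] by (rule al(1)[OF T0])
  moreover have "wn M w (%l. Y1 l 0 - dst M (ndl M u1) l) <= \<alpha> * s" unfolding neg[of "%l. Y1 l 0"] by (rule al(3))
  ultimately show ?thesis by linarith
 qed
 have "E n <= Cg L T \<alpha> (ka * Kx) (ka * (K1 + KD)) * (s + ts^2)"
 proof (rule error_gronwall[OF tau nt pos(1-3) _ _ E0 _ step])
  show "0 <= ka * Kx" "0 <= ka * (K1 + KD)" using pos Kpos KD_nonneg by auto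
  have "E 0 = wn M w (%l. Y l 0 - dst M (ug 0) l)" unfolding E_def dP by simp
  then show "E 0 <= \<alpha> * s" unfolding neg[of "%l. Y l 0"] using al(1)[OF T0] by simp
  show "G 0 <= ka * (K1 + KD) * ts + ((1 + L) * (\<alpha> * s) + L * E 0)" by (simp add: G_def S_def)
  show "G j <= ka * Kx * ts^2 + 2 * ((1 + L) * (\<alpha> * s) + L * E j) + ((1 + L) * (\<alpha> * s) + L * E (j - 1))" if "0 < j" for j
  using that by (simp add: G_def S_def)
 qed auto
 then show ?thesis by (simp only: E_def)
qed

definition Lm :: real where "Lm = 3 * La * (1 + 2 * R + 2 * (supc * C) * (b - a))"
definition Em :: real where "Em = Cg Lm T (pi * sqrt 2 * X) Kx (K1 + KD)"
definition E1 :: real where "E1 = Cg La T (sqrt 2 * X) ((b - a) * Kx) ((b - a) * (K1 + KD))"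

lemma R0: "R >= 0" using R mnn[OF kap_nonneg c_nonneg(1)] by linarith

lemma Lm_nonneg: "Lm >= 0" 
proof -
 have "0 <= 2 * (supc * C) * (b - a)" using ab by (intro mnn c_nonneg) auto
 then have "0 <= 1 + 2 * R + 2 * (supc * C) * (b - a)" using R0 by linarith
 then show ?thesis unfolding Lm_def using Lam by simp
qed

lemma error_gradient:
 assumes n: "n <= N" and bd: "!!j i. j < n ==> i <= M ==> cmod (Ps j i) <= R"
 shows "wn M (fq) (%l. Y l (real n * ts) - dst M (Ps n) l) <= Em * (h ^ (m - 1) + ts^2)"
proof -
 have "wn M (fq) (%l. Y l (real n * ts) - dst M (Ps n) l) <= Cg Lm T (pi * sqrt 2 * X) (1 * Kx) (1 * (K1 + KD)) * (h ^ (m - 1) + ts^2)"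
 proof (rule weighted_error[OF mu_nonneg Lm_nonneg _ _ _ _ _ _ _ _ n bd])
  show "wn M (fq) (%l. dst M (ug t) l - Y l t) <= pi * sqrt 2 * X * h ^ (m - 1)" if "t : {0..T}" for t
  by (rule inverse_estimate[OF aliasing_one(1)[OF that]])
  show "wn M (fq) (%l. dst M (%i. Fnl f (ug t i)) l - Fh l t) <= pi * sqrt 2 * X * h ^ (m - 1)" if "t : {0..T}" for t
  by (rule inverse_estimate[OF aliasing_one(2)[OF that]])
  show "wn M (fq) (%l. dst M (ndl M u1) l - Y1 l 0) <= pi * sqrt 2 * X * h ^ (m - 1)"
  by (rule inverse_estimate[OF aliasing_one(3)])
  fix t j assume t: "t : {0..T}" and b: "!!i. i <= M ==> cmod (Ps j i) <= R"
  have us: "cmod (ug t i) <= R" if "i <= M" for i using ug_sup[OF t that] R' by linarith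
  show "wn M (fq) (%l. dst M (%i. Fnl f (ug t i)) l - dst M (%i. Fnl f (Ps j i)) l) <= Lm * wn M (fq) (%l. dst M (ug t) l - dst M (Ps j) l)"
  unfolding Lm_def
  by (rule stability_gradient[OF sdF Lam R0 c_nonneg(3) h M us b]) (use ug_ends[OF t] Psi_ends ug_increment[OF t] in auto)
 qed (use X_nonneg h_pos in auto)
 then show ?thesis by (simp add: Em_def)
qed

lemma error_one:
 assumes n: "n <= N" and bd: "!!j i. j < n ==> i <= M ==> cmod (Ps j i) <= R"
 shows "wn M (%_. 1) (%l. Y l (real n * ts) - dst M (Ps n) l) <= E1 * (h ^ m + ts^2)"
 unfolding E1_def
proof (rule weighted_error[OF _ Lam _ _ _ aliasing_one _ wn_one_le_mu n bd])
 fix t j assume t: "t : {0..T}" and b: "!!i. i <= M ==> cmod (Ps j i) <= R"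
 have us: "cmod (ug t i) <= R" if "i <= M" for i using ug_sup[OF t that] R' by linarith
 show "wn M (%_. 1) (%l. dst M (%i. Fnl f (ug t i)) l - dst M (%i. Fnl f (Ps j i)) l) <= La * wn M (%_. 1) (%l. dst M (ug t) l - dst M (Ps j) l)"
  by (rule stability_one[OF sdF Lam M]) (use us b in auto)
qed (use X_nonneg h_pos ab in auto)

text \<open>The maximum norm is controlled by the discrete \<open>H\<^sup>1\<close> norm, so a small error keeps the next iterate in
 the ball and the induction goes on.\<close>

lemma sup_error:
 assumes small: "(b - a) * ((Em + pi * sqrt 2 * X) * (h ^ (m - 1) + ts^2)) <= 1"
 shows "n <= N ==> i <= M ==> cmod (Ps n i - ug (real n * ts) i) <= 1"
proof (induction n arbitrary: i rule: less_induct)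
 case (less n)
 have tj: "real j * ts : {0..T}" if "j <= n" for j
  using time_le[OF order_trans[OF that less.prems(1)] tau(1) N] tau by simp
 have bd: "cmod (Ps j i) <= R" if "j < n" "i <= M" for j i
 proof -
  have "cmod (Ps j i - ug (real j * ts) i) <= 1" by (rule less.IH) (use that less.prems in auto)
  moreover have "cmod (ug (real j * ts) i) <= kap * c1" by (rule ug_sup[OF tj that(2)]) (use that in simp)
  ultimately show ?thesis using R norm_triangle_sub[of "Ps j i" "ug (real j * ts) i"] by linarith
 qed
 let ?t = "real n * ts" have t: "?t : {0..T}" by (rule tj) simp
 let ?e = "%i. ug ?t i - Ps n i"
 have z: "?e 0 = 0" "?e M = 0" using ug_ends[OF t] Psi_ends[of n] by auto
 have "wn M (fq) (dst M ?e) = wn M (fq) (%l. (dst M (ug ?t) l - Y l ?t) + (Y l ?t - dst M (Ps n) l))"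
  unfolding dst_diff[abs_def] by simp
 also have "... <= pi * sqrt 2 * X * h ^ (m - 1) + Em * (h ^ (m - 1) + ts^2)"
  by (intro order_trans[OF wn_add[OF mu_nonneg]] add_mono inverse_estimate aliasing_one(1) t error_gradient less.prems(1) bd)
 also have "... <= (Em + pi * sqrt 2 * X) * (h ^ (m - 1) + ts^2)" using X_nonneg by (simp add: alg)
 finally have W: "wn M (fq) (dst M ?e) <= (Em + pi * sqrt 2 * X) * (h ^ (m - 1) + ts^2)" .
 have "cmod (?e i) = cmod (synth M (dst M ?e) i)" using synth_dst_full[of ?e, OF z less.prems(2)] by simp
 also have "... <= (b - a) * wn M (fq) (dst M ?e)" by (rule synth_sup)
 also have "... <= (b - a) * ((Em + pi * sqrt 2 * X) * (h ^ (m - 1) + ts^2))" using W ab by (intro mlm) auto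
 also have "... <= 1" by (rule small)
 finally show ?case by (simp add: norm_minus_commute)
qed

lemma interp_psum: "itp M v = psum (dst M v) (M - 1)"
 by (rule ext) (simp add: interp_def psum_def sn_def sRc mult.commute)

text \<open>Frequencies beyond the grid are small because they carry the weight \<open>nu\<^sup>m\<close> with \<open>nu >= 1 / h\<close>.\<close>

lemma full_coefficients:
 assumes t: "t : {0..T}" and i: "i <= m"
 shows "wn (Suc n) (%l. fq l ^ i) (sc (%x. u t x - itp M v x)) <=
  wn M (%l. fq l ^ i) (%l. Y l t - dst M v l) + X * h ^ (m - i)"
proof -
 let ?w = "%l. fq l ^ i"
 let ?p = "%l. if l < M then Y l t - dst M v l else 0" let ?q = "%l. if l < M then 0 else Y l t"
 have w: "?w l >= 0" for l by (intro zero_le_power mu_nonneg)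
 have sc: "sc (%x. u t x - itp M v x) l = ?p l + ?q l" if "l : {1..Suc n - 1}" for l
 proof -
  have "sc (%x. u t x - psum (dst M v) (M - 1) x) l = Y l t - sc (psum (dst M v) (M - 1)) l"
  using sine_coeff_diff[OF u_facts(7)[OF t] L2_cont[OF psum_cont]] u_facts(5)[OF t] by simp
  then show ?thesis unfolding interp_psum using that M by (auto simp: sine_coeff_psum)
 qed
 have "wn (Suc n) ?w (sc (%x. u t x - itp M v x)) = wn (Suc n) ?w (%l. ?p l + ?q l)"
  by (rule wn_cong) (rule sc)
 also have "... <= wn (Suc n) ?w ?p + wn (Suc n) ?w ?q" by (rule wn_add[OF w])
 also have "wn (Suc n) ?w ?p <= wn M ?w (%l. Y l t - dst M v l)"
 proof (rule power2_le_imp_le)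
  have "(wn (Suc n) ?w ?p)^2 = (\<Sum>l\<in>{1..n} \<inter> {1..M - 1}. (?w l * cmod (Y l t - dst M v l))^2)"
  unfolding wn_sq by (rule sum.mono_neutral_cong_right) auto
  also have "... <= (wn M ?w (%l. Y l t - dst M v l))^2" unfolding wn_sq by (rule sum_mono2) auto
  finally show "(wn (Suc n) ?w ?p)^2 <= (wn M ?w (%l. Y l t - dst M v l))^2" .
 qed simp
 also have "wn (Suc n) ?w ?q <= wn (Suc n) (%l. h ^ (m - i) * fq l ^ m) (%l. Y l t)"
 proof (rule wn_mono[OF w])
  fix l assume l: "l : {1..Suc n - 1}"
  have hw: "0 <= h ^ (m - i) * fq l ^ m" using h_pos mu_nonneg by simp
  show "?w l * cmod (?q l) <= h ^ (m - i) * fq l ^ m * cmod (Y l t)"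
  proof (cases "l < M")
  case True then show ?thesis using mnn[OF hw norm_ge_zero[of "Y l t"]] by simp
  next
  case False
  have "1 <= h * fq M" unfolding h mu_def using M ab pi_ge_two by simp
  also have "... <= h * fq l" using False h_pos by (intro mlm mu_mono) auto
  finally have "1 <= (h * fq l) ^ (m - i)" by (rule one_le_power)
  then have "1 * fq l ^ i <= (h * fq l) ^ (m - i) * fq l ^ i" by (intro mrm w)
  also have "... = h ^ (m - i) * fq l ^ m" using i by (simp add: pmd mult.assoc flip: power_add)
  finally show ?thesis using False by (auto intro!: mrm)
  qed
 qed
 also have "... = h ^ (m - i) * wn (Suc n) (%l. fq l ^ m) (%l. Y l t)" by (rule wn_scale) (use h_pos in simp)
 also have "... <= h ^ (m - i) * X" using h_pos XY[OF t] by (intro mlm) auto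
 finally show ?thesis by (simp add: mult.commute)
qed

lemma interp_h2z: "h2z (itp M v)"
proof -
 let ?c = "dst M v"
 let ?v = "%x. \<Sum>l\<in>{1..M - 1}. ?c l * of_real (fq l * cN l x)"
 let ?w = "%x. \<Sum>l\<in>{1..M - 1}. ?c l * of_real (- ((fq l)^2 * sN l x))"
 have ds: "(sN l has_real_derivative fq l * cN l x) (at x within {a..b})" for l x
  unfolding sn_def[abs_def] cn_def by (auto intro!: derivative_eq_intros)
 have dc: "((%x. fq l * cN l x) has_real_derivative - ((fq l)^2 * sN l x)) (at x within {a..b})" for l x
  unfolding sn_def cn_def[abs_def] by (auto intro!: derivative_eq_intros simp: psq)
 have "ac (psum ?c (M - 1)) ?v"
 proof (rule AC_smooth)
  show "(psum ?c (M - 1) hvd ?v x) (at x within {a..b})" for x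
  unfolding psum_def[abs_def] by (intro has_vector_derivative_sum has_vector_derivative_mult_right has_vector_derivative_of_real ds)
  show "cont ?v" by (intro continuous_intros)
 qed
 moreover have "ac ?v ?w"
 proof (rule AC_smooth)
  show "(?v hvd ?w x) (at x within {a..b})" for x
  by (intro has_vector_derivative_sum has_vector_derivative_mult_right has_vector_derivative_of_real dc)
  show "cont ?w" by (intro continuous_intros)
 qed
 moreover have "?w : LL" by (rule L2_cont) (intro continuous_intros)
 moreover have "psum ?c (M - 1) a = 0" "psum ?c (M - 1) b = 0" by (simp_all add: psum_def sn_ends)
 ultimately show ?thesis unfolding h2z_def interp_psum by blast
qed

theorem scheme_conclusion:
 assumes small: "(b - a) * ((Em + pi * sqrt 2 * X) * (h ^ (m - 1) + ts^2)) <= 1" and n: "n <= N"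
 shows "nrm (%x. \<psi> (real n * ts) x - itp M (Ps n) x) <= sqrt ((b - a) / 2) * (E1 + X) * (h ^ m + ts^2)"
  "nrm (dX 1 (%x. \<psi> (real n * ts) x - itp M (Ps n) x)) <= sqrt ((b - a) / 2) * (Em + X) * (h ^ (m - 1) + ts^2)"
  "i <= M ==> cmod (Ps n i) <= cmod (u (real n * ts) (gr M i)) + 1"
proof -
 have tj: "real j * ts : {0..T}" if "j <= n" for j
  using time_le[OF order_trans[OF that n] tau(1) N] tau by simp
 have bd: "cmod (Ps j i) <= R" if "j < n" "i <= M" for j i
 proof -
  have "cmod (Ps j i - ug (real j * ts) i) <= 1" by (rule sup_error[OF small]) (use that n in auto)
  moreover have "cmod (ug (real j * ts) i) <= kap * c1" by (rule ug_sup[OF tj that(2)]) (use that in simp)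
  ultimately show ?thesis using R norm_triangle_sub[of "Ps j i" "ug (real j * ts) i"] by linarith
 qed
 let ?t = "real n * ts" have t: "?t : {0..T}" by (rule tj) simp
 show "cmod (Ps n i) <= cmod (u ?t (gr M i)) + 1" if "i <= M"
  using sup_error[OF small n that] norm_triangle_sub[of "Ps n i" "ug ?t i"] unfolding ug_def by linarith
 let ?I = "itp M (Ps n)"
 let ?g = "%x. u ?t x - ?I x" let ?d = "%x. \<psi> ?t x - ?I x"
 have Ic: "cont ?I" unfolding interp_psum by (rule psum_cont)
 have IL: "?I : LL" by (rule L2_cont[OF Ic])
 have dL: "?d : LL" by (rule L2_diff(1)[OF u_facts(6)[OF t] IL])
 have gL: "?g : LL" by (rule L2_diff(1)[OF u_facts(7)[OF t] IL])
 have AE: "AE x in OM. ?d x = ?g x" using u_facts(2)[OF t] by eventually_elim simp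
 have gc: "cont ?g" by (intro continuous_on_diff u_facts(8) t Ic)
 have f0: "wn (Suc k) (%_. 1) (sc ?g) <= (E1 + X) * (h ^ m + ts^2)" for k
 proof -
  have "wn (Suc k) (%_. 1) (sc ?g) <= wn M (%_. 1) (%l. Y l ?t - dst M (Ps n) l) + X * h ^ m"
  using full_coefficients[OF t, of 0 k "Ps n"] by simp
  also have "... <= E1 * (h ^ m + ts^2) + X * h ^ m" by (intro add_right_mono error_one n bd)
  also have "... <= (E1 + X) * (h ^ m + ts^2)" using X_nonneg by (simp add: alg)
  finally show ?thesis .
 qed
 have f1: "wn (Suc k) (fq) (sc ?g) <= (Em + X) * (h ^ (m - 1) + ts^2)" for k
 proof -
  have "wn (Suc k) (fq) (sc ?g) <= wn M (fq) (%l. Y l ?t - dst M (Ps n) l) + X * h ^ (m - 1)"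
  using full_coefficients[OF t, of 1 k "Ps n"] m by simp
  also have "... <= Em * (h ^ (m - 1) + ts^2) + X * h ^ (m - 1)" by (intro add_right_mono error_gradient n bd)
  also have "... <= (Em + X) * (h ^ (m - 1) + ts^2)" using X_nonneg by (simp add: alg)
  finally show ?thesis .
 qed
 have z0: "0 <= (E1 + X) * (h ^ m + ts^2)" by (rule order_trans[OF wn_nonneg f0])
 have z1: "0 <= (Em + X) * (h ^ (m - 1) + ts^2)" by (rule order_trans[OF wn_nonneg f1])
 have s1: "(\<Sum>l=1..k. (fq l * cmod (sc ?g l))^2) <= ((Em + X) * (h ^ (m - 1) + ts^2))^2" for k
  using f1[of k] wn_Suc_le[OF z1] by simp
 have s0: "(\<Sum>l=1..k. (cmod (sc ?g l))^2) <= ((E1 + X) * (h ^ m + ts^2))^2" for k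
  using f0[of k] wn_Suc_le[OF z0, of k "%_. 1"] by simp
 have "nrm ?g <= sqrt ((b - a) / 2) * ((E1 + X) * (h ^ m + ts^2))"
  by (rule parseval_le[OF gc weighted_summable(1)[OF s1 z1] s0 z0])
 then show "nrm ?d <= sqrt ((b - a) / 2) * (E1 + X) * (h ^ m + ts^2)"
  using L2norm_cong_AE[OF AE L2_meas[OF dL] L2_meas[OF gL]] by (simp add: mult.assoc)
 obtain v w where vw: "ac ?g v" "ac v w" "w : LL" "?g a = 0" "?g b = 0"
  using h2z_diff[OF h2z_u[OF t] interp_h2z] unfolding h2z_def by blast
 have "nrm v <= sqrt ((b - a) / 2) * ((Em + X) * (h ^ (m - 1) + ts^2))"
  by (rule gradient_parseval_le[OF vw s1 z1])
 moreover have "weak_deriv a b 1 ?d v"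
 proof (rule weak_deriv_AE_cong[OF AC_imp_weak[OF vw(1)] L2_meas[OF gL] L2_int[OF dL]])
  show "AE x in OM. ?g x = ?d x" using AE by eventually_elim simp
 qed
 ultimately show "nrm (dX 1 ?d) <= sqrt ((b - a) / 2) * (Em + X) * (h ^ (m - 1) + ts^2)"
  using Dx_eq(4)[of 1 ?d v] AC_L2[OF vw(2)] by (simp add: mult.assoc)
qed

end

section \<open>Initial data\<close>

context seg
begin

lemma Hs_hseq:
 assumes w: "w : Hs a b n" and n: "n >= 1"
 shows "\<exists>U. hseq n (hN n w) (crp w) U & (\<forall>j<n. even j --> U j a = 0 & U j b = 0) &
  (\<forall>j\<in>{1..n}. AE x in OM. dX j w x = U j x)"
proof -
 have H: "w : hS n" using w by (simp add: Hs_def)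
 obtain U where U: "hseq n (hN n w) (crp w) U" "\<forall>j\<in>{1..n}. AE x in OM. dX j w x = U j x"
  using Hspace_crep(1)[OF H n] by blast
 have "U j a = 0 & U j b = 0" if j: "j < n" "even j" for j
 proof -
  have z: "crp (dX j w) a = 0 & crp (dX j w) b = 0"
  using w j by (auto simp: Hs_def elim!: evenE)
  have c: "cont (U j)" using U(1) j by (intro AC_continuous[of "U j" "U (Suc j)"]) (simp add: hseq_def)
  have "AE x in OM. dX j w x = U j x"
  proof (cases "j = 0")
  case True
  have "AE x in OM. dX 0 w x = w x" by (rule Dx_eq(2)[OF weak_deriv_0]) (rule Hspace_L2[OF H])+
  moreover have "U 0 = crp w" using U(1) by (simp add: hseq_def)
  ultimately show ?thesis using Hspace_crep(2)[OF H n] True by (auto elim: eventually_elim2)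
  next
  case False then show ?thesis using U(2) j by auto
  qed
  then have "crp (dX j w) x = U j x" if "x : {a..b}" for x by (rule crep_eq[OF _ c that])
  then show ?thesis using z ab by simp
 qed
 then show ?thesis using U by blast
qed

text \<open>The bound for the partial sums obtained from the boundary conditions only serves to make the series converge; otherwise its formal sum would carry no information.\<close>

lemma Hs_norm_ge:
 assumes w: "w : Hs a b n" and n: "n >= 1"
 shows "wn M (%l. fq l ^ n) (sc w) <= Hs_norm a b n w"
proof -
 have H: "w : hS n" using w by (simp add: Hs_def)
 obtain U where U: "hseq n (hN n w) (crp w) U" "!!j. j < n ==> even j ==> U j a = 0 & U j b = 0"
  using Hs_hseq[OF w n] by blast
 have R: "rg n True (supc * hN n w) (crp w)" by (rule hseq_reg[OF U(1)]) (use U(2) in auto)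
 have sc: "sc (crp w) l = sc w l" for l
  by (rule sine_coeff_cong_AE[symmetric, OF Hspace_crep(2)[OF H n] L2_meas[OF Hspace_L2[OF H]]])
 let ?g = "%l. (fq (Suc l) ^ n * cmod (sc w (Suc l)))^2"
 have e: "(\<Sum>l<k. ?g l) = (\<Sum>l=1..k. (fq l ^ n * cmod (sc w l))^2)" for k
  by (rule sum.reindex_bij_witness[of _ "%l. l - 1" Suc]) auto
 have "summable ?g"
 proof (rule sums_bounded_nonneg(1))
  show "(\<Sum>l<k. ?g l) <= 2 / (b - a) * (supc * hN n w)^2" for k
  unfolding e using reg_sine_bound[OF R, of "{1..k}"] unfolding sc by simp
 qed simp
 then have "(\<Sum>l<M - 1. ?g l) <= suminf ?g" by (rule sum_le_suminf) auto
 then have "(wn M (%l. fq l ^ n) (sc w))^2 <= suminf ?g" unfolding e wn_sq .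
 moreover have "?g = (%l. fq (Suc l) ^ (2 * n) * (cmod (sc w (Suc l)))^2)"
  by (rule ext) (simp add: pmd power_mult[symmetric] mult.commute)
 ultimately show ?thesis unfolding Hs_norm_def by (intro real_le_rsqrt) simp
qed

text \<open>Grid functions that are bounded and have increments \<open>O(h)\<close>, with a common constant; they form an algebra.\<close>

definition bl :: "nat => real => real => (nat => complex) => bool" where
 "bl M h K v \<longleftrightarrow> (\<forall>i\<le>M. cmod (v i) <= K) & (\<forall>i<M. cmod (v (Suc i) - v i) <= K * h)"

lemma bl_nonneg: "bl M h K v ==> K >= 0"
 unfolding bl_def by (meson le0 norm_ge_zero order_trans)

lemma bl_add: "bl M h A v ==> bl M h B w ==> bl M h (A + B) (%i. v i + w i)"
 unfolding bl_def by (auto simp: add_diff_add distrib_right intro!: norm_triangle_mono)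

lemma bl_cnj: "bl M h A v ==> bl M h A (%i. cnj (v i))"
 unfolding bl_def by (simp flip: complex_cnj_diff)

lemma bl_mult:
 assumes v: "bl M h A v" and w: "bl M h B w"
 shows "bl M h (2 * (A * B)) (%i. v i * w i)"
proof -
 have p: "A >= 0" "B >= 0" using bl_nonneg v w by auto
 show ?thesis unfolding bl_def
 proof (intro conjI allI impI)
  fix i assume "i <= M"
  then have "cmod (v i * w i) <= A * B" unfolding norm_mult using v w p by (intro mult_mono) (auto simp: bl_def)
  then show "cmod (v i * w i) <= 2 * (A * B)" using mnn[OF p] by linarith
 next
  fix i assume i: "i < M"
  have "v (Suc i) * w (Suc i) - v i * w i = (v (Suc i) - v i) * w (Suc i) + v i * (w (Suc i) - w i)" by (simp add: alg)
  also have "cmod ... <= (A * h) * B + A * (B * h)"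
  proof (rule norm_triangle_mono)
  have b: "cmod (v (Suc i) - v i) <= A * h" "cmod (w (Suc i)) <= B" "cmod (v i) <= A" "cmod (w (Suc i) - w i) <= B * h"
  using v w i by (auto simp: bl_def)
  show "cmod ((v (Suc i) - v i) * w (Suc i)) <= (A * h) * B"
  unfolding norm_mult by (rule mult_mono[OF b(1,2) order_trans[OF norm_ge_zero b(1)]]) simp
  show "cmod (v i * (w (Suc i) - w i)) <= A * (B * h)"
  unfolding norm_mult by (rule mult_mono[OF b(3,4) p(1)]) simp
  qed
  finally show "cmod (v (Suc i) * w (Suc i) - v i * w i) <= 2 * (A * B) * h" by (simp add: mult_ac)
 qed
qed

lemma bl_sd:
 assumes s: "sd R La Ph" and v: "bl M h A v" and A: "A <= R" and L: "La >= 0" and h: "h >= 0"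
 shows "bl M h (La * (1 + A)) (%i. Ph (v i))"
 unfolding bl_def
proof (intro conjI allI impI)
 have A0: "A >= 0" by (rule bl_nonneg[OF v])
 have r: "cmod (v i) <= R" if "i <= M" for i using v A that unfolding bl_def by (meson order_trans)
 have le: "La <= La * (1 + A)" using L A0 by (simp add: distrib_left)
 fix i
 { assume "i <= M" then show "cmod (Ph (v i)) <= La * (1 + A)" using sdD(1)[OF s r[of i]] le by linarith }
 assume i: "i < M"
 have "cmod (Ph (v (Suc i)) - Ph (v i)) <= La * cmod (v (Suc i) - v i)" by (rule sdD(2)[OF s r r]) (use i in auto)
 also have "... <= La * ((1 + A) * h)"
 proof (rule mlm[OF _ L])
  have "cmod (v (Suc i) - v i) <= A * h" using v i by (auto simp: bl_def)
  then show "cmod (v (Suc i) - v i) <= (1 + A) * h" using h by (simp add: distrib_right)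
 qed
 finally show "cmod (Ph (v (Suc i)) - Ph (v i)) <= La * (1 + A) * h" by (simp only: mult.assoc)
qed

lemma reg2_increment:
 assumes g: "rg 2 p B g" and x: "a <= x" "x <= y" "y <= b"
 shows "cmod (g y - g x) <= B * (y - x)"
proof -
 obtain v where v: "ac g v" "rg (Suc 0) (\<not> p) B v"
  using reg_SucE[OF g[unfolded numeral_2_eq_2]] by blast
 have "cmod (v z) <= B" if "z : {x..y}" for z using reg_sup[OF v(2), of z] that x by auto
 then have "norm (integral {x..y} v) <= integral {x..y} (%_. B)"
  by (intro norm_integral_le AC_abs_int[OF v(1)]) (use x in auto)
 then show ?thesis using AC_diff[OF v(1) x] x by (simp add: mult_ac)
qed

lemma reg2_bl:
 assumes g: "rg 2 p B g" and h: "h = (b - a) / real M" and M: "M > 0"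
 shows "bl M h B (%i. g (gr M i))"
 unfolding bl_def
proof (intro conjI allI impI)
 fix i
 { assume "i <= M" then show "cmod (g (gr M i)) <= B"
  by (intro reg_sup[OF g[unfolded numeral_2_eq_2] grid_in[OF M]]) }
 assume i: "i < M"
 have d: "gr M (Suc i) - gr M i = h" unfolding grid_def h[symmetric] by (simp add: alg)
 have hp: "h > 0" using h M ab by simp
 have "a <= gr M i" "gr M (Suc i) <= b" using grid_in[OF M, of i] grid_in[OF M, of "Suc i"] i by auto
 moreover have "gr M i <= gr M (Suc i)" using d hp by linarith
 ultimately show "cmod (g (gr M (Suc i)) - g (gr M i)) <= B * h"
  using reg2_increment[OF g] by (metis d)
qed

lemma fder_eq:
 assumes D: "Ck_family k D" "D 0 = f" and k: "k >= 1" and s: "s >= 0"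
 shows "fder f s = D 1 s"
proof -
 have "(D 0 has_real_derivative D (Suc 0) s) (at s within {0..})"
  using D(1) k s unfolding Ck_family_def by (metis Suc_le_eq One_nat_def)
 then have d: "(f hvd D 1 s) (at s within {0..})"
  unfolding D(2) One_nat_def by (rule has_real_derivative_iff_has_vector_derivative[THEN iffD1])
 have "s islimpt {s..s + 1}" by (subst islimpt_Icc) auto
 then have "s islimpt {0..}" by (rule islimpt_subset) (use s in auto)
 then have "at s within {0..} ~= bot" by (simp add: trivial_limit_within)
 then show ?thesis unfolding fder_def by (rule vector_derivative_within[OF _ d])
qed

text \<open>The slope is a polynomial in the data, their conjugates, \<open>f(|z|\<^sup>2)\<close> and \<open>f'(|z|\<^sup>2)\<close>.\<close>

lemma initial_slope_bound:
 assumes D: "Ck_family k D" "D 0 = f" and k: "k >= 3"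
 shows "\<exists>K\<ge>0. \<forall>M h v0 v1 ts Ps. M > 0 --> h = (b - a) / real M --> bl M h A v0 --> bl M h A v1 -->
  v0 0 = 0 --> v0 M = 0 --> v1 0 = 0 --> v1 M = 0 --> wn M (fq) (dst M (Dnl f ts v0 v1 Ps 0)) <= K"
proof -
 let ?s = "%z. (cmod z)^2"
 let ?L = "(max 1 A)^2 * (4 + 2 * \<bar>A\<bar>)"
 have L0: "?L >= 0" by simp
 have s: "sd A ?L (%z. of_real (?s z))"
  unfolding complex_norm_square by (rule sd_mult[OF sd_id sd_cnj[OF sd_id]])
 have k0: "Suc (Suc 0) <= k" and k1: "Suc (Suc 1) <= k" using k by auto
 obtain La0 La1 where S0: "sd A La0 (%z. of_real (D 0 (?s z)))" and S1: "sd A La1 (%z. of_real (D 1 (?s z)))"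
  using sd_chain[OF D(1) k0 s _ L0] sd_chain[OF D(1) k1 s _ L0] by auto
 define L where "L = max 0 (max La0 La1)"
 have S: "sd A L (%z. of_real (D 0 (?s z)))" "sd A L (%z. of_real (D 1 (?s z)))" and Lp: "L >= 0"
  using sd_mono[OF S0, of L] sd_mono[OF S1, of L] by (auto simp: L_def)
 let ?P = "L * (1 + A)"
 let ?K = "2 * (?P * A) + (2 * (2 * (?P * (2 * (A * A))) * A) + 2 * (2 * (?P * (2 * (A * A))) * A))"
 show ?thesis
 proof (intro exI[of _ "3 * \<bar>?K\<bar>"] conjI allI impI)
  fix M h v0 v1 ts Ps assume M: "M > 0" and h: "h = (b - a) / real M" and b0: "bl M h A v0" and b1: "bl M h A v1"
  and z: "v0 0 = 0" "v0 M = 0" "v1 0 = 0" "v1 M = 0"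
  have hp: "h >= 0" using h M ab by simp
  let ?a = "%i. cr (D 0 (?s (v0 i)))" let ?c = "%i. cr (D 1 (?s (v0 i)))"
  have eq: "Dnl f ts v0 v1 Ps 0 = (%i. ?a i * v1 i + ((?c i * (v0 i * cnj (v0 i))) * v1 i + (?c i * (v0 i * v0 i)) * cnj (v1 i)))"
  proof
  fix i
  have fd: "fder f (?s (v0 i)) = D 1 (?s (v0 i))" by (rule fder_eq[OF D]) (use k in auto)
  have sq: "v0 i * cnj (v0 i) = of_real (?s (v0 i))" by (simp only: complex_norm_square)
  show "Dnl f ts v0 v1 Ps 0 i = ?a i * v1 i + ((?c i * (v0 i * cnj (v0 i))) * v1 i + (?c i * (v0 i * v0 i)) * cnj (v1 i))"
  unfolding sq Dnl_def Gnl_def Hnl_def fd D(2) by (simp add: sRc distrib_right psq)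
  qed
  note Pa = bl_sd[OF S(1) b0 order_refl Lp hp] and Pc = bl_sd[OF S(2) b0 order_refl Lp hp]
  have "bl M h ?K (Dnl f ts v0 v1 Ps 0)" unfolding eq
  by (intro bl_add bl_mult[OF Pa b1] bl_mult[OF bl_mult[OF Pc bl_mult[OF b0 bl_cnj[OF b0]]] b1] bl_mult[OF bl_mult[OF Pc bl_mult[OF b0 b0]] bl_cnj[OF b1]])
  then have inc: "cmod (Dnl f ts v0 v1 Ps 0 (Suc i) - Dnl f ts v0 v1 Ps 0 i) <= \<bar>?K\<bar> * h" if "i < M" for i
  proof -
  have "cmod (Dnl f ts v0 v1 Ps 0 (Suc i) - Dnl f ts v0 v1 Ps 0 i) <= ?K * h" using \<open>bl M h ?K _\<close> that unfolding bl_def by blast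
  also have "... <= \<bar>?K\<bar> * h" by (rule mrm[OF abs_ge_self hp])
  finally show ?thesis .
  qed
  show "wn M (fq) (dst M (Dnl f ts v0 v1 Ps 0)) <= 3 * \<bar>?K\<bar>"
  proof (rule increments_wn[OF h M])
  show "Dnl f ts v0 v1 Ps 0 0 = 0" "Dnl f ts v0 v1 Ps 0 M = 0" unfolding eq using z by simp_all
  qed (use inc in auto)
 qed simp
qed

section \<open>The convergence theorem\<close>

lemma has_Dt_Dt: "Dt_exists a b J u ==> t : J ==> has_Dt a b u t (dT u t)"
 unfolding Dt_exists_def Dt_def by (rule someI_ex[of "has_Dt a b u t"]) blast

lemma nlsw_wave:
 assumes sol: "nlsw_solution a b f ep \<psi>0 \<psi>1 S ph" and T: "0 < T" "ereal T < S" and e: "0 < ep" "ep <= 1" and m0: "2 <= m0" and C: "0 <= C"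
  and b0: "LinfT T (Xnorm a b m0) ph <= ennreal C" and b1: "LinfT T (H_ext a b 1) (dT ph) <= ennreal C"
  and b2: "LinfT T (H_ext a b 1) (dT (dT ph)) <= ennreal C"
 shows "wave a b f T C ep ph m0"
proof -
 have td: "t : time_dom S" if "t : {0..T}" for t
  using that T(2) by (auto simp: time_dom_def intro: le_less_trans[of "ereal t" "ereal T"])
 note s = sol[unfolded nlsw_solution_def]
 have c: "max C 0 = C" using C by simp
 have "wave_axioms a b f T C ep ph m0"
 proof
  fix t assume t: "t : {0..T}"
  show "ph t : hS 2 \<inter> hZ" using s td[OF t] unfolding cont_time_def by blast
  show "has_Dt a b ph t (dT ph t)" using s td[OF t] by (intro has_Dt_Dt) auto
  show "dT ph t : hZ" using s td[OF t] unfolding cont_time_def by blast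
  show "has_Dt a b (dT ph) t (dT (dT ph) t)" using s td[OF t] by (intro has_Dt_Dt) auto
 next
  have "cont_time (time_dom S) (LL) (nrm) (dT (dT ph))" using s by blast
  then show "cont_time {0..T} (LL) (nrm) (dT (dT ph))"
  unfolding cont_time_def using td by (blast intro: tendsto_within_subset)
 next
  fix t assume "0 < t" "t <= T"
  then show "AE x in OM. \<i> * dT ph t x - ep\<^sup>2 *\<^sub>R dT (dT ph) t x + dX 2 (ph t) x + Fnl f (ph t x) = 0"
  using s td[of t] by auto
 next
  show "AE t in lebesgue_on {0..T}. ph t : hS m0 & hN m0 (ph t) <= C" using LinfT_X[OF b0] unfolding c .
  show "AE t in lebesgue_on {0..T}. hN 1 (dT ph t) <= C" using LinfT_H[OF b1] unfolding c by (auto elim: eventually_mono)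
  show "AE t in lebesgue_on {0..T}. dT (dT ph) t : hS 1 & hN 1 (dT (dT ph) t) <= C"
  using LinfT_H[OF b2] unfolding c .
 qed (use T e C m0 in auto)
 then show ?thesis by (intro wave.intro seg_axioms)
qed

end

theorem theorem2p1:
  fixes a b T \<alpha> \<alpha>s :: real
    and f :: "real \<Rightarrow> real"
    and k m0 m :: nat
    and \<psi>0 :: "real \<Rightarrow> complex"
    and \<omega> :: "real \<Rightarrow> real \<Rightarrow> complex"
    and \<psi> :: "real \<Rightarrow> real \<Rightarrow> real \<Rightarrow> complex"
    and \<psi>s :: "real \<Rightarrow> real \<Rightarrow> complex"
    and M1 :: ennreal
  defines "\<alpha>s \<equiv> min \<alpha> 2"
    and "m \<equiv> min m0 k"
    and "M1 \<equiv> max (SUP \<epsilon>\<in>{0<..1}. Linf_cyl a b T (\<psi> \<epsilon>)) (Linf_cyl a b T \<psi>s)"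
  assumes "a < b"
    and "k \<ge> 3" and "Ck_halfline k f"
    and "m0 \<ge> 2" and "\<alpha> \<ge> 2"
    and "\<forall>\<epsilon>\<in>{0<..1}. \<omega> \<epsilon> \<in> H10 a b \<inter> Hspace a b 2"
    and "\<exists>C. \<forall>\<epsilon>\<in>{0<..1}. Hnorm a b 2 (\<omega> \<epsilon>) \<le> C"
    and "Liminf (at_right 0) (\<lambda>\<epsilon>. ereal (Hnorm a b 2 (\<omega> \<epsilon>))) > 0"
    and "\<forall>\<epsilon>\<in>{0<..1}. nlsw_solution a b f \<epsilon> \<psi>0 (psi1 a b f \<alpha> \<psi>0 \<omega> \<epsilon>) (Tmax a b f \<alpha> \<psi>0 \<omega>) (\<psi> \<epsilon>)"
    and "nls_solution a b f \<psi>0 (Tmax a b f \<alpha> \<psi>0 \<omega>) \<psi>s"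
    and "0 < T" and "ereal T < Tmax a b f \<alpha> \<psi>0 \<omega>"
    and A1: "\<forall>\<epsilon>\<in>{0<..1}. \<omega> \<epsilon> \<in> Hs a b m0"
    and A2: "\<exists>C. \<forall>\<epsilon>\<in>{0<..1}. 1 \<le> C * Hs_norm a b m0 (\<omega> \<epsilon>)"
    and A3: "\<exists>C. \<forall>\<epsilon>\<in>{0<..1}. Hs_norm a b m0 (\<omega> \<epsilon>) \<le> C"
    and A4: "\<psi>0 \<in> Hs a b (m0 + 2)"
    and B1: "\<exists>C. \<forall>\<epsilon>\<in>{0<..1}.
        LinfT T (Xnorm a b m0) (\<psi> \<epsilon>) + LinfT T (H_ext a b 1) (Dt a b (\<psi> \<epsilon>))
          + LinfT T (Xnorm a b m0) \<psi>s \<le> ennreal C"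
    and B2: "\<exists>C. \<forall>\<epsilon>\<in>{0<..1}.
        LinfT T (H_ext a b 1) (Dt a b (Dt a b (\<psi> \<epsilon>))) \<le> ennreal (C * \<epsilon> powr (- (2 - \<alpha>s)))"
    and B3: "Dt_exists a b {0..T} (Dt a b \<psi>s)"
    and B4: "\<forall>j\<in>{1, 2}. \<exists>C. LinfT T (H_ext a b 1) ((Dt a b ^^ j) \<psi>s) \<le> ennreal C"
    and B5: "\<exists>C. \<forall>\<epsilon>\<in>{0<..1}.
        LinfT T (H_ext a b 1) (\<lambda>t x. \<psi> \<epsilon> t x - \<psi>s t x) \<le> ennreal (C * \<epsilon>\<^sup>2)"
  shows "\<exists>\<tau>0 h0 C. 0 < \<tau>0 \<and> \<tau>0 \<le> 1 \<and> 0 < h0 \<and> h0 \<le> pi \<and>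
    (\<forall>\<epsilon>\<in>{0<..1}. \<forall>M::nat. \<forall>h \<tau> :: real. \<forall>\<Psi>. \<forall>n::nat.
       M > 0 \<longrightarrow> h = (b - a) / real M \<longrightarrow> 0 < h \<longrightarrow> h \<le> h0 \<longrightarrow> 0 < \<tau> \<longrightarrow> \<tau> \<le> \<tau>0 \<longrightarrow>
       ewi_sp a b f \<epsilon> \<psi>0 (psi1 a b f \<alpha> \<psi>0 \<omega> \<epsilon>) M \<tau> \<Psi> \<longrightarrow>
       real n \<le> T / \<tau> \<longrightarrow>
         L2norm a b (\<lambda>x. \<psi> \<epsilon> (real n * \<tau>) x - interp a b M (\<Psi> n) x) \<le> C * (h ^ m + \<tau>\<^sup>2) \<and>
         L2norm a b (Dx a b 1 (\<lambda>x. \<psi> \<epsilon> (real n * \<tau>) x - interp a b M (\<Psi> n) x))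
           \<le> C * (h ^ (m - 1) + \<tau>\<^sup>2) \<and>
         ennreal (linf_norm M (\<Psi> n)) \<le> M1 + 1)"
proof -
 interpret seg a b by unfold_locales (rule \<open>a < b\<close>)
 have k3: "3 <= k" and m02: "2 <= m0" and T0: "0 < T" by fact+
 have mm: "2 <= m" "m <= m0" "m <= k" using k3 m02 by (auto simp: m_def)
 (* the bound for the second time derivative is therefore uniform *)
 have as: "\<alpha>s = 2" using \<open>\<alpha> >= 2\<close> by (simp add: \<alpha>s_def)
 obtain D where D: "Ck_family k D" "D 0 = f"
  using \<open>Ck_halfline k f\<close> unfolding Ck_halfline_def Ck_family_def by blast
 obtain CB1 where CB1: "!!ep. ep : {0<..1} ==> LinfT T (Xnorm a b m0) (\<psi> ep) + LinfT T (H_ext a b 1) (dT (\<psi> ep))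
  + LinfT T (Xnorm a b m0) \<psi>s <= ennreal CB1" using B1 by blast
 obtain CB2 where CB2: "!!ep. ep : {0<..1} ==> LinfT T (H_ext a b 1) (dT (dT (\<psi> ep))) <= ennreal (CB2 * ep powr (- (2 - \<alpha>s)))"
  using B2 by blast
 obtain CW where CW: "!!ep. ep : {0<..1} ==> hN 2 (\<omega> ep) <= CW"
  using \<open>\<exists>C. \<forall>ep\<in>{0<..1}. Hnorm a b 2 (\<omega> ep) <= C\<close> by blast
 obtain CA where CA: "!!ep. ep : {0<..1} ==> Hs_norm a b m0 (\<omega> ep) <= CA" using A3 by blast
 define C where "C = max 0 (max CB1 CB2)"
 have C0: "0 <= C" by (simp add: C_def)
 have p1: "x <= x + y + z" and p2: "y <= x + y + z" for x y z :: ennreal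
  by (rule add_increasing2[OF zero_le add_increasing2[OF zero_le order_refl]], rule add_increasing2[OF zero_le add_increasing[OF zero_le order_refl]])
 have wv: "wave a b f T C ep (\<psi> ep) m0" if e: "ep : {0<..1}" for ep
 proof (rule nlsw_wave[OF _ T0 \<open>ereal T < Tmax a b f \<alpha> \<psi>0 \<omega>\<close> _ _ m02 C0])
  have le: "ennreal CB1 <= ennreal C" "ennreal CB2 <= ennreal C" by (auto simp: C_def intro!: ennreal_leI)
  show "nlsw_solution a b f ep \<psi>0 (psi1 a b f \<alpha> \<psi>0 \<omega> ep) (Tmax a b f \<alpha> \<psi>0 \<omega>) (\<psi> ep)"
  using \<open>\<forall>ep\<in>{0<..1}. nlsw_solution _ _ _ _ _ _ _ _\<close> e by blast
  show "LinfT T (Xnorm a b m0) (\<psi> ep) <= ennreal C" by (rule order_trans[OF order_trans[OF p1 CB1[OF e]] le(1)])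
  show "LinfT T (H_ext a b 1) (dT (\<psi> ep)) <= ennreal C" by (rule order_trans[OF order_trans[OF p2 CB1[OF e]] le(1)])
  have eq: "CB2 * ep powr (- (2 - \<alpha>s)) = CB2" using e unfolding as by simp
  show "LinfT T (H_ext a b 1) (dT (dT (\<psi> ep))) <= ennreal C"
  by (rule order_trans[OF CB2[OF e, unfolded eq] le(2)])
  show "0 < ep" "ep <= 1" using e by auto
 qed
 let ?s2 = "sqrt (2 / (b - a))"
 let ?c1 = "?s2 * (supc * C)" let ?c2 = "2 * ?s2 * C"
 have cpos: "?c1 >= 0" "?c2 >= 0" "?s2 >= 0" using C0 supc_ge ab by auto

 have Freg: "\<exists>Z. \<forall>g. rg j True B g --> rg j True Z (%x. Fnl f (g x))" if j: "1 <= j" "j <= k" for j B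
 proof -
  obtain i where i: "j = Suc i" using j by (cases j) auto
  have "Suc i <= k" using j i by simp
  from reg_Fnl[OF D this, of B] show ?thesis unfolding i by blast
 qed
 have "\<forall>j. \<exists>Z. 1 <= j & j <= m --> (\<forall>g. rg j True (supc * C) g --> rg j True Z (%x. Fnl f (g x)))"
 proof
  fix j show "\<exists>Z. 1 <= j & j <= m --> (\<forall>g. rg j True (supc * C) g --> rg j True Z (%x. Fnl f (g x)))"
  proof (cases "1 <= j & j <= m")
  case True then show ?thesis using Freg[of j "supc * C"] mm by auto
  qed blast
 qed
 then obtain CF where CF: "!!j g. 1 <= j ==> j <= m ==> rg j True (supc * C) g ==> rg j True (CF j) (%x. Fnl f (g x))"
  by (metis choice)

 define p0 where "p0 = crp \<psi>0"
 define CU where "CU = hN (m0 + 2) \<psi>0"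
 have HU: "\<psi>0 : hS (m0 + 2)" using A4 by (simp add: Hs_def)
 obtain U where U: "hseq (m0 + 2) CU p0 U" "!!j. j < m0 + 2 ==> even j ==> U j a = 0 & U j b = 0"
  "AE x in OM. dX 2 \<psi>0 x = U 2 x"
 proof -
  obtain U where "hseq (m0 + 2) CU p0 U & (\<forall>j<m0 + 2. even j --> U j a = 0 & U j b = 0) & (\<forall>j\<in>{1..m0 + 2}. AE x in OM. dX j \<psi>0 x = U j x)"
  using Hs_hseq[OF A4] unfolding CU_def p0_def by auto
  then show ?thesis using that[of U] by auto
 qed
 have p0AE: "AE x in OM. \<psi>0 x = p0 x" unfolding p0_def by (rule Hspace_crep(2)[OF HU]) simp
 have p0reg: "rg j True (supc * CU) p0" if "j <= m0 + 2" for j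
  by (rule hseq_reg[OF U(1) that]) (use U(2) that in auto)
 have p0c: "continuous_on {a..b} p0" using p0reg[of 1] reg_continuous unfolding One_nat_def by auto
 have U2reg: "rg j True (supc * CU) (U 2)" if "j <= m0" for j
  by (rule hseq_reg[OF hseq_shift[OF U(1)] that]) (use U(2)[of "2 + _"] that in auto)
 define z0 where "z0 = (%x. \<i> * (U 2 x + Fnl f (p0 x)))"
 have z0reg: "\<exists>Z. rg j True Z z0" if j: "1 <= j" "j <= m0" "j <= k" for j
 proof -
  obtain Z where "rg j True Z (%x. Fnl f (p0 x))" using Freg[OF j(1,3), of "supc * CU"] p0reg[of j] j by auto
  from reg_cmult[OF reg_add[OF U2reg[OF j(2)] this]] show ?thesis unfolding z0_def by blast
 qed
 obtain Zm where Zm: "rg m True Zm z0" using z0reg[of m] mm by auto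
 obtain Z2 where Z2: "rg 2 True Z2 z0" using z0reg[of 2] m02 k3 by auto
 have z0L: "z0 : LL" by (rule reg_L2[OF Zm])
 have CW0: "CW >= 0"
 proof -
  have "0 <= hN 2 (\<omega> 1)" unfolding Hnorm_def by (intro real_sqrt_ge_zero sum_nonneg) auto
  then show ?thesis using CW[of 1] by simp
 qed
 (* a common bound for the initial data and their increments on the grid *)
 define A where "A = max (supc * CU) (Z2 + supc * CW)"
 have m1p: "fq 1 > 0" by (rule mu_pos) simp
 define X1c where "X1c = ?s2 * Zm + 1 / fq 1 ^ (m0 - m) * CA"

 define q where "q = (%ep. crp (\<omega> ep))"
 define w1 where "w1 = (%ep x. z0 x + of_real (ep powr \<alpha>) * q ep x)"
 have data: "rg 2 True (Z2 + supc * CW) (w1 ep)"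
  "AE x in OM. psi1 a b f \<alpha> \<psi>0 \<omega> ep x = w1 ep x"
  "wn n (%l. fq l ^ m) (sc (w1 ep)) <= X1c" if e: "ep : {0<..1}" for ep n
 proof -
  have om: "\<omega> ep : hZ" "\<omega> ep : hS 2" "\<omega> ep : Hs a b m0"
  using \<open>\<forall>ep\<in>{0<..1}. \<omega> ep \<in> H10 a b \<inter> Hspace a b 2\<close> A1 e by auto
  obtain W where W: "hseq 2 (hN 2 (\<omega> ep)) (q ep) W" using Hspace_crep(1)[OF om(2)] unfolding q_def by auto
  have "q ep a = 0" "q ep b = 0" using om(1) by (auto simp: H10_def q_def)
  moreover have "W 0 = q ep" using W by (simp add: hseq_def)
  ultimately have "rg 2 True (supc * hN 2 (\<omega> ep)) (q ep)"
  by (intro hseq_reg[OF W]) (auto simp: less_2_cases_iff)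
  then have q2: "rg 2 True (supc * CW) (q ep)"
  by (rule reg_mono) (use CW[OF e] supc_ge in \<open>auto intro!: mlm\<close>)
  have ea: "cmod (of_real (ep powr \<alpha>)) <= 1" using e \<open>\<alpha> >= 2\<close> by (simp add: powr_le1)
  have q2': "rg 2 True (supc * CW) (%x. of_real (ep powr \<alpha>) * q ep x)"
  proof (rule reg_mono[OF reg_cmult[OF q2]])
  have "0 <= supc * CW" using CW0 supc_ge by auto
  from mrm[OF ea this]
  show "cmod (of_real (ep powr \<alpha>)) * (supc * CW) <= supc * CW" by (simp only: mult_1)
  qed
  show "rg 2 True (Z2 + supc * CW) (w1 ep)" unfolding w1_def by (rule reg_add[OF Z2 q2'])
  have qAE: "AE x in OM. \<omega> ep x = q ep x" unfolding q_def by (rule Hspace_crep(2)[OF om(2)]) simp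
  show "AE x in OM. psi1 a b f \<alpha> \<psi>0 \<omega> ep x = w1 ep x"
  using U(3) p0AE qAE by eventually_elim (simp add: psi1_def w1_def z0_def sRc)
  have qL: "q ep : LL" by (rule reg_L2[OF q2])
  have sq: "sc (q ep) = sc (\<omega> ep)"
  by (rule ext) (rule sine_coeff_cong_AE[symmetric, OF qAE L2_meas[OF Hspace_L2[OF om(2)]]])
  have sc: "sc (w1 ep) = (%l. sc z0 l + of_real (ep powr \<alpha>) * sc (\<omega> ep) l)"
  unfolding w1_def sine_coeff_add[OF z0L L2_cmult(1)[OF qL], abs_def] sine_coeff_cmult sq ..
  have w: "0 <= fq l ^ m" for l by (intro zero_le_power mu_nonneg)
  have "wn n (%l. fq l ^ m) (sc (w1 ep)) <= wn n (%l. fq l ^ m) (sc z0) + wn n (%l. fq l ^ m) (%l. of_real (ep powr \<alpha>) * sc (\<omega> ep) l)"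
  unfolding sc by (rule wn_add[OF w])
  also have "... <= ?s2 * Zm + 1 * (1 / fq 1 ^ (m0 - m) * CA)"
  proof (intro add_mono reg_wn[OF Zm])
  have "wn n (%l. fq l ^ m) (sc (\<omega> ep)) <= 1 / fq 1 ^ (m0 - m) * wn n (%l. fq l ^ m0) (sc (\<omega> ep))"
  by (rule wn_power_le[OF mm(2)])
  also have "... <= 1 / fq 1 ^ (m0 - m) * CA"
  proof (rule mlm)
  show "wn n (%l. fq l ^ m0) (sc (\<omega> ep)) <= CA"
  by (rule order_trans[OF Hs_norm_ge[OF om(3)] CA[OF e]]) (use m02 in simp)
  qed (use m1p in simp)
  finally show "wn n (%l. fq l ^ m) (%l. of_real (ep powr \<alpha>) * sc (\<omega> ep) l) <= 1 * (1 / fq 1 ^ (m0 - m) * CA)"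
  unfolding wn_cmult using ea by (intro mult_mono) auto
  qed
  finally show "wn n (%l. fq l ^ m) (sc (w1 ep)) <= X1c" by (simp add: X1c_def)
 qed

 (* the exact solution stays in the ball of radius kap * c1; the numerical one is allowed distance 1 *)
 define R where "R = kap * ?c1 + 1"
 obtain La where Lam: "La >= 0" "sd R La (Fnl f)" using sd_Fnl[OF D, of R] k3 by auto
 define CZ where "CZ = kap * (?c1 + 2 * ?c2)"
 have "0 <= ?c1 + 2 * ?c2" using cpos by linarith
 from mnn[OF kap_nonneg this] have CZ0: "CZ >= 0" unfolding CZ_def .
 obtain Kx where Kx: "Kx >= 0" "!!t r um v0 up n. 0 < t ==> t <= 1 ==> 0 <= r ==> r <= 1 ==> Zt CZ t r um v0 up ==>
  (\<forall>y\<in>{a, b}. um y = 0 & v0 y = 0 & up y = 0) ==>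
  (\<Sum>l=1..n. (fq l * cmod (sc (%x. Fnl f (up x) - Fnl f (v0 x) - of_real r * (Fnl f (v0 x) - Fnl f (um x))) l))^2) <= (Kx * t^2)^2"
  using Fnl_extrapolation[OF D k3 CZ0] by blast
 obtain KZ where KZ: "KZ >= 0" "!!t r um v0 up. 0 < t ==> t <= 1 ==> 0 <= r ==> r <= 1 ==>
  Zt CZ t r um v0 up ==> Zt KZ t r (%x. Fnl f (um x)) (%x. Fnl f (v0 x)) (%x. Fnl f (up x))"
  using Zt_Fnl[OF D k3 CZ0] by blast
 define K1 where "K1 = ?s2 * KZ"
 have K10: "K1 >= 0" using KZ(1) cpos by (simp add: K1_def)
 obtain KD where KD: "KD >= 0" "!!M h v0 v1 ts Ps. M > 0 ==> h = (b - a) / real M ==> bl M h A v0 ==> bl M h A v1 ==>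
  v0 0 = 0 ==> v0 M = 0 ==> v1 0 = 0 ==> v1 M = 0 ==> wn M (fq) (dst M (Dnl f ts v0 v1 Ps 0)) <= KD"
  using initial_slope_bound[OF D k3, of A] by blast
 define X where "X = max ?c1 (max (?s2 * CF m) X1c)"

 have sch: "scheme a b f T C ep (\<psi> ep) m0 R La X Kx K1 KD h ts m M n Ps \<psi>0 (psi1 a b f \<alpha> \<psi>0 \<omega> ep) (w1 ep)"
  if e: "ep : {0<..1}" and M: "M > 0" and h: "h = (b - a) / real M" and tau: "0 < ts" "ts <= 1" and n: "real n * ts <= T"
  and ewi: "ewi_sp a b f ep \<psi>0 (psi1 a b f \<alpha> \<psi>0 \<omega> ep) M ts Ps" for ep M h ts n Ps
 proof -
  interpret W: wave a b f T C ep "\<psi> ep" m0 by (rule wv[OF e])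
  have c: "W.c1 = ?c1" "W.c2 = ?c2" by (simp_all add: W.c1_def W.c2_def)
  have Rc: "kap * W.c1 + 1 <= R" "kap * W.c1 <= R" by (simp_all add: R_def c)
  note sdF = Lam(2) and Lp = Lam(1)
  have t0: "0 : {0..T}" using T0 by simp
  have ns: "nlsw_solution a b f ep \<psi>0 (psi1 a b f \<alpha> \<psi>0 \<omega> ep) (Tmax a b f \<alpha> \<psi>0 \<omega>) (\<psi> ep)"
  using \<open>\<forall>ep\<in>{0<..1}. nlsw_solution _ _ _ _ _ _ _ _\<close> e by blast
  then have i0: "AE x in OM. \<psi> ep 0 x = \<psi>0 x" and i1: "AE x in OM. dT (\<psi> ep) 0 x = psi1 a b f \<alpha> \<psi>0 \<omega> ep x"
  unfolding nlsw_solution_def by auto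
  have u0: "W.u 0 x = p0 x" if "x : {a..b}" for x
  proof -
  have "AE x in OM. \<psi> ep 0 x = p0 x" using i0 p0AE by eventually_elim simp
  from crep_eq[OF this p0c that] show ?thesis by (simp add: W.u_def)
  qed
  have Y0: "W.Y l 0 = sc p0 l" for l
  proof -
  have "AE x in OM. \<psi> ep 0 x = p0 x" using i0 p0AE by eventually_elim simp
  from sine_coeff_cong_AE[OF this L2_meas[OF W.u_facts(6)[OF t0]]] show ?thesis by (simp add: W.Y_def)
  qed
  have Y10: "sc (w1 ep) l = W.Y1 l 0" for l
  proof -
  have "AE x in OM. dT (\<psi> ep) 0 x = w1 ep x" using i1 data(2)[OF e] by eventually_elim simp
  moreover have "dT (\<psi> ep) 0 : LL" using W.D1[OF t0] by (simp add: has_Dt_def)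
  ultimately show ?thesis unfolding W.Y1_def by (intro sine_coeff_cong_AE[symmetric] L2_meas)
  qed
  have X1: "wn n (%l. fq l ^ m) (%l. W.Y1 l 0) <= X1c" for n
  using data(3)[OF e, of n] unfolding Y10[abs_def] .
  have X0: "wn n (%l. fq l ^ m) (%l. W.Y l 0) <= ?s2 * (supc * CU)" for n
  unfolding Y0 by (rule reg_wn[OF p0reg]) (use mm in simp)
  have m1: "1 <= m" using mm by simp
  have sr1: "wn n (%l. fq l ^ m) (%l. W.Y l t) <= ?c1" if t: "t : {0..T}" for n t
  unfolding c(1)[symmetric] by (rule W.spatial_regularity(1)[OF sdF Rc(2) Lp m1 mm(2) CF X0 X1 t])
  have sr2: "wn n (%l. fq l ^ m) (%l. W.Fh l t) <= ?s2 * CF m" if t: "t : {0..T}" for n t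
  by (rule W.spatial_regularity(2)[OF sdF Rc(2) Lp m1 mm(2) CF X0 X1 t])
  have Xle: "?c1 <= X" "?s2 * CF m <= X" "X1c <= X" by (simp_all add: X_def)
  have w1c: "continuous_on {a..b} (w1 ep)" by (rule reg_continuous[OF data(1)[OF e, unfolded numeral_2_eq_2]])
  have v0: "ndl M \<psi>0 i = W.u 0 (gr M i)" if "i <= M" for i
  unfolding nodal_def u0[OF grid_in[OF M that]] p0_def ..
  have v1: "ndl M (psi1 a b f \<alpha> \<psi>0 \<omega> ep) i = w1 ep (gr M i)" if "i <= M" for i
  unfolding nodal_def by (rule crep_eq[OF data(2)[OF e] w1c grid_in[OF M that]])
  show ?thesis
  proof (intro scheme.intro[OF wv[OF e]] scheme_axioms.intro)
  show "sd R La (Fnl f)" "0 <= La" "2 <= m" "0 < M" "h = (b - a) / real M" "0 < ts" "ts <= 1" "real n * ts <= T"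
  "ewi_sp a b f ep \<psi>0 (psi1 a b f \<alpha> \<psi>0 \<omega> ep) M ts Ps" "0 <= Kx" "0 <= K1" "kap * W.c1 + 1 <= R"
  using Lam mm M h tau n ewi Kx(1) K10 Rc by auto
  show "ndl M \<psi>0 i = W.u 0 (gr M i)" if "i <= M" for i by (rule v0[OF that])
  show "continuous_on {a..b} (w1 ep)" by (rule w1c)
  show "ndl M (psi1 a b f \<alpha> \<psi>0 \<omega> ep) i = w1 ep (gr M i)" if "i <= M" for i by (rule v1[OF that])
  show "sc (w1 ep) l = W.Y1 l 0" for l by (rule Y10)
  show "wn n (%l. fq l ^ m) (%l. W.Y l t) <= X" if "t : {0..T}" for t n
  by (rule order_trans[OF sr1[OF that] Xle(1)])
  show "wn n (%l. fq l ^ m) (%l. W.Fh l t) <= X" if "t : {0..T}" for t n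
  by (rule order_trans[OF sr2[OF that] Xle(2)])
  show "wn n (%l. fq l ^ m) (%l. W.Y1 l 0) <= X" for n by (rule order_trans[OF X1 Xle(3)])
  next
  fix t v assume t: "ts <= t" "0 <= v" "v <= ts" "t + v <= T"
  have mem: "t + v : {0..T}" "t : {0..T}" "t - ts : {0..T}" using t tau by auto
  note L = L2_cont[OF W.Fu_cont[OF sdF Rc(2) Lp mem(1)]] L2_cont[OF W.Fu_cont[OF sdF Rc(2) Lp mem(2)]] L2_cont[OF W.Fu_cont[OF sdF Rc(2) Lp mem(3)]]
  have sc: "sc (%x. Fnl f (W.u (t + v) x) - Fnl f (W.u t x) - of_real (v / ts) * (Fnl f (W.u t x) - Fnl f (W.u (t - ts) x))) l =
  W.Fh l (t + v) - W.Fh l t - of_real (v / ts) * (W.Fh l t - W.Fh l (t - ts))" for l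
  unfolding sine_coeff_diff[OF L2_diff(1)[OF L(1,2)] L2_cmult(1)[OF L2_diff(1)[OF L(2,3)]]] sine_coeff_cmult
  sine_coeff_diff[OF L(1,2)] sine_coeff_diff[OF L(2,3)] W.Fh_def ..
  have Z: "Zt CZ ts (v / ts) (W.u (t - ts)) (W.u t) (W.u (t + v))"
  using W.Zt_u[OF tau t] unfolding c CZ_def .
  have "(\<Sum>l=1..M - 1. (fq l * cmod (W.Fh l (t + v) - W.Fh l t - of_real (v / ts) * (W.Fh l t - W.Fh l (t - ts))))^2) <= (Kx * ts^2)^2"
  using Kx(2)[OF tau _ _ Z, of "M - 1"] t tau W.u_facts(3,4)[OF mem(1)] W.u_facts(3,4)[OF mem(2)] W.u_facts(3,4)[OF mem(3)]
  unfolding sc by simp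
  then show "wn M (fq) (%l. W.Fh l (t + v) - W.Fh l t - of_real (v / ts) * (W.Fh l t - W.Fh l (t - ts))) <= Kx * ts^2"
  using Kx(1) by (subst wn_le) auto
  next
  fix v assume v: "0 <= v" "v <= ts" "v <= T"
  have mem: "v : {0..T}" using v by simp
  note L = L2_cont[OF W.Fu_cont[OF sdF Rc(2) Lp mem]] L2_cont[OF W.Fu_cont[OF sdF Rc(2) Lp t0]]
  have "Zt CZ ts 0 (W.u 0) (W.u v) (W.u v)" using W.Zt_first[OF tau v] unfolding c CZ_def .
  from KZ(2)[OF tau _ _ this] have "rg 1 False (KZ * ts) (%x. Fnl f (W.u v x) - Fnl f (W.u 0 x))" unfolding Zt_def by simp
  then have "rg 1 True (KZ * ts) (%x. Fnl f (W.u v x) - Fnl f (W.u 0 x))"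
  by (rule reg1_odd) (use W.u_facts(3,4)[OF mem] W.u_facts(3,4)[OF t0] in auto)
  from reg_wn[OF this, of M] have "wn M (fq) (sc (%x. Fnl f (W.u v x) - Fnl f (W.u 0 x))) <= ?s2 * (KZ * ts)" by simp
  moreover have "sc (%x. Fnl f (W.u v x) - Fnl f (W.u 0 x)) = (%l. W.Fh l v - W.Fh l 0)"
  by (rule ext) (simp only: sine_coeff_diff[OF L] W.Fh_def)
  ultimately show "wn M (fq) (%l. W.Fh l v - W.Fh l 0) <= K1 * ts" by (simp only: K1_def mult.assoc)
  next
  have b0: "bl M h A (ndl M \<psi>0)"
  proof -
  have r: "rg 2 True A p0" by (rule reg_mono[OF p0reg]) (auto simp: A_def)
  have "bl M h A (%i. p0 (gr M i))" by (rule reg2_bl[OF r h M])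
  then show ?thesis unfolding nodal_def[abs_def] p0_def[symmetric] .
  qed
  have "bl M h A (%i. w1 ep (gr M i))"
  by (rule reg2_bl[OF reg_mono[OF data(1)[OF e]] h M]) (simp add: A_def)
  then have b1: "bl M h A (ndl M (psi1 a b f \<alpha> \<psi>0 \<omega> ep))" unfolding bl_def using v1 by simp
  have z: "ndl M \<psi>0 0 = 0" "ndl M \<psi>0 M = 0"
  using v0[of 0] v0[of M] W.u_facts(3,4)[OF t0] grid_ends(1) grid_ends(2)[OF M] by simp_all
  have wz: "w1 ep a = 0" "w1 ep b = 0" using data(1)[OF e] unfolding numeral_2_eq_2 by (auto elim!: reg_SucE)
  have z1: "ndl M (psi1 a b f \<alpha> \<psi>0 \<omega> ep) 0 = 0" "ndl M (psi1 a b f \<alpha> \<psi>0 \<omega> ep) M = 0"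
  using v1[of 0] v1[of M] wz grid_ends(1) grid_ends(2)[OF M] by simp_all
  show "wn M (fq) (dst M (Dnl f ts (ndl M \<psi>0) (ndl M (psi1 a b f \<alpha> \<psi>0 \<omega> ep)) Ps 0)) <= KD"
  by (rule KD(2)[OF M h b0 b1 z z1])
  qed
 qed

 define Ec where "Ec = Cg (3 * La * (1 + 2 * R + 2 * (supc * C) * (b - a))) T (pi * sqrt 2 * X) Kx (K1 + KD)"
 define E1c where "E1c = Cg La T (sqrt 2 * X) ((b - a) * Kx) ((b - a) * (K1 + KD))"
 define Q where "Q = (b - a) * \<bar>Ec + pi * sqrt 2 * X\<bar>"
 (* the error in the maximum norm is at most Q (h^(m-1) + ts^2), which must not exceed 1 *)
 define \<delta> where "\<delta> = 1 / (2 * Q + 1)"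
 define Cf where "Cf = max (sqrt ((b - a) / 2) * (E1c + X)) (sqrt ((b - a) / 2) * (Ec + X))"
 have Q0: "Q >= 0" using ab by (simp add: Q_def)
 have \<delta>: "0 < \<delta>" "\<delta> <= 1" "Q * (2 * \<delta>) <= 1" using Q0 by (simp_all add: \<delta>_def divide_simps)
 show ?thesis
 proof (rule exI[of _ \<delta>], rule exI[of _ \<delta>], rule exI[of _ Cf], intro conjI ballI allI impI)
  show "\<delta> <= pi" using \<delta>(2) pi_ge_two by linarith
  fix ep :: real and M :: nat and h ts :: real and Ps :: "nat => nat => complex" and n :: nat
  assume e: "ep : {0<..1}" and M: "0 < M" and h: "h = (b - a) / real M" "0 < h" "h <= \<delta>" and tau: "0 < ts" "ts <= \<delta>"
  and ewi: "ewi_sp a b f ep \<psi>0 (psi1 a b f \<alpha> \<psi>0 \<omega> ep) M ts Ps" and n: "real n <= T / ts"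
  have tau1: "ts <= 1" using tau \<delta> by linarith
  have nT: "real n * ts <= T" using n tau by (simp add: field_simps)
  interpret S: scheme a b f T C ep "\<psi> ep" m0 R La X Kx K1 KD h ts m M n Ps \<psi>0 "psi1 a b f \<alpha> \<psi>0 \<omega> ep" "w1 ep"
  by (rule sch[OF e M h(1) tau(1) tau1 nT ewi])
  have E: "S.Em = Ec" "S.E1 = E1c" by (simp_all add: S.Em_def S.E1_def S.Lm_def Ec_def E1c_def)
  have "h ^ (m - 1) <= h ^ 1" using h \<delta> mm by (intro power_decreasing) auto
  moreover have "ts^2 <= ts ^ 1" using tau tau1 by (intro power_decreasing) auto
  ultimately have s: "h ^ (m - 1) + ts^2 <= 2 * \<delta>" using h tau by simp
  have p: "0 <= h ^ (m - 1) + ts^2" "0 <= h ^ m + ts^2" using h by auto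
  have small: "(b - a) * ((S.Em + pi * sqrt 2 * X) * (h ^ (m - 1) + ts^2)) <= 1"
  proof -
  have "(b - a) * ((S.Em + pi * sqrt 2 * X) * (h ^ (m - 1) + ts^2)) <= (b - a) * (\<bar>Ec + pi * sqrt 2 * X\<bar> * (h ^ (m - 1) + ts^2))"
  unfolding E by (intro mlm mrm abs_ge_self p) (use ab in simp)
  also have "... = Q * (h ^ (m - 1) + ts^2)" by (simp only: Q_def mult.assoc)
  also have "... <= Q * (2 * \<delta>)" by (rule mlm[OF s Q0])
  also have "... <= 1" by (rule \<delta>(3))
  finally show ?thesis .
  qed
  note concl = S.scheme_conclusion[OF small order_refl, unfolded E]
  have "sqrt ((b - a) / 2) * (E1c + X) * (h ^ m + ts^2) <= Cf * (h ^ m + ts^2)" by (rule mrm[OF _ p(2)]) (simp add: Cf_def)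
  then show "nrm (%x. \<psi> ep (real n * ts) x - itp M (Ps n) x) <= Cf * (h ^ m + ts^2)" using concl(1) by linarith
  have "sqrt ((b - a) / 2) * (Ec + X) * (h ^ (m - 1) + ts^2) <= Cf * (h ^ (m - 1) + ts^2)" by (rule mrm[OF _ p(1)]) (simp add: Cf_def)
  then show "nrm (dX 1 (%x. \<psi> ep (real n * ts) x - itp M (Ps n) x)) <= Cf * (h ^ (m - 1) + ts^2)" using concl(2) by linarith
  have tn: "real n * ts : {0..T}" using nT tau by simp
  have M1le: "Linf_cyl a b T (\<psi> ep) <= M1" unfolding M1_def using e by (intro max.coboundedI1 SUP_upper)
  have bound: "ennreal (cmod (Ps n j)) <= M1 + 1" if j: "j : {1..M - 1}" for j
  proof -
  have jM: "j <= M" using j by auto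
  have "ennreal (cmod (Ps n j)) <= ennreal (cmod (S.u (real n * ts) (gr M j)) + 1)" by (rule ennreal_leI[OF concl(3)[OF jM]])
  also have "... = ennreal (cmod (S.u (real n * ts) (gr M j))) + 1" by (simp add: ennreal_plus)
  also have "... <= M1 + 1" by (intro add_right_mono order_trans[OF S.sup_cylinder[OF tn grid_in[OF M jM]] M1le])
  finally show ?thesis .
  qed
  have "linf_norm M (Ps n) : insert 0 ((%j. cmod (Ps n j)) ` {1..M - 1})" unfolding linf_norm_def by (rule Max_in) auto
  then show "ennreal (linf_norm M (Ps n)) <= M1 + 1" using bound by auto
 qed (use \<delta> in auto)
qed
end
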